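(* Let $p\geq 2$ and suppose that the sequence $f_n=n^pa_n$ ($n=0,1,2,\ldots$), $a_n$ being the coefficients of the Legendre expansion $\frac{1}{4\pi}\sum_{n=0}^\infty(2n+1)a_nP_n(\cos u)$, satisfies the Hausdorff-type condition: there exist constants $M>0$ and $\epsilon>0$ with $$(n+1)^{(1+\epsilon)}\sum_{i=0}^n \binom{n}{i}^{(2+\epsilon)} \left|\Delta^i f_{n-i}\right|^{(2+\epsilon)} < M \qquad (n=0,1,2,\ldots).$$ Let $\underline{F}(y)$, $y=\cosh v\ge1$, be the jump function across the cut, and let $$\psi_m(y)=\frac{1}{\pi\sqrt2}\,\frac{d}{dy}\left[\left(\sum_{\ell=0}^m c_\ell\,\Phi_\ell\right)*\chi_1\right](y).$$ Then for every $\phi\in S_\infty(\mathbb{R})$, $$\lim_{m\to\infty}\langle(\underline{F}-\psi_m),\phi\rangle=0 .$$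
   Context: $P_n$ denotes the Legendre polynomials. $\Delta$ is the difference operator $\Delta f_n=f_{n+1}-f_n$, with $\Delta^0$ the identity and $\Delta^k f_n=\sum_{m=0}^k(-1)^m\binom{k}{m}f_{n+k-m}$; the numbers $f_n$ are real. Under the hypothesis the Legendre expansion converges for $|\cos u|<1$ to a function $\underline{f}(\cos u)$ which extends holomorphically to the complex $\cos\theta$-plane ($\theta=u+iv$) cut along $[1,+\infty)$; put $f(\theta)=\underline{f}(\cos\theta)$. The boundary values are $f_\pm(v)=\lim_{u\to0^+}f(\pm u+iv)$ for $v\ge0$, and the jump function is $\underline{F}(\cosh v)=i[f_+(v)-f_-(v)]$. The coefficients and functions are $$c_\ell=\sqrt2\sum_{n=0}^\infty\frac{(-1)^n}{n!}\,a_n\,\mathcal{P}_\ell\!\left[-i\left(n+\tfrac12\right)\right],\qquad \Phi_\ell(w)=i^\ell\sqrt2\,e^{-w/2}L_\ell(2e^{-w})\,e^{-e^{-w}},$$ where $L_\ell$ are the Laguerre polynomials and $\mathcal{P}_\ell$ are the Pollaczek polynomials, i.e. the (Meixner--)Pollaczek polynomials $P_\ell^{(1/2)}(x;\pi/2)$, orthonormal on $\mathbb{R}$ with respect to the weight $\frac1\pi|\Gamma(\tfrac12+ix)|^2$ and with positive leading coefficient (e.g. $\mathcal{P}_0=1$, $\mathcal{P}_1(x)=2x$). In the definition of $\psi_m$, $\Phi_\ell$ is regarded as a function of $x=\cosh w\ge1$ ($w\ge0$), and for a function $g(x)$, $x\geq1$, the convolution is $(g*\chi_1)(y)=\int_1^y\frac{g(x)}{\sqrt{y-x}}\,dx$.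 The functions $\underline{F}$ and $\psi_m$ are taken to vanish for $y<1$. $S_\infty(\mathbb{R})$ is the Schwartz space of $C^\infty(\mathbb{R})$ functions that, together with all their derivatives, decrease for $|x|\to\infty$ faster than any negative power of $|x|$, and $\langle f,\phi\rangle=\int_{-\infty}^{+\infty}\overline{f}\,\phi\,dx$. *)

theory Defs
  imports "HOL-Complex_Analysis.Complex_Analysis"
begin

definition fdiff :: "(nat \<Rightarrow> real) \<Rightarrow> nat \<Rightarrow> real" where
  "fdiff f n = f (Suc n) - f n"

lemma fdiff_funpow:
  "(fdiff ^^ k) f n = (\<Sum>m\<le>k. (-1) ^ m * real (k choose m) * f (n + k - m))"
proof (induction k arbitrary: n)
  case (Suc k)
  let ?t = "\<lambda>m. (-1) ^ m * real (k choose m) * f (n + Suc k - m)"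
  have A: "(fdiff ^^ k) f (Suc n) = (\<Sum>m\<le>k. ?t m)"
    unfolding Suc.IH by simp
  have B: "(fdiff ^^ k) f n = (\<Sum>m\<le>k. (-1) ^ m * real (k choose m) * f (n + k - m))"
    by (rule Suc.IH)
  have "(\<Sum>m\<le>Suc k. (-1) ^ m * real (Suc k choose m) * f (n + Suc k - m))
      = f (n + Suc k) + (\<Sum>m\<le>k. (-1) ^ Suc m * real (Suc k choose Suc m) * f (n + k - m))"
    by (subst sum.atMost_Suc_shift) simp
  also have "(\<Sum>m\<le>k. (-1) ^ Suc m * real (Suc k choose Suc m) * f (n + k - m))
      = (\<Sum>m\<le>k. ?t (Suc m)) - (\<Sum>m\<le>k. (-1) ^ m * real (k choose m) * f (n + k - m))"
    unfolding sum_subtractf[symmetric] by (rule sum.cong) (simp_all add: algebra_simps)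
  also have "f (n + Suc k) + \<dots> = (\<Sum>m\<le>Suc k. ?t m)
      - (\<Sum>m\<le>k. (-1) ^ m * real (k choose m) * f (n + k - m))"
    by (subst sum.atMost_Suc_shift) simp
  also have "(\<Sum>m\<le>Suc k. ?t m) = (\<Sum>m\<le>k. ?t m)"
    by simp
  finally show ?case
    using A B by (simp add: fdiff_def [of "(fdiff ^^ k) f"])
qed simp

(* Bonnet's recurrence, standard normalisation P_n(1) = 1. *)
fun legendre_P :: "nat \<Rightarrow> real \<Rightarrow> real" where
  "legendre_P 0 x = 1"
| "legendre_P (Suc 0) x = x"
| "legendre_P (Suc (Suc n)) x =
     ((2 * real n + 3) * x * legendre_P (Suc n) x - (real n + 1) * legendre_P n x) / (real n + 2)"

definition laguerre_L :: "nat \<Rightarrow> real \<Rightarrow> real" where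
  "laguerre_L n x = (\<Sum>k\<le>n. (-1) ^ k * real (n choose k) / fact k * x ^ k)"

(* The Meixner-Pollaczek polynomial P_n^(lambda)(x; phi) in its usual normalisation
     ((2 lambda)_n / n!) e^(i n phi) 2F1(-n, lambda + i x; 2 lambda; 1 - e^(-2 i phi)). *)
definition meixner_pollaczek :: "real \<Rightarrow> real \<Rightarrow> nat \<Rightarrow> complex \<Rightarrow> complex" where
  "meixner_pollaczek lam phi n x =
     pochhammer (2 * of_real lam) n / fact n * exp (\<i> * of_nat n * of_real phi) *
     (\<Sum>k\<le>n. pochhammer (- of_nat n) k * pochhammer (of_real lam + \<i> * x) k /
        (pochhammer (2 * of_real lam) k * fact k) * (1 - exp (- 2 * \<i> * of_real phi)) ^ k)"

(* For lambda = 1/2 and phi = pi/2 this normalisation is the orthonormal one for the weight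
   |Gamma(1/2 + i x)|^2 / pi = sech(pi x) on the real line; the leading coefficient is 2^n / n!. *)
definition pollaczek :: "nat \<Rightarrow> complex \<Rightarrow> complex" where
  "pollaczek = meixner_pollaczek (1/2) (pi/2)"

lemma pollaczek_sum:
  "pollaczek n x = \<i> ^ n *
     (\<Sum>k\<le>n. pochhammer (- of_nat n) k * pochhammer (1/2 + \<i> * x) k / (fact k)\<^sup>2 * 2 ^ k)"
proof -
  have "exp (\<i> * of_nat n * of_real (pi/2)) = \<i> ^ n"
    by (metis cis_conv_exp cis_pi_half exp_of_nat_mult mult.assoc mult.commute)
  moreover have "exp (- (2 * \<i> * complex_of_real (pi/2))) = -1"
    by (simp add: exp_minus mult.commute mult.left_commute)
  ultimately show ?thesis
    by (simp add: pollaczek_def meixner_pollaczek_def power2_eq_square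
        flip: pochhammer_fact)
qed

lemma pollaczek_0: "pollaczek 0 x = 1"
  by (simp add: pollaczek_sum)

lemma pollaczek_1: "pollaczek 1 x = 2 * x"
  by (simp add: pollaczek_sum algebra_simps)

definition coeff_c :: "(nat \<Rightarrow> real) \<Rightarrow> nat \<Rightarrow> complex" where
  "coeff_c a l = of_real (sqrt 2) *
     (\<Sum>n. (-1) ^ n / fact n * of_real (a n) * pollaczek l (- \<i> * (of_nat n + 1/2)))"

definition Phi :: "nat \<Rightarrow> real \<Rightarrow> complex" where
  "Phi l w = \<i> ^ l *
     of_real (sqrt 2 * exp (- w / 2) * laguerre_L l (2 * exp (- w)) * exp (- exp (- w)))"

definition cut_plane :: "complex set" where
  "cut_plane = - {z. Im z = 0 \<and> 1 \<le> Re z}"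

(* The analytic continuation to the cut plane of the sum of the Legendre expansion on (-1,1).
   It is unique on the cut plane; its values on the cut are unspecified and never used. *)
definition legendre_sum :: "(nat \<Rightarrow> real) \<Rightarrow> complex \<Rightarrow> complex" where
  "legendre_sum a = (SOME g. g holomorphic_on cut_plane \<and>
     (\<forall>x::real. \<bar>x\<bar> < 1 \<longrightarrow>
        (\<lambda>n. of_real (1 / (4 * pi) * ((2 * real n + 1) * a n * legendre_P n x)))
          sums g (of_real x)))"

definition f_plus :: "(nat \<Rightarrow> real) \<Rightarrow> real \<Rightarrow> complex" where
  "f_plus a v = Lim (at_right 0) (\<lambda>u. legendre_sum a (cos (Complex u v)))"

definition f_minus :: "(nat \<Rightarrow> real) \<Rightarrow> real \<Rightarrow> complex" where
  "f_minus a v = Lim (at_right 0) (\<lambda>u. legendre_sum a (cos (Complex (- u) v)))"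

definition jump_fun :: "(nat \<Rightarrow> real) \<Rightarrow> real \<Rightarrow> complex" where
  "jump_fun a y = (if y < 1 then 0 else \<i> * (f_plus a (arcosh y) - f_minus a (arcosh y)))"

definition conv_chi :: "(real \<Rightarrow> complex) \<Rightarrow> real \<Rightarrow> complex" where
  "conv_chi g y = (LBINT x:{1..y}. g x / of_real (sqrt (y - x)))"

(* The derivative may fail to exist at the single point y = 1, where the value is then irrelevant. *)
definition psi :: "(nat \<Rightarrow> real) \<Rightarrow> nat \<Rightarrow> real \<Rightarrow> complex" where
  "psi a m y = (if y < 1 then 0 else
     of_real (1 / (pi * sqrt 2)) *
       vector_derivative (conv_chi (\<lambda>x. \<Sum>l\<le>m. coeff_c a l * Phi l (arcosh x))) (at y))"

definition vderiv :: "(real \<Rightarrow> complex) \<Rightarrow> real \<Rightarrow> complex" where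
  "vderiv g x = vector_derivative g (at x)"

definition schwartz_space :: "(real \<Rightarrow> complex) set" where
  "schwartz_space = {\<phi>.
     (\<forall>k x. (vderiv ^^ k) \<phi> differentiable (at x)) \<and>
     (\<forall>k j::nat. ((\<lambda>x. of_real (x ^ j) * (vderiv ^^ k) \<phi> x) \<longlongrightarrow> 0) at_infinity)}"

definition pairing :: "(real \<Rightarrow> complex) \<Rightarrow> (real \<Rightarrow> complex) \<Rightarrow> complex" where
  "pairing f \<phi> = (LBINT x. cnj (f x) * \<phi> x)"

end

theory Submission
  imports Defs "HOL-Real_Asymp.Real_Asymp"
begin

text \<open>
  The variable is changed to \<open>t = exp (-w)\<close>. Put \<open>\<mu>(n,i) = (n choose i) (-1)^i \<Delta>^i f(n-i)\<close>. The
  Hausdorff condition bounds also the sums with exponent 2, which says that the signed measures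
  on \<open>[0,1]\<close> with mass \<open>\<mu>(n,i)\<close> spread over the cell \<open>[(n-i)/(n+1), (n-i+1)/(n+1)]\<close> have
  densities bounded in \<open>L\<^sup>2\<close>. Their distribution functions are therefore uniformly Hoelder
  continuous of exponent 1/2, and a uniform limit \<open>U\<close> of a subsequence satisfies \<open>f k = - k \<integral>
  t^(k-1) U(t) dt\<close> (\<open>hausdorff_moments\<close>; note \<open>f 0 = 0\<close>). Dividing by \<open>n^(p-2)\<close> is a fractional
  integration in \<open>w\<close>. This gives a continuous \<open>T\<close> and a primitive \<open>\<tau>\<close> of it, both of size \<open>sqrt
  w\<close> at 0 and of small exponential growth, with \<open>n a(n) = \<integral> exp (-nw) T(w) dw\<close> and \<open>a(n) = \<integral> exp
  (-nw) \<tau>(w) dw\<close> for \<open>n \<ge> 1\<close> (\<open>hausdorff_laplace_representation\<close>).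

  Hence \<open>(2n+1) a(n) = \<integral> exp (-nw) D(w) dw\<close> with \<open>D = 2T + \<tau>\<close>, and the generating function of
  the Legendre polynomials sums the expansion to \<open>(a(0) + \<integral> D(w) (R(z,w)^(-1/2) - 1) dw) / (4
  \<pi>)\<close>, where \<open>R(z,w) = 1 - 2 z exp (-w) + exp (-2w) = 2 exp (-w) (cosh w - z)\<close>. This is
  holomorphic in the cut plane. At \<open>z = cosh v\<close> the two boundary values differ only through
  those \<open>w\<close> for which \<open>R\<close> is negative, that is \<open>w < v\<close>. With \<open>h(w) = exp (w/2) \<tau>(w)\<close> one has
  \<open>h'(w) = exp (w/2) D(w) / 2\<close>, and the jump at \<open>y = cosh v\<close> is \<open>1/(\<pi> sqrt 2)\<close> times \<open>\<integral> h'(w) /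
  sqrt (y - cosh w) dw\<close> over \<open>0 < w < v\<close> (\<open>jump_fun_eq\<close>). Since \<open>h 0 = 0\<close>, this integral is the
  derivative of the Abel transform \<open>(h \<circ> arcosh) * \<chi>\<^sub>1\<close> (\<open>vector_derivative_conv_chi\<close>). So the
  jump function and \<open>\<psi>\<^sub>m\<close> come from the same operation, applied to \<open>h\<close> and to the partial sum
  \<open>S\<^sub>m\<close> of \<open>c\<^sub>l \<Phi>\<^sub>l\<close>.

  Integration by parts and Fubini move the operation to the test function: for a Schwartz
  function \<open>\<phi>\<close>, pairing it with the derivative of the Abel transform of \<open>h\<close> gives \<open>- \<integral> h(w) sinh
  w J(cosh w) dw\<close>, with the rapidly decreasing smooth function \<open>J(x) = \<integral> \<phi>'(y) / sqrt (y - x)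
  dy\<close> over \<open>y > x\<close> (\<open>abel_pairing\<close>). Put \<open>P(w) = exp (w/2) sinh w J(cosh w)\<close> and \<open>\<Lambda>\<^sub>l(s) = exp
  (-s) L\<^sub>l(2s)\<close>. The values of the Pollaczek polynomials at \<open>-i (n + 1/2)\<close> are, up to a unit,
  the coefficients of \<open>\<Lambda>\<^sub>l\<close> in powers \<open>(-s)^n / n!\<close>, so \<open>c\<^sub>l \<Phi>\<^sub>l(w) = 2 d\<^sub>l exp (-w/2) \<Lambda>\<^sub>l(exp
  (-w))\<close> with \<open>d\<^sub>l = a(0) + \<integral> \<tau>(w) (\<Lambda>\<^sub>l(exp (-w)) - 1) dw\<close>. The theorem becomes \<open>\<Sum> d\<^sub>l b\<^sub>l = \<integral> \<tau>
  P\<close> with \<open>b\<^sub>l = 2 \<integral> exp (-w) \<Lambda>\<^sub>l(exp (-w)) P(w) dw\<close> (\<open>laguerre_series_pairing\<close>).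

  The functions \<open>sqrt 2 \<Lambda>\<^sub>l\<close> are orthonormal on \<open>(0,\<infinity>)\<close>, and the \<open>b\<^sub>l\<close> are the coefficients of
  the function that is \<open>P(- ln s)\<close> for \<open>0 < s < 1\<close> and 0 for \<open>s \<ge> 1\<close>. Because \<open>P 0 = 0\<close>, its
  only singularity on \<open>(0,\<infinity>)\<close> is a kink at \<open>s = 1\<close>; the Laguerre equation and the uniform bound
  \<open>\<Lambda>\<^sub>l(s) = O((l s)^(-1/4))\<close> on \<open>(0,1]\<close> then give \<open>b\<^sub>l = O(l^(-5/4))\<close> (\<open>laguerre_coeff_bound\<close>),
  and the expansion converges pointwise, at \<open>s = 0\<close> to 0 (\<open>laguerre_expansion\<close>). As \<open>\<Lambda>\<^sub>l(0) =
  1\<close>, the last point says \<open>\<Sum> b\<^sub>l = 0\<close>: it removes the arbitrary \<open>a(0)\<close> and permits the use of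
  \<open>\<Lambda>\<^sub>l - 1\<close>, which is \<open>O((l s)^(3/16))\<close> on \<open>[0,1]\<close>. Since 5/4 - 3/16 exceeds 1, summation and
  integration may be interchanged.
\<close>

section \<open>Integrals over half-lines\<close>

lemma improper_FTC:
  fixes f F :: "real \<Rightarrow> real"
  assumes F: "\<And>x. x > a \<Longrightarrow> (F has_real_derivative f x) (at x)"
    and f: "\<And>x. x > a \<Longrightarrow> isCont f x"
    and int: "set_integrable lborel {a<..} f"
    and A: "(F \<longlongrightarrow> A) (at_right a)" and B: "(F \<longlongrightarrow> B) at_top"
  shows "(LBINT x:{a<..}. f x) = B - A"
proof -
  have e: "einterval (ereal a) \<infinity> = {a<..}"
    by (auto simp: einterval_def)
  have "(LBINT x=ereal a..\<infinity>. f x) = B - A"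
  proof (rule interval_integral_FTC_integrable[where F = F])
    show "set_integrable lborel (einterval (ereal a) \<infinity>) f" using int by (simp add: e)
    show "((F \<circ> real_of_ereal) \<longlongrightarrow> A) (at_right (ereal a))"
      using A by (simp add: ereal_tendsto_simps)
    show "((F \<circ> real_of_ereal) \<longlongrightarrow> B) (at_left \<infinity>)"
      using B by (simp add: ereal_tendsto_simps)
  qed (use F f in \<open>auto simp: has_real_derivative_iff_has_vector_derivative\<close>)
  then show ?thesis
    by (simp add: interval_lebesgue_integral_le_eq e)
qed

lemma improper_FTC_nonneg:
  fixes f F :: "real \<Rightarrow> real"
  assumes F: "\<And>x. x > a \<Longrightarrow> (F has_real_derivative f x) (at x)"
    and f: "\<And>x. x > a \<Longrightarrow> isCont f x"
    and nn: "\<And>x. x > a \<Longrightarrow> 0 \<le> f x"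
    and A: "(F \<longlongrightarrow> A) (at_right a)" and B: "(F \<longlongrightarrow> B) at_top"
  shows "set_integrable lborel {a<..} f" "(LBINT x:{a<..}. f x) = B - A"
proof -
  have e: "einterval (ereal a) \<infinity> = {a<..}"
    by (auto simp: einterval_def)
  have "set_integrable lborel (einterval (ereal a) \<infinity>) f"
  proof (rule interval_integral_FTC_nonneg[where F = F])
    show "((F \<circ> real_of_ereal) \<longlongrightarrow> A) (at_right (ereal a))"
      using A by (simp add: ereal_tendsto_simps)
    show "((F \<circ> real_of_ereal) \<longlongrightarrow> B) (at_left \<infinity>)"
      using B by (simp add: ereal_tendsto_simps)
  qed (use F f nn in auto)
  then show *: "set_integrable lborel {a<..} f" by (simp add: e)
  show "(LBINT x:{a<..}. f x) = B - A"
    by (rule improper_FTC[OF F f * A B])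
qed

lemma set_integrable_exp_decay:
  fixes c :: real
  assumes "c > 0"
  shows "set_integrable lborel {a<..} (\<lambda>w. exp (- c * w))"
    "(LBINT w:{0<..}. exp (- c * w)) = 1 / c"
proof -
  have lim: "((\<lambda>w. - exp (- c * w) / c) \<longlongrightarrow> 0) at_top"
    using assms by real_asymp
  have A: "((\<lambda>w. - exp (- c * w) / c) \<longlongrightarrow> - exp (- c * a) / c) (at_right a)" for a
    using assms by (intro tendsto_intros) auto
  have D: "((\<lambda>w. - exp (- c * w) / c) has_real_derivative exp (- c * x)) (at x)" for x
    using assms by (auto intro!: derivative_eq_intros)
  show "set_integrable lborel {a<..} (\<lambda>w. exp (- c * w))"
    by (rule improper_FTC_nonneg[OF D _ _ A lim]) auto
  show "(LBINT w:{0<..}. exp (- c * w)) = 1 / c"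
    by (subst improper_FTC_nonneg(2)[OF D _ _ A lim]) auto
qed

lemma set_borel_measurable_continuous_on:
  fixes f :: "real \<Rightarrow> real"
  assumes "continuous_on S f" "S \<in> sets borel"
  shows "set_borel_measurable lborel S f"
  using borel_measurable_continuous_on_indicator[OF assms(2,1)] by (simp add: set_borel_measurable_def)

lemma set_integrable_inverse_sqrt_dist:
  "set_integrable lborel {v - 1<..<v + 1} (\<lambda>w::real. 1 / sqrt \<bar>w - v\<bar>)"
proof -
  have "set_integrable lborel (einterval v (v + 1)) (\<lambda>w::real. 1 / sqrt \<bar>w - v\<bar>)"
  proof (rule interval_integral_FTC_nonneg[where F = "\<lambda>w. 2 * sqrt (w - v)"])
    show "(((\<lambda>w. 2 * sqrt (w - v)) \<circ> real_of_ereal) \<longlongrightarrow> 0) (at_right (ereal v))"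
      unfolding ereal_tendsto_simps by (auto intro!: tendsto_eq_intros)
    show "(((\<lambda>w. 2 * sqrt (w - v)) \<circ> real_of_ereal) \<longlongrightarrow> 2) (at_left (ereal (v+1)))"
      unfolding ereal_tendsto_simps by (auto intro!: tendsto_eq_intros)
    show "DERIV (\<lambda>w. 2 * sqrt (w - v)) x :> 1 / sqrt \<bar>x - v\<bar>" if "ereal v < ereal x" for x
      using that by (auto intro!: derivative_eq_intros simp: field_simps)
  qed (auto intro!: continuous_intros)
  moreover have "set_integrable lborel (einterval (v - 1) v) (\<lambda>w::real. 1 / sqrt \<bar>w - v\<bar>)"
  proof (rule interval_integral_FTC_nonneg[where F = "\<lambda>w. - 2 * sqrt (v - w)"])
    show "(((\<lambda>w. - 2 * sqrt (v - w)) \<circ> real_of_ereal) \<longlongrightarrow> -2) (at_right (ereal (v-1)))"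
      unfolding ereal_tendsto_simps by (auto intro!: tendsto_eq_intros)
    show "(((\<lambda>w. - 2 * sqrt (v - w)) \<circ> real_of_ereal) \<longlongrightarrow> 0) (at_left (ereal v))"
      unfolding ereal_tendsto_simps by (auto intro!: tendsto_eq_intros)
    show "DERIV (\<lambda>w. - 2 * sqrt (v - w)) x :> 1 / sqrt \<bar>x - v\<bar>" if "ereal x < ereal v" for x
      using that by (auto intro!: derivative_eq_intros simp: field_simps)
  qed (auto intro!: continuous_intros)
  moreover have "set_integrable lborel {v} (\<lambda>w::real. 1 / sqrt \<bar>w - v\<bar>)"
    by (rule set_integrable_cong[THEN iffD1, of lborel lborel "{v}" "{v}" "\<lambda>_. 0"]) (auto simp: set_integrable_def)
  ultimately have "set_integrable lborel (einterval v (v + 1) \<union> einterval (v - 1) v \<union> {v}) (\<lambda>w::real. 1 / sqrt \<bar>w - v\<bar>)"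
    by (intro set_integrable_Un) auto
  also have "einterval v (v + 1) \<union> einterval (v - 1) v \<union> {v} = {v-1<..<v+1}"
    by (auto simp: einterval_def)
  finally show ?thesis .
qed

text \<open>This is the majorant that makes dominated convergence work when \<open>z\<close> approaches the cut at
  \<open>cosh v\<close>: the singularity at \<open>w = v\<close> is of inverse square root type, hence integrable.\<close>

lemma set_integrable_exp_inverse_sqrt:
  fixes c v :: real
  assumes c: "c > 0" and v: "v \<ge> 0"
  shows "set_integrable lborel {0<..} (\<lambda>w. exp (- c * w) / sqrt \<bar>w - v\<bar>)"
proof -
  have 1: "set_integrable lborel ({0<..} \<inter> {v-1<..<v+1}) (\<lambda>w. 1 / sqrt \<bar>w - v\<bar>)"
    by (rule set_integrable_subset[OF set_integrable_inverse_sqrt_dist[of v]]) auto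
  have "set_integrable lborel ({0<..} \<inter> {v-1<..<v+1}) (\<lambda>w. exp (- c * w) / sqrt \<bar>w - v\<bar>)"
    by (rule set_integrable_bound[OF 1])
       (use c in \<open>auto simp: set_borel_measurable_def divide_right_mono intro!: AE_I2\<close>)
  moreover have "set_integrable lborel ({0<..} - {v-1<..<v+1}) (\<lambda>w. exp (- c * w) / sqrt \<bar>w - v\<bar>)"
  proof (rule set_integrable_bound[OF set_integrable_subset[OF set_integrable_exp_decay(1)[OF c, of 0]]])
    show "AE x in lborel. x \<in> {0<..} - {v - 1<..<v + 1} \<longrightarrow>
                norm (exp (- c * x) / sqrt \<bar>x - v\<bar>) \<le> norm (exp (- c * x))"
    proof (intro AE_I2 impI)
      fix x assume "x \<in> {0<..} - {v - 1<..<v + 1}"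
      then have "sqrt \<bar>x - v\<bar> \<ge> 1" by auto
      then show "norm (exp (- c * x) / sqrt \<bar>x - v\<bar>) \<le> norm (exp (- c * x))"
        by (simp add: field_simps)
    qed
  qed (auto simp: set_borel_measurable_def)
  ultimately have "set_integrable lborel (({0<..} \<inter> {v-1<..<v+1}) \<union> ({0<..} - {v-1<..<v+1})) (\<lambda>w. exp (- c * w) / sqrt \<bar>w - v\<bar>)"
    by (intro set_integrable_Un) auto
  also have "({0<..} \<inter> {v-1<..<v+1}) \<union> ({0<..} - {v-1<..<v+1}) = {0<..}" by auto
  finally show ?thesis .
qed

lemma sqrt_le_exp: "c > 0 \<Longrightarrow> w \<ge> 0 \<Longrightarrow> sqrt w \<le> (1 + 1 / c) * exp (c * w)" for c w :: real
proof -
  assume c: "c > 0" and w: "w \<ge> 0"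
  have "sqrt w \<le> 1 + w"
    by (rule real_le_lsqrt) (use w in \<open>auto simp: power2_eq_square field_simps\<close>)
  also have "1 + w \<le> (1 + 1/c) * (1 + c * w)"
    using c w by (simp add: field_simps)
  also have "\<dots> \<le> (1 + 1/c) * exp (c * w)"
    using c by (intro mult_left_mono exp_ge_add_one_self) auto
  finally show ?thesis .
qed

text \<open>The bound \<open>C sqrt w exp (c w)\<close> is the form in which all functions built from the Legendre
  coefficients are controlled.\<close>

lemma set_integrable_sqrt_bound:
  fixes f :: "real \<Rightarrow> real"
  assumes f: "set_borel_measurable lborel {0<..} f"
    and b: "\<And>w. w > 0 \<Longrightarrow> \<bar>f w\<bar> \<le> C * (sqrt w * exp (- c * w))" and c: "c > 0"
  shows "set_integrable lborel {0<..} f"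
proof -
  define K where "K = 1 + 1 / (c/2)"
  have "set_integrable lborel {0<..} (\<lambda>w. \<bar>C\<bar> * K * exp (- (c/2) * w))"
    using set_integrable_exp_decay(1)[of "c/2" 0] c by simp
  then show ?thesis
  proof (rule set_integrable_bound[OF _ f], intro AE_I2 impI)
    fix w :: real assume w: "w \<in> {0<..}"
    have "\<bar>f w\<bar> \<le> C * (sqrt w * exp (- c * w))" using b w by auto
    also have "\<dots> \<le> \<bar>C\<bar> * (K * exp ((c/2) * w) * exp (- c * w))"
      using w c sqrt_le_exp[of "c/2" w] unfolding K_def by (intro mult_mono mult_right_mono) auto
    also have "\<dots> = \<bar>C\<bar> * K * exp (- (c/2) * w)"
      by (simp add: mult_exp_exp mult.assoc)
    also have "\<dots> \<le> norm (\<bar>C\<bar> * K * exp (- (c/2) * w))" by simp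
    finally show "norm (f w) \<le> norm (\<bar>C\<bar> * K * exp (- (c/2) * w))" by simp
  qed
qed

text \<open>The substitution rule for absolutely integrable functions concerns the completed measure;
  measurability of both integrands transfers it to the Borel measure. Taking \<open>g\<close> injective on an
  arbitrary Borel set allows the improper endpoints of the Abel substitutions.\<close>

lemma lborel_change_of_variables:
  fixes f g g' :: "real \<Rightarrow> real"
  assumes S: "S \<in> sets borel" and T: "g ` S = T" "T \<in> sets borel"
    and der: "\<And>x. x \<in> S \<Longrightarrow> (g has_real_derivative g' x) (at x within S)"
    and inj: "inj_on g S"
    and m1: "set_borel_measurable lborel T f"
    and m2: "set_borel_measurable lborel S (\<lambda>x. \<bar>g' x\<bar> * f (g x))"
  shows "set_integrable lborel S (\<lambda>x. \<bar>g' x\<bar> * f (g x)) \<longleftrightarrow> set_integrable lborel T f"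
    and "(LBINT x:S. \<bar>g' x\<bar> * f (g x)) = (LBINT x:T. f x)"
proof -
  let ?h = "\<lambda>x. \<bar>g' x\<bar> * f (g x)"
  have S': "S \<in> sets lebesgue" using S by simp
  note cov = has_absolute_integral_change_of_variables_1'[OF S' der inj, of f]
  have c: "set_integrable lebesgue A k \<longleftrightarrow> set_integrable lborel A k"
    if "set_borel_measurable lborel A k" for A and k :: "real \<Rightarrow> real"
    using that unfolding set_integrable_def set_borel_measurable_def
    by (simp add: integrable_completion)
  show iff: "set_integrable lborel S ?h \<longleftrightarrow> set_integrable lborel T f"
    using cov T(1) c[OF m1] c[OF m2] by blast
  show "(LBINT x:S. ?h x) = (LBINT x:T. f x)"
  proof (cases "set_integrable lborel T f")
    case True
    then show ?thesis
      using cov T(1) c[OF m1] c[OF m2] iff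
      by (metis set_borel_integral_eq_integral(2))
  next
    case False
    with iff show ?thesis
      by (simp add: set_integrable_def set_lebesgue_integral_def not_integrable_integral_eq)
  qed
qed

lemma set_lebesgue_integral_nonneg:
  fixes f :: "'a \<Rightarrow> real"
  assumes "\<And>x. x \<in> A \<Longrightarrow> 0 \<le> f x"
  shows "0 \<le> (LINT x:A|M. f x)"
  unfolding set_lebesgue_integral_def
  using assms by (intro Bochner_Integration.integral_nonneg) (auto simp: indicator_def)

lemma set_integral_mono_subset:
  fixes f :: "real \<Rightarrow> real"
  assumes "set_integrable lborel B f" "A \<subseteq> B" "A \<in> sets borel" "\<And>x. x \<in> B \<Longrightarrow> 0 \<le> f x"
  shows "(LBINT x:A. f x) \<le> (LBINT x:B. f x)"
proof -
  have "set_integrable lborel A f"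
    using assms by (intro set_integrable_subset[OF assms(1)]) auto
  then show ?thesis
    using assms unfolding set_lebesgue_integral_def set_integrable_def
    by (intro integral_mono) (auto simp: indicator_def)
qed

lemma set_integral_suminf:
  fixes f :: "nat \<Rightarrow> real \<Rightarrow> real"
  assumes f: "\<And>i. set_integrable lborel A (f i)"
    and summ: "\<And>x. x \<in> A \<Longrightarrow> summable (\<lambda>i. \<bar>f i x\<bar>)"
    and int: "summable (\<lambda>i. LBINT x:A. \<bar>f i x\<bar>)"
  shows "set_integrable lborel A (\<lambda>x. \<Sum>i. f i x)"
    and "(\<lambda>i. LBINT x:A. f i x) sums (LBINT x:A. (\<Sum>i. f i x))"
proof -
  let ?g = "\<lambda>i x. indicator A x *\<^sub>R f i x"
  have g: "integrable lborel (?g i)" for i using f by (simp add: set_integrable_def)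
  have s: "AE x in lborel. summable (\<lambda>i. norm (?g i x))"
    using summ by (intro AE_I2) (auto simp: indicator_def)
  have n: "summable (\<lambda>i. LBINT x. norm (?g i x))"
    using int by (simp add: set_lebesgue_integral_def abs_mult)
  have e: "indicator A x *\<^sub>R (\<Sum>i. f i x) = (\<Sum>i. ?g i x)" for x
    by (cases "x \<in> A") auto
  show "set_integrable lborel A (\<lambda>x. \<Sum>i. f i x)"
    unfolding set_integrable_def e by (rule integrable_suminf[OF g s n])
  show "(\<lambda>i. LBINT x:A. f i x) sums (LBINT x:A. (\<Sum>i. f i x))"
    unfolding set_lebesgue_integral_def e by (rule sums_integral[OF g s n])
qed

text \<open>Differentiation under the integral sign by dominated convergence of the difference
  quotients, which the mean value inequality bounds by \<open>g\<close>. The field may be real or complex: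
  the complex case gives holomorphy of the continued Legendre sum, the real one smoothness of
  the dual Abel transform.\<close>

lemma has_field_derivative_set_integral:
  fixes f f' :: "'a::{real_normed_field, banach, second_countable_topology} \<Rightarrow> real \<Rightarrow> 'a" and g :: "real \<Rightarrow> real"
  assumes d: "d > 0"
    and f: "\<And>x. dist x x0 < d \<Longrightarrow> set_integrable lborel A (f x)"
    and f': "\<And>x t. dist x x0 < d \<Longrightarrow> t \<in> A \<Longrightarrow> ((\<lambda>x. f x t) has_field_derivative f' x t) (at x)"
    and g: "set_integrable lborel A g"
    and bound: "\<And>x t. dist x x0 < d \<Longrightarrow> t \<in> A \<Longrightarrow> norm (f' x t) \<le> g t"
    and meas: "set_borel_measurable lborel A (f' x0)"
  shows "((\<lambda>x. LBINT t:A. f x t) has_field_derivative (LBINT t:A. f' x0 t)) (at x0)"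
proof -
  have "((\<lambda>x. ((LBINT t:A. f x t) - (LBINT t:A. f x0 t)) / (x - x0)) \<longlongrightarrow> (LBINT t:A. f' x0 t)) (at x0)"
    unfolding tendsto_at_iff_sequentially comp_def
  proof (intro allI impI)
    fix X :: "nat \<Rightarrow> 'a"
    assume X: "\<forall>i. X i \<in> UNIV - {x0}" "X \<longlonglongrightarrow> x0"
    have ev: "\<forall>\<^sub>F n in sequentially. dist (X n) x0 < d"
      using X(2) d by (simp add: tendsto_iff)
    then obtain n0 where n0: "\<And>n. n \<ge> n0 \<Longrightarrow> dist (X n) x0 < d"
      by (auto simp: eventually_sequentially)
    define q where "q = (\<lambda>n t. indicator A t *\<^sub>R ((f (X (n + n0)) t - f x0 t) / (X (n + n0) - x0)))"
    have fi: "integrable lborel (\<lambda>t. indicator A t *\<^sub>R f x t)" if "dist x x0 < d" for x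
      using f[OF that] by (simp add: set_integrable_def)
    have x0d: "dist x0 x0 < d" using d by simp
    have "(\<lambda>n. LBINT t. q n t) \<longlonglongrightarrow> (LBINT t. indicator A t *\<^sub>R f' x0 t)"
    proof (rule integral_dominated_convergence[where w = "\<lambda>t. indicator A t *\<^sub>R g t"])
      show "integrable lborel (\<lambda>t. indicator A t *\<^sub>R g t)" using g by (simp add: set_integrable_def)
      show "(\<lambda>t. indicator A t *\<^sub>R f' x0 t) \<in> borel_measurable lborel"
        using meas by (simp add: set_borel_measurable_def)
      show "q n \<in> borel_measurable lborel" for n
      proof -
        have "q n = (\<lambda>t. (indicator A t *\<^sub>R f (X (n + n0)) t - indicator A t *\<^sub>R f x0 t) / (X (n + n0) - x0))"
          by (rule ext) (simp add: q_def indicator_def)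
        then show ?thesis
          using fi[OF n0[of "n + n0"]] fi[OF x0d] by simp
      qed
      show "AE t in lborel. (\<lambda>n. q n t) \<longlonglongrightarrow> indicator A t *\<^sub>R f' x0 t"
      proof (intro AE_I2)
        fix t
        show "(\<lambda>n. q n t) \<longlonglongrightarrow> indicator A t *\<^sub>R f' x0 t"
        proof (cases "t \<in> A")
          case True
          have "((\<lambda>x. (f x t - f x0 t) / (x - x0)) \<longlongrightarrow> f' x0 t) (at x0)"
            using f'[OF x0d True] by (simp add: has_field_derivative_iff)
          moreover have "filterlim (\<lambda>n. X (n + n0)) (at x0) sequentially"
            using X by (auto simp: filterlim_at intro!: LIMSEQ_ignore_initial_segment)
          ultimately have "(\<lambda>n. (f (X (n + n0)) t - f x0 t) / (X (n + n0) - x0)) \<longlonglongrightarrow> f' x0 t"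
            by (rule filterlim_compose)
          then show ?thesis using True by (simp add: q_def)
        qed (simp add: q_def)
      qed
      show "AE t in lborel. norm (q n t) \<le> indicator A t *\<^sub>R g t" for n
      proof (intro AE_I2)
        fix t
        show "norm (q n t) \<le> indicator A t *\<^sub>R g t"
        proof (cases "t \<in> A")
          case True
          have "norm (f (X (n + n0)) t - f x0 t) \<le> g t * norm (X (n + n0) - x0)"
          proof (rule field_differentiable_bound[of "ball x0 d" "\<lambda>x. f x t" "\<lambda>x. f' x t"])
            show "((\<lambda>x. f x t) has_field_derivative f' z t) (at z within ball x0 d)" if "z \<in> ball x0 d" for z
              using f'[of z t] that True by (auto simp: dist_commute intro: has_field_derivative_at_within)
            show "norm (f' z t) \<le> g t" if "z \<in> ball x0 d" for z
              using bound[of z t] that True by (simp add: dist_commute)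
          qed (use n0[of "n + n0"] d in \<open>auto simp: dist_commute\<close>)
          moreover have "X (n + n0) - x0 \<noteq> 0" using X(1) by (auto dest: spec[of _ "n + n0"])
          ultimately show ?thesis using True by (simp add: q_def norm_divide divide_simps)
        qed (simp add: q_def)
      qed
    qed
    moreover have "(LBINT t. q n t) = ((LBINT t:A. f (X (n + n0)) t) - (LBINT t:A. f x0 t)) / (X (n + n0) - x0)" for n
    proof -
      have "q n = (\<lambda>t. (indicator A t *\<^sub>R f (X (n + n0)) t - indicator A t *\<^sub>R f x0 t) / (X (n + n0) - x0))"
        by (rule ext) (simp add: q_def indicator_def)
      then show ?thesis
        using fi[OF n0[of "n + n0"]] fi[OF x0d]
        by (simp add: set_lebesgue_integral_def Bochner_Integration.integral_diff)
    qed
    ultimately have "(\<lambda>n. ((LBINT t:A. f (X (n + n0)) t) - (LBINT t:A. f x0 t)) / (X (n + n0) - x0)) \<longlonglongrightarrow> (LBINT t:A. f' x0 t)"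
      by (simp add: set_lebesgue_integral_def)
    then show "(\<lambda>n. ((LBINT t:A. f (X n) t) - (LBINT t:A. f x0 t)) / (X n - x0)) \<longlonglongrightarrow> (LBINT t:A. f' x0 t)"
      by (rule LIMSEQ_offset)
  qed
  then show ?thesis by (simp add: has_field_derivative_iff)
qed

section \<open>Laguerre functions\<close>

definition laguerre_poly :: "nat \<Rightarrow> real poly" where
  "laguerre_poly l = (\<Sum>k\<le>l. monom ((-1) ^ k * real (l choose k) / fact k) k)"

lemma coeff_laguerre_poly: "coeff (laguerre_poly l) k = (-1) ^ k * real (l choose k) / fact k"
  by (auto simp: laguerre_poly_def coeff_sum if_distrib cong: if_cong)

lemma poly_laguerre_poly: "poly (laguerre_poly l) x = laguerre_L l x"
  by (simp add: laguerre_poly_def laguerre_L_def poly_sum poly_monom)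

text \<open>This is Laguerre's equation \<open>x p'' + (1 - x) p' + l p = 0\<close>, with multiplication by \<open>x\<close>
  written as \<open>pCons 0\<close>.\<close>

lemma laguerre_poly_ode:
  fixes l :: nat
  defines "p \<equiv> laguerre_poly l"
  shows "pCons 0 (pderiv (pderiv p)) + pderiv p - pCons 0 (pderiv p) + smult (real l) p = 0"
proof (rule poly_eqI)
  fix n
  have c: "real (Suc n) * (real (Suc n) * coeff p (Suc n)) = - ((real l - real n) * coeff p n)"
  proof -
    have "real (Suc n) * real (l choose Suc n) = (real l - real n) * real (l choose n)"
    proof (cases "n \<le> l")
      case True
      then show ?thesis
        by (metis binomial_absorb_comp binomial_absorption of_nat_diff of_nat_mult)
    qed (simp add: binomial_eq_0)
    then show ?thesis
      by (simp add: p_def coeff_laguerre_poly fact_reduce divide_simps)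
  qed
  show "coeff (pCons 0 (pderiv (pderiv p)) + pderiv p - pCons 0 (pderiv p) + smult (real l) p) n = coeff 0 n"
    using c by (cases n) (simp_all add: coeff_pderiv algebra_simps)
qed

text \<open>Up to the factor \<open>sqrt 2\<close> these are the orthonormal Laguerre functions on \<open>(0,\<infinity>)\<close>. The
  scaling is chosen so that \<open>\<Phi>\<^sub>l\<close> is a multiple of \<open>exp (-w/2)\<close> times this function at \<open>exp
  (-w)\<close>.\<close>

definition laguerre_fun :: "nat \<Rightarrow> real \<Rightarrow> real" where
  "laguerre_fun l s = exp (- s) * laguerre_L l (2 * s)"

definition laguerre_fun' :: "nat \<Rightarrow> real \<Rightarrow> real" where
  "laguerre_fun' l s = exp (- s) * (2 * poly (pderiv (laguerre_poly l)) (2 * s) - laguerre_L l (2 * s))"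

lemma laguerre_fun_0 [simp]: "laguerre_fun l 0 = 1"
proof -
  have "laguerre_L l 0 = (\<Sum>k\<le>l. if k = 0 then 1 else 0)"
    unfolding laguerre_L_def by (intro sum.cong) auto
  then show ?thesis by (simp add: laguerre_fun_def)
qed

lemma laguerre_fun_zero_index: "laguerre_fun 0 s = exp (- s)" and laguerre_fun'_zero_index: "laguerre_fun' 0 s = - exp (- s)"
  by (simp_all add: laguerre_fun_def laguerre_fun'_def laguerre_L_def laguerre_poly_def)

lemma laguerre_fun_deriv: "(laguerre_fun l has_real_derivative laguerre_fun' l s) (at s)"
  unfolding laguerre_fun_def[abs_def] laguerre_fun'_def poly_laguerre_poly[symmetric]
  by (auto intro!: derivative_eq_intros simp: algebra_simps)

text \<open>In this self-adjoint form \<open>(s y')' = - (N - s) y\<close> with \<open>N = 2l + 1\<close>, the Laguerre equation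
  yields the energy estimates below and, in the variable \<open>w = - ln s\<close>, the decay of the
  expansion coefficients.\<close>

lemma laguerre_fun'_deriv: "((\<lambda>s. s * laguerre_fun' l s) has_real_derivative - ((2 * real l + 1 - s) * laguerre_fun l s)) (at s)"
proof -
  let ?p = "laguerre_poly l"
  have "poly (pCons 0 (pderiv (pderiv ?p)) + pderiv ?p - pCons 0 (pderiv ?p) + smult (real l) ?p) (2 * s) = 0"
    using laguerre_poly_ode[of l] by simp
  then have ode: "2 * s * poly (pderiv (pderiv ?p)) (2 * s) =
      2 * s * poly (pderiv ?p) (2 * s) - poly (pderiv ?p) (2 * s) - real l * poly ?p (2 * s)"
    by (simp add: algebra_simps)
  have "((\<lambda>s. s * laguerre_fun' l s) has_real_derivative
     (exp (- s) * (2 * poly (pderiv ?p) (2 * s) - poly ?p (2 * s)) +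
     s * (exp (- s) * (4 * poly (pderiv (pderiv ?p)) (2 * s) - 2 * poly (pderiv ?p) (2 * s)) - exp (- s) * (2 * poly (pderiv ?p) (2 * s) - poly ?p (2 * s))))) (at s)"
    unfolding laguerre_fun'_def poly_laguerre_poly[symmetric]
    by (auto intro!: derivative_eq_intros simp: algebra_simps)
  also have "(exp (- s) * (2 * poly (pderiv ?p) (2 * s) - poly ?p (2 * s)) +
     s * (exp (- s) * (4 * poly (pderiv (pderiv ?p)) (2 * s) - 2 * poly (pderiv ?p) (2 * s)) - exp (- s) * (2 * poly (pderiv ?p) (2 * s) - poly ?p (2 * s))))
     = exp (- s) * (2 * poly (pderiv ?p) (2 * s) - poly ?p (2 * s) + 2 * (2 * s * poly (pderiv (pderiv ?p)) (2 * s))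
        - 4 * s * poly (pderiv ?p) (2 * s) + s * poly ?p (2 * s))"
    by (simp add: algebra_simps)
  also have "\<dots> = - ((2 * real l + 1 - s) * laguerre_fun l s)"
    unfolding ode laguerre_fun_def poly_laguerre_poly[symmetric] by (simp add: algebra_simps)
  finally show ?thesis .
qed

lemma continuous_on_laguerre_fun [continuous_intros]:
  "continuous_on S f \<Longrightarrow> continuous_on S (\<lambda>x. laguerre_fun l (f x))"
  "continuous_on S f \<Longrightarrow> continuous_on S (\<lambda>x. laguerre_fun' l (f x))"
  unfolding laguerre_fun_def laguerre_fun'_def poly_laguerre_poly[symmetric] by (auto intro!: continuous_intros)

text \<open>The energy \<open>y\<^sup>2 + s y'\<^sup>2 / (N - s)\<close> of the oscillator \<open>(s y')' = - (N - s) y\<close> equals 1 at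
  \<open>s = 0\<close> and decreases as long as \<open>s (N - s)\<close> increases, that is for \<open>s \<le> N/2\<close>.\<close>

lemma laguerre_fun_energy_bound_aux:
  assumes s: "0 < s" "s \<le> real l + 1/2"
  shows "(laguerre_fun l s)\<^sup>2 + s * (laguerre_fun' l s)\<^sup>2 / (2 * real l + 1 - s) \<le> 1"
proof -
  let ?W = "\<lambda>s. (laguerre_fun l s)\<^sup>2 + s * (laguerre_fun' l s)\<^sup>2 / (2 * real l + 1 - s)"
  define P where "P = (\<lambda>s. s * laguerre_fun' l s)"
  note P = laguerre_fun'_deriv[of l, folded P_def]
  let ?V = "\<lambda>s. (laguerre_fun l s)\<^sup>2 + (P s)\<^sup>2 / (s * (2 * real l + 1 - s))"
  have "?W s \<le> ?W 0"
  proof (rule DERIV_nonpos_imp_decreasing_open[where f = ?W])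
    fix x assume x: "0 < x" "x < s"
    define q where "q = 2 * real l + 1 - x"
    have q: "q > 0" "q \<ge> x" using x s by (auto simp: q_def)
    have L: "laguerre_fun' l x = P x / x" using x by (simp add: P_def)
    have "(?V has_real_derivative - ((P x)\<^sup>2 * (q - x) / (x * q)\<^sup>2)) (at x)"
      using q x
      by (auto intro!: derivative_eq_intros laguerre_fun_deriv P simp flip: q_def simp add: L)
         (simp add: field_simps power2_eq_square)
    then have "(?W has_real_derivative - ((P x)\<^sup>2 * (q - x) / (x * q)\<^sup>2)) (at x)"
    proof (rule has_field_derivative_transform_within[where d = x])
      show "?V y = ?W y" if "y \<in> UNIV" "dist y x < x" for y
        using that x by (cases "y = 0") (auto simp: P_def power2_eq_square)
    qed (use x in auto)
    moreover have "- ((P x)\<^sup>2 * (q - x) / (x * q)\<^sup>2) \<le> 0"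
      using q by simp
    ultimately show "\<exists>y. (?W has_real_derivative y) (at x) \<and> y \<le> 0" by blast
  next
    show "continuous_on {0..s} ?W"
      using s by (auto intro!: continuous_intros)
  qed (use s in auto)
  then show ?thesis by simp
qed

lemma laguerre_fun_energy_bound:
  assumes s: "0 < s" "s \<le> 1 \<or> s \<le> real l + 1/2"
  shows "\<bar>laguerre_fun l s\<bar> \<le> 1" "s * (laguerre_fun' l s)\<^sup>2 \<le> 2 * real l + 1"
proof -
  have "\<bar>laguerre_fun l s\<bar> \<le> 1 \<and> s * (laguerre_fun' l s)\<^sup>2 \<le> 2 * real l + 1"
  proof (cases "l = 0 \<and> s \<le> 1")
    case True
    then have "s * (exp (- s))\<^sup>2 \<le> 1 * 1\<^sup>2"
      using s by (intro mult_mono power_mono) auto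
    then show ?thesis using True s by (simp add: laguerre_fun_zero_index laguerre_fun'_zero_index)
  next
    case False
    then have s2: "s \<le> real l + 1/2" using s by (cases "l = 0") auto
    note W = laguerre_fun_energy_bound_aux[OF s(1) s2]
    have q: "2 * real l + 1 - s > 0" using s2 by simp
    have nn: "0 \<le> s * (laguerre_fun' l s)\<^sup>2 / (2 * real l + 1 - s)" using q s by simp
    have "(laguerre_fun l s)\<^sup>2 \<le> 1\<^sup>2" using W nn by simp
    then have 1: "\<bar>laguerre_fun l s\<bar> \<le> 1" by (simp add: abs_square_le_1)
    have "s * (laguerre_fun' l s)\<^sup>2 / (2 * real l + 1 - s) \<le> 1"
      using W zero_le_power2[of "laguerre_fun l s"] by linarith
    then show ?thesis using 1 q s by (simp add: field_simps)
  qed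
  then show "\<bar>laguerre_fun l s\<bar> \<le> 1" "s * (laguerre_fun' l s)\<^sup>2 \<le> 2 * real l + 1" by auto
qed

lemma laguerre_fun_le_one: "0 \<le> s \<Longrightarrow> s \<le> 1 \<or> s \<le> real l + 1/2 \<Longrightarrow> \<bar>laguerre_fun l s\<bar> \<le> 1"
  using laguerre_fun_energy_bound(1)[of s l] by (cases "s = 0") auto

text \<open>The energy estimate bounds the derivative by \<open>sqrt (N / s)\<close>, whose integral is \<open>2 sqrt (N
  s)\<close>.\<close>

lemma laguerre_fun_minus_one_bound:
  assumes s: "0 \<le> s" "s \<le> 1"
  shows "\<bar>laguerre_fun l s - 1\<bar> \<le> 2 * sqrt ((2 * real l + 1) * s)"
proof (cases "s = 0")
  case False
  then have s0: "s > 0" using s by simp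
  define N where "N = 2 * real l + 1"
  have N: "N \<ge> 1" by (simp add: N_def)
  have d: "\<bar>laguerre_fun' l x\<bar> \<le> sqrt N / sqrt x" if "0 < x" "x < s" for x
  proof -
    have "x * (laguerre_fun' l x)\<^sup>2 \<le> N" using laguerre_fun_energy_bound(2)[of x l] that s by (auto simp: N_def)
    then have "(laguerre_fun' l x)\<^sup>2 \<le> N / x" using that by (simp add: field_simps)
    then have "\<bar>laguerre_fun' l x\<bar> \<le> sqrt (N / x)" by (simp add: real_le_rsqrt)
    then show ?thesis by (simp add: real_sqrt_divide)
  qed
  have D: "((\<lambda>x. 2 * sqrt (N * x)) has_real_derivative sqrt N / sqrt x) (at x)" if "0 < x" for x
    using that N by (auto intro!: derivative_eq_intros simp: real_sqrt_mult field_simps)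
  have "laguerre_fun l s - 2 * sqrt (N * s) \<le> laguerre_fun l 0 - 2 * sqrt (N * 0)"
  proof (rule DERIV_nonpos_imp_decreasing_open[where f = "\<lambda>s. laguerre_fun l s - 2 * sqrt (N * s)"])
    fix x assume x: "0 < x" "x < s"
    show "\<exists>y. ((\<lambda>s. laguerre_fun l s - 2 * sqrt (N * s)) has_real_derivative y) (at x) \<and> y \<le> 0"
      by (rule exI[of _ "laguerre_fun' l x - sqrt N / sqrt x"])
         (use x d[of x] in \<open>auto intro!: DERIV_diff D laguerre_fun_deriv\<close>)
  qed (use s in \<open>auto intro!: continuous_intros\<close>)
  moreover have "laguerre_fun l s + 2 * sqrt (N * s) \<ge> laguerre_fun l 0 + 2 * sqrt (N * 0)"
  proof (rule DERIV_nonneg_imp_increasing_open[where f = "\<lambda>s. laguerre_fun l s + 2 * sqrt (N * s)"])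
    fix x assume x: "0 < x" "x < s"
    show "\<exists>y. ((\<lambda>s. laguerre_fun l s + 2 * sqrt (N * s)) has_real_derivative y) (at x) \<and> y \<ge> 0"
      by (rule exI[of _ "laguerre_fun' l x + sqrt N / sqrt x"])
         (use x d[of x] in \<open>auto intro!: DERIV_add D laguerre_fun_deriv\<close>)
  qed (use s in \<open>auto intro!: continuous_intros\<close>)
  ultimately show ?thesis by (auto simp: N_def abs_le_iff)
qed auto

text \<open>This is the WKB-type bound \<open>y = O((N s)^(-1/4))\<close>. The Liouville substitution \<open>s = r\<^sup>2\<close>,
  \<open>z(r) = sqrt r y(r\<^sup>2)\<close> turns the Laguerre equation into \<open>z'' + q z = 0\<close> with the decreasing
  \<open>q(r) = 4 (N - r\<^sup>2) + 1/(4 r\<^sup>2)\<close>, so that the energy \<open>z'\<^sup>2 + q z\<^sup>2\<close> decreases.\<close>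

lemma laguerre_fun_amplitude_bound:
  assumes s: "0 < s" "s \<le> 1"
  shows "(laguerre_fun l s)\<^sup>2 * sqrt ((2 * real l + 1) * s) \<le> 4"
proof -
  define N where "N = 2 * real l + 1"
  have N: "N \<ge> 1" by (simp add: N_def)
  show ?thesis
  proof (cases "N * s \<le> 1")
    case True
    have "\<bar>laguerre_fun l s\<bar> \<le> 1" using laguerre_fun_le_one[of s l] s by simp
    then have "(laguerre_fun l s)\<^sup>2 \<le> 1" by (simp add: abs_square_le_1)
    then have "(laguerre_fun l s)\<^sup>2 * sqrt (N * s) \<le> 1 * 1"
      using True s N by (intro mult_mono) auto
    then show ?thesis by (simp add: N_def)
  next
    case False
    then have l: "l > 0" using s by (cases l) (auto simp: N_def)
    then have N3: "N \<ge> 3" by (simp add: N_def)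
    define y where "y = laguerre_fun l"
    define P where "P = (\<lambda>s. s * laguerre_fun' l s)"
    note P = laguerre_fun'_deriv[of l, folded P_def]
    \<comment> \<open>The energy \<open>z'\<^sup>2 + q z\<^sup>2\<close> written in the variable \<open>s\<close>; the form as a sum of squares is
      fact \<open>EE\<close>.\<close>
    define E where "E = (\<lambda>s. sqrt s * ((y s)\<^sup>2 / (2 * s) + 2 * y s * P s / s + 4 * (P s)\<^sup>2 / s + 4 * (N - s) * (y s)\<^sup>2))"
    \<comment> \<open>The scale \<open>1/N\<close> of the first oscillation: there the earlier energy estimate bounds \<open>y\<close>
      and \<open>s y'\<close> by 1.\<close>
    define s0 where "s0 = 1 / N"
    have s0: "s0 > 0" "s0 < s" "s0 \<le> 1" using False N by (auto simp: s0_def field_simps)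
    have "E s \<le> E s0"
    proof (rule DERIV_nonpos_imp_nonincreasing[where f = E])
      fix x assume "s0 \<le> x" "x \<le> s"
      then have x: "x > 0" using s0 by simp
      define r where "r = sqrt x"
      have r: "r > 0" "x = r\<^sup>2" using x by (auto simp: r_def)
      have p: "laguerre_fun' l x = P x / x" using x by (simp add: P_def)
      have "(E has_real_derivative - (4 * r + 1 / (4 * r ^ 3)) * (y x)\<^sup>2) (at x)"
        unfolding E_def y_def
        using x by (auto intro!: derivative_eq_intros laguerre_fun_deriv[of l, folded y_def] P simp flip: r_def N_def y_def simp add: p)
           (use r(1) in \<open>simp add: r(2) divide_simps power2_eq_square\<close>, simp add: N_def algebra_simps power2_eq_square power3_eq_cube)
      moreover have "(4 * r + 1 / (4 * r ^ 3)) * (y x)\<^sup>2 \<ge> 0"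
        using r(1) by (intro mult_nonneg_nonneg add_nonneg_nonneg) auto
      ultimately show "\<exists>z. (E has_real_derivative z) (at x) \<and> z \<le> 0"
        by (intro exI conjI) (assumption, simp only: mult_minus_left neg_le_0_iff_le)
    qed (use s0 in auto)
    have EE: "E x = sqrt x * ((y x / (2 * sqrt x) + 2 * sqrt x * laguerre_fun' l x)\<^sup>2 + (y x)\<^sup>2 / (4 * x) + 4 * (N - x) * (y x)\<^sup>2)" if "x > 0" for x
    proof -
      define r where "r = sqrt x"
      have r: "r > 0" "x = r\<^sup>2" using that by (auto simp: r_def)
      show ?thesis unfolding E_def P_def r_def[symmetric] unfolding r(2) using r(1)
        by (simp add: divide_simps power2_eq_square) (simp add: algebra_simps power2_eq_square)
    qed
    have lower: "sqrt s * (4 * (N - s) * (y s)\<^sup>2) \<le> E s"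
      unfolding EE[OF s(1)] using s by (intro mult_left_mono) auto
    have "sqrt s0 * E s0 \<le> 21 / 2"
    proof -
      have y1: "\<bar>y s0\<bar> \<le> 1" using laguerre_fun_le_one[of s0 l] s0 by (simp add: y_def)
      have d1: "s0 * (laguerre_fun' l s0)\<^sup>2 \<le> N" using laguerre_fun_energy_bound(2)[of s0 l] s0 by (simp add: N_def)
      have y2: "(y s0)\<^sup>2 \<le> 1" using y1 by (simp add: abs_square_le_1)
      have "(s0 * laguerre_fun' l s0)\<^sup>2 \<le> 1\<^sup>2"
        using d1 N s0 by (simp add: s0_def power2_eq_square field_simps)
      then have d2: "\<bar>s0 * laguerre_fun' l s0\<bar> \<le> 1" using abs_square_le_1[of "s0 * laguerre_fun' l s0"] by simp
      have "\<bar>y s0 * (s0 * laguerre_fun' l s0)\<bar> \<le> 1 * 1"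
        unfolding abs_mult[of "y s0"] using y1 d2 by (intro mult_mono) auto
      then have yd: "y s0 * (s0 * laguerre_fun' l s0) \<le> 1" by linarith
      have "s0 * (4 * (N - s0) * (y s0)\<^sup>2) \<le> s0 * (4 * N * 1)"
        using s0 y2 N by (intro mult_left_mono mult_mono) auto
      then have q: "s0 * (4 * (N - s0) * (y s0)\<^sup>2) \<le> 4" using N by (simp add: s0_def)
      have "sqrt s0 * E s0 = s0 * ((y s0)\<^sup>2 / (2 * s0) + 2 * y s0 * (s0 * laguerre_fun' l s0) / s0 + 4 * (s0 * laguerre_fun' l s0)\<^sup>2 / s0 + 4 * (N - s0) * (y s0)\<^sup>2)"
        unfolding E_def P_def using s0 by (simp flip: mult.assoc)
      also have "\<dots> = (y s0)\<^sup>2 / 2 + 2 * (y s0 * (s0 * laguerre_fun' l s0)) + 4 * (s0 * laguerre_fun' l s0)\<^sup>2 + s0 * (4 * (N - s0) * (y s0)\<^sup>2)"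
        using s0 by (simp add: field_simps)
      also have "\<dots> \<le> 1 / 2 + 2 * 1 + 4 * 1 + 4"
        using y2 yd q \<open>(s0 * laguerre_fun' l s0)\<^sup>2 \<le> 1\<^sup>2\<close> by (intro add_mono) auto
      finally show ?thesis by simp
    qed
    then have "E s0 \<le> 21 / 2 * sqrt N"
      using N by (simp add: s0_def real_sqrt_divide field_simps)
    with lower \<open>E s \<le> E s0\<close> have "sqrt s * (4 * (N - s) * (y s)\<^sup>2) \<le> 21 / 2 * sqrt N" by linarith
    moreover have "sqrt s * (4 * (2 / 3 * N) * (y s)\<^sup>2) \<le> sqrt s * (4 * (N - s) * (y s)\<^sup>2)"
      using s N3 by (intro mult_left_mono mult_right_mono) auto
    ultimately have "sqrt s * (4 * (2 / 3 * N) * (y s)\<^sup>2) \<le> 21 / 2 * sqrt N" by linarith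
    moreover have "sqrt s * (4 * (2 / 3 * N) * (y s)\<^sup>2) = (8 / 3 * ((y s)\<^sup>2 * sqrt (N * s))) * sqrt N"
      using N by (simp add: real_sqrt_mult)
    ultimately have "8 / 3 * ((y s)\<^sup>2 * sqrt (N * s)) \<le> 21 / 2"
      using N by (metis mult_le_cancel_right_pos real_sqrt_gt_0_iff less_le_trans zero_less_one)
    then show ?thesis by (simp add: y_def N_def)
  qed
qed

text \<open>Beyond \<open>s = l + 1/2\<close> the trivial bound \<open>2^l exp (2s)\<close> for the polynomial suffices, since
  there \<open>2^l \<le> exp s\<close>. A bound uniform in \<open>l\<close> is needed on the whole half-line to take Laplace
  transforms termwise.\<close>

lemma laguerre_fun_exp_bound: "s \<ge> 0 \<Longrightarrow> \<bar>laguerre_fun l s\<bar> \<le> exp (2 * s)"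
proof -
  assume s: "s \<ge> 0"
  show ?thesis
  proof (cases "s \<le> real l + 1/2")
    case True
    then show ?thesis using laguerre_fun_le_one[of s l] s
      by (metis exp_le_cancel_iff exp_zero mult_nonneg_nonneg order_trans zero_le_numeral)
  next
    case False
    have e: "(2 * s) ^ k / fact k \<le> exp (2 * s)" for k
    proof -
      have "(\<Sum>k\<in>{k}. (2 * s) ^ k /\<^sub>R fact k) \<le> exp (2 * s)"
        unfolding exp_def using s by (intro sum_le_suminf summable_exp_generic) auto
      then show ?thesis by (simp add: field_simps)
    qed
    have "\<bar>laguerre_L l (2 * s)\<bar> \<le> (\<Sum>k\<le>l. real (l choose k) * ((2 * s) ^ k / fact k))"
      unfolding laguerre_L_def by (rule order_trans[OF sum_abs]) (use s in \<open>auto simp: abs_mult power_abs intro!: sum_mono\<close>)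
    also have "\<dots> \<le> (\<Sum>k\<le>l. real (l choose k) * exp (2 * s))"
      by (intro sum_mono mult_left_mono e) auto
    also have "\<dots> = 2 ^ l * exp (2 * s)"
      by (simp add: choose_row_sum flip: sum_distrib_right of_nat_sum)
    also have "(2::real) ^ l \<le> exp 1 ^ l"
      using exp_ge_add_one_self[of 1] by (intro power_mono) auto
    also have "exp 1 ^ l = exp (real l)" by (simp flip: exp_of_nat_mult)
    also have "exp (real l) \<le> exp s" using False by simp
    finally have "\<bar>laguerre_L l (2 * s)\<bar> \<le> exp s * exp (2 * s)" by simp
    then have "exp (- s) * \<bar>laguerre_L l (2 * s)\<bar> \<le> exp (- s) * (exp s * exp (2 * s))"
      by (intro mult_left_mono) auto
    then show ?thesis by (simp add: laguerre_fun_def abs_mult exp_minus field_simps)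
  qed
qed

lemma binomial_series_column:
  fixes r :: real
  assumes r: "0 \<le> r" "r < 1"
  shows "(\<lambda>l. real (l choose k) * r ^ l) sums (r ^ k / (1 - r) ^ Suc k)"
proof (induction k)
  case 0
  then show ?case using geometric_sums[of r] r by simp
next
  case (Suc k)
  let ?a = "\<lambda>l. real (l choose k) * r ^ l"
  have "(\<lambda>n. \<Sum>i\<le>n. ?a i * r ^ (n - i)) sums ((\<Sum>l. ?a l) * (\<Sum>l. r ^ l))"
    by (rule Cauchy_product_sums)
       (use r Suc.IH in \<open>auto simp: abs_mult sums_iff summable_geometric\<close>)
  also have "(\<lambda>n. \<Sum>i\<le>n. ?a i * r ^ (n - i)) = (\<lambda>n. real (Suc n choose Suc k) * r ^ n)"
  proof
    fix n
    have "(\<Sum>i\<le>n. ?a i * r ^ (n - i)) = (\<Sum>i\<le>n. real (i choose k) * r ^ n)"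
      by (intro sum.cong refl) (simp add: mult.assoc flip: power_add)
    also have "\<dots> = real (Suc n choose Suc k) * r ^ n"
      unfolding sum_choose_upper[of k n, symmetric] by (simp add: sum_distrib_right atMost_atLeast0)
    finally show "(\<Sum>i\<le>n. ?a i * r ^ (n - i)) = real (Suc n choose Suc k) * r ^ n" .
  qed
  also have "(\<Sum>l. ?a l) * (\<Sum>l. r ^ l) = r ^ k / (1 - r) ^ Suc (Suc k)"
    using Suc.IH r by (simp add: sums_iff suminf_geometric)
  finally have "(\<lambda>n. r * (real (Suc n choose Suc k) * r ^ n)) sums (r * (r ^ k / (1 - r) ^ Suc (Suc k)))"
    by (rule sums_mult)
  then have "(\<lambda>n. real (Suc n choose Suc k) * r ^ Suc n) sums (r ^ Suc k / (1 - r) ^ Suc (Suc k))"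
    by (simp add: algebra_simps)
  then show ?case
    using sums_Suc[of "\<lambda>l. real (l choose Suc k) * r ^ l"] by simp
qed

text \<open>Interchanging the two summations reduces the Laguerre generating function to the negative
  binomial series in each column \<open>k\<close> and the exponential series in \<open>x\<close>; nonnegative \<open>r\<close> makes
  absolute convergence explicit.\<close>

lemma laguerre_genfun:
  fixes r :: real
  assumes r: "0 \<le> r" "r < 1"
  shows "(\<lambda>l. r ^ l * laguerre_L l x) sums (exp (- x * r / (1 - r)) / (1 - r))"
proof -
  define F where "F = (\<lambda>k l. real (l choose k) * r ^ l * ((- x) ^ k / fact k))"
  define G where "G = (\<lambda>k. (r ^ k / (1 - r) ^ Suc k) * ((- x) ^ k / fact k))"
  define G' where "G' = (\<lambda>k. (r ^ k / (1 - r) ^ Suc k) * (\<bar>x\<bar> ^ k / fact k))"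
  have Gs: "(\<lambda>k. (r ^ k / (1 - r) ^ Suc k) * (y ^ k / fact k)) sums (exp (y * r / (1 - r)) / (1 - r))" for y
  proof -
    have "(\<lambda>k. (y * r / (1 - r)) ^ k /\<^sub>R fact k / (1 - r)) sums (exp (y * r / (1 - r)) / (1 - r))"
      by (intro sums_divide exp_converges)
    then show ?thesis by (simp add: power_divide power_mult_distrib field_simps)
  qed
  have col: "((\<lambda>l. F k l) has_sum G k) UNIV" for k
  proof -
    have "((\<lambda>l. real (l choose k) * r ^ l) has_sum (r ^ k / (1 - r) ^ Suc k)) UNIV"
      using binomial_series_column[OF r, of k] r by (intro sums_nonneg_imp_has_sum) auto
    from has_sum_cmult_left[OF this, of "(- x) ^ k / fact k"] show ?thesis by (simp add: F_def G_def)
  qed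
  have col': "((\<lambda>l. \<bar>F k l\<bar>) has_sum G' k) UNIV" for k
  proof -
    have "((\<lambda>l. real (l choose k) * r ^ l) has_sum (r ^ k / (1 - r) ^ Suc k)) UNIV"
      using binomial_series_column[OF r, of k] r by (intro sums_nonneg_imp_has_sum) auto
    from has_sum_cmult_left[OF this, of "\<bar>x\<bar> ^ k / fact k"] show ?thesis
      using r by (simp add: F_def G'_def abs_mult power_abs)
  qed
  have G': "G' summable_on UNIV"
    using sums_nonneg_imp_has_sum[of G'] Gs[of "\<bar>x\<bar>"] r
    by (auto simp: G'_def summable_on_def)
  have "(\<lambda>(k, l). \<bar>F k l\<bar>) summable_on (UNIV \<times> UNIV)"
    by (rule summable_on_SigmaI[OF _ G']) (use col' in auto)
  then have S: "(\<lambda>(k, l). F k l) summable_on (UNIV \<times> UNIV)"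
    by (intro abs_summable_summable[of "\<lambda>(k, l). F k l"]) (auto simp: case_prod_unfold)
  have rows: "((\<lambda>k. F k l) has_sum (r ^ l * laguerre_L l x)) UNIV" for l
  proof -
    have "((\<lambda>k. F k l) has_sum (\<Sum>k\<le>l. F k l)) {..l}" by (rule has_sum_finite) auto
    then have "((\<lambda>k. F k l) has_sum (\<Sum>k\<le>l. F k l)) UNIV"
      by (rule has_sum_cong_neutral[THEN iffD1, rotated -1]) (auto simp: F_def binomial_eq_0)
    also have "(\<Sum>k\<le>l. F k l) = r ^ l * laguerre_L l x"
      unfolding F_def laguerre_L_def sum_distrib_left
      by (intro sum.cong refl) (simp add: power_minus[of x] )
    finally show ?thesis .
  qed
  from S obtain t where t: "((\<lambda>(k, l). F k l) has_sum t) (UNIV \<times> UNIV)" by (auto simp: summable_on_def)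
  have "(G has_sum t) UNIV"
    by (rule has_sum_SigmaD[OF t]) (use col in auto)
  then have "G sums t" by (rule has_sum_imp_sums)
  then have "t = exp (- x * r / (1 - r)) / (1 - r)"
    using Gs[of "-x"] unfolding G_def by (rule sums_unique2)
  moreover have "((\<lambda>(l, k). F k l) has_sum t) (UNIV \<times> UNIV)"
    using t by (subst has_sum_swap) simp
  then have "((\<lambda>l. r ^ l * laguerre_L l x) has_sum t) UNIV"
    by (rule has_sum_SigmaD) (use rows in auto)
  ultimately show ?thesis using has_sum_imp_sums[of "\<lambda>l. r ^ l * laguerre_L l x" t] by simp
qed

lemma laguerre_fun_genfun:
  fixes r :: real
  assumes r: "0 \<le> r" "r < 1"
  shows "(\<lambda>l. r ^ l * laguerre_fun l s) sums (exp (- s * ((1 + r) / (1 - r))) / (1 - r))"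
proof -
  have "(\<lambda>l. exp (- s) * (r ^ l * laguerre_L l (2 * s))) sums (exp (- s) * (exp (- (2 * s) * r / (1 - r)) / (1 - r)))"
    by (intro sums_mult laguerre_genfun r)
  also have "exp (- s) * (exp (- (2 * s) * r / (1 - r)) / (1 - r)) = exp (- s + - (2 * s) * r / (1 - r)) / (1 - r)"
    by (simp only: times_divide_eq_right mult_exp_exp)
  also have "- s + - (2 * s) * r / (1 - r) = - s * ((1 + r) / (1 - r))"
    using r by (simp add: field_simps)
  finally show ?thesis by (simp add: laguerre_fun_def mult_ac)
qed

lemma power_exp_integral:
  fixes \<mu> :: real
  assumes \<mu>: "\<mu> > 0"
  shows "set_integrable lborel {0<..} (\<lambda>s. s ^ k * exp (- \<mu> * s))"
    "(LBINT s:{0<..}. s ^ k * exp (- \<mu> * s)) = fact k / \<mu> ^ Suc k"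
proof -
  have "\<exists>F. (\<forall>s. (F has_real_derivative s ^ k * exp (- \<mu> * s)) (at s)) \<and> F 0 = - fact k / \<mu> ^ Suc k \<and> (F \<longlongrightarrow> 0) at_top"
  proof (induction k)
    case 0
    have "((\<lambda>s. - exp (- \<mu> * s) / \<mu>) \<longlongrightarrow> 0) at_top" using \<mu> by real_asymp
    then show ?case using \<mu>
      by (intro exI[of _ "\<lambda>s. - exp (- \<mu> * s) / \<mu>"]) (auto intro!: derivative_eq_intros)
  next
    case (Suc k)
    then obtain F where F: "\<And>s. (F has_real_derivative s ^ k * exp (- \<mu> * s)) (at s)"
      "F 0 = - fact k / \<mu> ^ Suc k" "(F \<longlongrightarrow> 0) at_top" by auto
    have "((\<lambda>s. - (s ^ n) * exp (- \<mu> * s) / \<mu>) \<longlongrightarrow> 0) at_top" for n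
    proof -
      have "((\<lambda>s. (\<mu> * s) ^ n / exp (\<mu> * s)) \<longlongrightarrow> 0) at_top"
        by (rule filterlim_compose[OF tendsto_power_div_exp_0])
           (use \<mu> in \<open>auto intro!: filterlim_tendsto_pos_mult_at_top[OF tendsto_const] filterlim_ident\<close>)
      then have "((\<lambda>s. - (1 / \<mu> ^ Suc n) * ((\<mu> * s) ^ n / exp (\<mu> * s))) \<longlongrightarrow> - (1 / \<mu> ^ Suc n) * 0) at_top"
        by (intro tendsto_intros)
      moreover have "- (1 / \<mu> ^ Suc n) * ((\<mu> * s) ^ n / exp (\<mu> * s)) = - (s ^ n) * exp (- \<mu> * s) / \<mu>" for s
        using \<mu> by (simp add: power_mult_distrib exp_minus field_simps)
      ultimately show ?thesis by (simp only: mult_zero_right)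
    qed
    from this[of "Suc k"]
    have "((\<lambda>s. - (s ^ Suc k) * exp (- \<mu> * s) / \<mu> + real (Suc k) / \<mu> * F s) \<longlongrightarrow> 0 + real (Suc k) / \<mu> * 0) at_top"
      using F(3) by (intro tendsto_intros)
    moreover have "((\<lambda>s. - (s ^ Suc k) * exp (- \<mu> * s) / \<mu> + real (Suc k) / \<mu> * F s) has_real_derivative s ^ Suc k * exp (- \<mu> * s)) (at s)" for s
    proof -
      have S: "((\<lambda>s. s ^ Suc k) has_real_derivative real (Suc k) * s ^ k) (at s)"
        using DERIV_pow[of "Suc k" s] by simp
      have E: "((\<lambda>s. exp (- \<mu> * s)) has_real_derivative - \<mu> * exp (- \<mu> * s)) (at s)"
        by (auto intro!: derivative_eq_intros)
      show ?thesis
        by (rule DERIV_cong[OF DERIV_add[OF DERIV_cdivide[OF DERIV_mult[OF DERIV_minus[OF S] E]] DERIV_cmult[OF F(1)]]])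
           (use \<mu> in \<open>simp add: field_simps\<close>)
    qed
    moreover have "- (0 ^ Suc k) * exp (- \<mu> * 0) / \<mu> + real (Suc k) / \<mu> * F 0 = - fact (Suc k) / \<mu> ^ Suc (Suc k)"
      using \<mu> by (simp add: F(2) field_simps)
    ultimately show ?case
      by (intro exI[of _ "\<lambda>s. - (s ^ Suc k) * exp (- \<mu> * s) / \<mu> + real (Suc k) / \<mu> * F s"]) simp
  qed
  then obtain F where F: "\<And>s. (F has_real_derivative s ^ k * exp (- \<mu> * s)) (at s)"
      "F 0 = - fact k / \<mu> ^ Suc k" "(F \<longlongrightarrow> 0) at_top" by auto
  have "isCont F 0" using F(1) DERIV_isCont by blast
  then have A: "(F \<longlongrightarrow> F 0) (at_right 0)"
    by (simp add: continuous_within filterlim_at_split)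
  show "set_integrable lborel {0<..} (\<lambda>s. s ^ k * exp (- \<mu> * s))"
    by (rule improper_FTC_nonneg[OF F(1) _ _ A F(3)]) auto
  show "(LBINT s:{0<..}. s ^ k * exp (- \<mu> * s)) = fact k / \<mu> ^ Suc k"
    by (subst improper_FTC_nonneg(2)[OF F(1) _ _ A F(3)]) (auto simp: F(2))
qed

lemma laguerre_fun_laplace:
  fixes \<Lambda> :: real
  assumes \<Lambda>: "\<Lambda> > 0"
  shows "set_integrable lborel {0<..} (\<lambda>s. exp (- \<Lambda> * s) * laguerre_fun l s)"
    "(LBINT s:{0<..}. exp (- \<Lambda> * s) * laguerre_fun l s) = 1 / (\<Lambda> + 1) * ((\<Lambda> - 1) / (\<Lambda> + 1)) ^ l"
proof -
  define c where "c = (\<lambda>k. (-1) ^ k * real (l choose k) / fact k * 2 ^ k)"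
  have e: "exp (- \<Lambda> * s) * laguerre_fun l s = (\<Sum>k\<le>l. c k * (s ^ k * exp (- (\<Lambda> + 1) * s)))" for s
  proof -
    have "exp (- \<Lambda> * s) * laguerre_fun l s = exp (- (\<Lambda> + 1) * s) * laguerre_L l (2 * s)"
      by (simp add: laguerre_fun_def mult_exp_exp algebra_simps flip: mult.assoc)
    then show ?thesis
      by (simp add: laguerre_L_def c_def sum_distrib_left power_mult_distrib mult_ac)
  qed
  have i: "set_integrable lborel {0<..} (\<lambda>s. c k * (s ^ k * exp (- (\<Lambda> + 1) * s)))" for k
    using power_exp_integral(1)[of "\<Lambda> + 1" k] \<Lambda> by simp
  show "set_integrable lborel {0<..} (\<lambda>s. exp (- \<Lambda> * s) * laguerre_fun l s)"
    unfolding e using i unfolding set_integrable_def scaleR_sum_right by (intro Bochner_Integration.integrable_sum)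
  have "(LBINT s:{0<..}. exp (- \<Lambda> * s) * laguerre_fun l s) = (\<Sum>k\<le>l. c k * (fact k / (\<Lambda> + 1) ^ Suc k))"
    unfolding e set_lebesgue_integral_def scaleR_sum_right
    by (subst Bochner_Integration.integral_sum)
       (use i power_exp_integral(2)[of "\<Lambda> + 1"] \<Lambda> in \<open>auto simp: set_integrable_def set_lebesgue_integral_def mult.left_commute\<close>)
  also have "\<dots> = 1 / (\<Lambda> + 1) * (\<Sum>k\<le>l. real (l choose k) * (- 2 / (\<Lambda> + 1)) ^ k * 1 ^ (l - k))"
    unfolding sum_distrib_left
  proof (intro sum.cong refl)
    fix k
    have "(- 2 / (\<Lambda> + 1)) ^ k = (-1) ^ k * 2 ^ k / (\<Lambda> + 1) ^ k"
      by (simp only: power_divide power_minus[of 2])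
    then show "c k * (fact k / (\<Lambda> + 1) ^ Suc k) = 1 / (\<Lambda> + 1) * (real (l choose k) * (- 2 / (\<Lambda> + 1)) ^ k * 1 ^ (l - k))"
      by (simp add: c_def)
  qed
  also have "(\<Sum>k\<le>l. real (l choose k) * (- 2 / (\<Lambda> + 1)) ^ k * 1 ^ (l - k)) = (- 2 / (\<Lambda> + 1) + 1) ^ l"
    by (rule binomial_ring[symmetric])
  also have "- 2 / (\<Lambda> + 1) + 1 = (\<Lambda> - 1) / (\<Lambda> + 1)" using \<Lambda> by (simp add: field_simps)
  finally show "(LBINT s:{0<..}. exp (- \<Lambda> * s) * laguerre_fun l s) = 1 / (\<Lambda> + 1) * ((\<Lambda> - 1) / (\<Lambda> + 1)) ^ l" .
qed

section \<open>Uniqueness for Laplace transforms at integer points\<close>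

text \<open>Lerch's theorem with integer sample points: in the variable \<open>x = exp (-s)\<close> the hypothesis
  says that all moments of a continuous function on \<open>[0,1]\<close> vanish, so by Weierstrass it is
  orthogonal to itself. The offset 4 leaves room for the growth \<open>exp (2s)\<close>.\<close>

lemma laplace_unique:
  fixes g :: "real \<Rightarrow> real"
  assumes cont: "continuous_on {0..} g"
    and bound: "\<And>s. s \<ge> 0 \<Longrightarrow> \<bar>g s\<bar> \<le> C * exp (2 * s)"
    and zero: "\<And>n::nat. (LBINT s:{0<..}. exp (- (real n + 4) * s) * g s) = 0"
    and s: "s \<ge> 0"
  shows "g s = 0"
proof -
  \<comment> \<open>The factor \<open>x^3\<close> beats the growth \<open>x^(-2)\<close> of \<open>g(- ln x)\<close> and makes \<open>k\<close> continuous at 0;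
    with the Jacobian \<open>x\<close> it accounts for the shift by 4.\<close>
  define k where "k = (\<lambda>x. if x \<le> 0 then 0 else x ^ 3 * g (- ln x))"
  have C: "C \<ge> 0" using bound[of 0] by simp
  have kb: "\<bar>k x\<bar> \<le> C * x" if "0 \<le> x" "x \<le> 1" for x
  proof (cases "x = 0")
    case False
    then have x: "x > 0" using that by simp
    have "\<bar>g (- ln x)\<bar> \<le> C * exp (2 * (- ln x))" using bound[of "- ln x"] x that by auto
    also have "exp (2 * (- ln x)) = 1 / x ^ 2"
    proof -
      have "exp (2 * (- ln x)) = exp (- ln x) ^ 2" by (rule exp_double)
      then show ?thesis using x by (simp add: exp_minus power_one_over inverse_eq_divide)
    qed
    finally have "x ^ 3 * \<bar>g (- ln x)\<bar> \<le> x ^ 3 * (C * (1 / x ^ 2))"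
      using x by (intro mult_left_mono) auto
    also have "\<dots> = C * x" using x by (simp add: power3_eq_cube power2_eq_square)
    finally show ?thesis using x by (simp add: k_def abs_mult)
  qed (simp add: k_def)
  have k_exp: "k (exp (- s)) = exp (- 3 * s) * g s" for s
    by (simp add: k_def flip: exp_of_nat_mult)
  have kcont: "continuous_on {0..1} k"
  proof -
    have "continuous_on {0<..1} (\<lambda>x. x ^ 3 * g (- ln x))"
      by (intro continuous_intros continuous_on_compose2[OF cont]) auto
    then have c1: "continuous_on {0<..1} k"
      by (rule continuous_on_eq) (simp add: k_def)
    have "continuous (at x within {0..1}) k" if x: "x \<in> {0..1}" for x
    proof (cases "x = 0")
      case True
      have "((\<lambda>x. C * x) \<longlongrightarrow> 0) (at 0 within {0..1})" by (auto intro!: tendsto_eq_intros)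
      then have "(k \<longlongrightarrow> 0) (at 0 within {0..1})"
        by (rule Lim_null_comparison[rotated]) (auto simp: eventually_at_filter kb)
      then show ?thesis using True by (simp add: continuous_within k_def)
    next
      case False
      then have "continuous (at x within {0<..1}) k" using c1 x by (auto simp: continuous_on_eq_continuous_within)
      moreover have "at x within {0..1} = at x within {0<..1}"
        by (rule at_within_nhd[of _ "{0<..}"]) (use x False in auto)
      ultimately show ?thesis by (simp add: continuous_within)
    qed
    then show ?thesis by (simp add: continuous_on_eq_continuous_within)
  qed
  have kcont': "continuous_on UNIV (\<lambda>s. k (exp (- max 0 s)))"
    by (intro continuous_on_compose2[OF kcont] continuous_intros) auto
  have meas: "set_borel_measurable lborel {0<..} (\<lambda>s. exp (- s) * f (exp (- s)) * k (exp (- s)))"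
    if "continuous_on UNIV f" for f
  proof (rule set_borel_measurable_continuous_on)
    have "continuous_on {0<..} (\<lambda>s. exp (- s) * f (exp (- s)) * k (exp (- max 0 s)))"
      by (intro continuous_intros continuous_on_compose2[OF that] continuous_on_subset[OF kcont']) auto
    then show "continuous_on {0<..} (\<lambda>s. exp (- s) * f (exp (- s)) * k (exp (- s)))"
      by (rule continuous_on_eq) auto
  qed auto
  have eint: "set_integrable lborel {0<..} (\<lambda>s::real. K * exp (- s))" for K
    using set_integrable_exp_decay(1)[of 1 0] by simp
  have int: "set_integrable lborel {0<..} (\<lambda>s. exp (- s) * f (exp (- s)) * k (exp (- s)))"
    if f: "continuous_on UNIV f" for f
  proof -
    have "compact (f ` {0..1})" by (intro compact_continuous_image continuous_on_subset[OF f]) auto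
    then obtain B where B: "\<And>x. x \<in> {0..1} \<Longrightarrow> \<bar>f x\<bar> \<le> B"
      using compact_imp_bounded[THEN bounded_iff[THEN iffD1]] by (metis imageI real_norm_def)
    have B0: "B \<ge> 0" using B[of 0] by simp
    show ?thesis
    proof (rule set_integrable_bound[OF eint[of "B * C"] meas[OF f]], intro AE_I2 impI)
      fix s :: real assume s: "s \<in> {0<..}"
      have "\<bar>f (exp (- s))\<bar> * \<bar>k (exp (- s))\<bar> \<le> B * (C * 1)"
        using B[of "exp (-s)"] kb[of "exp (-s)"] s C B0
        by (intro mult_mono order_trans[OF kb] mult_left_mono) auto
      then show "norm (exp (- s) * f (exp (- s)) * k (exp (- s))) \<le> norm (B * C * exp (- s))"
        using B0 C by (simp add: abs_mult mult.assoc mult.commute)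
    qed
  qed
  have pz: "(LBINT s:{0<..}. exp (- s) * (\<Sum>i\<le>n. a i * exp (- s) ^ i) * k (exp (- s))) = 0" for n :: nat and a :: "nat \<Rightarrow> real"
  proof -
    have ee: "exp (- (real i + 4) * s) = exp (- s) * exp (- s) ^ i * exp (- 3 * s)" for i s
      by (simp flip: exp_of_nat_mult exp_add) (simp add: algebra_simps)
    have e: "exp (- s) * (\<Sum>i\<le>n. a i * exp (- s) ^ i) * k (exp (- s)) = (\<Sum>i\<le>n. a i * (exp (- (real i + 4) * s) * g s))" for s
      unfolding k_exp sum_distrib_left sum_distrib_right
    proof (intro sum.cong refl)
      fix i
      show "exp (- s) * (a i * exp (- s) ^ i) * (exp (- 3 * s) * g s) = a i * (exp (- (real i + 4) * s) * g s)"
        unfolding ee by simp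
    qed
    have i: "set_integrable lborel {0<..} (\<lambda>s. exp (- (real i + 4) * s) * g s)" for i
    proof -
      have "set_integrable lborel {0<..} (\<lambda>s. exp (- s) * (exp (- s) ^ i) * k (exp (- s)))"
        by (rule int[of "\<lambda>x. x ^ i"]) (intro continuous_intros)
      also have "(\<lambda>s. exp (- s) * (exp (- s) ^ i) * k (exp (- s))) = (\<lambda>s. exp (- (real i + 4) * s) * g s)"
        unfolding k_exp ee by (simp add: mult_ac)
      finally show ?thesis .
    qed
    have "(LBINT s:{0<..}. (\<Sum>i\<le>n. a i * (exp (- (real i + 4) * s) * g s))) = (\<Sum>i\<le>n. a i * (LBINT s:{0<..}. exp (- (real i + 4) * s) * g s))"
      unfolding set_lebesgue_integral_def scaleR_sum_right
      by (subst Bochner_Integration.integral_sum) (use i in \<open>auto simp: set_integrable_def mult.left_commute\<close>)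
    then show ?thesis unfolding e using zero by simp
  qed
  define I where "I = (LBINT s:{0<..}. exp (- s) * k (exp (- s)) * k (exp (- s)))"
  have Ibound: "I \<le> e * C" and Iint: "set_integrable lborel {0<..} (\<lambda>s. exp (- s) * k (exp (- s)) * k (exp (- s)))" if e: "e > 0" for e
  proof -
    obtain q where "real_polynomial_function q" and q: "\<And>x. x \<in> {0..1} \<Longrightarrow> \<bar>k x - q x\<bar> < e"
      using Stone_Weierstrass_real_polynomial_function[OF _ kcont e] by auto
    then obtain a n where qa: "q = (\<lambda>x. \<Sum>i\<le>n. a i * x ^ i)"
      using real_polynomial_function_iff_sum by auto
    have qc: "continuous_on UNIV q" unfolding qa by (intro continuous_intros)
    have b: "exp (- s) * (k (exp (- s)) - q (exp (- s))) * k (exp (- s)) \<le> e * C * exp (- s)"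
      "\<bar>exp (- s) * (k (exp (- s)) - q (exp (- s))) * k (exp (- s))\<bar> \<le> e * C * exp (- s)"
      if "s > 0" for s
    proof -
      have "\<bar>k (exp (- s)) - q (exp (- s))\<bar> * \<bar>k (exp (- s))\<bar> \<le> e * (C * 1)"
        using q[of "exp (-s)"] kb[of "exp (-s)"] that C e
        by (intro mult_mono order_trans[OF kb] mult_left_mono) auto
      then show *: "\<bar>exp (- s) * (k (exp (- s)) - q (exp (- s))) * k (exp (- s))\<bar> \<le> e * C * exp (- s)"
        by (simp add: abs_mult mult.assoc mult.commute)
      show "exp (- s) * (k (exp (- s)) - q (exp (- s))) * k (exp (- s)) \<le> e * C * exp (- s)"
        using * by linarith
    qed
    have i1: "set_integrable lborel {0<..} (\<lambda>s. exp (- s) * q (exp (- s)) * k (exp (- s)))" by (rule int[OF qc])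
    have "set_borel_measurable lborel {0<..} (\<lambda>s. exp (- s) * (k (exp (- s)) - q (exp (- s))) * k (exp (- s)))"
    proof (rule set_borel_measurable_continuous_on)
      have "continuous_on {0<..} (\<lambda>s. exp (- s) * (k (exp (- max 0 s)) - q (exp (- s))) * k (exp (- max 0 s)))"
        by (intro continuous_intros continuous_on_compose2[OF qc] continuous_on_subset[OF kcont']) auto
      then show "continuous_on {0<..} (\<lambda>s. exp (- s) * (k (exp (- s)) - q (exp (- s))) * k (exp (- s)))"
        by (rule continuous_on_eq) auto
    qed auto
    then have i2: "set_integrable lborel {0<..} (\<lambda>s. exp (- s) * (k (exp (- s)) - q (exp (- s))) * k (exp (- s)))"
    proof (rule set_integrable_bound[OF eint[of "e * C"]], intro AE_I2 impI)
      fix s :: real assume "s \<in> {0<..}"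
      then show "norm (exp (- s) * (k (exp (- s)) - q (exp (- s))) * k (exp (- s))) \<le> norm (e * C * exp (- s))"
        using b(2)[of s] by simp
    qed
    have eq: "exp (- s) * k (exp (- s)) * k (exp (- s)) =
      exp (- s) * (k (exp (- s)) - q (exp (- s))) * k (exp (- s)) + exp (- s) * q (exp (- s)) * k (exp (- s))" for s
      by (simp add: algebra_simps)
    show "set_integrable lborel {0<..} (\<lambda>s. exp (- s) * k (exp (- s)) * k (exp (- s)))"
      unfolding eq by (intro set_integral_add i1 i2)
    have "I = (LBINT s:{0<..}. exp (- s) * (k (exp (- s)) - q (exp (- s))) * k (exp (- s))) + (LBINT s:{0<..}. exp (- s) * q (exp (- s)) * k (exp (- s)))"
      unfolding I_def eq by (intro set_integral_add i1 i2)
    also have "(LBINT s:{0<..}. exp (- s) * q (exp (- s)) * k (exp (- s))) = 0"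
      unfolding qa by (rule pz)
    also have "(LBINT s:{0<..}. exp (- s) * (k (exp (- s)) - q (exp (- s))) * k (exp (- s))) \<le> (LBINT s:{0<..}. e * C * exp (- s))"
      by (intro set_integral_mono i2 eint b) auto
    also have "(LBINT s:{0<..}. e * C * exp (- s)) = e * C"
      using set_integrable_exp_decay(2)[of 1] by simp
    finally show "I \<le> e * C" by simp
  qed
  have "I \<le> 0 + e" if "e > 0" for e
  proof -
    have "I \<le> e / (C + 1) * C" by (rule Ibound) (use that C in auto)
    also have "\<dots> \<le> e" using that C by (simp add: field_simps)
    finally show ?thesis by simp
  qed
  then have I0: "I \<le> 0" by (rule field_le_epsilon)
  have kz: "k (exp (- t)) = 0" if t: "t > 0" for t
  proof -
    let ?h = "\<lambda>s. exp (- s) * k (exp (- s)) * k (exp (- s))"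
    have hc: "continuous_on {t..t+1} ?h"
    proof -
      have "continuous_on {t..t+1} (\<lambda>s. exp (- s) * k (exp (- max 0 s)) * k (exp (- max 0 s)))"
        by (intro continuous_intros continuous_on_subset[OF kcont']) auto
      then show ?thesis by (rule continuous_on_eq) (use t in auto)
    qed
    have nn: "?h s \<ge> 0" for s by (simp add: mult.assoc)
    have si: "set_integrable lborel {t..t+1} ?h"
      by (rule set_integrable_subset[OF Iint[of 1]]) (use t in auto)
    have "(LBINT s:{t..t+1}. ?h s) \<le> I"
      unfolding I_def by (rule set_integral_mono_subset[OF Iint[of 1]]) (use t nn in auto)
    moreover have "(LBINT s:{t..t+1}. ?h s) \<ge> 0"
      by (rule set_lebesgue_integral_nonneg) (use nn in auto)
    ultimately have "(LBINT s:{t..t+1}. ?h s) = 0" using I0 by linarith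
    then have "integral {t..t+1} ?h = 0" "?h integrable_on {t..t+1}"
      using set_borel_integral_eq_integral[OF si] by auto
    then have "(?h has_integral 0) (cbox t (t+1))"
      by (metis integrable_integral interval_cbox)
    then have "?h t = 0"
      by (rule has_integral_0_cbox_imp_0[rotated 2]) (use hc nn in auto)
    then show ?thesis by simp
  qed
  have gz: "g t = 0" if "t > 0" for t
    using kz[OF that] k_exp[of t] by simp
  show ?thesis
  proof (cases "s = 0")
    case True
    have "(g \<longlongrightarrow> g 0) (at 0 within {0..})" using cont by (simp add: continuous_on_def)
    moreover have "at 0 within {0..} = at_right (0::real)"
      by (simp add: at_within_Ici_at_right)
    moreover have "(g \<longlongrightarrow> 0) (at_right 0)"
      by (rule tendsto_eventually) (auto simp: eventually_at_filter gz)
    ultimately show ?thesis using True tendsto_unique[OF trivial_limit_at_right_real] by metis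
  qed (use gz s in auto)
qed

section \<open>Laguerre expansions of functions with a kink\<close>

lemma exp_minus_substitution:
  fixes X :: "real \<Rightarrow> real"
  assumes "continuous_on {0<..<1} X"
  shows "(LBINT w:{0<..}. exp (- w) * X (exp (- w))) = (LBINT s:{0<..<1}. X s)"
proof -
  have img: "(\<lambda>w::real. exp (- w)) ` {0<..} = {0<..<1}"
  proof (intro equalityI subsetI)
    fix s :: real assume "s \<in> {0<..<1}"
    then show "s \<in> (\<lambda>w. exp (- w)) ` {0<..}"
      by (intro image_eqI[of _ _ "- ln s"]) auto
  qed auto
  have "(LBINT w:{0<..}. \<bar>- exp (- w)\<bar> * X (exp (- w))) = (LBINT s:{0<..<1}. X s)"
  proof (rule lborel_change_of_variables(2)[OF _ img])
    show "set_borel_measurable lborel {0<..<1} X"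
      by (rule set_borel_measurable_continuous_on[OF assms]) auto
    show "set_borel_measurable lborel {0<..} (\<lambda>w. \<bar>- exp (- w)\<bar> * X (exp (- w)))"
      by (intro set_borel_measurable_continuous_on continuous_intros continuous_on_compose2[OF assms]) auto
  qed (auto intro!: derivative_eq_intros inj_onI)
  then show ?thesis by simp
qed

text \<open>Completeness of the Laguerre functions is obtained through Laplace transforms: at \<open>L = n +
  4\<close> the transform of the series is computed termwise, that of the limit from the generating
  function with \<open>r = (L - 1)/(L + 1)\<close>, and both equal \<open>\<Sum> b\<^sub>l r^l / (L + 1)\<close>. Absolute
  summability makes the series continuous, so equality holds at every point, including \<open>s = 0\<close>.\<close>

lemma laguerre_expansion:
  fixes P :: "real \<Rightarrow> real" and b :: "nat \<Rightarrow> real"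
  assumes cont: "continuous_on UNIV P"
    and bound: "\<And>w. w \<ge> 0 \<Longrightarrow> \<bar>P w\<bar> \<le> C * exp (- w)"
    and P0: "P 0 = 0"
    and b: "\<And>l. b l = 2 * (LBINT w:{0<..}. exp (- w) * laguerre_fun l (exp (- w)) * P w)"
    and summ: "summable (\<lambda>l. \<bar>b l\<bar>)"
    and s: "s \<ge> 0"
  shows "(\<lambda>l. b l * laguerre_fun l s) sums (if 0 < s \<and> s < 1 then P (- ln s) else 0)"
proof -
  define \<beta> where "\<beta> = (\<lambda>s::real. if 0 < s \<and> s < 1 then P (- ln s) else 0)"
  define G where "G = (\<lambda>s. \<Sum>l. b l * laguerre_fun l s)"
  have C: "C \<ge> 0" using bound[of 0] by simp
  have sG: "summable (\<lambda>l. \<bar>b l * laguerre_fun l s\<bar>)" if "s \<ge> 0" for s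
  proof (rule summable_comparison_test'[OF summable_mult2[OF summ, of "exp (2 * s)"]])
    fix n show "norm \<bar>b n * laguerre_fun n s\<bar> \<le> \<bar>b n\<bar> * exp (2 * s)"
      using laguerre_fun_exp_bound[OF that, of n] by (auto simp: abs_mult intro!: mult_left_mono)
  qed
  have sG': "summable (\<lambda>l. b l * laguerre_fun l s)" if "s \<ge> 0" for s
    using sG[OF that] by (rule summable_rabs_cancel)
  have bG: "\<bar>G s\<bar> \<le> (\<Sum>l. \<bar>b l\<bar>) * exp (2 * s)" if "s \<ge> 0" for s
  proof -
    have "\<bar>G s\<bar> \<le> (\<Sum>l. \<bar>b l * laguerre_fun l s\<bar>)"
      unfolding G_def by (rule summable_rabs[OF sG[OF that]])
    also have "\<dots> \<le> (\<Sum>l. \<bar>b l\<bar> * exp (2 * s))"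
      by (rule suminf_le[OF _ sG[OF that] summable_mult2[OF summ]])
         (use laguerre_fun_exp_bound[OF that] in \<open>auto simp: abs_mult intro!: mult_left_mono\<close>)
    finally show ?thesis using suminf_mult2[OF summ] by simp
  qed
  have cG: "continuous_on {0..} G"
  proof -
    have "uniform_limit {0..} (\<lambda>n s. \<Sum>l<n. b l * (laguerre_fun l s * exp (- 2 * s))) (\<lambda>s. \<Sum>l. b l * (laguerre_fun l s * exp (- 2 * s))) sequentially"
    proof (rule Weierstrass_m_test[OF _ summ])
      fix n and s :: real assume "s \<in> {0..}"
      then have "\<bar>laguerre_fun n s\<bar> * exp (- 2 * s) \<le> exp (2 * s) * exp (- 2 * s)"
        by (intro mult_right_mono laguerre_fun_exp_bound) auto
      then have "\<bar>laguerre_fun n s\<bar> * exp (- 2 * s) \<le> 1" by (simp flip: exp_add)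
      then show "norm (b n * (laguerre_fun n s * exp (- 2 * s))) \<le> \<bar>b n\<bar>"
        by (simp add: abs_mult mult_left_le)
    qed
    then have "continuous_on {0..} (\<lambda>s. \<Sum>l. b l * (laguerre_fun l s * exp (- 2 * s)))"
      by (rule uniform_limit_theorem[rotated]) (auto intro!: always_eventually continuous_intros)
    then have "continuous_on {0..} (\<lambda>s. exp (2 * s) * (\<Sum>l. b l * (laguerre_fun l s * exp (- 2 * s))))"
      by (intro continuous_intros)
    then show ?thesis
    proof (rule continuous_on_eq)
      fix s :: real assume s: "s \<in> {0..}"
      have "(\<Sum>l. b l * (laguerre_fun l s * exp (- 2 * s))) = G s * exp (- 2 * s)"
        using suminf_mult2[OF sG', of s "exp (- 2 * s)"] s by (simp add: G_def mult_ac)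
      then show "exp (2 * s) * (\<Sum>l. b l * (laguerre_fun l s * exp (- 2 * s))) = G s"
        by (simp add: mult_exp_exp flip: mult.assoc)
    qed
  qed
  have b\<beta>: "\<bar>\<beta> s\<bar> \<le> C * s" if "s \<ge> 0" for s
    using bound[of "- ln s"] that C by (auto simp: \<beta>_def)
  have c\<beta>: "continuous_on {0..} \<beta>"
  proof -
    have "continuous_on {0<..} (\<lambda>s. P (max 0 (- ln s)))"
      by (intro continuous_on_compose2[OF cont] continuous_intros) auto
    then have c1: "continuous_on {0<..} \<beta>"
    proof (rule continuous_on_eq)
      fix s :: real assume "s \<in> {0<..}"
      then show "P (max 0 (- ln s)) = \<beta> s" using P0 by (auto simp: \<beta>_def max_def)
    qed
    have "continuous (at x within {0..}) \<beta>" if x: "x \<in> {0..}" for x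
    proof (cases "x = 0")
      case True
      have "((\<lambda>x. C * x) \<longlongrightarrow> 0) (at 0 within {0..})" by (auto intro!: tendsto_eq_intros)
      then have "(\<beta> \<longlongrightarrow> 0) (at 0 within {0..})"
        by (rule Lim_null_comparison[rotated]) (auto simp: eventually_at_filter b\<beta>)
      then show ?thesis using True by (simp add: continuous_within \<beta>_def)
    next
      case False
      then have "continuous (at x within {0<..}) \<beta>" using c1 x by (auto simp: continuous_on_eq_continuous_within)
      moreover have "at x within {0..} = at x within {0<..}"
        by (rule at_within_nhd[of _ "{0<..}"]) (use x False in auto)
      ultimately show ?thesis by (simp add: continuous_within)
    qed
    then show ?thesis by (simp add: continuous_on_eq_continuous_within)
  qed
  have "G s - \<beta> s = 0"
  proof (rule laplace_unique[OF _ _ _ s])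
    show "continuous_on {0..} (\<lambda>s. G s - \<beta> s)" by (intro continuous_intros cG c\<beta>)
    fix s :: real assume s: "s \<ge> 0"
    have "s \<le> exp (2 * s)" using exp_ge_add_one_self[of "2 * s"] s by linarith
    then have "C * s \<le> C * exp (2 * s)" using C by (intro mult_left_mono)
    then show "\<bar>G s - \<beta> s\<bar> \<le> ((\<Sum>l. \<bar>b l\<bar>) + C) * exp (2 * s)"
      using bG[OF s] b\<beta>[OF s] by (simp add: distrib_right)
  next
    fix n :: nat
    define L where "L = real n + 4"
    \<comment> \<open>With this \<open>r\<close> the exponent \<open>(1 + r)/(1 - r)\<close> of the generating function is \<open>L\<close>.\<close>
    define r where "r = (L - 1) / (L + 1)"
    have L: "L \<ge> 4" by (simp add: L_def)
    have r: "0 \<le> r" "r < 1" "1 - r = 2 / (L + 1)" "(1 + r) / (1 - r) = L"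
      using L by (auto simp: r_def field_simps)
    have meas: "set_borel_measurable lborel {0<..} f" if "continuous_on {0..} f" for f :: "real \<Rightarrow> real"
      by (intro set_borel_measurable_continuous_on continuous_on_subset[OF that]) auto
    have intG: "set_integrable lborel {0<..} (\<lambda>s. exp (- L * s) * G s)"
      and sumG: "(\<lambda>l. LBINT s:{0<..}. exp (- L * s) * (b l * laguerre_fun l s)) sums (LBINT s:{0<..}. exp (- L * s) * G s)"
    proof -
      have i: "set_integrable lborel {0<..} (\<lambda>s. exp (- L * s) * (b l * laguerre_fun l s))" for l
        using laguerre_fun_laplace(1)[of L l] L by (simp add: mult.left_commute)
      have "(LBINT s:{0<..}. \<bar>exp (- L * s) * (b l * laguerre_fun l s)\<bar>) \<le> \<bar>b l\<bar> * 1" for l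
      proof -
        have "(LBINT s:{0<..}. \<bar>exp (- L * s) * (b l * laguerre_fun l s)\<bar>) \<le> (LBINT s:{0<..}. \<bar>b l\<bar> * exp (- (L - 2) * s))"
        proof (rule set_integral_mono)
          show "set_integrable lborel {0<..} (\<lambda>s. \<bar>exp (- L * s) * (b l * laguerre_fun l s)\<bar>)"
            by (rule set_integrable_abs[OF i])
          show "set_integrable lborel {0<..} (\<lambda>s. \<bar>b l\<bar> * exp (- (L - 2) * s))"
            using set_integrable_exp_decay(1)[of "L - 2" 0] L by simp
          fix s :: real assume "s \<in> {0<..}"
          then have "exp (- L * s) * \<bar>laguerre_fun l s\<bar> \<le> exp (- L * s) * exp (2 * s)"
            by (intro mult_left_mono laguerre_fun_exp_bound) auto
          also have "\<dots> = exp (- (L - 2) * s)" by (simp add: mult_exp_exp algebra_simps)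
          finally have "\<bar>b l\<bar> * (exp (- L * s) * \<bar>laguerre_fun l s\<bar>) \<le> \<bar>b l\<bar> * exp (- (L - 2) * s)"
            by (intro mult_left_mono) auto
          then show "\<bar>exp (- L * s) * (b l * laguerre_fun l s)\<bar> \<le> \<bar>b l\<bar> * exp (- (L - 2) * s)"
            by (simp add: abs_mult mult_ac)
        qed
        also have "\<dots> = \<bar>b l\<bar> * (1 / (L - 2))"
          using set_integrable_exp_decay(2)[of "L - 2"] L by simp
        also have "\<dots> \<le> \<bar>b l\<bar> * 1" using L by (intro mult_left_mono) auto
        finally show ?thesis .
      qed
      moreover have "(LBINT s:{0<..}. \<bar>exp (- L * s) * (b l * laguerre_fun l s)\<bar>) \<ge> 0" for l
        by (rule set_lebesgue_integral_nonneg) auto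
      ultimately have sn: "summable (\<lambda>l. LBINT s:{0<..}. \<bar>exp (- L * s) * (b l * laguerre_fun l s)\<bar>)"
        by (intro summable_comparison_test'[OF summ]) auto
      have sx: "summable (\<lambda>l. \<bar>exp (- L * s) * (b l * laguerre_fun l s)\<bar>)" if "s \<in> {0<..}" for s
        using summable_mult[OF sG[of s], of "exp (- L * s)"] that by (simp add: abs_mult)
      have eq: "(\<Sum>l. exp (- L * s) * (b l * laguerre_fun l s)) = exp (- L * s) * G s" if "s \<in> {0<..}" for s
        unfolding G_def using that by (intro suminf_mult sG') auto
      have "set_integrable lborel {0<..} (\<lambda>s. \<Sum>l. exp (- L * s) * (b l * laguerre_fun l s))"
        by (rule set_integral_suminf(1)[OF i sx sn])
      then show "set_integrable lborel {0<..} (\<lambda>s. exp (- L * s) * G s)"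
        by (rule set_integrable_cong[THEN iffD1, rotated -1]) (use eq in auto)
      have "(\<lambda>l. LBINT s:{0<..}. exp (- L * s) * (b l * laguerre_fun l s)) sums (LBINT s:{0<..}. (\<Sum>l. exp (- L * s) * (b l * laguerre_fun l s)))"
        by (rule set_integral_suminf(2)[OF i sx sn])
      also have "(LBINT s:{0<..}. (\<Sum>l. exp (- L * s) * (b l * laguerre_fun l s))) = (LBINT s:{0<..}. exp (- L * s) * G s)"
        by (intro set_lebesgue_integral_cong) (use eq in auto)
      finally show "(\<lambda>l. LBINT s:{0<..}. exp (- L * s) * (b l * laguerre_fun l s)) sums (LBINT s:{0<..}. exp (- L * s) * G s)" .
    qed
    have e1: "(LBINT s:{0<..}. exp (- L * s) * (b l * laguerre_fun l s)) = (1 / (L + 1)) * (b l * r ^ l)" for l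
    proof -
      have "(LBINT s:{0<..}. exp (- L * s) * (b l * laguerre_fun l s)) = (LBINT s:{0<..}. b l * (exp (- L * s) * laguerre_fun l s))"
        by (intro set_lebesgue_integral_cong) auto
      also have "\<dots> = b l * (1 / (L + 1) * r ^ l)"
        using laguerre_fun_laplace(2)[of L l] L by (simp add: r_def)
      finally show ?thesis by simp
    qed
    have pint: "set_integrable lborel {0<..} (\<lambda>w. K * exp (- w))" for K :: real
      using set_integrable_exp_decay(1)[of 1 0] by simp
    have lag1: "\<bar>laguerre_fun l (exp (- w))\<bar> \<le> 1" if "w > 0" for w l
      using that by (intro laguerre_fun_le_one) auto
    have i2: "set_integrable lborel {0<..} (\<lambda>w. exp (- w) * laguerre_fun l (exp (- w)) * P w)"
      and i2': "\<And>w. w > 0 \<Longrightarrow> \<bar>exp (- w) * laguerre_fun l (exp (- w)) * P w\<bar> \<le> C * exp (- w)" for l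
    proof -
      show b: "\<bar>exp (- w) * laguerre_fun l (exp (- w)) * P w\<bar> \<le> C * exp (- w)" if "w > 0" for w
      proof -
        have "exp (- w) * \<bar>laguerre_fun l (exp (- w))\<bar> * \<bar>P w\<bar> \<le> 1 * 1 * (C * exp (- w))"
          using that lag1[OF that] bound[of w] by (intro mult_mono) auto
        then show ?thesis by (simp add: abs_mult)
      qed
      show "set_integrable lborel {0<..} (\<lambda>w. exp (- w) * laguerre_fun l (exp (- w)) * P w)"
      proof (rule set_integrable_bound[OF pint[of C]])
        show "set_borel_measurable lborel {0<..} (\<lambda>w. exp (- w) * laguerre_fun l (exp (- w)) * P w)"
          by (intro set_borel_measurable_continuous_on continuous_intros continuous_on_subset[OF cont]) auto
      qed (use b C in auto)
    qed
    have sumP: "(\<lambda>l. LBINT w:{0<..}. r ^ l * (exp (- w) * laguerre_fun l (exp (- w)) * P w)) sums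
        (LBINT w:{0<..}. (\<Sum>l. r ^ l * (exp (- w) * laguerre_fun l (exp (- w)) * P w)))"
    proof (rule set_integral_suminf(2))
      show "set_integrable lborel {0<..} (\<lambda>w. r ^ l * (exp (- w) * laguerre_fun l (exp (- w)) * P w))" for l
        using i2[of l] by simp
      show "summable (\<lambda>l. \<bar>r ^ l * (exp (- w) * laguerre_fun l (exp (- w)) * P w)\<bar>)" if "w \<in> {0<..}" for w
      proof (rule summable_comparison_test'[OF summable_mult2[OF summable_geometric[of r], of "C * exp (- w)"]])
        fix l show "norm \<bar>r ^ l * (exp (- w) * laguerre_fun l (exp (- w)) * P w)\<bar> \<le> r ^ l * (C * exp (- w))"
          using i2'[of w l] that r by (simp add: abs_mult mult_left_mono)
      qed (use r in auto)
      show "summable (\<lambda>l. LBINT w:{0<..}. \<bar>r ^ l * (exp (- w) * laguerre_fun l (exp (- w)) * P w)\<bar>)"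
      proof (rule summable_comparison_test'[OF summable_mult2[OF summable_geometric[of r], of C]])
        fix l
        have "(LBINT w:{0<..}. \<bar>r ^ l * (exp (- w) * laguerre_fun l (exp (- w)) * P w)\<bar>) \<le> (LBINT w:{0<..}. (r ^ l * C) * exp (- w))"
        proof (rule set_integral_mono[OF set_integrable_abs pint])
          show "set_integrable lborel {0<..} (\<lambda>w. r ^ l * (exp (- w) * laguerre_fun l (exp (- w)) * P w))"
            using i2[of l] by simp
          fix w :: real assume "w \<in> {0<..}"
          then show "\<bar>r ^ l * (exp (- w) * laguerre_fun l (exp (- w)) * P w)\<bar> \<le> (r ^ l * C) * exp (- w)"
            using i2'[of w l] r by (simp add: abs_mult mult_left_mono mult.assoc)
        qed
        also have "\<dots> = r ^ l * C" using set_integrable_exp_decay(2)[of 1] by simp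
        finally show "norm (LBINT w:{0<..}. \<bar>r ^ l * (exp (- w) * laguerre_fun l (exp (- w)) * P w)\<bar>) \<le> r ^ l * C"
          using set_lebesgue_integral_nonneg[of "{0<..}" "\<lambda>w. \<bar>r ^ l * (exp (- w) * laguerre_fun l (exp (- w)) * P w)\<bar>" lborel] by simp
      qed (use r in auto)
    qed
    have "(LBINT w:{0<..}. (\<Sum>l. r ^ l * (exp (- w) * laguerre_fun l (exp (- w)) * P w))) =
          (LBINT w:{0<..}. ((L + 1) / 2) * (exp (- w) * (exp (- L * exp (- w)) * P (- ln (exp (- w))))))"
    proof (intro set_lebesgue_integral_cong allI impI)
      fix w :: real
      have "(\<lambda>l. r ^ l * laguerre_fun l (exp (- w))) sums (exp (- exp (- w) * ((1 + r) / (1 - r))) / (1 - r))"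
        by (rule laguerre_fun_genfun) (use r in auto)
      also have "exp (- exp (- w) * ((1 + r) / (1 - r))) / (1 - r) = (L + 1) / 2 * exp (- L * exp (- w))"
        by (simp only: r(4)) (simp add: r(3) mult.commute)
      finally have "(\<lambda>l. r ^ l * laguerre_fun l (exp (- w))) sums ((L + 1) / 2 * exp (- L * exp (- w)))" .
      from sums_mult2[OF this, of "exp (- w) * P w"]
      show "(\<Sum>l. r ^ l * (exp (- w) * laguerre_fun l (exp (- w)) * P w)) = ((L + 1) / 2) * (exp (- w) * (exp (- L * exp (- w)) * P (- ln (exp (- w)))))"
        by (intro sums_unique[symmetric]) (simp add: mult_ac)
    qed auto
    also have "\<dots> = ((L + 1) / 2) * (LBINT w:{0<..}. exp (- w) * (exp (- L * exp (- w)) * P (- ln (exp (- w)))))"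
      by simp
    also have "(LBINT w:{0<..}. exp (- w) * (exp (- L * exp (- w)) * P (- ln (exp (- w))))) = (LBINT s:{0<..<1}. exp (- L * s) * P (- ln s))"
      by (rule exp_minus_substitution[of "\<lambda>s. exp (- L * s) * P (- ln s)"])
         (intro continuous_intros continuous_on_compose2[OF cont], auto)
    also have "(LBINT s:{0<..<1}. exp (- L * s) * P (- ln s)) = (LBINT s:{0<..}. exp (- L * s) * \<beta> s)"
      unfolding set_lebesgue_integral_def by (intro Bochner_Integration.integral_cong) (auto simp: \<beta>_def indicator_def)
    finally have sumP_eq: "(LBINT w:{0<..}. (\<Sum>l. r ^ l * (exp (- w) * laguerre_fun l (exp (- w)) * P w))) =
        (L + 1) / 2 * (LBINT s:{0<..}. exp (- L * s) * \<beta> s)" .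
    have "(\<lambda>l. r ^ l * (b l / 2)) sums ((L + 1) / 2 * (LBINT s:{0<..}. exp (- L * s) * \<beta> s))"
      using sumP unfolding sumP_eq by (simp add: b)
    then have "(\<lambda>l. 2 / (L + 1) * (r ^ l * (b l / 2))) sums (2 / (L + 1) * ((L + 1) / 2 * (LBINT s:{0<..}. exp (- L * s) * \<beta> s)))"
      by (rule sums_mult)
    moreover have "2 / (L + 1) * (r ^ l * (b l / 2)) = (1 / (L + 1)) * (b l * r ^ l)" for l
      using L by (simp add: field_simps)
    moreover have "2 / (L + 1) * ((L + 1) / 2 * x) = x" for x
      using L by simp
    ultimately have "(\<lambda>l. (1 / (L + 1)) * (b l * r ^ l)) sums (LBINT s:{0<..}. exp (- L * s) * \<beta> s)"
      by (simp only:)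
    with sumG have eq: "(LBINT s:{0<..}. exp (- L * s) * G s) = (LBINT s:{0<..}. exp (- L * s) * \<beta> s)"
      unfolding e1 using sums_unique2 by blast
    have int\<beta>: "set_integrable lborel {0<..} (\<lambda>s. exp (- L * s) * \<beta> s)"
    proof (rule set_integrable_bound)
      show "set_integrable lborel {0<..} (\<lambda>s. C * exp (- 1 * s))"
        using set_integrable_exp_decay(1)[of 1 0] by simp
      show "set_borel_measurable lborel {0<..} (\<lambda>s. exp (- L * s) * \<beta> s)"
        by (intro meas continuous_intros c\<beta>)
      show "AE s in lborel. s \<in> {0<..} \<longrightarrow> norm (exp (- L * s) * \<beta> s) \<le> norm (C * exp (- 1 * s))"
      proof (intro AE_I2 impI)
        fix s :: real assume s: "s \<in> {0<..}"
        have "s \<le> exp s" using exp_ge_add_one_self[of s] by linarith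
        then have "C * s \<le> C * exp s" using C by (intro mult_left_mono)
        then have "exp (- L * s) * \<bar>\<beta> s\<bar> \<le> exp (- 2 * s) * (C * exp s)"
          using b\<beta>[of s] s L by (intro mult_mono) auto
        also have "\<dots> = C * exp (- 1 * s)" by (simp add: mult_exp_exp mult.left_commute)
        finally show "norm (exp (- L * s) * \<beta> s) \<le> norm (C * exp (- 1 * s))"
          using C by (simp add: abs_mult)
      qed
    qed
    have "(LBINT s:{0<..}. exp (- L * s) * (G s - \<beta> s)) = (LBINT s:{0<..}. exp (- L * s) * G s) - (LBINT s:{0<..}. exp (- L * s) * \<beta> s)"
      unfolding right_diff_distrib by (rule set_integral_diff(2)[OF intG int\<beta>])
    then show "(LBINT s:{0<..}. exp (- (real n + 4) * s) * (G s - \<beta> s)) = 0"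
      using eq by (simp add: L_def)
  qed
  then have "G s = \<beta> s" by simp
  then show ?thesis
    using summable_sums[OF sG'[OF s]] unfolding G_def \<beta>_def by simp
qed

text \<open>Writing \<open>N exp (-w) y = exp (-2w) y - y''\<close> by the Laguerre equation for \<open>y(w) = \<Lambda>\<^sub>l(exp
  (-w))\<close> and integrating by parts twice gains a factor \<open>1/N\<close>. The only boundary term left is
  \<open>y(0) P'(0)\<close>, the contribution of the kink, because \<open>P 0 = 0\<close>; it and the remaining integral
  are \<open>O(N^(-1/4))\<close> by the amplitude bound.\<close>

lemma laguerre_coeff_bound:
  fixes P P' P'' :: "real \<Rightarrow> real"
  assumes d1: "\<And>w. (P has_real_derivative P' w) (at w)"
    and d2: "\<And>w. (P' has_real_derivative P'' w) (at w)"
    and c2: "continuous_on UNIV P''"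
    and bP: "\<And>w. w \<ge> 0 \<Longrightarrow> \<bar>P w\<bar> \<le> C * exp (- w)"
    and bP': "\<And>w. w \<ge> 0 \<Longrightarrow> \<bar>P' w\<bar> \<le> C * exp (- w)"
    and bP'': "\<And>w. w \<ge> 0 \<Longrightarrow> \<bar>P'' w\<bar> \<le> C * exp (- w)"
    and P0: "P 0 = 0"
  shows "\<bar>2 * (LBINT w:{0<..}. exp (- w) * laguerre_fun l (exp (- w)) * P w)\<bar> \<le> 15 * C * (2 * real l + 1) powr (- 5 / 4)"
proof -
  define N where "N = 2 * real l + 1"
  have N: "N \<ge> 1" by (simp add: N_def)
  have C: "C \<ge> 0" using bP[of 0] by simp
  have cP: "continuous_on UNIV P" "continuous_on UNIV P'"
    by (auto intro!: continuous_at_imp_continuous_on DERIV_isCont[OF d1] DERIV_isCont[OF d2])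
  define y where "y = (\<lambda>w. laguerre_fun l (exp (- w)))"
  define y' where "y' = (\<lambda>w. - (exp (- w) * laguerre_fun' l (exp (- w))))"
  have dy: "(y has_real_derivative y' w) (at w)" for w
    unfolding y_def y'_def by (rule DERIV_cong[OF DERIV_chain2[OF laguerre_fun_deriv]]) (auto intro!: derivative_eq_intros)
  have dy': "(y' has_real_derivative - (exp (- w) * (N - exp (- w)) * y w)) (at w)" for w
    unfolding y_def y'_def
    by (rule DERIV_cong[OF DERIV_minus[OF DERIV_chain2[OF laguerre_fun'_deriv]]])
       (auto intro!: derivative_eq_intros simp: N_def)
  have cy: "continuous_on S y" "continuous_on S y'" for S
    unfolding y_def y'_def by (auto intro!: continuous_intros)
  have y1: "\<bar>y w\<bar> \<le> 1" if "w \<ge> 0" for w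
    unfolding y_def using that by (intro laguerre_fun_le_one) auto
  have y'1: "\<bar>y' w\<bar> \<le> N" if "w \<ge> 0" for w
  proof -
    have s: "exp (- w) \<le> 1" using that by simp
    have "exp (- w) * (laguerre_fun' l (exp (- w)))\<^sup>2 \<le> N"
      using laguerre_fun_energy_bound(2)[of "exp (-w)" l] s by (auto simp: N_def)
    then have "exp (- w) * (exp (- w) * (laguerre_fun' l (exp (- w)))\<^sup>2) \<le> 1 * N"
      using s by (intro mult_mono) auto
    then have "(y' w)\<^sup>2 \<le> N" by (simp add: y'_def power2_eq_square mult_ac)
    also have "N \<le> N\<^sup>2" using N by (simp add: power2_eq_square)
    finally show ?thesis using N by (intro power2_le_imp_le[of "\<bar>y' w\<bar>"]) auto
  qed
  have y2: "\<bar>y w\<bar> \<le> 2 * N powr (- 1 / 4) * exp (w / 4)" if "w \<ge> 0" for w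
  proof -
    define t where "t = N powr (1 / 4) * exp (- w / 4)"
    have t: "t > 0" using N by (simp add: t_def)
    have "sqrt (N * exp (- w)) = t\<^sup>2"
    proof (rule real_sqrt_unique)
      have "(N powr (1 / 4)) ^ 4 = N" using N by (simp add: powr_power)
      moreover have "exp (- w / 4) ^ 4 = exp (- w)" by (simp flip: exp_of_nat_mult)
      ultimately show "(t\<^sup>2)\<^sup>2 = N * exp (- w)" by (simp add: t_def power_mult_distrib flip: power_mult)
    qed simp
    moreover have "(y w)\<^sup>2 * sqrt (N * exp (- w)) \<le> 4"
      using laguerre_fun_amplitude_bound[of "exp (-w)" l] that by (simp add: y_def N_def)
    ultimately have "(y w * t)\<^sup>2 \<le> 2\<^sup>2" by (simp add: power_mult_distrib)
    then have "\<bar>y w * t\<bar> \<le> 2" by (metis abs_le_square_iff abs_numeral)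
    then have "\<bar>y w\<bar> \<le> 2 / t" using t by (simp add: abs_mult field_simps)
    also have "2 / t = 2 * N powr (- 1 / 4) * exp (w / 4)"
      using N by (simp add: t_def powr_minus exp_minus field_simps)
    finally show ?thesis .
  qed
  have pint: "set_integrable lborel {0<..} (\<lambda>w. K * exp (- w))" for K :: real
    using set_integrable_exp_decay(1)[of 1 0] by simp
  have i1: "set_integrable lborel {0<..} (\<lambda>w. exp (- w) * y w * P w)"
  proof (rule set_integrable_bound[OF pint[of C]])
    show "set_borel_measurable lborel {0<..} (\<lambda>w. exp (- w) * y w * P w)"
      by (intro set_borel_measurable_continuous_on continuous_intros cy continuous_on_subset[OF cP(1)]) auto
    show "AE w in lborel. w \<in> {0<..} \<longrightarrow> norm (exp (- w) * y w * P w) \<le> norm (C * exp (- w))"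
    proof (intro AE_I2 impI)
      fix w :: real assume w: "w \<in> {0<..}"
      then have "exp (- w) * \<bar>y w\<bar> * \<bar>P w\<bar> \<le> 1 * 1 * (C * exp (- w))"
        using y1[of w] bP[of w] by (intro mult_mono) auto
      then show "norm (exp (- w) * y w * P w) \<le> norm (C * exp (- w))" using C by (simp add: abs_mult)
    qed
  qed
  \<comment> \<open>By the equation for \<open>y\<close>, the derivative of the Wronskian \<open>y' P - y P'\<close> is \<open>y R - N exp (-w)
    y P\<close>.\<close>
  define R where "R = (\<lambda>w. (exp (- w))\<^sup>2 * P w - P'' w)"
  have R: "\<bar>R w\<bar> \<le> 2 * C * exp (- w)" if "w \<ge> 0" for w
  proof -
    have "(exp (- w))\<^sup>2 * \<bar>P w\<bar> \<le> 1 * (C * exp (- w))"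
      using that bP[of w] by (intro mult_mono) (auto simp: power_le_one)
    then have "\<bar>(exp (- w))\<^sup>2 * P w\<bar> \<le> C * exp (- w)" by (simp add: abs_mult)
    then show ?thesis using bP''[OF that] by (simp add: R_def)
  qed
  have yR: "\<bar>y w * R w\<bar> \<le> 4 * C * N powr (- 1 / 4) * exp (- (3 / 4) * w)" if "w \<ge> 0" for w
  proof -
    have "\<bar>y w\<bar> * \<bar>R w\<bar> \<le> (2 * N powr (- 1 / 4) * exp (w / 4)) * (2 * C * exp (- w))"
      using y2[OF that] R[OF that] by (intro mult_mono) auto
    also have "\<dots> = 4 * C * N powr (- 1 / 4) * (exp (w / 4) * exp (- w))" by simp
    also have "exp (w / 4) * exp (- w) = exp (- (3 / 4) * w)" by (simp add: mult_exp_exp)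
    finally show ?thesis by (simp add: abs_mult)
  qed
  have rint: "set_integrable lborel {0<..} (\<lambda>w. 4 * C * N powr (- 1 / 4) * exp (- (3 / 4) * w))"
    using set_integrable_exp_decay(1)[of "3/4" 0] by simp
  have i2: "set_integrable lborel {0<..} (\<lambda>w. y w * R w)"
  proof (rule set_integrable_bound[OF rint])
    show "set_borel_measurable lborel {0<..} (\<lambda>w. y w * R w)"
      unfolding R_def
      by (intro set_borel_measurable_continuous_on continuous_intros cy continuous_on_subset[OF cP(1)] continuous_on_subset[OF c2]) auto
    show "AE w in lborel. w \<in> {0<..} \<longrightarrow> norm (y w * R w) \<le> norm (4 * C * N powr (- 1 / 4) * exp (- (3 / 4) * w))"
      using yR C by (intro AE_I2 impI) auto
  qed
  have "(LBINT w:{0<..}. y w * R w - N * (exp (- w) * y w * P w)) = 0 - (y' 0 * P 0 - y 0 * P' 0)"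
  proof (rule improper_FTC)
    show "((\<lambda>w. y' w * P w - y w * P' w) has_real_derivative y w * R w - N * (exp (- w) * y w * P w)) (at w)" for w
      by (rule DERIV_cong[OF DERIV_diff[OF DERIV_mult[OF dy' d1] DERIV_mult[OF dy d2]]])
         (simp add: R_def algebra_simps power2_eq_square)
    show "isCont (\<lambda>w. y w * R w - N * (exp (- w) * y w * P w)) x" for x
    proof -
      have "continuous_on UNIV (\<lambda>w. y w * R w - N * (exp (- w) * y w * P w))"
        unfolding R_def by (intro continuous_intros cy cP c2)
      then show ?thesis by (simp add: continuous_on_eq_continuous_at)
    qed
    show "set_integrable lborel {0<..} (\<lambda>w. y w * R w - N * (exp (- w) * y w * P w))"
      using i1 i2 by (intro set_integral_diff) auto
    have "continuous_on UNIV (\<lambda>w. y' w * P w - y w * P' w)"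
      by (intro continuous_intros cy cP)
    then have "isCont (\<lambda>w. y' w * P w - y w * P' w) 0" by (simp add: continuous_on_eq_continuous_at)
    then show "((\<lambda>w. y' w * P w - y w * P' w) \<longlongrightarrow> y' 0 * P 0 - y 0 * P' 0) (at_right 0)"
      by (simp add: isCont_def filterlim_at_split)
    have "((\<lambda>w. (N + 1) * C * exp (- w)) \<longlongrightarrow> 0) at_top" by real_asymp
    then show "((\<lambda>w. y' w * P w - y w * P' w) \<longlongrightarrow> 0) at_top"
    proof (rule Lim_null_comparison[rotated], intro eventually_mono[OF eventually_ge_at_top[of 0]])
      fix w :: real assume w: "w \<ge> 0"
      have "\<bar>y' w\<bar> * \<bar>P w\<bar> \<le> N * (C * exp (- w))"
        using y'1[OF w] bP[OF w] N by (intro mult_mono) auto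
      moreover have "\<bar>y w\<bar> * \<bar>P' w\<bar> \<le> 1 * (C * exp (- w))"
        using y1[OF w] bP'[OF w] by (intro mult_mono) auto
      moreover have "\<bar>y' w * P w - y w * P' w\<bar> \<le> \<bar>y' w\<bar> * \<bar>P w\<bar> + \<bar>y w\<bar> * \<bar>P' w\<bar>"
        using abs_triangle_ineq4[of "y' w * P w" "y w * P' w"] by (simp add: abs_mult)
      ultimately show "norm (y' w * P w - y w * P' w) \<le> (N + 1) * C * exp (- w)"
        by (simp add: algebra_simps)
    qed
  qed
  also have "(LBINT w:{0<..}. y w * R w - N * (exp (- w) * y w * P w)) = (LBINT w:{0<..}. y w * R w) - N * (LBINT w:{0<..}. exp (- w) * y w * P w)"
    using i1 i2 by (subst set_integral_diff(2)) auto
  finally have main: "N * (LBINT w:{0<..}. exp (- w) * y w * P w) = (LBINT w:{0<..}. y w * R w) - y 0 * P' 0"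
    using P0 by simp
  have b1: "\<bar>LBINT w:{0<..}. y w * R w\<bar> \<le> 16 / 3 * C * N powr (- 1 / 4)"
  proof -
    have "\<bar>LBINT w:{0<..}. y w * R w\<bar> \<le> (LBINT w:{0<..}. \<bar>y w * R w\<bar>)"
      unfolding set_lebesgue_integral_def
      by (rule order_trans[OF integral_abs_bound]) (simp add: abs_mult)
    also have "\<dots> \<le> (LBINT w:{0<..}. 4 * C * N powr (- 1 / 4) * exp (- (3 / 4) * w))"
      using yR by (intro set_integral_mono set_integrable_abs i2 rint) auto
    also have "\<dots> = 16 / 3 * C * N powr (- 1 / 4)"
      using set_integrable_exp_decay(2)[of "3/4"] by simp
    finally show ?thesis .
  qed
  have "\<bar>y 0\<bar> * \<bar>P' 0\<bar> \<le> (2 * N powr (- 1 / 4)) * C"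
    using y2[of 0] bP'[of 0] by (intro mult_mono) auto
  then have b2: "\<bar>y 0 * P' 0\<bar> \<le> 2 * C * N powr (- 1 / 4)" by (simp add: abs_mult mult_ac)
  have "\<bar>N * (LBINT w:{0<..}. exp (- w) * y w * P w)\<bar> \<le> (22 / 3) * (C * N powr (- 1 / 4))"
    unfolding main using b1 b2 abs_triangle_ineq4[of "LBINT w:{0<..}. y w * R w" "y 0 * P' 0"] by simp
  also have "\<dots> \<le> (15 / 2) * (C * N powr (- 1 / 4))"
    using C by (intro mult_right_mono) auto
  finally have "N * \<bar>LBINT w:{0<..}. exp (- w) * y w * P w\<bar> \<le> (15 / 2) * (C * N powr (- 1 / 4))"
    using N by (simp add: abs_mult)
  also have "N powr (- 1 / 4) = N * N powr (- 5 / 4)"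
    using N by (simp add: powr_mult_base)
  finally have "N * \<bar>LBINT w:{0<..}. exp (- w) * y w * P w\<bar> \<le> N * ((15 / 2) * C * N powr (- 5 / 4))"
    by (simp add: mult_ac)
  then have "\<bar>LBINT w:{0<..}. exp (- w) * y w * P w\<bar> \<le> (15 / 2) * C * N powr (- 5 / 4)"
    using N by simp
  then show ?thesis unfolding y_def N_def by (simp add: abs_mult)
qed

section \<open>Pollaczek polynomials at half-integers and the coefficients of the expansion\<close>

text \<open>These are the Meixner polynomials in \<open>N\<close> at parameter -1, equivalently the Delannoy
  numbers.\<close>

definition meixner_sum :: "nat \<Rightarrow> nat \<Rightarrow> real" where
  "meixner_sum l N = (\<Sum>k\<le>l. real (l choose k) * real (N choose k) * 2 ^ k)"

lemma meixner_sum_0 [simp]: "meixner_sum l 0 = 1"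
proof -
  have "meixner_sum l 0 = (\<Sum>k\<le>l. if k = 0 then 1 else 0)"
    unfolding meixner_sum_def by (intro sum.cong) (auto simp: binomial_eq_0_iff)
  then show ?thesis by simp
qed

lemma meixner_sum_nonneg: "meixner_sum l N \<ge> 0"
  unfolding meixner_sum_def by (intro sum_nonneg) auto

lemma binomial_inversion_sum:
  assumes "j \<le> l"
  shows "(\<Sum>k\<le>l. (-2::real) ^ k * real (l choose k) * real (k choose j)) = (-1) ^ l * (real (l choose j) * 2 ^ j)"
proof -
  have "(\<Sum>k\<le>l. (-2::real) ^ k * real (l choose k) * real (k choose j)) = (\<Sum>k\<in>{j..l}. (-2::real) ^ k * real (l choose k) * real (k choose j))"
    by (rule sum.mono_neutral_right) (auto simp: binomial_eq_0)
  also have "\<dots> = (\<Sum>k\<in>{j..l}. real (l choose j) * ((-2) ^ k * real ((l - j) choose (k - j))))"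
  proof (intro sum.cong refl)
    fix k assume "k \<in> {j..l}"
    then have "real ((l choose k) * (k choose j)) = real ((l choose j) * ((l - j) choose (k - j)))"
      by (subst choose_mult) auto
    then show "(-2::real) ^ k * real (l choose k) * real (k choose j) = real (l choose j) * ((-2) ^ k * real ((l - j) choose (k - j)))"
      by simp
  qed
  also have "\<dots> = (\<Sum>m\<in>{0..l - j}. real (l choose j) * ((-2) ^ (m + j) * real ((l - j) choose m)))"
    by (rule sum.reindex_bij_witness[of _ "\<lambda>m. m + j" "\<lambda>k. k - j"]) (use assms in auto)
  also have "\<dots> = real (l choose j) * (-2) ^ j * (\<Sum>m\<le>l - j. real ((l - j) choose m) * (-2) ^ m * 1 ^ (l - j - m))"
    by (simp add: sum_distrib_left power_add atMost_atLeast0 mult_ac)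
  also have "(\<Sum>m\<le>l - j. real ((l - j) choose m) * (-2) ^ m * 1 ^ (l - j - m)) = (- 2 + 1) ^ (l - j)"
    by (rule binomial_ring[symmetric])
  also have "real (l choose j) * (-2) ^ j * (- 2 + 1) ^ (l - j) = ((-1) ^ j * (-1) ^ (l - j)) * (real (l choose j) * 2 ^ j)"
    by (simp add: power_minus[of "2::real"])
  also have "(-1::real) ^ j * (-1) ^ (l - j) = (-1) ^ l" using assms by (simp flip: power_add)
  finally show ?thesis .
qed

text \<open>Vandermonde's identity expands \<open>(N + k) choose k\<close> in products of \<open>N choose j\<close> and \<open>k
  choose j\<close>; the sum over \<open>k\<close> then collapses by the binomial theorem for \<open>(1 - 2)^(l - j)\<close>.\<close>

lemma meixner_sum_reflection:
  "(\<Sum>k\<le>l. (-2) ^ k * real (l choose k) * real ((N + k) choose k)) = (-1) ^ l * meixner_sum l N"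
proof -
  have v: "real ((N + k) choose k) = (\<Sum>j\<le>l. real (N choose j) * real (k choose j))" if "k \<le> l" for k
  proof -
    have "(N + k) choose k = (\<Sum>j\<le>k. (N choose j) * (k choose (k - j)))" by (rule vandermonde[symmetric])
    also have "\<dots> = (\<Sum>j\<le>k. (N choose j) * (k choose j))"
      by (intro sum.cong refl) (simp add: binomial_symmetric[symmetric])
    also have "\<dots> = (\<Sum>j\<le>l. (N choose j) * (k choose j))"
      by (rule sum.mono_neutral_left) (use that in \<open>auto simp: binomial_eq_0\<close>)
    finally show ?thesis by simp
  qed
  have "(\<Sum>k\<le>l. (-2) ^ k * real (l choose k) * real ((N + k) choose k)) =
     (\<Sum>k\<le>l. \<Sum>j\<le>l. real (N choose j) * ((-2) ^ k * real (l choose k) * real (k choose j)))"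
    by (intro sum.cong refl) (simp add: v sum_distrib_left mult_ac)
  also have "\<dots> = (\<Sum>j\<le>l. \<Sum>k\<le>l. real (N choose j) * ((-2) ^ k * real (l choose k) * real (k choose j)))"
    by (rule sum.swap)
  also have "\<dots> = (\<Sum>j\<le>l. real (N choose j) * ((-1) ^ l * (real (l choose j) * 2 ^ j)))"
    unfolding sum_distrib_left[symmetric] by (intro sum.cong refl) (simp add: binomial_inversion_sum)
  also have "\<dots> = (-1) ^ l * meixner_sum l N"
    by (simp add: meixner_sum_def sum_distrib_left mult_ac)
  finally show ?thesis .
qed

lemma pollaczek_at_half_integer:
  "pollaczek l (- \<i> * (of_nat N + 1 / 2)) = (- \<i>) ^ l * of_real (meixner_sum l N)"
proof -
  have arg: "1 / 2 + \<i> * (- \<i> * (of_nat N + 1 / 2)) = (of_nat N + 1 :: complex)"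
    by (simp add: field_simps)
  have t: "pochhammer (- of_nat l) k * pochhammer (of_nat N + 1) k / (fact k)\<^sup>2 * 2 ^ k =
      complex_of_real ((-2) ^ k * real (l choose k) * real ((N + k) choose k))" for k
  proof -
    have "of_nat (l choose k) = (-1) ^ k * pochhammer (- of_nat l :: complex) k / fact k"
      by (simp only: binomial_gbinomial gbinomial_pochhammer)
    then have 1: "pochhammer (- of_nat l :: complex) k = (-1) ^ k * fact k * of_nat (l choose k)"
      by simp
    have "of_nat ((N + k) choose k) = pochhammer (of_nat (N + k) - of_nat k + 1 :: complex) k / fact k"
      by (simp only: binomial_gbinomial gbinomial_pochhammer')
    then have 2: "pochhammer (of_nat N + 1 :: complex) k = fact k * of_nat ((N + k) choose k)"
      by simp
    show ?thesis unfolding 1 2 by (simp add: power2_eq_square power_minus[of "2::complex"])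
  qed
  have "pollaczek l (- \<i> * (of_nat N + 1 / 2)) = \<i> ^ l * of_real (\<Sum>k\<le>l. (-2) ^ k * real (l choose k) * real ((N + k) choose k))"
    unfolding pollaczek_sum arg t by simp
  also have "\<dots> = \<i> ^ l * of_real ((-1) ^ l * meixner_sum l N)"
    unfolding meixner_sum_reflection ..
  also have "\<dots> = (- \<i>) ^ l * of_real (meixner_sum l N)"
    by (simp add: power_minus[of \<i>])
  finally show ?thesis .
qed

text \<open>The power series of \<open>exp (-s) L\<^sub>l(2s)\<close> has the same coefficients that the Pollaczek
  polynomials produce at half-integers. This coincidence is what ties the coefficients \<open>c\<^sub>l\<close> to
  Laguerre functions.\<close>

lemma laguerre_fun_series:
  "(\<lambda>N. (- s) ^ N / fact N * meixner_sum l N) sums laguerre_fun l s"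
proof -
  have k: "(\<lambda>N. (- s) ^ N / fact N * real (N choose k)) sums ((- s) ^ k / fact k * exp (- s))" for k
  proof -
    have "(\<lambda>i. (- s) ^ k / fact k * ((- s) ^ i /\<^sub>R fact i)) sums ((- s) ^ k / fact k * exp (- s))"
      by (intro sums_mult exp_converges)
    also have "(\<lambda>i. (- s) ^ k / fact k * ((- s) ^ i /\<^sub>R fact i)) = (\<lambda>i. (- s) ^ (i + k) / fact (i + k) * real ((i + k) choose k))"
      by (rule ext) (simp add: binomial_fact power_add field_simps)
    finally show ?thesis
      by (subst sums_zero_iff_shift[symmetric, of k]) (auto simp: binomial_eq_0)
  qed
  have "(\<lambda>N. \<Sum>k\<le>l. real (l choose k) * 2 ^ k * ((- s) ^ N / fact N * real (N choose k))) sums (\<Sum>k\<le>l. real (l choose k) * 2 ^ k * ((- s) ^ k / fact k * exp (- s)))"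
    by (intro sums_sum sums_mult k)
  also have "(\<Sum>k\<le>l. real (l choose k) * 2 ^ k * ((- s) ^ k / fact k * exp (- s))) = laguerre_fun l s"
    unfolding laguerre_fun_def laguerre_L_def sum_distrib_left
    by (intro sum.cong refl) (simp add: power_mult_distrib power_minus[of s])
  also have "(\<lambda>N. \<Sum>k\<le>l. real (l choose k) * 2 ^ k * ((- s) ^ N / fact N * real (N choose k))) = (\<lambda>N. (- s) ^ N / fact N * meixner_sum l N)"
    by (rule ext) (simp add: meixner_sum_def sum_distrib_left mult_ac)
  finally show ?thesis .
qed

definition laguerre_coeff :: "(nat \<Rightarrow> real) \<Rightarrow> nat \<Rightarrow> real" where
  "laguerre_coeff a l = (\<Sum>N. (-1) ^ N / fact N * a N * meixner_sum l N)"

lemma summable_laguerre_coeff: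
  assumes "\<And>N. \<bar>a N\<bar> \<le> A"
  shows "summable (\<lambda>N. (-1) ^ N / fact N * a N * meixner_sum l N)"
proof (rule summable_comparison_test')
  show "summable (\<lambda>N. A * (1 / fact N * meixner_sum l N))"
    using laguerre_fun_series[of "-1" l] by (intro summable_mult) (simp add: sums_iff)
  fix N
  have "\<bar>a N\<bar> * (1 / fact N * meixner_sum l N) \<le> A * (1 / fact N * meixner_sum l N)"
    using assms[of N] meixner_sum_nonneg[of l N] by (intro mult_right_mono) auto
  then show "norm ((-1) ^ N / fact N * a N * meixner_sum l N) \<le> A * (1 / fact N * meixner_sum l N)"
    using meixner_sum_nonneg[of l N] by (simp add: abs_mult)
qed

lemma coeff_c_eq:
  assumes "\<And>N. \<bar>a N\<bar> \<le> A"
  shows "coeff_c a l = of_real (sqrt 2) * (- \<i>) ^ l * of_real (laguerre_coeff a l)"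
proof -
  have "(\<lambda>N. (-1) ^ N / fact N * of_real (a N) * pollaczek l (- \<i> * (of_nat N + 1 / 2))) =
     (\<lambda>N. (- \<i>) ^ l * of_real ((-1) ^ N / fact N * a N * meixner_sum l N))"
    by (rule ext) (simp only: pollaczek_at_half_integer, simp)
  moreover have "(\<lambda>N. (- \<i>) ^ l * complex_of_real ((-1) ^ N / fact N * a N * meixner_sum l N)) sums ((- \<i>) ^ l * of_real (laguerre_coeff a l))"
    unfolding laguerre_coeff_def
    by (intro sums_mult sums_of_real summable_sums summable_laguerre_coeff[OF assms])
  ultimately show ?thesis by (simp add: coeff_c_def sums_iff mult.assoc)
qed

lemma coeff_c_Phi:
  assumes "\<And>N. \<bar>a N\<bar> \<le> A"
  shows "coeff_c a l * Phi l w = of_real (laguerre_coeff a l * (2 * exp (- w / 2) * laguerre_fun l (exp (- w))))"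
proof -
  have "(- \<i>) ^ l * \<i> ^ l = (1::complex)" by (simp flip: power_mult_distrib)
  moreover have "Phi l w = \<i> ^ l * of_real (sqrt 2 * exp (- w / 2) * laguerre_fun l (exp (- w)))"
    by (simp add: Phi_def laguerre_fun_def mult_ac)
  ultimately have "coeff_c a l * Phi l w = of_real (sqrt 2) * of_real (laguerre_coeff a l) * 1 * of_real (sqrt 2 * exp (- w / 2) * laguerre_fun l (exp (- w)))"
    unfolding coeff_c_eq[OF assms] by (simp add: mult_ac)
  also have "\<dots> = of_real ((sqrt 2 * sqrt 2) * (laguerre_coeff a l * (exp (- w / 2) * laguerre_fun l (exp (- w)))))"
    by (simp only: of_real_mult mult_ac mult_1_right mult_1_left)
  finally show ?thesis by (simp add: mult_ac)
qed

text \<open>Term 0 is split off because \<open>a 0\<close> need not be the Laplace integral of \<open>\<tau>\<close> at 0; the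
  remaining series is the power series of \<open>\<Lambda>\<^sub>l - 1\<close> at \<open>exp (-w)\<close> integrated against \<open>\<tau>\<close>.\<close>

lemma laguerre_coeff_integral:
  fixes \<tau> :: "real \<Rightarrow> real"
  assumes cont: "continuous_on UNIV \<tau>"
    and int: "set_integrable lborel {0<..} (\<lambda>w. exp (- w) * \<tau> w)"
    and a: "\<And>N. a (Suc N) = (LBINT w:{0<..}. exp (- real (Suc N) * w) * \<tau> w)"
    and bdd: "\<And>N. \<bar>a N\<bar> \<le> A"
  shows "laguerre_coeff a l = a 0 + (LBINT w:{0<..}. \<tau> w * (laguerre_fun l (exp (- w)) - 1))"
proof -
  define q where "q = (\<lambda>N. (-1) ^ Suc N / fact (Suc N) * meixner_sum l (Suc N))"
  define f where "f = (\<lambda>N w. q N * (exp (- real (Suc N) * w) * \<tau> w))"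
  define I where "I = (LBINT w:{0<..}. \<bar>exp (- w) * \<tau> w\<bar>)"
  have qs: "summable (\<lambda>N. \<bar>q N\<bar>)"
  proof -
    have "summable (\<lambda>N. 1 / fact (Suc N) * meixner_sum l (Suc N))"
      using laguerre_fun_series[of "-1" l] by (subst summable_Suc_iff) (simp add: sums_iff)
    moreover have "\<bar>q N\<bar> = 1 / fact (Suc N) * meixner_sum l (Suc N)" for N
      using meixner_sum_nonneg[of l "Suc N"] by (simp add: q_def abs_mult)
    ultimately show ?thesis by simp
  qed
  have le: "\<bar>exp (- real (Suc N) * w) * \<tau> w\<bar> \<le> \<bar>exp (- w) * \<tau> w\<bar>" if "w > 0" for N w
  proof -
    have "- real (Suc N) * w \<le> - w" using that by (simp add: algebra_simps)
    then show ?thesis unfolding abs_mult by (intro mult_right_mono) auto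
  qed
  have i: "set_integrable lborel {0<..} (\<lambda>w. exp (- real (Suc N) * w) * \<tau> w)" for N
    by (rule set_integrable_bound[OF int])
       (use le in \<open>auto intro!: set_borel_measurable_continuous_on continuous_intros continuous_on_subset[OF cont] AE_I2\<close>)
  have fi: "set_integrable lborel {0<..} (f N)" for N
    unfolding f_def by (intro set_integrable_mult_right i)
  have fx: "summable (\<lambda>N. \<bar>f N w\<bar>)" if "w \<in> {0<..}" for w
  proof (rule summable_comparison_test'[OF summable_mult2[OF qs, of "\<bar>exp (- w) * \<tau> w\<bar>"]])
    show "norm \<bar>f N w\<bar> \<le> \<bar>q N\<bar> * \<bar>exp (- w) * \<tau> w\<bar>" for N
      using le[of w N] that unfolding f_def abs_mult[of "q N"] by (simp add: mult_left_mono)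
  qed
  have fn: "summable (\<lambda>N. LBINT w:{0<..}. \<bar>f N w\<bar>)"
  proof (rule summable_comparison_test'[OF summable_mult2[OF qs, of I]])
    fix N
    have "(LBINT w:{0<..}. \<bar>f N w\<bar>) \<le> (LBINT w:{0<..}. \<bar>q N\<bar> * \<bar>exp (- w) * \<tau> w\<bar>)"
    proof (intro set_integral_mono set_integrable_abs fi set_integrable_mult_right int)
      fix w :: real assume "w \<in> {0<..}"
      then show "\<bar>f N w\<bar> \<le> \<bar>q N\<bar> * \<bar>exp (- w) * \<tau> w\<bar>"
        using le[of w N] unfolding f_def abs_mult[of "q N"] by (simp add: mult_left_mono)
    qed
    then show "norm (LBINT w:{0<..}. \<bar>f N w\<bar>) \<le> \<bar>q N\<bar> * I"
      using set_lebesgue_integral_nonneg[of "{0<..}" "\<lambda>w. \<bar>f N w\<bar>" lborel] by (simp add: I_def)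
  qed
  have "(\<lambda>N. LBINT w:{0<..}. f N w) sums (LBINT w:{0<..}. (\<Sum>N. f N w))"
    by (rule set_integral_suminf(2)[OF fi fx fn])
  moreover have "(LBINT w:{0<..}. f N w) = q N * a (Suc N)" for N
    unfolding f_def a by (rule set_integral_mult_right)
  moreover have "(LBINT w:{0<..}. (\<Sum>N. f N w)) = (LBINT w:{0<..}. \<tau> w * (laguerre_fun l (exp (- w)) - 1))"
  proof (intro set_lebesgue_integral_cong allI impI)
    fix w :: real
    have "(\<lambda>N. (- exp (- w)) ^ Suc N / fact (Suc N) * meixner_sum l (Suc N)) sums (laguerre_fun l (exp (- w)) - 1)"
      using laguerre_fun_series[of "exp (- w)" l] by (subst sums_Suc_iff) simp
    then have "(\<lambda>N. ((- exp (- w)) ^ Suc N / fact (Suc N) * meixner_sum l (Suc N)) * \<tau> w) sums ((laguerre_fun l (exp (- w)) - 1) * \<tau> w)"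
      by (rule sums_mult2)
    also have "(\<lambda>N. ((- exp (- w)) ^ Suc N / fact (Suc N) * meixner_sum l (Suc N)) * \<tau> w) = (\<lambda>N. f N w)"
    proof
      fix N
      have "(- exp (- w)) ^ Suc N = (-1) ^ Suc N * exp (- real (Suc N) * w)"
        by (subst power_minus) (simp only: exp_of_nat_mult[symmetric], simp add: algebra_simps)
      then show "((- exp (- w)) ^ Suc N / fact (Suc N) * meixner_sum l (Suc N)) * \<tau> w = f N w"
        by (simp only: f_def q_def) (simp add: mult_ac)
    qed
    finally show "(\<Sum>N. f N w) = \<tau> w * (laguerre_fun l (exp (- w)) - 1)"
      by (simp add: sums_iff mult.commute)
  qed simp
  ultimately have "(\<lambda>N. q N * a (Suc N)) sums (LBINT w:{0<..}. \<tau> w * (laguerre_fun l (exp (- w)) - 1))"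
    by simp
  then have "(\<lambda>N. (-1) ^ Suc N / fact (Suc N) * a (Suc N) * meixner_sum l (Suc N)) sums (LBINT w:{0<..}. \<tau> w * (laguerre_fun l (exp (- w)) - 1))"
    by (simp add: q_def mult_ac)
  then have "(\<lambda>N. (-1) ^ N / fact N * a N * meixner_sum l N) sums ((LBINT w:{0<..}. \<tau> w * (laguerre_fun l (exp (- w)) - 1)) + (-1) ^ 0 / fact 0 * a 0 * meixner_sum l 0)"
    by (rule sums_Suc)
  then show ?thesis by (simp add: laguerre_coeff_def sums_iff)
qed

text \<open>Any exponent below 1/4 would do, so that the coefficients \<open>O(l^(-5/4))\<close> stay summable, and
  it must exceed 1/16, the growth rate of \<open>\<tau>\<close>.\<close>

lemma laguerre_fun_minus_one_power_bound:
  assumes s: "0 \<le> s" "s \<le> 1"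
  shows "\<bar>laguerre_fun l s - 1\<bar> \<le> 2 * ((2 * real l + 1) * s) powr (3 / 16)"
proof -
  define x where "x = (2 * real l + 1) * s"
  have x: "x \<ge> 0" using s by (simp add: x_def)
  show ?thesis
  proof (cases "x \<ge> 1")
    case True
    have "\<bar>laguerre_fun l s\<bar> \<le> 1" using laguerre_fun_le_one[of s l] s by simp
    then have "\<bar>laguerre_fun l s - 1\<bar> \<le> 2 * 1" by linarith
    also have "2 * 1 \<le> 2 * x powr (3 / 16)" using True by (intro mult_left_mono ge_one_powr_ge_zero) auto
    finally show ?thesis by (simp add: x_def)
  next
    case False
    have "\<bar>laguerre_fun l s - 1\<bar> \<le> 2 * sqrt x" using laguerre_fun_minus_one_bound[OF s] by (simp add: x_def)
    also have "sqrt x = x powr (1 / 2)" using x by (simp add: powr_half_sqrt)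
    also have "x powr (1 / 2) \<le> x powr (3 / 16)" using x False by (intro powr_mono') auto
    finally show ?thesis by (simp add: x_def)
  qed
qed

text \<open>The series \<open>\<Sum> b\<^sub>l (\<Lambda>\<^sub>l(exp (-w)) - 1) = P(w)\<close> is integrated termwise against \<open>\<tau>\<close>. The
  subtraction of 1 is free since \<open>\<Sum> b\<^sub>l = 0\<close>, and it supplies the decay in \<open>w\<close> that \<open>\<tau>\<close> lacks.\<close>

theorem laguerre_series_pairing:
  fixes \<tau> P P' P'' :: "real \<Rightarrow> real"
  assumes \<tau>: "continuous_on UNIV \<tau>" "\<And>w. w > 0 \<Longrightarrow> \<bar>\<tau> w\<bar> \<le> A * (sqrt w * exp (w / 16))"
    and a: "\<And>N. a (Suc N) = (LBINT w:{0<..}. exp (- real (Suc N) * w) * \<tau> w)"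
    and bdd: "\<And>N. \<bar>a N\<bar> \<le> A'"
    and d1: "\<And>w. (P has_real_derivative P' w) (at w)"
    and d2: "\<And>w. (P' has_real_derivative P'' w) (at w)"
    and c2: "continuous_on UNIV P''"
    and bP: "\<And>w. w \<ge> 0 \<Longrightarrow> \<bar>P w\<bar> \<le> C * exp (- w)"
    and bP': "\<And>w. w \<ge> 0 \<Longrightarrow> \<bar>P' w\<bar> \<le> C * exp (- w)"
    and bP'': "\<And>w. w \<ge> 0 \<Longrightarrow> \<bar>P'' w\<bar> \<le> C * exp (- w)"
    and P0: "P 0 = 0"
  shows "(\<lambda>l. laguerre_coeff a l * (2 * (LBINT w:{0<..}. exp (- w) * laguerre_fun l (exp (- w)) * P w))) sums (LBINT w:{0<..}. \<tau> w * P w)"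
proof -
  define b where "b = (\<lambda>l. 2 * (LBINT w:{0<..}. exp (- w) * laguerre_fun l (exp (- w)) * P w))"
  have C: "C \<ge> 0" using bP[of 0] by simp
  have bb: "\<bar>b l\<bar> \<le> 15 * C * (2 * real l + 1) powr (- 5 / 4)" for l
    unfolding b_def by (rule laguerre_coeff_bound[OF d1 d2 c2 bP bP' bP'' P0])
  have cP: "continuous_on UNIV P"
    by (auto intro!: continuous_at_imp_continuous_on DERIV_isCont[OF d1])
  have sp: "summable (\<lambda>l. (2 * real l + 1) powr e)" if "e < -1" for e
  proof (rule summable_comparison_test)
    show "summable (\<lambda>l. real l powr e)" using that by (simp add: summable_real_powr_iff)
    show "\<exists>N. \<forall>n\<ge>N. norm ((2 * real n + 1) powr e) \<le> real n powr e"
      using that by (intro exI[of _ 1] allI impI) (auto intro!: powr_mono2')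
  qed
  \<comment> \<open>The exponent -5/4 + 3/16 = -17/16 is still below -1.\<close>
  define B where "B = (\<lambda>l. \<bar>b l\<bar> * (2 * (2 * real l + 1) powr (3 / 16)))"
  have sB: "summable B"
  proof (rule summable_comparison_test')
    show "summable (\<lambda>l. 30 * C * (2 * real l + 1) powr (- 17 / 16))"
      by (intro summable_mult sp) simp
    fix l
    have "B l \<le> (15 * C * (2 * real l + 1) powr (- 5 / 4)) * (2 * (2 * real l + 1) powr (3 / 16))"
      unfolding B_def by (intro mult_right_mono bb) auto
    also have "\<dots> = 30 * C * (2 * real l + 1) powr (- 17 / 16)" by (simp flip: powr_add)
    finally show "norm (B l) \<le> 30 * C * (2 * real l + 1) powr (- 17 / 16)" by (simp add: B_def)
  qed
  have sb: "summable (\<lambda>l. \<bar>b l\<bar>)"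
  proof (rule summable_comparison_test'[OF sB])
    fix l
    have "\<bar>b l\<bar> * 1 \<le> \<bar>b l\<bar> * (2 * (2 * real l + 1) powr (3 / 16))"
      using ge_one_powr_ge_zero[of "2 * real l + 1" "3/16"] by (intro mult_left_mono) auto
    then show "norm \<bar>b l\<bar> \<le> B l" by (simp add: B_def)
  qed
  have ex: "(\<lambda>l. b l * laguerre_fun l s) sums (if 0 < s \<and> s < 1 then P (- ln s) else 0)" if "s \<ge> 0" for s
    by (rule laguerre_expansion[OF cP bP P0 _ sb that]) (simp_all add: b_def)
  \<comment> \<open>All Laguerre functions have the value 1 at 0.\<close>
  have b0: "b sums 0" using ex[of 0] by simp
  have exw: "(\<lambda>l. b l * (laguerre_fun l (exp (- w)) - 1)) sums P w" if "w > 0" for w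
    using sums_diff[OF ex[of "exp (-w)"] b0] that by (simp add: right_diff_distrib)
  \<comment> \<open>Bounding \<open>\<Lambda>\<^sub>l(exp (-w)) - 1\<close> by the power 3/16 leaves this integrable majorant, uniform in
    \<open>l\<close>.\<close>
  define g where "g = (\<lambda>w. \<tau> w * exp (- (3 / 16) * w))"
  have g: "set_integrable lborel {0<..} g"
  proof (rule set_integrable_sqrt_bound[where C = A and c = "1/8"])
    show "set_borel_measurable lborel {0<..} g"
      unfolding g_def by (intro set_borel_measurable_continuous_on continuous_intros continuous_on_subset[OF \<tau>(1)]) auto
    fix w :: real assume w: "w > 0"
    have "\<bar>\<tau> w\<bar> * exp (- (3 / 16) * w) \<le> A * (sqrt w * exp (w / 16)) * exp (- (3 / 16) * w)"
      by (intro mult_right_mono \<tau>(2) w) auto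
    also have "\<dots> = A * (sqrt w * (exp (w / 16) * exp (- (3 / 16) * w)))" by simp
    also have "exp (w / 16) * exp (- (3 / 16) * w) = exp (- (1 / 8) * w)" by (simp add: mult_exp_exp)
    finally show "\<bar>g w\<bar> \<le> A * (sqrt w * exp (- (1 / 8) * w))" by (simp add: g_def abs_mult)
  qed simp
  have \<tau>int: "set_integrable lborel {0<..} (\<lambda>w. exp (- w) * \<tau> w)"
  proof (rule set_integrable_bound[OF g])
    show "set_borel_measurable lborel {0<..} (\<lambda>w. exp (- w) * \<tau> w)"
      by (intro set_borel_measurable_continuous_on continuous_intros continuous_on_subset[OF \<tau>(1)]) auto
    show "AE w in lborel. w \<in> {0<..} \<longrightarrow> norm (exp (- w) * \<tau> w) \<le> norm (g w)"
      by (intro AE_I2 impI) (auto simp: g_def abs_mult mult.commute intro!: mult_left_mono)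
  qed
  define f where "f = (\<lambda>l w. \<tau> w * (b l * (laguerre_fun l (exp (- w)) - 1)))"
  have fb: "\<bar>f l w\<bar> \<le> B l * \<bar>g w\<bar>" if "w > 0" for l w
  proof -
    have "\<bar>laguerre_fun l (exp (- w)) - 1\<bar> \<le> 2 * ((2 * real l + 1) * exp (- w)) powr (3 / 16)"
      by (rule laguerre_fun_minus_one_power_bound) (use that in auto)
    also have "\<dots> = 2 * (2 * real l + 1) powr (3 / 16) * exp (- (3 / 16) * w)"
      by (simp add: powr_mult exp_powr_real mult.commute)
    finally have "\<bar>\<tau> w\<bar> * (\<bar>b l\<bar> * \<bar>laguerre_fun l (exp (- w)) - 1\<bar>) \<le> \<bar>\<tau> w\<bar> * (\<bar>b l\<bar> * (2 * (2 * real l + 1) powr (3 / 16) * exp (- (3 / 16) * w)))"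
      by (intro mult_left_mono) auto
    then show ?thesis by (simp add: f_def g_def B_def abs_mult mult_ac)
  qed
  have fi: "set_integrable lborel {0<..} (f l)" for l
  proof (rule set_integrable_bound[OF set_integrable_mult_right[OF g, of "B l"]])
    show "set_borel_measurable lborel {0<..} (f l)"
      unfolding f_def by (intro set_borel_measurable_continuous_on continuous_intros continuous_on_subset[OF \<tau>(1)]) auto
    have "B l \<ge> 0" by (simp add: B_def)
    then show "AE w in lborel. w \<in> {0<..} \<longrightarrow> norm (f l w) \<le> norm (B l * g w)"
      using fb by (intro AE_I2 impI) (auto simp: abs_mult)
  qed
  have "(\<lambda>l. LBINT w:{0<..}. f l w) sums (LBINT w:{0<..}. (\<Sum>l. f l w))"
  proof (rule set_integral_suminf(2)[OF fi])
    show "summable (\<lambda>l. \<bar>f l w\<bar>)" if "w \<in> {0<..}" for w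
      by (rule summable_comparison_test'[OF summable_mult2[OF sB, of "\<bar>g w\<bar>"]]) (use fb that in auto)
    show "summable (\<lambda>l. LBINT w:{0<..}. \<bar>f l w\<bar>)"
    proof (rule summable_comparison_test'[OF summable_mult2[OF sB, of "LBINT w:{0<..}. \<bar>g w\<bar>"]])
      fix l
      have "(LBINT w:{0<..}. \<bar>f l w\<bar>) \<le> (LBINT w:{0<..}. B l * \<bar>g w\<bar>)"
        by (intro set_integral_mono set_integrable_abs fi set_integrable_mult_right g fb) auto
      then show "norm (LBINT w:{0<..}. \<bar>f l w\<bar>) \<le> B l * (LBINT w:{0<..}. \<bar>g w\<bar>)"
        using set_lebesgue_integral_nonneg[of "{0<..}" "\<lambda>w. \<bar>f l w\<bar>" lborel] by simp
    qed
  qed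
  also have "(LBINT w:{0<..}. (\<Sum>l. f l w)) = (LBINT w:{0<..}. \<tau> w * P w)"
  proof (intro set_lebesgue_integral_cong allI impI)
    fix w :: real assume "w \<in> {0<..}"
    then show "(\<Sum>l. f l w) = \<tau> w * P w"
      using sums_mult[OF exw[of w], of "\<tau> w"] by (simp add: f_def sums_iff)
  qed simp
  finally have 1: "(\<lambda>l. LBINT w:{0<..}. f l w) sums (LBINT w:{0<..}. \<tau> w * P w)" .
  have 2: "(LBINT w:{0<..}. f l w) = b l * (LBINT w:{0<..}. \<tau> w * (laguerre_fun l (exp (- w)) - 1))" for l
  proof -
    have "f l = (\<lambda>w. b l * (\<tau> w * (laguerre_fun l (exp (- w)) - 1)))" by (auto simp: f_def)
    then show ?thesis by (simp only: set_integral_mult_right)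
  qed
  have "laguerre_coeff a l * b l = (LBINT w:{0<..}. f l w) + a 0 * b l" for l
    unfolding 2 laguerre_coeff_integral[OF \<tau>(1) \<tau>int a bdd] by (simp add: algebra_simps)
  moreover have "(\<lambda>l. (LBINT w:{0<..}. f l w) + a 0 * b l) sums ((LBINT w:{0<..}. \<tau> w * P w) + a 0 * 0)"
    by (intro sums_add 1 sums_mult b0)
  ultimately show ?thesis by (simp add: b_def)
qed

section \<open>The Hausdorff moment problem\<close>

text \<open>These are Hausdorff's masses of the moment sequence \<open>f\<close> at level \<open>n\<close>; mass \<open>i\<close> sits near
  the point \<open>(n - i)/n\<close>.\<close>

definition hausdorff_mass :: "(nat \<Rightarrow> real) \<Rightarrow> nat \<Rightarrow> nat \<Rightarrow> real" where
  "hausdorff_mass f n i = real (n choose i) * (-1) ^ i * (fdiff ^^ i) f (n - i)"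

text \<open>In terms of the shift \<open>E\<close>, this is the binomial expansion of \<open>1 = (E - \<Delta>)^m\<close>.\<close>

lemma binomial_differences:
  "f k = (\<Sum>i\<le>m. real (m choose i) * (-1) ^ i * (fdiff ^^ i) f (k + (m - i)))"
proof (induction m)
  case (Suc m)
  let ?D = "\<lambda>i. (fdiff ^^ i) f"
  have s: "?D i (k + (m - i)) = ?D i (k + (Suc m - i)) - ?D (Suc i) (k + (m - i))" if "i \<le> m" for i
    using that by (simp add: fdiff_def Suc_diff_le)
  have "(\<Sum>i\<le>Suc m. real (Suc m choose i) * (-1) ^ i * ?D i (k + (Suc m - i))) =
      ?D 0 (k + Suc m) + (\<Sum>i\<le>m. real (Suc m choose Suc i) * (-1) ^ Suc i * ?D (Suc i) (k + (m - i)))"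
    by (subst sum.atMost_Suc_shift) simp
  also have "(\<Sum>i\<le>m. real (Suc m choose Suc i) * (-1) ^ Suc i * ?D (Suc i) (k + (m - i))) =
      (\<Sum>i\<le>m. real (m choose Suc i) * (-1) ^ Suc i * ?D (Suc i) (k + (m - i))) - (\<Sum>i\<le>m. real (m choose i) * (-1) ^ i * ?D (Suc i) (k + (m - i)))"
    unfolding sum_subtractf[symmetric] by (intro sum.cong refl) (simp add: algebra_simps)
  also have "?D 0 (k + Suc m) + ((\<Sum>i\<le>m. real (m choose Suc i) * (-1) ^ Suc i * ?D (Suc i) (k + (m - i))) - (\<Sum>i\<le>m. real (m choose i) * (-1) ^ i * ?D (Suc i) (k + (m - i)))) =
      (\<Sum>i\<le>Suc m. real (m choose i) * (-1) ^ i * ?D i (k + (Suc m - i))) - (\<Sum>i\<le>m. real (m choose i) * (-1) ^ i * ?D (Suc i) (k + (m - i)))"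
    by (subst sum.atMost_Suc_shift) simp
  also have "(\<Sum>i\<le>Suc m. real (m choose i) * (-1) ^ i * ?D i (k + (Suc m - i))) = (\<Sum>i\<le>m. real (m choose i) * (-1) ^ i * ?D i (k + (Suc m - i)))"
    by simp
  also have "\<dots> - (\<Sum>i\<le>m. real (m choose i) * (-1) ^ i * ?D (Suc i) (k + (m - i))) = (\<Sum>i\<le>m. real (m choose i) * (-1) ^ i * ?D i (k + (m - i)))"
    unfolding sum_subtractf[symmetric]
    by (intro sum.cong refl) (simp only: s atMost_iff, simp add: algebra_simps)
  also have "\<dots> = f k" using Suc.IH by simp
  finally show ?case by simp
qed simp

text \<open>The expansion of the previous lemma at level \<open>n - k\<close>, rewritten at level \<open>n\<close>: the masses
  reproduce the moments up to replacing the power \<open>((n - i)/n)^k\<close> by a quotient of binomial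
  coefficients.\<close>

lemma moment_hausdorff_mass:
  assumes "k \<le> n"
  shows "f k = (\<Sum>i\<le>n. hausdorff_mass f n i * (real ((n - i) choose k) / real (n choose k)))"
proof -
  have "f k = (\<Sum>i\<le>n - k. real ((n - k) choose i) * (-1) ^ i * (fdiff ^^ i) f (k + (n - k - i)))"
    by (rule binomial_differences)
  also have "\<dots> = (\<Sum>i\<le>n - k. hausdorff_mass f n i * (real ((n - i) choose k) / real (n choose k)))"
  proof (intro sum.cong refl)
    fix i assume i: "i \<in> {..n - k}"
    then have e: "k + (n - k - i) = n - i" using assms by auto
    have "(n choose (n - i)) * ((n - i) choose k) = (n choose k) * ((n - k) choose (n - i - k))"
      by (rule choose_mult) (use i assms in auto)
    moreover have "n choose (n - i) = n choose i" using i assms by (intro binomial_symmetric[symmetric]) auto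
    moreover have "(n - k) choose (n - i - k) = (n - k) choose i"
    proof -
      have "n - i - k = (n - k) - i" using i by simp
      then show ?thesis using i binomial_symmetric[of i "n - k"] by simp
    qed
    ultimately have "real (n choose i) * real ((n - i) choose k) = real (n choose k) * real ((n - k) choose i)"
      by (metis of_nat_mult)
    moreover have "real (n choose k) > 0" using assms by simp
    ultimately have "real ((n - k) choose i) = real (n choose i) * (real ((n - i) choose k) / real (n choose k))"
      by (simp add: field_simps)
    then show "real ((n - k) choose i) * (-1) ^ i * (fdiff ^^ i) f (k + (n - k - i)) = hausdorff_mass f n i * (real ((n - i) choose k) / real (n choose k))"
      unfolding e hausdorff_mass_def by simp
  qed
  also have "\<dots> = (\<Sum>i\<le>n. hausdorff_mass f n i * (real ((n - i) choose k) / real (n choose k)))"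
    by (rule sum.mono_neutral_left) (use assms in \<open>auto simp: binomial_eq_0\<close>)
  finally show ?thesis .
qed

lemma binomial_ratio_close:
  assumes j: "j \<le> n" and k: "2 * k \<le> n" and n: "n > 0"
  shows "\<bar>real (j choose k) / real (n choose k) - (real j / real (n + 1)) ^ k\<bar> \<le> 2 * real k * (real k + 1) / real n"
proof -
  have c: "real (m choose k) = (\<Prod>i<k. real m - real i) / fact k" for m
    unfolding binomial_gbinomial gbinomial_prod_rev by (simp add: atLeast0LessThan)
  have pos: "real n - real i > 0" "real n - real i \<ge> real n / 2" if "i < k" for i using that k n by auto
  have "real (j choose k) / real (n choose k) = (\<Prod>i<k. (real j - real i) / (real n - real i))"
    unfolding c by (simp add: prod_dividef)
  moreover have "(real j / real (n + 1)) ^ k = (\<Prod>i<k. real j / real (n + 1))" by simp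
  ultimately have "\<bar>real (j choose k) / real (n choose k) - (real j / real (n + 1)) ^ k\<bar> = norm ((\<Prod>i<k. (real j - real i) / (real n - real i)) - (\<Prod>i<k. real j / real (n + 1)))"
    by simp
  also have "\<dots> \<le> (\<Sum>i<k. norm ((real j - real i) / (real n - real i) - real j / real (n + 1)))"
  proof (rule norm_prod_diff)
    fix i assume "i \<in> {..<k}"
    then have i: "i < k" by simp
    have "\<bar>real j - real i\<bar> \<le> real n - real i" using i j k by (auto simp: abs_le_iff)
    then show "norm ((real j - real i) / (real n - real i)) \<le> 1"
      using pos[OF i] by (simp add: divide_le_eq)
    show "norm (real j / real (n + 1)) \<le> 1" using j by simp
  qed
  also have "\<dots> \<le> (\<Sum>i<k. 2 * (real k + 1) / real n)"
  proof (intro sum_mono)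
    fix i assume "i \<in> {..<k}"
    then have i: "i < k" by simp
    note p = pos[OF i]
    have eq: "(real j - real i) / (real n - real i) - real j / real (n + 1) = (real j - real i * (real n + 1 - real j)) / ((real n - real i) * (real n + 1))"
      using p by (simp add: divide_simps) (simp add: algebra_simps)
    have bd: "\<bar>real j - real i * (real n + 1 - real j)\<bar> \<le> (real k + 1) * (real n + 1)"
    proof -
      have "\<bar>real j - real i * (real n + 1 - real j)\<bar> \<le> real j + real i * (real n + 1 - real j)"
        using j by (intro order_trans[OF abs_triangle_ineq4]) (auto simp: abs_mult)
      also have "\<dots> \<le> (real n + 1) + real k * (real n + 1)"
        using i j by (intro add_mono mult_mono) auto
      finally show ?thesis by (simp add: algebra_simps)
    qed
    have "norm ((real j - real i) / (real n - real i) - real j / real (n + 1)) = \<bar>real j - real i * (real n + 1 - real j)\<bar> / ((real n - real i) * (real n + 1))"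
      unfolding eq using p by (simp add: abs_mult)
    also have "\<dots> \<le> ((real k + 1) * (real n + 1)) / ((real n - real i) * (real n + 1))"
      using p by (intro divide_right_mono bd) auto
    also have "\<dots> = (real k + 1) / (real n - real i)"
      by (simp add: add_nonneg_eq_0_iff)
    also have "\<dots> \<le> (real k + 1) / (real n / 2)"
      using p n by (intro divide_left_mono mult_pos_pos) auto
    finally show "norm ((real j - real i) / (real n - real i) - real j / real (n + 1)) \<le> 2 * (real k + 1) / real n"
      by (simp add: mult.commute)
  qed
  also have "\<dots> = 2 * real k * (real k + 1) / real n" by simp
  finally show ?thesis .
qed

definition unit_ramp :: "real \<Rightarrow> real" where "unit_ramp x = min (max x 0) 1"

lemma unit_ramp_simps: "x \<le> 0 \<Longrightarrow> unit_ramp x = 0" "x \<ge> 1 \<Longrightarrow> unit_ramp x = 1" "0 \<le> unit_ramp x" "unit_ramp x \<le> 1"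
  "x \<le> y \<Longrightarrow> unit_ramp x \<le> unit_ramp y"
  by (auto simp: unit_ramp_def)

lemma continuous_unit_ramp [continuous_intros]: "continuous_on S g \<Longrightarrow> continuous_on S (\<lambda>x. unit_ramp (g x))"
  unfolding unit_ramp_def by (intro continuous_intros)

lemma sum_unit_ramp: "x \<ge> 0 \<Longrightarrow> (\<Sum>j<m. unit_ramp (x - real j)) = min x (real m)"
proof (induction m)
  case (Suc m)
  then show ?case by (auto simp: unit_ramp_def min_def max_def)
qed simp

text \<open>The distribution function of the masses, each spread uniformly over a cell of length \<open>1/(n
  + 1)\<close>.\<close>

definition hausdorff_cdf :: "(nat \<Rightarrow> real) \<Rightarrow> nat \<Rightarrow> real \<Rightarrow> real" where
  "hausdorff_cdf f n t = (\<Sum>i\<le>n. hausdorff_mass f n i * unit_ramp (real (n + 1) * t - real (n - i)))"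

lemma sum_unit_ramp_nodes:
  assumes "0 \<le> t" "t \<le> 1"
  shows "(\<Sum>i\<le>n. unit_ramp (real (n + 1) * t - real (n - i))) = real (n + 1) * t"
proof -
  have "(\<Sum>i\<le>n. unit_ramp (real (n + 1) * t - real (n - i))) = (\<Sum>j<Suc n. unit_ramp (real (n + 1) * t - real j))"
    by (rule sum.reindex_bij_witness[of _ "\<lambda>j. n - j" "\<lambda>i. n - i"]) auto
  also have "\<dots> = min (real (n + 1) * t) (real (Suc n))"
    by (rule sum_unit_ramp) (use assms in auto)
  also have "\<dots> = real (n + 1) * t" using assms by (simp add: min_def mult_left_le)
  finally show ?thesis .
qed

text \<open>By Cauchy--Schwarz: the squared masses sum to at most \<open>K/(n + 1)\<close>, and the increments of
  the ramps, lying in \<open>[0,1]\<close>, have squares that sum to at most \<open>(n + 1) (t - s)\<close>.\<close>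

lemma hausdorff_cdf_hoelder:
  assumes K: "real (n + 1) * (\<Sum>i\<le>n. (hausdorff_mass f n i)\<^sup>2) \<le> K" and st: "0 \<le> s" "s \<le> t" "t \<le> 1"
  shows "\<bar>hausdorff_cdf f n t - hausdorff_cdf f n s\<bar> \<le> sqrt K * sqrt (t - s)"
proof -
  define b where "b = (\<lambda>i. unit_ramp (real (n + 1) * t - real (n - i)) - unit_ramp (real (n + 1) * s - real (n - i)))"
  have b: "0 \<le> b i" "b i \<le> 1" for i
  proof -
    show "0 \<le> b i" unfolding b_def using st by (simp add: unit_ramp_simps(5) mult_left_mono)
    show "b i \<le> 1"
      unfolding b_def using unit_ramp_simps(3)[of "real (n + 1) * s - real (n - i)"] unit_ramp_simps(4)[of "real (n + 1) * t - real (n - i)"] by linarith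
  qed
  have d: "hausdorff_cdf f n t - hausdorff_cdf f n s = (\<Sum>i\<le>n. hausdorff_mass f n i * b i)"
    by (simp add: hausdorff_cdf_def b_def sum_subtractf right_diff_distrib)
  have "(\<Sum>i\<le>n. (b i)\<^sup>2) \<le> (\<Sum>i\<le>n. b i)"
    using b by (intro sum_mono) (simp add: power2_eq_square mult_left_le)
  also have "\<dots> = real (n + 1) * (t - s)"
    unfolding b_def sum_subtractf using sum_unit_ramp_nodes[of t n] sum_unit_ramp_nodes[of s n] st by (simp add: right_diff_distrib)
  finally have B: "(\<Sum>i\<le>n. (b i)\<^sup>2) \<le> real (n + 1) * (t - s)" .
  have "(\<Sum>i\<le>n. hausdorff_mass f n i * b i)\<^sup>2 \<le> (\<Sum>i\<le>n. (hausdorff_mass f n i)\<^sup>2) * (\<Sum>i\<le>n. (b i)\<^sup>2)"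
    by (rule Cauchy_Schwarz_ineq_sum)
  also have "\<dots> \<le> (\<Sum>i\<le>n. (hausdorff_mass f n i)\<^sup>2) * (real (n + 1) * (t - s))"
    by (intro mult_left_mono B sum_nonneg) auto
  also have "\<dots> = (real (n + 1) * (\<Sum>i\<le>n. (hausdorff_mass f n i)\<^sup>2)) * (t - s)" by simp
  also have "\<dots> \<le> K * (t - s)" by (intro mult_right_mono K) (use st in auto)
  finally have "\<bar>\<Sum>i\<le>n. hausdorff_mass f n i * b i\<bar> \<le> sqrt (K * (t - s))"
    by (rule real_le_rsqrt[of "\<bar>x\<bar>" for x, simplified])
  then show ?thesis unfolding d by (simp add: real_sqrt_mult)
qed

lemma hausdorff_cdf_0: "hausdorff_cdf f n 0 = 0"
  by (simp add: hausdorff_cdf_def unit_ramp_simps)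

lemma hausdorff_cdf_1: "hausdorff_cdf f n 1 = f 0"
proof -
  have "hausdorff_cdf f n 1 = (\<Sum>i\<le>n. hausdorff_mass f n i)"
    unfolding hausdorff_cdf_def by (intro sum.cong refl) (simp add: unit_ramp_simps(2))
  then show ?thesis using moment_hausdorff_mass[of 0 n f] by simp
qed

text \<open>Up to its ramp the integrand is the derivative of \<open>t^k\<close>; the ramp is squeezed between the
  indicators of \<open>[\<beta>,1]\<close> and \<open>[\<alpha>,1]\<close>, where \<open>[\<alpha>,\<beta>]\<close> is the cell.\<close>

lemma unit_ramp_moment:
  assumes j: "j \<le> n" and k: "k \<ge> 1"
  shows "\<bar>integral {0..1} (\<lambda>t. real k * t ^ (k - 1) * unit_ramp (real (n + 1) * t - real j)) - (1 - (real j / real (n + 1)) ^ k)\<bar> \<le> real k / real (n + 1)"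
proof -
  define \<alpha> \<beta> where "\<alpha> = real j / real (n + 1)" and "\<beta> = (real j + 1) / real (n + 1)"
  have ab: "0 \<le> \<alpha>" "\<alpha> \<le> \<beta>" "\<beta> \<le> 1" "\<beta> - \<alpha> = 1 / real (n + 1)"
    using j by (auto simp: \<alpha>_def \<beta>_def divide_right_mono simp flip: diff_divide_distrib)
  let ?g = "\<lambda>t. real k * t ^ (k - 1) * unit_ramp (real (n + 1) * t - real j)"
  have gI: "?g integrable_on {0..1}"
    by (intro integrable_continuous_real continuous_intros)
  have ftc: "((\<lambda>t. if t \<in> {c..1} then real k * t ^ (k - 1) else 0) has_integral (1 - c ^ k)) {0..1}" if "0 \<le> c" "c \<le> 1" for c
  proof -
    have "((\<lambda>t. real k * t ^ (k - 1)) has_integral (1 ^ k - c ^ k)) {c..1}"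
      using that by (intro fundamental_theorem_of_calculus)
        (auto intro!: derivative_eq_intros simp flip: has_real_derivative_iff_has_vector_derivative)
    then have "((\<lambda>t. real k * t ^ (k - 1)) has_integral (1 - c ^ k)) {c..1}" by simp
    then show ?thesis by (subst has_integral_restrict) (use that in auto)
  qed
  have lo: "1 - \<beta> ^ k \<le> integral {0..1} ?g"
  proof (rule has_integral_le[OF ftc integrable_integral[OF gI]])
    fix t :: real assume t: "t \<in> {0..1}"
    show "(if t \<in> {\<beta>..1} then real k * t ^ (k - 1) else 0) \<le> ?g t"
    proof (cases "t \<in> {\<beta>..1}")
      case True
      then have "real (n + 1) * \<beta> \<le> real (n + 1) * t" by (intro mult_left_mono) auto
      then have "unit_ramp (real (n + 1) * t - real j) = 1" by (intro unit_ramp_simps) (simp add: \<beta>_def)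
      then show ?thesis using True t by auto
    next
      case False
      have "0 \<le> ?g t" using t unit_ramp_simps(3) by (intro mult_nonneg_nonneg) auto
      then show ?thesis by (simp only: False if_False)
    qed
  qed (use ab in auto)
  have hi: "integral {0..1} ?g \<le> 1 - \<alpha> ^ k"
  proof (rule has_integral_le[OF integrable_integral[OF gI] ftc])
    fix t :: real assume t: "t \<in> {0..1}"
    show "?g t \<le> (if t \<in> {\<alpha>..1} then real k * t ^ (k - 1) else 0)"
    proof (cases "t \<in> {\<alpha>..1}")
      case True
      then show ?thesis using t unit_ramp_simps(4) by (auto intro!: mult_left_le)
    next
      case False
      then have "real (n + 1) * t \<le> real (n + 1) * \<alpha>" using t by (intro mult_left_mono) auto
      then have "unit_ramp (real (n + 1) * t - real j) = 0" by (intro unit_ramp_simps) (simp add: \<alpha>_def)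
      then show ?thesis by (simp only: False if_False mult_zero_right order_refl)
    qed
  qed (use ab in auto)
  have "\<beta> ^ k - \<alpha> ^ k \<le> real k * (\<beta> - \<alpha>)"
  proof -
    have "norm ((\<Prod>i<k. \<beta>) - (\<Prod>i<k. \<alpha>)) \<le> (\<Sum>i<k. norm (\<beta> - \<alpha>))"
      by (rule norm_prod_diff) (use ab in auto)
    then show ?thesis using ab by simp
  qed
  then have "\<beta> ^ k - \<alpha> ^ k \<le> real k / real (n + 1)" using ab by simp
  then show ?thesis using lo hi by (simp add: \<alpha>_def abs_le_iff)
qed

lemma hausdorff_cdf_moment:
  assumes K: "real (n + 1) * (\<Sum>i\<le>n. (hausdorff_mass f n i)\<^sup>2) \<le> K"
    and k: "k \<ge> 1" "2 * k \<le> n"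
  shows "\<bar>integral {0..1} (\<lambda>t. real k * t ^ (k - 1) * hausdorff_cdf f n t) - (f 0 - f k)\<bar> \<le> sqrt K * (real k / real (n + 1) + 2 * real k * (real k + 1) / real n)"
proof -
  define I where "I = (\<lambda>i. integral {0..1} (\<lambda>t. real k * t ^ (k - 1) * unit_ramp (real (n + 1) * t - real (n - i))))"
  define r where "r = (\<lambda>i. real ((n - i) choose k) / real (n choose k))"
  define E where "E = real k / real (n + 1) + 2 * real k * (real k + 1) / real n"
  have n: "n > 0" using k by simp
  have "integral {0..1} (\<lambda>t. real k * t ^ (k - 1) * hausdorff_cdf f n t) = integral {0..1} (\<lambda>t. \<Sum>i\<le>n. hausdorff_mass f n i * (real k * t ^ (k - 1) * unit_ramp (real (n + 1) * t - real (n - i))))"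
    by (simp add: hausdorff_cdf_def sum_distrib_left mult_ac)
  also have "\<dots> = (\<Sum>i\<le>n. hausdorff_mass f n i * I i)"
    unfolding I_def
    by (subst integral_sum) (auto intro!: integrable_continuous_real continuous_intros)
  finally have 1: "integral {0..1} (\<lambda>t. real k * t ^ (k - 1) * hausdorff_cdf f n t) = (\<Sum>i\<le>n. hausdorff_mass f n i * I i)" .
  have 2: "f 0 - f k = (\<Sum>i\<le>n. hausdorff_mass f n i * (1 - r i))"
    using moment_hausdorff_mass[of 0 n f] moment_hausdorff_mass[of k n f] k by (simp add: r_def right_diff_distrib sum_subtractf)
  have e: "\<bar>I i - (1 - r i)\<bar> \<le> E" for i
  proof -
    have "\<bar>I i - (1 - (real (n - i) / real (n + 1)) ^ k)\<bar> \<le> real k / real (n + 1)"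
      unfolding I_def by (rule unit_ramp_moment) (use k in auto)
    moreover have "\<bar>r i - (real (n - i) / real (n + 1)) ^ k\<bar> \<le> 2 * real k * (real k + 1) / real n"
      unfolding r_def by (rule binomial_ratio_close) (use k n in auto)
    ultimately show ?thesis unfolding E_def by linarith
  qed
  have E0: "E \<ge> 0" by (simp add: E_def)
  have "(\<Sum>i\<le>n. \<bar>hausdorff_mass f n i\<bar> * 1)\<^sup>2 \<le> (\<Sum>i\<le>n. \<bar>hausdorff_mass f n i\<bar>\<^sup>2) * (\<Sum>i\<le>n. 1\<^sup>2)"
    by (rule Cauchy_Schwarz_ineq_sum)
  also have "\<dots> = real (n + 1) * (\<Sum>i\<le>n. (hausdorff_mass f n i)\<^sup>2)" by (simp add: algebra_simps)
  finally have tv: "(\<Sum>i\<le>n. \<bar>hausdorff_mass f n i\<bar>) \<le> sqrt K"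
    using K by (intro real_le_rsqrt) simp
  have "\<bar>(\<Sum>i\<le>n. hausdorff_mass f n i * I i) - (\<Sum>i\<le>n. hausdorff_mass f n i * (1 - r i))\<bar> = \<bar>\<Sum>i\<le>n. hausdorff_mass f n i * (I i - (1 - r i))\<bar>"
    by (simp only: sum_subtractf[symmetric] right_diff_distrib[symmetric])
  also have "\<dots> \<le> (\<Sum>i\<le>n. \<bar>hausdorff_mass f n i * (I i - (1 - r i))\<bar>)" by (rule sum_abs)
  also have "\<dots> \<le> (\<Sum>i\<le>n. \<bar>hausdorff_mass f n i\<bar> * E)"
    unfolding abs_mult by (intro sum_mono mult_left_mono e) auto
  also have "\<dots> = (\<Sum>i\<le>n. \<bar>hausdorff_mass f n i\<bar>) * E" by (simp add: sum_distrib_right)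
  also have "\<dots> \<le> sqrt K * E" by (intro mult_right_mono tv E0)
  finally show ?thesis unfolding 1 2 E_def .
qed

text \<open>A Hausdorff-type existence theorem for the moment problem: \<open>U\<close> is the limit of the
  distribution functions by Arzela--Ascoli. Moments are stated after integration by parts, which
  avoids Stieltjes integrals and a density of \<open>U\<close>.\<close>

theorem hausdorff_moments:
  assumes K: "\<And>n. real (n + 1) * (\<Sum>i\<le>n. (hausdorff_mass f n i)\<^sup>2) \<le> K"
  obtains U where "continuous_on {0..1} U"
    "\<And>s t. 0 \<le> s \<Longrightarrow> s \<le> t \<Longrightarrow> t \<le> 1 \<Longrightarrow> \<bar>U t - U s\<bar> \<le> sqrt K * sqrt (t - s)"
    "U 1 = f 0"
    "\<And>k. k \<ge> 1 \<Longrightarrow> integral {0..1} (\<lambda>t. real k * t ^ (k - 1) * U t) = f 0 - f k"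
proof -
  have K0: "K \<ge> 0"
    using K[of 0] sum_nonneg[of "{..0}" "\<lambda>i. (hausdorff_mass f 0 i)\<^sup>2"] by (smt (verit) mult_nonneg_nonneg of_nat_0_le_iff zero_le_power2)
  note H = hausdorff_cdf_hoelder[OF K]
  have Hs: "\<bar>hausdorff_cdf f n t - hausdorff_cdf f n s\<bar> \<le> sqrt K * sqrt \<bar>t - s\<bar>" if "s \<in> {0..1}" "t \<in> {0..1}" for n s t
    using H[of s t n] H[of t s n] that by (cases "s \<le> t") (auto simp: abs_minus_commute)
  obtain U r where U: "continuous_on {0..1::real} U" and r: "strict_mono (r :: nat \<Rightarrow> nat)"
    and lim: "\<And>e. 0 < e \<Longrightarrow> \<exists>N. \<forall>n x. n \<ge> N \<and> x \<in> {0..1} \<longrightarrow> norm (hausdorff_cdf f (r n) x - U x) < e"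
  proof (rule Arzela_Ascoli[of "{0..1::real}" "hausdorff_cdf f" "sqrt K"])
    show "norm (hausdorff_cdf f n x) \<le> sqrt K" if "x \<in> {0..1}" for n x
    proof -
      have "\<bar>hausdorff_cdf f n x - hausdorff_cdf f n 0\<bar> \<le> sqrt K * sqrt \<bar>x - 0\<bar>" using that by (intro Hs) auto
      also have "\<dots> \<le> sqrt K * 1" using that K0 by (intro mult_left_mono) auto
      finally show ?thesis by (simp add: hausdorff_cdf_0)
    qed
    show "\<exists>d. 0 < d \<and> (\<forall>n y. y \<in> {0..1} \<and> norm (x - y) < d \<longrightarrow> norm (hausdorff_cdf f n x - hausdorff_cdf f n y) < e)"
      if x: "x \<in> {0..1}" and e: "e > 0" for x e
    proof (intro exI[of _ "(e / (sqrt K + 1))\<^sup>2"] conjI allI impI)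
      have s: "sqrt K + 1 > 0" using K0 by (simp add: add_nonneg_pos)
      then show "0 < (e / (sqrt K + 1))\<^sup>2" using e by simp
      fix n y assume y: "y \<in> {0..1} \<and> norm (x - y) < (e / (sqrt K + 1))\<^sup>2"
      then have "sqrt \<bar>x - y\<bar> < e / (sqrt K + 1)"
        using e s by (intro real_less_lsqrt) auto
      then have "(sqrt K + 1) * sqrt \<bar>x - y\<bar> < e" using s by (simp add: pos_less_divide_eq mult.commute)
      moreover have "norm (hausdorff_cdf f n x - hausdorff_cdf f n y) \<le> sqrt K * sqrt \<bar>x - y\<bar>"
        using Hs[of y x n] x y by simp
      moreover have "sqrt K * sqrt \<bar>x - y\<bar> \<le> (sqrt K + 1) * sqrt \<bar>x - y\<bar>"
        by (intro mult_right_mono) auto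
      ultimately show "norm (hausdorff_cdf f n x - hausdorff_cdf f n y) < e" by linarith
    qed
  qed auto
  have pw: "(\<lambda>n. hausdorff_cdf f (r n) x) \<longlonglongrightarrow> U x" if "x \<in> {0..1}" for x
    unfolding LIMSEQ_iff using lim that by blast
  have unif: "uniform_limit {0..1} (\<lambda>n. hausdorff_cdf f (r n)) U sequentially"
    unfolding uniform_limit_iff eventually_sequentially dist_norm using lim by (meson order_refl)
  have rtop: "filterlim r at_top sequentially" by (rule filterlim_subseq[OF r])
  show ?thesis
  proof (rule that[OF U])
    show "U 1 = f 0" using pw[of 1] by (simp add: hausdorff_cdf_1 LIMSEQ_const_iff)
    fix s t :: real assume st: "0 \<le> s" "s \<le> t" "t \<le> 1"
    have "(\<lambda>n. \<bar>hausdorff_cdf f (r n) t - hausdorff_cdf f (r n) s\<bar>) \<longlonglongrightarrow> \<bar>U t - U s\<bar>"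
      using st by (intro tendsto_intros pw) auto
    then show "\<bar>U t - U s\<bar> \<le> sqrt K * sqrt (t - s)"
      by (rule LIMSEQ_le_const2) (use H st in auto)
  next
    fix k :: nat assume k: "k \<ge> 1"
    have ci: "continuous_on {0..1} (hausdorff_cdf f n)" for n
      unfolding hausdorff_cdf_def by (intro continuous_intros)
    have ul: "uniform_limit (cbox 0 1) (\<lambda>n t. real k * t ^ (k - 1) * hausdorff_cdf f (r n) t) (\<lambda>t. real k * t ^ (k - 1) * U t) sequentially"
    proof -
      have "bounded (U ` {0..1})" by (intro compact_imp_bounded compact_continuous_image U) auto
      moreover have "bounded ((\<lambda>t. real k * t ^ (k - 1)) ` {0..1::real})"
        by (intro compact_imp_bounded compact_continuous_image continuous_intros) auto
      ultimately show ?thesis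
        using unif by (intro uniform_lim_mult uniform_limit_const) auto
    qed
    have "(\<lambda>n. integral (cbox 0 1) (\<lambda>t. real k * t ^ (k - 1) * hausdorff_cdf f (r n) t)) \<longlonglongrightarrow> integral (cbox 0 1) (\<lambda>t. real k * t ^ (k - 1) * U t)"
    proof -
      have c: "continuous_on (cbox 0 1) (\<lambda>t. real k * t ^ (k - 1) * hausdorff_cdf f (r n) t)" for n
        using ci by (auto intro!: continuous_intros)
      obtain I J where IJ: "\<And>n. ((\<lambda>t. real k * t ^ (k - 1) * hausdorff_cdf f (r n) t) has_integral I n) (cbox 0 1)"
        "((\<lambda>t. real k * t ^ (k - 1) * U t) has_integral J) (cbox 0 1)" "I \<longlonglongrightarrow> J"
        by (rule uniform_limit_integral_cbox[OF ul c]) auto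
      have "I = (\<lambda>n. integral (cbox 0 1) (\<lambda>t. real k * t ^ (k - 1) * hausdorff_cdf f (r n) t))"
        using IJ(1) by (intro ext integral_unique[symmetric])
      moreover have "J = integral (cbox 0 1) (\<lambda>t. real k * t ^ (k - 1) * U t)"
        using IJ(2) by (rule integral_unique[symmetric])
      ultimately show ?thesis using IJ(3) by (simp only:)
    qed
    moreover have "(\<lambda>n. integral (cbox 0 1) (\<lambda>t. real k * t ^ (k - 1) * hausdorff_cdf f (r n) t)) \<longlonglongrightarrow> f 0 - f k"
    proof -
      have "((\<lambda>n. sqrt K * (real k / real (n + 1) + 2 * real k * (real k + 1) / real n)) \<longlongrightarrow> 0) sequentially"
        by real_asymp
      then have z: "(\<lambda>n. sqrt K * (real k / real (r n + 1) + 2 * real k * (real k + 1) / real (r n))) \<longlonglongrightarrow> 0"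
        by (rule filterlim_compose[OF _ rtop])
      have ev: "\<forall>\<^sub>F n in sequentially. r n \<ge> 2 * k" using rtop by (simp add: filterlim_at_top)
      have "(\<lambda>n. integral (cbox 0 1) (\<lambda>t. real k * t ^ (k - 1) * hausdorff_cdf f (r n) t) - (f 0 - f k)) \<longlonglongrightarrow> 0"
        by (rule Lim_null_comparison[OF eventually_mono[OF ev] z]) (use hausdorff_cdf_moment[OF K k] in auto)
      then show ?thesis by (simp add: LIM_zero_iff)
    qed
    ultimately show "integral {0..1} (\<lambda>t. real k * t ^ (k - 1) * U t) = f 0 - f k"
      using LIMSEQ_unique by fastforce
  qed
qed

section \<open>The Legendre coefficients as Laplace transforms\<close>

lemma power_le_exp_powr:
  fixes w q c :: real
  assumes "w \<ge> 0" "q > 0" "c > 0"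
  shows "w powr q \<le> (q / c) powr q * exp (c * w)"
proof -
  have "w * (c / q) \<le> exp (w * (c / q))"
    using exp_ge_add_one_self[of "w * (c / q)"] by linarith
  then have "(w * (c / q)) powr q \<le> exp (w * (c / q)) powr q"
    using assms by (intro powr_mono2) auto
  also have "\<dots> = exp (c * w)" using assms by (simp add: exp_powr_real)
  finally have "(q / c) powr q * (w * (c / q)) powr q \<le> (q / c) powr q * exp (c * w)"
    by (intro mult_left_mono) auto
  moreover have "(q / c) powr q * (w * (c / q)) powr q = w powr q"
    using assms by (simp flip: powr_mult)
  ultimately show ?thesis by simp
qed

lemma Gamma_integral_scaled:
  fixes q :: real and k :: real
  assumes q: "q > 0" and k: "k > 0"
  shows "set_integrable lborel {0<..} (\<lambda>x. x powr (q - 1) * exp (- k * x))"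
    and "(LBINT x:{0<..}. x powr (q - 1) * exp (- k * x)) = Gamma q / k powr q"
proof -
  let ?G = "\<lambda>t. t powr (q - 1) * exp (- t)"
  have m: "set_borel_measurable lborel {0<..} ?G" "set_borel_measurable lborel {0<..} (\<lambda>x. x powr (q - 1) * exp (- k * x))"
    by (auto simp: set_borel_measurable_def)
  have G: "(?G has_integral Gamma q) {0<..}"
  proof -
    have "((\<lambda>t. t powr (q - 1) / exp t) has_integral Gamma q) {0..}" by (rule Gamma_integral_real[OF q])
    then have "((\<lambda>t. if t \<in> {0<..} then ?G t else 0) has_integral Gamma q) {0..}"
      by (rule has_integral_spike[of "{0}", rotated 2]) (auto simp: exp_minus divide_inverse)
    then show ?thesis by (subst (asm) has_integral_restrict) auto
  qed
  have Gi: "set_integrable lborel {0<..} ?G"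
  proof -
    have "?G absolutely_integrable_on {0<..}"
      using G by (intro nonnegative_absolutely_integrable_1) (auto simp: has_integral_integrable)
    then show ?thesis using m(1) unfolding set_integrable_def set_borel_measurable_def
      by (simp add: integrable_completion)
  qed
  have Gv: "(LBINT t:{0<..}. ?G t) = Gamma q"
    using set_borel_integral_eq_integral(2)[OF Gi] integral_unique[OF G] by simp
  have img: "(\<lambda>x. k * x) ` {0<..} = {0::real<..}"
  proof (intro equalityI subsetI)
    fix x :: real assume "x \<in> {0<..}"
    then show "x \<in> (\<lambda>x. k * x) ` {0<..}" using k by (intro image_eqI[of _ _ "x / k"]) auto
  qed (use k in auto)
  have e: "\<bar>k\<bar> * ?G (k * x) = k powr q * (x powr (q - 1) * exp (- k * x))" if "x \<in> {0<..}" for x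
  proof -
    have "k * k powr (q - 1) = k powr q" using k by (simp add: powr_mult_base)
    then show ?thesis using that k by (simp add: powr_mult)
  qed
  have m2: "set_borel_measurable lborel {0<..} (\<lambda>x. \<bar>k\<bar> * ?G (k * x))"
    by (auto simp: set_borel_measurable_def)
  have d: "((\<lambda>x. k * x) has_real_derivative k) (at x within {0<..})" for x
    by (auto intro!: derivative_eq_intros)
  have inj: "inj_on (\<lambda>x. k * x) {0<..}" using k by (auto simp: inj_on_def)
  note cov = lborel_change_of_variables[OF _ img _ d inj m(1) m2]
  have 1: "set_integrable lborel {0<..} (\<lambda>x. k powr q * (x powr (q - 1) * exp (- k * x)))"
  proof -
    have "set_integrable lborel {0<..} (\<lambda>x. \<bar>k\<bar> * ?G (k * x))" using cov(1) Gi by simp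
    then show ?thesis by (rule set_integrable_cong[THEN iffD1, rotated -1]) (use e in auto)
  qed
  have "set_integrable lborel {0<..} (\<lambda>x. (1 / k powr q) * (k powr q * (x powr (q - 1) * exp (- k * x))))"
    by (rule set_integrable_mult_right[OF 1])
  then show "set_integrable lborel {0<..} (\<lambda>x. x powr (q - 1) * exp (- k * x))" using k by simp
  have "k powr q * (LBINT x:{0<..}. x powr (q - 1) * exp (- k * x)) = (LBINT x:{0<..}. k powr q * (x powr (q - 1) * exp (- k * x)))"
    by (rule set_integral_mult_right[symmetric])
  also have "\<dots> = (LBINT x:{0<..}. \<bar>k\<bar> * ?G (k * x))"
    by (intro set_lebesgue_integral_cong) (use e in auto)
  also have "\<dots> = Gamma q" using cov(2) Gv by simp
  finally show "(LBINT x:{0<..}. x powr (q - 1) * exp (- k * x)) = Gamma q / k powr q"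
    using k by (simp add: field_simps)
qed

lemma powr_integral_0:
  fixes q w :: real
  assumes q: "q > 0" and w: "w > 0"
  shows "set_integrable lborel {0<..<w} (\<lambda>x. x powr (q - 1))"
    and "(LBINT x:{0<..<w}. x powr (q - 1)) = w powr q / q"
proof -
  have e: "einterval 0 w = {0<..<w}" by (auto simp: einterval_def zero_ereal_def)
  have D: "((\<lambda>x. x powr q / q) has_real_derivative x powr (q - 1)) (at x)" if "x > 0" for x
    using that q by (auto intro!: derivative_eq_intros)
  have A: "(((\<lambda>x. x powr q / q) \<circ> real_of_ereal) \<longlongrightarrow> 0) (at_right 0)"
  proof -
    have "((\<lambda>x. x powr q / q) \<longlongrightarrow> 0) (at_right 0)"
      using q by (auto intro!: tendsto_eq_intros simp: eventually_at_filter)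
    then show ?thesis unfolding zero_ereal_def ereal_tendsto_simps by simp
  qed
  have B: "(((\<lambda>x. x powr q / q) \<circ> real_of_ereal) \<longlongrightarrow> w powr q / q) (at_left (ereal w))"
    unfolding ereal_tendsto_simps using w q by (auto intro!: tendsto_intros)
  have c: "isCont (\<lambda>x. x powr (q - 1)) x" if "x > 0" for x
    using that by (auto intro!: continuous_intros)
  have le: "(0::ereal) < ereal w" using w by (simp add: zero_ereal_def)
  have "set_integrable lborel (einterval 0 w) (\<lambda>x. x powr (q - 1))"
    by (rule interval_integral_FTC_nonneg(1)[OF le _ _ _ A B]) (use D c in \<open>auto simp: zero_ereal_def\<close>)
  then show "set_integrable lborel {0<..<w} (\<lambda>x. x powr (q - 1))" by (simp add: e)
  have "(LBINT x=0..w. x powr (q - 1)) = w powr q / q - 0"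
    by (rule interval_integral_FTC_nonneg(2)[OF le _ _ _ A B]) (use D c in \<open>auto simp: zero_ereal_def\<close>)
  then show "(LBINT x:{0<..<w}. x powr (q - 1)) = w powr q / q"
    using le by (simp add: interval_lebesgue_integral_le_eq e less_imp_le)
qed

text \<open>The Riemann--Liouville integral \<open>T(w) = 1/\<Gamma>(q) \<integral> x^(q-1) V(w - x) dx\<close> is a convolution, so
  its Laplace transform is that of \<open>V\<close> divided by \<open>k^q\<close>. Hoelder continuity of \<open>V\<close> gives both
  the continuity of \<open>T\<close> and its behaviour \<open>sqrt w\<close> at 0; the polynomial growth is absorbed in a
  small exponential.\<close>

lemma fractional_integral:
  fixes V :: "real \<Rightarrow> real" and q K :: real
  assumes q: "q > 0" and K: "K \<ge> 0"
    and hoelder: "\<And>s t. \<bar>V t - V s\<bar> \<le> K * sqrt \<bar>t - s\<bar>"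
    and V0: "\<And>w. w \<le> 0 \<Longrightarrow> V w = 0"
    and bdd: "\<And>w. \<bar>V w\<bar> \<le> K"
  obtains T C where "continuous_on UNIV T" "\<And>w. w \<le> 0 \<Longrightarrow> T w = 0" "C \<ge> 0"
    "\<And>w. w > 0 \<Longrightarrow> \<bar>T w\<bar> \<le> C * (sqrt w * exp (w / 32))"
    "\<And>k. k > 0 \<Longrightarrow> (LBINT w:{0<..}. exp (- k * w) * T w) = (LBINT w:{0<..}. exp (- k * w) * V w) / k powr q"
proof -
  define J where "J = (\<lambda>w. LBINT x:{0<..}. x powr (q - 1) * V (w - x))"
  define T where "T = (\<lambda>w. J w / Gamma q)"
  have G: "Gamma q > 0" using q by (rule Gamma_real_pos)
  have Vc: "continuous_on UNIV V"
  proof -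
    have "isCont V x" for x
    proof -
      have "((\<lambda>t. K * sqrt \<bar>t - x\<bar>) \<longlongrightarrow> K * sqrt \<bar>x - x\<bar>) (at x)" by (intro tendsto_intros)
      then have "((\<lambda>t. K * sqrt \<bar>t - x\<bar>) \<longlongrightarrow> 0) (at x)" by simp
      then have "((\<lambda>t. V t - V x) \<longlongrightarrow> 0) (at x)"
        by (rule Lim_null_comparison[rotated]) (use hoelder in auto)
      then show ?thesis by (simp add: isCont_def LIM_zero_iff)
    qed
    then show ?thesis by (simp add: continuous_on_eq_continuous_at)
  qed
  have [measurable]: "V \<in> borel_measurable borel" by (rule borel_measurable_continuous_onI[OF Vc])
  have zero: "V (w - x) = 0" if "x \<ge> w" for w x using V0 that by simp
  have Vs: "\<bar>V w\<bar> \<le> K * sqrt w" if "w \<ge> 0" for w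
    using hoelder[of w 0] V0[of 0] that by simp
  have cut: "indicator {0<..} x *\<^sub>R (x powr (q - 1) * F x) = indicator {0<..<w} x *\<^sub>R (x powr (q - 1) * F x)"
    if "\<And>x. x \<ge> w \<Longrightarrow> F x = 0" for w x and F :: "real \<Rightarrow> real"
    using that by (auto simp: indicator_def)
  have Fint: "set_integrable lborel {0<..} (\<lambda>x. x powr (q - 1) * F x)" "\<bar>LBINT x:{0<..}. x powr (q - 1) * F x\<bar> \<le> B * (w powr q / q)"
    if F: "F \<in> borel_measurable borel" "\<And>x. x \<ge> w \<Longrightarrow> F x = 0" "\<And>x. \<bar>F x\<bar> \<le> B" and w: "w > 0" for w B and F :: "real \<Rightarrow> real"
  proof -
    have cutF: "(\<lambda>x. indicator {0<..} x *\<^sub>R (x powr (q - 1) * F x)) = (\<lambda>x. indicator {0<..<w} x *\<^sub>R (x powr (q - 1) * F x))"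
      by (rule ext, rule cut) (rule F(2))
    have i: "set_integrable lborel {0<..<w} (\<lambda>x. B * x powr (q - 1))"
      using powr_integral_0(1)[OF q w] by simp
    have B: "B \<ge> 0" using F(3)[of 0] by linarith
    have j: "set_integrable lborel {0<..<w} (\<lambda>x. x powr (q - 1) * F x)"
      by (rule set_integrable_bound[OF i])
         (use F(1,3) B in \<open>auto simp: set_borel_measurable_def abs_mult mult.commute intro!: AE_I2 mult_left_mono\<close>)
    then show "set_integrable lborel {0<..} (\<lambda>x. x powr (q - 1) * F x)"
      unfolding set_integrable_def cutF .
    have "(LBINT x:{0<..}. x powr (q - 1) * F x) = (LBINT x:{0<..<w}. x powr (q - 1) * F x)"
      unfolding set_lebesgue_integral_def cutF ..
    also have "\<bar>\<dots>\<bar> \<le> (LBINT x:{0<..<w}. \<bar>x powr (q - 1) * F x\<bar>)"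
      unfolding set_lebesgue_integral_def
      by (rule order_trans[OF integral_abs_bound]) (simp add: abs_mult)
    also have "\<dots> \<le> (LBINT x:{0<..<w}. B * x powr (q - 1))"
      by (intro set_integral_mono set_integrable_abs j i) (use F(3) in \<open>auto simp: abs_mult mult.commute intro!: mult_left_mono\<close>)
    also have "\<dots> = B * (w powr q / q)" using powr_integral_0(2)[OF q w] by simp
    finally show "\<bar>LBINT x:{0<..}. x powr (q - 1) * F x\<bar> \<le> B * (w powr q / q)" .
  qed
  have T0: "T w = 0" if "w \<le> 0" for w
  proof -
    have "J w = (LBINT x:{0::real<..}. 0)"
      unfolding J_def by (intro set_lebesgue_integral_cong) (use that V0 in auto)
    then show ?thesis by (simp add: T_def)
  qed
  have Jb: "\<bar>J w\<bar> \<le> (K * sqrt w) * (w powr q / q)" if w: "w > 0" for w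
  proof -
    have "\<bar>LBINT x:{0<..}. x powr (q - 1) * (if x > 0 then V (w - x) else 0)\<bar> \<le> (K * sqrt w) * (w powr q / q)"
    proof (rule Fint(2)[OF _ _ _ w])
      show "\<bar>if x > 0 then V (w - x) else 0\<bar> \<le> K * sqrt w" for x
      proof (cases "x > 0 \<and> x < w")
        case True
        then have "\<bar>V (w - x)\<bar> \<le> K * sqrt (w - x)" by (intro Vs) auto
        also have "\<dots> \<le> K * sqrt w" using True K by (intro mult_left_mono) auto
        finally show ?thesis using True by simp
      qed (use zero K w in auto)
    qed (use zero in auto)
    also have "(LBINT x:{0<..}. x powr (q - 1) * (if x > 0 then V (w - x) else 0)) = J w"
      unfolding J_def by (intro set_lebesgue_integral_cong) auto
    finally show ?thesis .
  qed
  have Jint: "set_integrable lborel {0<..} (\<lambda>x. x powr (q - 1) * V (w - x))" for w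
    by (rule Fint(1)[of _ "max w 1" K]) (use zero bdd in auto)
  have Jd: "\<bar>J w' - J w\<bar> \<le> K * sqrt \<bar>w' - w\<bar> * (max (max w w') 1 powr q / q)" for w w'
  proof -
    have "J w' - J w = (LBINT x:{0<..}. x powr (q - 1) * (V (w' - x) - V (w - x)))"
      unfolding J_def right_diff_distrib by (rule set_integral_diff(2)[OF Jint Jint, symmetric])
    also have "\<bar>\<dots>\<bar> \<le> K * sqrt \<bar>w' - w\<bar> * (max (max w w') 1 powr q / q)"
    proof (rule Fint(2))
      show "\<bar>V (w' - x) - V (w - x)\<bar> \<le> K * sqrt \<bar>w' - w\<bar>" for x
        using hoelder[of "w' - x" "w - x"] by simp
    qed (use zero in auto)
    finally show ?thesis .
  qed
  have Tc: "continuous_on UNIV T"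
  proof -
    have "isCont J x" for x
    proof -
      have "((\<lambda>t. K * sqrt \<bar>t - x\<bar> * (max (max x t) 1 powr q / q)) \<longlongrightarrow> K * sqrt \<bar>x - x\<bar> * (max (max x x) 1 powr q / q)) (at x)"
        by (intro tendsto_intros) (use q in auto)
      then have "((\<lambda>t. K * sqrt \<bar>t - x\<bar> * (max (max x t) 1 powr q / q)) \<longlongrightarrow> 0) (at x)" by simp
      then have "((\<lambda>t. J t - J x) \<longlongrightarrow> 0) (at x)"
        by (rule Lim_null_comparison[rotated]) (use Jd in auto)
      then show ?thesis by (simp add: isCont_def LIM_zero_iff)
    qed
    then have "continuous_on UNIV J" by (simp add: continuous_on_eq_continuous_at)
    then show ?thesis unfolding T_def by (intro continuous_intros) (use G in auto)
  qed
  define C where "C = K * ((q / (1 / 32)) powr q / q) / Gamma q"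
  have Tb: "\<bar>T w\<bar> \<le> C * (sqrt w * exp (w / 32))" if w: "w > 0" for w
  proof -
    have "w powr q \<le> (q / (1/32)) powr q * exp ((1/32) * w)" by (rule power_le_exp_powr) (use w q in auto)
    then have "(K * sqrt w) * (w powr q / q) \<le> (K * sqrt w) * (((q / (1/32)) powr q * exp ((1/32) * w)) / q)"
      using w q K by (intro mult_left_mono divide_right_mono) auto
    then have "\<bar>J w\<bar> \<le> (K * sqrt w) * (((q / (1/32)) powr q * exp ((1/32) * w)) / q)" using Jb[OF w] by linarith
    then have "\<bar>J w\<bar> / Gamma q \<le> (K * sqrt w) * (((q / (1/32)) powr q * exp ((1/32) * w)) / q) / Gamma q"
      using G by (intro divide_right_mono) auto
    then show ?thesis using G by (simp add: T_def C_def mult_ac)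
  qed
  have C0: "C \<ge> 0" using K q G by (simp add: C_def)
  have Tl: "(LBINT w:{0<..}. exp (- k * w) * T w) = (LBINT w:{0<..}. exp (- k * w) * V w) / k powr q" if k: "k > 0" for k
  proof -
    define f where "f = (\<lambda>x w. indicator {0<..} x * (x powr (q - 1) * (exp (- k * w) * V (w - x))))"
    have m: "(\<lambda>(x, w). f x w) \<in> borel_measurable (lborel \<Otimes>\<^sub>M lborel)"
      unfolding f_def by measurable
    have Vind: "exp (- k * u) * V u = indicator {0<..} u *\<^sub>R (exp (- k * u) * V u)" for u
      using V0 by (auto simp: indicator_def)
    have Vi: "set_integrable lborel {0<..} (\<lambda>u. exp (- k * u) * V u)"
      by (rule set_integrable_bound[OF set_integrable_mult_right[OF set_integrable_exp_decay(1)[OF k, of 0], of K]])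
         (use bdd K in \<open>auto simp: set_borel_measurable_def abs_mult mult.commute intro!: AE_I2 mult_left_mono\<close>)
    then have Vi': "integrable lborel (\<lambda>u. exp (- k * u) * V u)"
      unfolding set_integrable_def Vind[symmetric] .
    have ee: "exp (- k * x) * (exp (- k * (w - x)) * y) = exp (- k * w) * y" for x w y
      by (simp only: mult.assoc[symmetric] mult_exp_exp) (simp add: algebra_simps)
    have sh: "(\<lambda>w. exp (- k * w) * V (w - x)) = (\<lambda>w. exp (- k * x) * (exp (- k * (w - x)) * V (w - x)))" for x
      by (simp only: ee)
    have shi: "integrable lborel (\<lambda>w. exp (- k * w) * V (w - x))" for x
    proof -
      have "integrable lborel (\<lambda>w. exp (- k * (w - x)) * V (w - x))"
        using lborel_integrable_real_affine[OF Vi', of 1 "-x"] by (simp add: algebra_simps)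
      then show ?thesis unfolding sh by (rule integrable_mult_right)
    qed
    have shv: "(LBINT w. exp (- k * w) * g (V (w - x))) = exp (- k * x) * (LBINT u. exp (- k * u) * g (V u))" for x and g :: "real \<Rightarrow> real"
    proof -
      have "(LBINT u. exp (- k * u) * g (V u)) = (LBINT w. exp (- k * (w - x)) * g (V (w - x)))"
        using lborel_integral_real_affine[of 1 "\<lambda>u. exp (- k * u) * g (V u)" "-x"] by (simp add: algebra_simps)
      also have "exp (- k * x) * \<dots> = (LBINT w. exp (- k * x) * (exp (- k * (w - x)) * g (V (w - x))))"
        by (rule integral_mult_right_zero[symmetric])
      also have "\<dots> = (LBINT w. exp (- k * w) * g (V (w - x)))"
        by (simp only: ee)
      finally show ?thesis by simp
    qed
    define L where "L = (LBINT u. exp (- k * u) * \<bar>V u\<bar>)"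
    have nf: "(LBINT w. norm (f x w)) = L * (indicator {0<..} x *\<^sub>R (x powr (q - 1) * exp (- k * x)))" for x
    proof -
      have "(LBINT w. norm (f x w)) = (LBINT w. (indicator {0<..} x * x powr (q - 1)) * (exp (- k * w) * \<bar>V (w - x)\<bar>))"
        by (rule Bochner_Integration.integral_cong) (auto simp: f_def abs_mult)
      also have "\<dots> = (indicator {0<..} x * x powr (q - 1)) * (exp (- k * x) * L)"
        unfolding L_def by (simp only: integral_mult_right_zero shv[where g = abs])
      finally show ?thesis by simp
    qed
    have int: "integrable (lborel \<Otimes>\<^sub>M lborel) (\<lambda>(x, w). f x w)"
    proof (rule lborel_pair.Fubini_integrable)
      show "(\<lambda>(x, w). f x w) \<in> borel_measurable (lborel \<Otimes>\<^sub>M lborel)" by (rule m)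
      have "integrable lborel (\<lambda>x. L * (indicator {0<..} x *\<^sub>R (x powr (q - 1) * exp (- k * x))))"
        using Gamma_integral_scaled(1)[OF q k] by (intro integrable_mult_right) (simp add: set_integrable_def)
      then show "integrable lborel (\<lambda>x. LBINT w. norm (case (x, w) of (x, w) \<Rightarrow> f x w))"
        by (simp add: nf[unfolded real_norm_def])
      show "AE x in lborel. integrable lborel (\<lambda>w. case (x, w) of (x, w) \<Rightarrow> f x w)"
        unfolding f_def prod.case by (intro AE_I2 integrable_mult_right shi)
    qed
    have "(LBINT w:{0<..}. exp (- k * w) * J w) = (LBINT w. exp (- k * w) * J w)"
    proof -
      have "exp (- k * w) * J w = indicator {0<..} w *\<^sub>R (exp (- k * w) * J w)" for w
        using T0[of w] G by (auto simp: indicator_def T_def)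
      then show ?thesis by (simp only: set_lebesgue_integral_def)
    qed
    also have "\<dots> = (LBINT w. (LBINT x. f x w))"
    proof (rule Bochner_Integration.integral_cong[OF refl])
      fix w
      have "(LBINT x. f x w) = (LBINT x. exp (- k * w) * (indicator {0<..} x *\<^sub>R (x powr (q - 1) * V (w - x))))"
        by (rule Bochner_Integration.integral_cong) (auto simp: f_def)
      then show "exp (- k * w) * J w = (LBINT x. f x w)"
        by (simp only: integral_mult_right_zero J_def set_lebesgue_integral_def)
    qed
    also have "\<dots> = (LBINT x. (LBINT w. f x w))"
      by (rule lborel_pair.Fubini_integral[OF int])
    also have "\<dots> = (LBINT x. (LBINT u. exp (- k * u) * V u) * (indicator {0<..} x *\<^sub>R (x powr (q - 1) * exp (- k * x))))"
    proof (rule Bochner_Integration.integral_cong[OF refl])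
      fix x
      have "(LBINT w. f x w) = indicator {0<..} x * (x powr (q - 1) * (LBINT w. exp (- k * w) * V (w - x)))"
        by (simp only: f_def integral_mult_right_zero)
      also have "(LBINT w. exp (- k * w) * V (w - x)) = exp (- k * x) * (LBINT u. exp (- k * u) * V u)"
        by (rule shv[where g = "\<lambda>x. x"])
      finally show "(LBINT w. f x w) = (LBINT u. exp (- k * u) * V u) * (indicator {0<..} x *\<^sub>R (x powr (q - 1) * exp (- k * x)))"
        by simp
    qed
    also have "\<dots> = (LBINT u. exp (- k * u) * V u) * (LBINT x:{0<..}. x powr (q - 1) * exp (- k * x))"
      by (simp only: integral_mult_right_zero set_lebesgue_integral_def)
    also have "\<dots> = (LBINT u:{0<..}. exp (- k * u) * V u) * (Gamma q / k powr q)"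
      unfolding Gamma_integral_scaled(2)[OF q k] by (simp only: set_lebesgue_integral_def Vind[symmetric])
    finally have "(LBINT w:{0<..}. exp (- k * w) * J w) = (LBINT u:{0<..}. exp (- k * u) * V u) * (Gamma q / k powr q)" .
    moreover have "(LBINT w:{0<..}. exp (- k * w) * T w) = (LBINT w:{0<..}. exp (- k * w) * J w) / Gamma q"
      by (simp add: T_def)
    ultimately show ?thesis using G by simp
  qed
  show ?thesis by (rule that[OF Tc T0 C0 Tb Tl])
qed

text \<open>With \<open>V(w) = U(exp (-w))\<close> the moment formula reads \<open>f k = - k \<integral> exp (-kw) V(w) dw\<close>. One
  factor \<open>k\<close> cancels against \<open>f k = k^p (a k)\<close>, one is kept on the left, and the remaining
  \<open>k^(p-2)\<close> is divided out by a fractional integration of order \<open>p - 2\<close>, absent when \<open>p = 2\<close>.\<close>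

theorem hausdorff_representation:
  fixes a f :: "nat \<Rightarrow> real" and p M \<epsilon> :: real
  assumes p: "p \<ge> 2"
    and f: "\<And>n. f n = real n powr p * a n"
    and "\<epsilon> > 0"
    and hausdorff: "\<And>n. real (n + 1) powr (1 + \<epsilon>) *
           (\<Sum>i\<le>n. real (n choose i) powr (2 + \<epsilon>) * \<bar>(fdiff ^^ i) f (n - i)\<bar> powr (2 + \<epsilon>)) < M"
  obtains T C A where "continuous_on UNIV T" "\<And>w. w \<le> 0 \<Longrightarrow> T w = 0" "C \<ge> 0"
    "\<And>w. w > 0 \<Longrightarrow> \<bar>T w\<bar> \<le> C * (sqrt w * exp (w / 32))"
    "\<And>k. real (Suc k) * a (Suc k) = (LBINT w:{0<..}. exp (- real (Suc k) * w) * T w)"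
    "\<And>n. \<bar>a n\<bar> \<le> A"
proof -
  \<comment> \<open>Lowers the exponent in the hypothesis to 2, at the cost of the constant term in \<open>K\<close>.\<close>
  have sq: "x\<^sup>2 \<le> 1 + x powr (2 + \<epsilon>)" if "x \<ge> 0" for x :: real
  proof (cases "x \<ge> 1")
    case True
    have "x\<^sup>2 = x powr 2" using True by (simp add: powr_numeral)
    also have "\<dots> \<le> x powr (2 + \<epsilon>)" using True \<open>\<epsilon> > 0\<close> by (intro powr_mono) auto
    finally show ?thesis by simp
  next
    case False
    then have "x\<^sup>2 \<le> 1" using that by (simp add: abs_square_le_1)
    then show ?thesis by (simp add: add_increasing2)
  qed
  define K where "K = 1 + M"
  have mass: "real (n + 1) * (\<Sum>i\<le>n. (hausdorff_mass f n i)\<^sup>2) \<le> K" for n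
  proof -
    define x where "x = (\<lambda>i. real (n + 1) * \<bar>hausdorff_mass f n i\<bar>)"
    have 1: "(\<Sum>i\<le>n. (x i)\<^sup>2) \<le> (\<Sum>i\<le>n. 1 + x i powr (2 + \<epsilon>))"
      by (intro sum_mono sq) (simp add: x_def)
    have "x i powr (2 + \<epsilon>) = real (n + 1) * (real (n + 1) powr (1 + \<epsilon>) * (real (n choose i) powr (2 + \<epsilon>) * \<bar>(fdiff ^^ i) f (n - i)\<bar> powr (2 + \<epsilon>)))" for i
    proof -
      have "real (n + 1) powr (2 + \<epsilon>) = real (n + 1) * real (n + 1) powr (1 + \<epsilon>)"
        by (subst powr_mult_base) (auto simp: add_ac)
      then show ?thesis
        by (simp add: x_def hausdorff_mass_def abs_mult powr_mult mult_ac)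
    qed
    then have "(\<Sum>i\<le>n. x i powr (2 + \<epsilon>)) = real (n + 1) * (real (n + 1) powr (1 + \<epsilon>) *
           (\<Sum>i\<le>n. real (n choose i) powr (2 + \<epsilon>) * \<bar>(fdiff ^^ i) f (n - i)\<bar> powr (2 + \<epsilon>)))"
      by (simp add: sum_distrib_left)
    also have "\<dots> \<le> real (n + 1) * M" using hausdorff[of n] by (intro mult_left_mono) auto
    finally have 2: "(\<Sum>i\<le>n. (x i)\<^sup>2) \<le> real (n + 1) + real (n + 1) * M"
      using 1 by (simp add: sum.distrib)
    have "(\<Sum>i\<le>n. (x i)\<^sup>2) = real (n + 1) * (real (n + 1) * (\<Sum>i\<le>n. (hausdorff_mass f n i)\<^sup>2))"
      by (simp add: x_def power_mult_distrib sum_distrib_left) (simp add: power2_eq_square mult_ac)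
    with 2 have "real (n + 1) * (real (n + 1) * (\<Sum>i\<le>n. (hausdorff_mass f n i)\<^sup>2)) \<le> real (n + 1) * (1 + M)"
      by (simp only: distrib_left mult_1_right)
    then show ?thesis unfolding K_def by (rule mult_left_le_imp_le) simp
  qed
  have f0: "f 0 = 0" using f[of 0] p by simp
  have fb: "\<bar>f n\<bar> \<le> 1 + K" for n
  proof -
    have "(hausdorff_mass f n 0)\<^sup>2 \<le> (\<Sum>i\<le>n. (hausdorff_mass f n i)\<^sup>2)" by (rule member_le_sum) auto
    also have "\<dots> \<le> real (n + 1) * (\<Sum>i\<le>n. (hausdorff_mass f n i)\<^sup>2)"
      using mult_right_mono[of 1 "real (n + 1)" "\<Sum>i\<le>n. (hausdorff_mass f n i)\<^sup>2"] by (simp add: sum_nonneg)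
    also have "\<dots> \<le> K" by (rule mass)
    finally have "\<bar>f n\<bar>\<^sup>2 \<le> K" by (simp add: hausdorff_mass_def)
    moreover have "2 * \<bar>f n\<bar> \<le> 1 + \<bar>f n\<bar>\<^sup>2"
      using zero_le_power2[of "\<bar>f n\<bar> - 1"] by (simp add: power2_eq_square algebra_simps)
    ultimately show ?thesis by linarith
  qed
  have ab: "\<bar>a n\<bar> \<le> \<bar>a 0\<bar> + (1 + K)" for n
  proof (cases "n = 0")
    case False
    then have "1 * \<bar>a n\<bar> \<le> real n powr p * \<bar>a n\<bar>"
      using p by (intro mult_right_mono ge_one_powr_ge_zero) auto
    also have "\<dots> = \<bar>f n\<bar>" by (simp add: f abs_mult)
    finally show ?thesis using fb[of n] by simp
  next
    case True
    then show ?thesis using fb[of 0] f0 by simp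
  qed
  obtain U where Uc: "continuous_on {0..1} U"
    and Uh: "\<And>s t. 0 \<le> s \<Longrightarrow> s \<le> t \<Longrightarrow> t \<le> 1 \<Longrightarrow> \<bar>U t - U s\<bar> \<le> sqrt K * sqrt (t - s)"
    and U1: "U 1 = f 0"
    and Um: "\<And>k. k \<ge> 1 \<Longrightarrow> integral {0..1} (\<lambda>t. real k * t ^ (k - 1) * U t) = f 0 - f k"
    by (rule hausdorff_moments[OF mass]) blast
  have K0: "K \<ge> 0" using fb[of 0] mass[of 0] by (auto simp: hausdorff_mass_def f0)
  \<comment> \<open>Clamping at 0 extends \<open>V\<close> by 0 to negative \<open>w\<close>, as \<open>U 1 = f 0 = 0\<close>; the Hoelder bound
    survives.\<close>
  define V where "V = (\<lambda>w. U (exp (- max 0 w)))"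
  have V0: "V w = 0" if "w \<le> 0" for w using that U1 f0 by (simp add: V_def)
  have Vh: "\<bar>V t - V s\<bar> \<le> sqrt K * sqrt \<bar>t - s\<bar>" for s t
  proof -
    have *: "\<bar>V t - V s\<bar> \<le> sqrt K * sqrt \<bar>t - s\<bar>" if "s \<le> t" for s t
    proof -
      define s' t' where "s' = max 0 s" and "t' = max 0 t"
      have st: "0 \<le> s'" "s' \<le> t'" "t' - s' \<le> t - s" using that by (auto simp: s'_def t'_def)
      have "exp (- s') - exp (- t') = exp (- s') * (1 - exp (- (t' - s')))"
        by (simp add: right_diff_distrib mult_exp_exp)
      also have "\<dots> \<le> 1 * (t' - s')"
      proof (rule mult_mono)
        show "1 - exp (- (t' - s')) \<le> t' - s'" using exp_ge_add_one_self[of "- (t' - s')"] by linarith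
      qed (use st in auto)
      finally have e: "exp (- s') - exp (- t') \<le> t - s" using st by simp
      have "\<bar>U (exp (- s')) - U (exp (- t'))\<bar> \<le> sqrt K * sqrt (exp (- s') - exp (- t'))"
        by (rule Uh) (use st in auto)
      also have "\<dots> \<le> sqrt K * sqrt \<bar>t - s\<bar>" using e K0 by (intro mult_left_mono) auto
      finally show ?thesis by (simp add: V_def s'_def t'_def abs_minus_commute)
    qed
    show ?thesis using *[of s t] *[of t s] by (cases "s \<le> t") (auto simp: abs_minus_commute)
  qed
  have Vb: "\<bar>V w\<bar> \<le> sqrt K" for w
  proof -
    have "\<bar>U 1 - U (exp (- max 0 w))\<bar> \<le> sqrt K * sqrt (1 - exp (- max 0 w))" by (rule Uh) auto
    also have "\<dots> \<le> sqrt K * 1" using K0 by (intro mult_left_mono) auto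
    finally show ?thesis using U1 f0 by (simp add: V_def)
  qed
  have Vm: "real k * (LBINT w:{0<..}. exp (- real k * w) * V w) = - f k" if k: "k \<ge> 1" for k
  proof -
    have c: "continuous_on {0..1} (\<lambda>t. real k * t ^ (k - 1) * U t)" by (intro continuous_intros Uc)
    have "(LBINT w:{0<..}. exp (- w) * (real k * exp (- w) ^ (k - 1) * U (exp (- w)))) = (LBINT t:{0<..<1}. real k * t ^ (k - 1) * U t)"
      by (rule exp_minus_substitution[of "\<lambda>t. real k * t ^ (k - 1) * U t"]) (rule continuous_on_subset[OF c], auto)
    also have "\<dots> = (LBINT t:{0..1}. real k * t ^ (k - 1) * U t)"
      by (rule set_integral_discrete_difference[of "{0, 1}"]) auto
    also have "\<dots> = integral {0..1} (\<lambda>t. real k * t ^ (k - 1) * U t)"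
      by (rule set_borel_integral_eq_integral(2)[OF borel_integrable_atLeastAtMost'[OF c]])
    also have "\<dots> = - f k" using Um[OF k] f0 by simp
    finally have "(LBINT w:{0<..}. exp (- w) * (real k * exp (- w) ^ (k - 1) * U (exp (- w)))) = - f k" .
    moreover have "(LBINT w:{0<..}. exp (- w) * (real k * exp (- w) ^ (k - 1) * U (exp (- w)))) = (LBINT w:{0<..}. real k * (exp (- real k * w) * V w))"
    proof (intro set_lebesgue_integral_cong allI impI)
      fix w :: real assume "w \<in> {0<..}"
      moreover have "exp (- w) * exp (- w) ^ (k - 1) = exp (- real k * w)"
      proof -
        have "exp (- w) * exp (- w) ^ (k - 1) = exp (- w) ^ k" using k by (cases k) auto
        then show ?thesis by (simp flip: exp_of_nat_mult)
      qed
      ultimately show "exp (- w) * (real k * exp (- w) ^ (k - 1) * U (exp (- w))) = real k * (exp (- real k * w) * V w)"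
        by (simp add: V_def)
    qed simp
    ultimately show ?thesis by simp
  qed
  have rep: "real k * a k = - ((LBINT w:{0<..}. exp (- real k * w) * V w) / real k powr (p - 2))" if k: "k \<ge> 1" for k
  proof -
    have "real k powr p = real k powr ((p - 2) + 1 + 1)" by simp
    also have "\<dots> = real k powr (p - 2) * real k * real k"
      using k by (simp only: powr_add powr_one)
    finally have "f k = real k powr (p - 2) * (real k * (real k * a k))" unfolding f by simp
    then have "real k * (LBINT w:{0<..}. exp (- real k * w) * V w) = real k * (- (real k powr (p - 2) * (real k * a k)))"
      using Vm[OF k] by simp
    then have "(LBINT w:{0<..}. exp (- real k * w) * V w) = - (real k powr (p - 2) * (real k * a k))"
      using k by (subst (asm) mult_left_cancel) auto
    then show ?thesis using k by simp
  qed
  show ?thesis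
  proof (cases "p = 2")
    case True
    show ?thesis
    proof (rule that[of "\<lambda>w. - V w" "sqrt K", OF _ _ _ _ _ ab])
      have "isCont V x" for x
      proof -
        have "((\<lambda>t. sqrt K * sqrt \<bar>t - x\<bar>) \<longlongrightarrow> sqrt K * sqrt \<bar>x - x\<bar>) (at x)" by (intro tendsto_intros)
        then have "((\<lambda>t. sqrt K * sqrt \<bar>t - x\<bar>) \<longlongrightarrow> 0) (at x)" by simp
        then have "((\<lambda>t. V t - V x) \<longlongrightarrow> 0) (at x)"
          by (rule Lim_null_comparison[rotated]) (use Vh in auto)
        then show ?thesis by (simp add: isCont_def LIM_zero_iff)
      qed
      then show "continuous_on UNIV (\<lambda>w. - V w)"
        by (intro continuous_on_minus) (simp add: continuous_on_eq_continuous_at)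
      fix w :: real assume w: "w > 0"
      have "\<bar>V w\<bar> \<le> sqrt K * sqrt w" using Vh[of w 0] V0[of 0] w by simp
      also have "\<dots> \<le> sqrt K * (sqrt w * exp (w / 32))"
        using w K0 by (intro mult_left_mono) (auto simp: mult_le_cancel_left1)
      finally show "\<bar>- V w\<bar> \<le> sqrt K * (sqrt w * exp (w / 32))" by simp
    next
      fix k
      show "real (Suc k) * a (Suc k) = (LBINT w:{0<..}. exp (- real (Suc k) * w) * - V w)"
        using rep[of "Suc k"] True by (simp add: set_lebesgue_integral_def)
    qed (use V0 K0 in auto)
  next
    case False
    then have q: "p - 2 > 0" using p by simp
    show ?thesis
    proof (rule fractional_integral[OF q real_sqrt_ge_zero[OF K0] Vh V0 Vb])
      fix T C
      assume T: "continuous_on UNIV T" "\<And>w. w \<le> 0 \<Longrightarrow> T w = 0" "C \<ge> 0"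
        "\<And>w. w > 0 \<Longrightarrow> \<bar>T w\<bar> \<le> C * (sqrt w * exp (w / 32))"
        "\<And>k. k > 0 \<Longrightarrow> (LBINT w:{0<..}. exp (- k * w) * T w) = (LBINT w:{0<..}. exp (- k * w) * V w) / k powr (p - 2)"
      show thesis
      proof (rule that[of "\<lambda>w. - T w" C, OF _ _ T(3) _ _ ab])
        show "continuous_on UNIV (\<lambda>w. - T w)" by (intro continuous_on_minus T)
        fix k
        show "real (Suc k) * a (Suc k) = (LBINT w:{0<..}. exp (- real (Suc k) * w) * - T w)"
          using rep[of "Suc k"] T(5)[of "real (Suc k)"] by (simp add: set_lebesgue_integral_def)
      qed (use T in auto)
    qed
  qed
qed

text \<open>Passing from \<open>T\<close> to its primitive \<open>\<tau>\<close> divides the Laplace transform by \<open>k\<close>. Both are kept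
  since \<open>2T + \<tau>\<close> represents \<open>(2k + 1) a k\<close>, the coefficients that the Legendre expansion
  actually contains.\<close>

lemma hausdorff_laplace_representation:
  fixes a f :: "nat \<Rightarrow> real" and p M \<epsilon> :: real
  assumes p: "p \<ge> 2"
    and f: "\<And>n. f n = real n powr p * a n"
    and \<epsilon>: "\<epsilon> > 0"
    and hausdorff: "\<And>n. real (n + 1) powr (1 + \<epsilon>) *
           (\<Sum>i\<le>n. real (n choose i) powr (2 + \<epsilon>) * \<bar>(fdiff ^^ i) f (n - i)\<bar> powr (2 + \<epsilon>)) < M"
  obtains \<tau> T C A where "\<And>w. (\<tau> has_real_derivative T w) (at w)" "continuous_on UNIV T" "\<tau> 0 = 0" "C \<ge> 0"
    "\<And>w. w \<ge> 0 \<Longrightarrow> \<bar>T w\<bar> \<le> C * (sqrt w * exp (w / 16))"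
    "\<And>w. w \<ge> 0 \<Longrightarrow> \<bar>\<tau> w\<bar> \<le> C * (sqrt w * exp (w / 16))"
    "\<And>k. a (Suc k) = (LBINT w:{0<..}. exp (- real (Suc k) * w) * \<tau> w)"
    "\<And>k. (2 * real (Suc k) + 1) * a (Suc k) = (LBINT w:{0<..}. exp (- real (Suc k) * w) * (2 * T w + \<tau> w))"
    "\<And>n. \<bar>a n\<bar> \<le> A"
proof -
  obtain T C0 A where T: "continuous_on UNIV T" "\<And>w. w \<le> 0 \<Longrightarrow> T w = 0" "C0 \<ge> 0"
    "\<And>w. w > 0 \<Longrightarrow> \<bar>T w\<bar> \<le> C0 * (sqrt w * exp (w / 32))"
    "\<And>k. real (Suc k) * a (Suc k) = (LBINT w:{0<..}. exp (- real (Suc k) * w) * T w)"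
    and A: "\<And>n. \<bar>a n\<bar> \<le> A"
    using hausdorff_representation[OF p f \<epsilon> hausdorff] by blast
  have Tc: "isCont T w" for w using T(1) by (simp add: continuous_on_eq_continuous_at)
  have "\<exists>F. \<forall>x::real. -\<infinity> < ereal x \<longrightarrow> ereal x < \<infinity> \<longrightarrow> (F has_vector_derivative T x) (at x)"
    by (rule einterval_antiderivative) (auto simp: Tc)
  then obtain F where F: "\<And>x. (F has_real_derivative T x) (at x)"
    by (auto simp: has_real_derivative_iff_has_vector_derivative)
  define \<tau> where "\<tau> = (\<lambda>w. F w - F 0)"
  have \<tau>: "(\<tau> has_real_derivative T w) (at w)" for w
    unfolding \<tau>_def by (auto intro!: derivative_eq_intros F)
  have \<tau>0: "\<tau> 0 = 0" by (simp add: \<tau>_def)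
  have \<tau>c: "isCont \<tau> w" for w by (rule DERIV_isCont[OF \<tau>])
  define C where "C = 32 * C0"
  have C: "C \<ge> 0" using T by (simp add: C_def)
  have Tb: "\<bar>T w\<bar> \<le> C * (sqrt w * exp (w / 16))" if "w \<ge> 0" for w
  proof (cases "w = 0")
    case False
    then have "\<bar>T w\<bar> \<le> C0 * (sqrt w * exp (w / 32))" using T(4) that by simp
    also have "\<dots> \<le> C * (sqrt w * exp (w / 16))"
      using that T(3) by (intro mult_mono) (auto simp: C_def)
    finally show ?thesis .
  qed (use T in simp)
  have \<tau>b: "\<bar>\<tau> w\<bar> \<le> C * (sqrt w * exp (w / 16))" if "w \<ge> 0" for w
  proof (cases "w = 0")
    case False
    then have w: "w > 0" using that by simp
    obtain z where z: "0 < z" "z < w" "\<tau> w - \<tau> 0 = (w - 0) * T z"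
      using MVT2[OF w, of \<tau> T] \<tau> by blast
    have "\<bar>T z\<bar> \<le> C0 * (sqrt z * exp (z / 32))" using T(4) z by simp
    also have "\<dots> \<le> C0 * (sqrt w * exp (w / 32))"
      using z T(3) by (intro mult_left_mono mult_mono) auto
    finally have 1: "\<bar>T z\<bar> \<le> C0 * (sqrt w * exp (w / 32))" .
    have "w \<le> 32 * exp (w / 32)" using exp_ge_add_one_self[of "w / 32"] by linarith
    then have "w * \<bar>T z\<bar> \<le> (32 * exp (w / 32)) * (C0 * (sqrt w * exp (w / 32)))"
      using 1 w by (intro mult_mono) auto
    also have "\<dots> = C * (sqrt w * exp (w / 16))"
      by (simp add: C_def flip: exp_add)
    finally show ?thesis using z w \<tau>0 by (simp add: abs_mult)
  qed (simp add: \<tau>0)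
  have int: "set_integrable lborel {0<..} (\<lambda>w. exp (- real (Suc k) * w) * g w)"
    if g: "continuous_on UNIV g" "\<And>w. w \<ge> 0 \<Longrightarrow> \<bar>g w\<bar> \<le> C * (sqrt w * exp (w / 16))" for g k
  proof (rule set_integrable_sqrt_bound[where C = C and c = "15/16"])
    show "set_borel_measurable lborel {0<..} (\<lambda>w. exp (- real (Suc k) * w) * g w)"
      by (intro set_borel_measurable_continuous_on continuous_intros continuous_on_subset[OF g(1)]) auto
    fix w :: real assume w: "w > 0"
    have "1 * w \<le> real (Suc k) * w" using w by (intro mult_right_mono) auto
    then have "exp (- real (Suc k) * w) \<le> exp (- w)" by (simp del: of_nat_Suc)
    then have "exp (- real (Suc k) * w) * \<bar>g w\<bar> \<le> exp (- w) * (C * (sqrt w * exp (w / 16)))"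
      using w g(2)[of w] C by (intro mult_mono) auto
    also have "\<dots> = C * (sqrt w * exp (- (15/16) * w))"
      by (simp add: mult_exp_exp)
    finally show "\<bar>exp (- real (Suc k) * w) * g w\<bar> \<le> C * (sqrt w * exp (- (15/16) * w))"
      by (simp add: abs_mult)
  qed simp
  have \<tau>cont: "continuous_on UNIV \<tau>" using \<tau>c by (simp add: continuous_on_eq_continuous_at)
  note intT = int[OF T(1) Tb] and int\<tau> = int[OF \<tau>cont \<tau>b]
  have ibp: "real (Suc k) * (LBINT w:{0<..}. exp (- real (Suc k) * w) * \<tau> w) = (LBINT w:{0<..}. exp (- real (Suc k) * w) * T w)" for k
  proof -
    define s where "s = real (Suc k)"
    have s: "s \<ge> 1" by (simp add: s_def)
    have "(LBINT w:{0<..}. exp (- s * w) * T w - s * (exp (- s * w) * \<tau> w)) = 0 - 0"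
    proof (rule improper_FTC[where F = "\<lambda>w. exp (- s * w) * \<tau> w"])
      fix x :: real assume "x > 0"
      show "((\<lambda>w. exp (- s * w) * \<tau> w) has_real_derivative exp (- s * x) * T x - s * (exp (- s * x) * \<tau> x)) (at x)"
        by (auto intro!: derivative_eq_intros \<tau> simp: algebra_simps)
      show "isCont (\<lambda>w. exp (- s * w) * T w - s * (exp (- s * w) * \<tau> w)) x"
        by (intro continuous_intros Tc \<tau>c)
    next
      show "set_integrable lborel {0<..} (\<lambda>w. exp (- s * w) * T w - s * (exp (- s * w) * \<tau> w))"
        unfolding s_def by (intro set_integral_diff set_integrable_mult_right intT int\<tau>)
      have "isCont (\<lambda>w. exp (- s * w) * \<tau> w) 0" by (intro continuous_intros \<tau>c)
      then show "((\<lambda>w. exp (- s * w) * \<tau> w) \<longlongrightarrow> 0) (at_right 0)"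
        using \<tau>0 by (auto simp: isCont_def intro: tendsto_mono at_le)
      show "((\<lambda>w. exp (- s * w) * \<tau> w) \<longlongrightarrow> 0) at_top"
      proof (rule tendsto_rabs_zero_cancel, rule tendsto_sandwich[where f = "\<lambda>_. 0"])
        show "((\<lambda>w. C * (sqrt w * exp (- (15/16) * w))) \<longlongrightarrow> 0) at_top" by real_asymp
        show "\<forall>\<^sub>F w in at_top. \<bar>exp (- s * w) * \<tau> w\<bar> \<le> C * (sqrt w * exp (- (15/16) * w))"
        proof (rule eventually_mono[OF eventually_gt_at_top[of 0]])
          fix w :: real assume w: "w > 0"
          have "1 * w \<le> s * w" using w s by (intro mult_right_mono) auto
          then have "exp (- s * w) \<le> exp (- w)" by simp
          then have "exp (- s * w) * \<bar>\<tau> w\<bar> \<le> exp (- w) * (C * (sqrt w * exp (w / 16)))"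
            using w \<tau>b[of w] C s by (intro mult_mono) auto
          also have "\<dots> = C * (sqrt w * exp (- (15/16) * w))" by (simp add: mult_exp_exp)
          finally show "\<bar>exp (- s * w) * \<tau> w\<bar> \<le> C * (sqrt w * exp (- (15/16) * w))" by (simp add: abs_mult)
        qed
      qed auto
    qed
    moreover have "(LBINT w:{0<..}. exp (- s * w) * T w - s * (exp (- s * w) * \<tau> w)) = (LBINT w:{0<..}. exp (- s * w) * T w) - (LBINT w:{0<..}. s * (exp (- s * w) * \<tau> w))"
      unfolding s_def by (intro set_integral_diff(2) set_integrable_mult_right intT int\<tau>)
    ultimately have "(LBINT w:{0<..}. exp (- s * w) * T w) = s * (LBINT w:{0<..}. exp (- s * w) * \<tau> w)"
      by simp
    then show ?thesis by (simp only: s_def)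
  qed
  show ?thesis
  proof (rule that[OF \<tau> T(1) \<tau>0 C Tb \<tau>b _ _ A])
    fix k
    have "real (Suc k) * a (Suc k) = real (Suc k) * (LBINT w:{0<..}. exp (- real (Suc k) * w) * \<tau> w)"
      unfolding T(5) ibp ..
    then show a: "a (Suc k) = (LBINT w:{0<..}. exp (- real (Suc k) * w) * \<tau> w)"
      by (simp only: mult_cancel_left) simp
    have "(LBINT w:{0<..}. exp (- real (Suc k) * w) * (2 * T w + \<tau> w)) = (LBINT w:{0<..}. 2 * (exp (- real (Suc k) * w) * T w) + exp (- real (Suc k) * w) * \<tau> w)"
      by (simp add: algebra_simps)
    also have "\<dots> = (LBINT w:{0<..}. 2 * (exp (- real (Suc k) * w) * T w)) + (LBINT w:{0<..}. exp (- real (Suc k) * w) * \<tau> w)"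
      by (intro set_integral_add(2) set_integrable_mult_right intT int\<tau>)
    also have "\<dots> = 2 * (LBINT w:{0<..}. exp (- real (Suc k) * w) * T w) + (LBINT w:{0<..}. exp (- real (Suc k) * w) * \<tau> w)"
      unfolding set_integral_mult_right ..
    also have "\<dots> = 2 * (real (Suc k) * a (Suc k)) + a (Suc k)" by (simp only: T(5)[symmetric] a[symmetric])
    finally show "(2 * real (Suc k) + 1) * a (Suc k) = (LBINT w:{0<..}. exp (- real (Suc k) * w) * (2 * T w + \<tau> w))"
      by (simp add: algebra_simps)
  qed
qed

section \<open>Legendre polynomials\<close>

text \<open>The Taylor coefficients of \<open>(1 - x)^(-1/2)\<close>.\<close>

definition sqrt_coeff :: "nat \<Rightarrow> real" where
  "sqrt_coeff k = pochhammer (1 / 2) k / fact k"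

lemma sqrt_coeff_nonneg: "sqrt_coeff k \<ge> 0"
  by (simp add: sqrt_coeff_def pochhammer_nonneg)

lemma sqrt_coeff_Suc: "real (Suc k) * sqrt_coeff (Suc k) = (real k + 1 / 2) * sqrt_coeff k"
  by (simp add: sqrt_coeff_def pochhammer_Suc mult_ac add_ac del: of_nat_Suc)

lemma bonnet_recurrence_unique:
  fixes g :: "nat \<Rightarrow> complex"
  assumes "g 0 = 1" "g 1 = of_real x"
    and rec: "\<And>n. (of_nat n + 2) * g (n + 2) = (2 * of_nat n + 3) * of_real x * g (n + 1) - (of_nat n + 1) * g n"
  shows "g n = of_real (legendre_P n x)"
proof (induction n rule: induct_nat_012)
  case (ge2 n)
  have "(of_nat n + 2 :: complex) = of_nat (n + 2)" by simp
  then have nz: "(of_nat n + 2 :: complex) \<noteq> 0" by (simp only: of_nat_eq_0_iff)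
  have "(of_nat n + 2) * g (Suc (Suc n)) = (2 * of_nat n + 3) * of_real x * of_real (legendre_P (Suc n) x) - (of_nat n + 1) * of_real (legendre_P n x)"
    using rec[of n] ge2 by simp
  then have "g (Suc (Suc n)) = ((2 * of_nat n + 3) * of_real x * of_real (legendre_P (Suc n) x) - (of_nat n + 1) * of_real (legendre_P n x)) / (of_nat n + 2)"
    using nz by (simp add: field_simps)
  then show ?case by simp
qed (use assms in auto)

text \<open>The generating function factors as \<open>(1 - e X)^(-1/2) (1 - cnj e X)^(-1/2)\<close>. Both factors
  satisfy a first order differential equation as formal power series, hence so does the product,
  and comparing coefficients gives Bonnet's recurrence. The resulting formula has nonnegative
  coefficients, from which the bound by the value at 1 is immediate.\<close>

lemma legendre_fourier:
  assumes e: "norm e = 1"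
  shows "(\<Sum>i\<le>n. of_real (sqrt_coeff i) * e ^ i * (of_real (sqrt_coeff (n - i)) * cnj e ^ (n - i))) = complex_of_real (legendre_P n (Re e))"
proof -
  define F where "F = (\<lambda>c::complex. Abs_fps (\<lambda>k. of_real (sqrt_coeff k) * c ^ k))"
  have ode: "fps_deriv (F c) * (1 - fps_const c * fps_X) = fps_const (c / 2) * F c" for c
  proof (rule fps_ext)
    fix n
    have s: "of_nat (Suc k) * complex_of_real (sqrt_coeff (Suc k)) = (of_nat k + 1 / 2) * of_real (sqrt_coeff k)" for k
    proof -
      have "complex_of_real (real (Suc k) * sqrt_coeff (Suc k)) = of_real ((real k + 1 / 2) * sqrt_coeff k)"
        by (simp only: sqrt_coeff_Suc)
      then show ?thesis by simp
    qed
    have "fps_nth (fps_deriv (F c) * (1 - fps_const c * fps_X)) n = of_nat (Suc n) * fps_nth (F c) (Suc n) - c * (if n = 0 then 0 else of_nat n * fps_nth (F c) n)"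
    proof -
      have "fps_deriv (F c) * (1 - fps_const c * fps_X) = fps_deriv (F c) - fps_const c * (fps_deriv (F c) * fps_X)"
        by (simp add: algebra_simps)
      moreover have "fps_nth (fps_deriv (F c) * fps_X) n = (if n = 0 then 0 else of_nat n * fps_nth (F c) n)"
        by (cases n) simp_all
      ultimately show ?thesis by simp
    qed
    also have "\<dots> = (of_nat (Suc n) * of_real (sqrt_coeff (Suc n)) - of_nat n * of_real (sqrt_coeff n)) * c ^ Suc n"
      by (simp add: F_def algebra_simps)
    also have "\<dots> = fps_nth (fps_const (c / 2) * F c) n"
      unfolding s by (simp add: F_def algebra_simps)
    finally show "fps_nth (fps_deriv (F c) * (1 - fps_const c * fps_X)) n = fps_nth (fps_const (c / 2) * F c) n" .
  qed
  define x where "x = Re e"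
  have sum: "e + cnj e = 2 * of_real x" by (simp add: x_def complex_add_cnj)
  have prod: "e * cnj e = 1" using e by (simp add: complex_norm_square[symmetric])
  define H where "H = F e * F (cnj e)"
  have "fps_deriv H * ((1 - fps_const e * fps_X) * (1 - fps_const (cnj e) * fps_X)) =
      (fps_deriv (F e) * (1 - fps_const e * fps_X)) * (F (cnj e) * (1 - fps_const (cnj e) * fps_X)) +
      (fps_deriv (F (cnj e)) * (1 - fps_const (cnj e) * fps_X)) * (F e * (1 - fps_const e * fps_X))"
  proof -
    have "(A * D2 + D1 * B) * ((1 - u) * (1 - v)) = (D1 * (1 - u)) * (B * (1 - v)) + (D2 * (1 - v)) * (A * (1 - u))"
      for A B D1 D2 u v :: "complex fps" by (simp add: algebra_simps)
    then show ?thesis by (simp only: H_def fps_deriv_mult)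
  qed
  also have "\<dots> = H * (fps_const (e / 2) * (1 - fps_const (cnj e) * fps_X) + fps_const (cnj e / 2) * (1 - fps_const e * fps_X))"
  proof -
    have "(c * A) * (B * u) + (d * B) * (A * v) = (A * B) * (c * u + d * v)" for A B c d u v :: "complex fps"
      by (simp add: algebra_simps)
    then show ?thesis by (simp only: H_def ode)
  qed
  also have "fps_const (e / 2) * (1 - fps_const (cnj e) * fps_X) + fps_const (cnj e / 2) * (1 - fps_const e * fps_X) = fps_const (of_real x) - fps_X"
  proof -
    have "fps_const (e / 2) * (1 - fps_const (cnj e) * fps_X) + fps_const (cnj e / 2) * (1 - fps_const e * fps_X) =
      fps_const ((e + cnj e) / 2) - fps_const (e * cnj e) * fps_X"
      by (rule fps_ext) (simp add: fps_X_def field_simps)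
    then show ?thesis by (simp add: sum prod)
  qed
  also have "(1 - fps_const e * fps_X) * (1 - fps_const (cnj e) * fps_X) = 1 - fps_const (e + cnj e) * fps_X + fps_const (e * cnj e) * fps_X ^ 2"
    by (simp add: algebra_simps power2_eq_square flip: fps_const_add fps_const_mult)
  finally have O: "fps_deriv H * (1 - fps_const (2 * of_real x) * fps_X + fps_X ^ 2) = H * (fps_const (of_real x) - fps_X)"
    by (simp add: sum prod)
  have L: "fps_nth (fps_deriv H * (1 - fps_const (2 * of_real x) * fps_X + fps_X ^ 2)) n =
     of_nat (n + 1) * fps_nth H (n + 1) - 2 * of_real x * (of_nat n * fps_nth H n) + (if n < 2 then 0 else of_nat (n - 1) * fps_nth H (n - 1))" for n
  proof -
    have "fps_deriv H * (1 - fps_const (2 * of_real x) * fps_X + fps_X ^ 2) = fps_deriv H - fps_const (2 * of_real x) * (fps_deriv H * fps_X) + fps_deriv H * fps_X ^ 2"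
      by (simp add: algebra_simps)
    moreover have "fps_nth (fps_deriv H * fps_X) n = of_nat n * fps_nth H n"
      by (cases n) (simp_all add: algebra_simps)
    moreover have "fps_nth (fps_deriv H * fps_X ^ 2) n = (if n < 2 then 0 else of_nat (n - 1) * fps_nth H (n - 1))"
    proof (cases "n < 2")
      case False
      then have "n - 2 + 1 = n - 1" by simp
      then show ?thesis using False unfolding fps_X_power_mult_right_nth fps_deriv_nth by simp
    qed (simp only: fps_X_power_mult_right_nth if_True)
    ultimately show ?thesis by simp
  qed
  have Rr: "fps_nth (H * (fps_const (of_real x) - fps_X)) n = of_real x * fps_nth H n - (if n = 0 then 0 else fps_nth H (n - 1))" for n
    by (cases n) (simp_all add: right_diff_distrib mult.commute)
  have "fps_nth H n = of_real (legendre_P n x)"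
  proof (rule bonnet_recurrence_unique)
    show H0: "fps_nth H 0 = 1" by (simp add: H_def F_def sqrt_coeff_def)
    show "fps_nth H 1 = of_real x"
      using arg_cong[OF O, of "\<lambda>f. fps_nth f 0"] unfolding L Rr by (simp add: H0)
    fix n
    show "(of_nat n + 2) * fps_nth H (n + 2) = (2 * of_nat n + 3) * of_real x * fps_nth H (n + 1) - (of_nat n + 1) * fps_nth H n"
      using arg_cong[OF O, of "\<lambda>f. fps_nth f (n + 1)"] unfolding L Rr
      by (cases n) (simp_all add: algebra_simps)
  qed
  then show ?thesis by (simp add: H_def F_def x_def fps_mult_nth atMost_atLeast0)
qed

lemma legendre_P_one: "legendre_P n 1 = 1"
  by (induction n rule: induct_nat_012) (auto simp: field_simps)

lemma unit_circle_point:
  assumes "\<bar>x\<bar> \<le> 1"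
  obtains e where "norm e = 1" "Re e = x"
proof
  have "x\<^sup>2 \<le> 1" using assms by (simp add: abs_square_le_1)
  then show "norm (Complex x (sqrt (1 - x\<^sup>2))) = 1" by (simp add: cmod_def)
qed simp

lemma legendre_P_bound:
  assumes "\<bar>x\<bar> \<le> 1"
  shows "\<bar>legendre_P n x\<bar> \<le> 1"
proof -
  obtain e where e: "norm e = 1" "Re e = x" using unit_circle_point[OF assms] .
  have "complex_of_real (legendre_P n x) = (\<Sum>i\<le>n. of_real (sqrt_coeff i) * e ^ i * (of_real (sqrt_coeff (n - i)) * cnj e ^ (n - i)))"
    using legendre_fourier[OF e(1), of n] e(2) by simp
  then have "\<bar>legendre_P n x\<bar> = norm (\<Sum>i\<le>n. of_real (sqrt_coeff i) * e ^ i * (of_real (sqrt_coeff (n - i)) * cnj e ^ (n - i)))"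
    by (metis norm_of_real)
  also have "\<dots> \<le> (\<Sum>i\<le>n. sqrt_coeff i * sqrt_coeff (n - i))"
    by (rule order_trans[OF norm_sum]) (use e in \<open>auto simp: norm_mult norm_power sqrt_coeff_nonneg intro!: sum_mono\<close>)
  also have "(\<Sum>i\<le>n. sqrt_coeff i * sqrt_coeff (n - i)) = legendre_P n 1"
  proof -
    have "complex_of_real (\<Sum>i\<le>n. sqrt_coeff i * sqrt_coeff (n - i)) = of_real (legendre_P n 1)"
      using legendre_fourier[of 1 n] by simp
    then show ?thesis by (simp only: of_real_eq_iff)
  qed
  finally show ?thesis by (simp add: legendre_P_one)
qed

text \<open>The two binomial series of the factorisation are complex conjugates of each other, so that
  their product is a squared modulus and no branch question arises.\<close>

lemma legendre_genfun:
  assumes x: "\<bar>x\<bar> \<le> 1" and t: "0 \<le> t" "t < 1"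
  shows "(\<lambda>n. t ^ n * legendre_P n x) sums (1 / sqrt (1 - 2 * x * t + t\<^sup>2))"
proof -
  obtain e where e: "norm e = 1" "Re e = x" using unit_circle_point[OF x] .
  have ser: "(\<lambda>k. of_real (sqrt_coeff k) * c ^ k * of_real t ^ k) sums ((1 - c * of_real t) powr (- 1 / 2))" if "norm c = 1" for c :: complex
  proof -
    have "norm (- (c * of_real t)) < 1" using that t by (simp add: norm_mult)
    then have "(\<lambda>k. ((- 1 / 2) gchoose k) * (- (c * of_real t)) ^ k) sums ((1 + - (c * of_real t)) powr (- 1 / 2))"
      by (rule gen_binomial_complex)
    moreover have "((- 1 / 2) gchoose k) * (- (c * of_real t)) ^ k = of_real (sqrt_coeff k) * c ^ k * of_real t ^ k" for k
    proof -
      have "pochhammer (1 / 2 :: complex) k = of_real (pochhammer (1 / 2) k)"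
        by (simp flip: pochhammer_of_real)
      then show ?thesis
        by (simp add: gbinomial_pochhammer sqrt_coeff_def power_minus[of "c * of_real t"] power_mult_distrib)
    qed
    ultimately show ?thesis by simp
  qed
  have sm: "summable (\<lambda>k. norm (of_real (sqrt_coeff k) * c ^ k * of_real t ^ k :: complex))" if "norm c = 1" for c
  proof -
    have "summable (\<lambda>k. complex_of_real (sqrt_coeff k * t ^ k))"
      using ser[of 1] by (simp add: sums_iff)
    then have "summable (\<lambda>k. sqrt_coeff k * t ^ k)" by (simp only: summable_of_real_iff)
    then show ?thesis using that t sqrt_coeff_nonneg by (simp add: norm_mult norm_power)
  qed
  define W where "W = 1 - e * of_real t"
  have ce: "norm (cnj e) = 1" using e by simp
  have "(\<lambda>n. \<Sum>i\<le>n. (of_real (sqrt_coeff i) * e ^ i * of_real t ^ i) * (of_real (sqrt_coeff (n - i)) * cnj e ^ (n - i) * of_real t ^ (n - i))) sums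
     ((\<Sum>k. of_real (sqrt_coeff k) * e ^ k * of_real t ^ k) * (\<Sum>k. of_real (sqrt_coeff k) * cnj e ^ k * of_real t ^ k))"
    by (rule Cauchy_product_sums[OF sm[OF e(1)] sm[OF ce]])
  also have "(\<Sum>k. of_real (sqrt_coeff k) * e ^ k * of_real t ^ k) = W powr (- 1 / 2)"
    using ser[OF e(1)] by (simp add: sums_iff W_def)
  also have "(\<Sum>k. of_real (sqrt_coeff k) * cnj e ^ k * of_real t ^ k) = cnj (W powr (- 1 / 2))"
  proof -
    have "(\<lambda>k. cnj (of_real (sqrt_coeff k) * e ^ k * of_real t ^ k)) sums cnj (W powr (- 1 / 2))"
      using ser[OF e(1)] unfolding sums_cnj W_def .
    then show ?thesis by (simp add: sums_iff)
  qed
  also have "W powr (- 1 / 2) * cnj (W powr (- 1 / 2)) = of_real (1 / sqrt (1 - 2 * x * t + t\<^sup>2))"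
  proof -
    have "norm (e * of_real t) < 1" using e t by (simp add: norm_mult)
    then have W0: "W \<noteq> 0" unfolding W_def by (metis norm_one eq_iff_diff_eq_0 less_irrefl)
    have "(W powr (- 1 / 2))\<^sup>2 = W powr (- 1)"
      by (simp add: power2_eq_square flip: powr_add)
    also have "\<dots> = inverse W" using W0 by (simp add: powr_minus)
    finally have "norm (W powr (- 1 / 2)) ^ 2 = 1 / norm W"
      by (metis norm_power norm_inverse inverse_eq_divide)
    moreover have "norm W = sqrt (1 - 2 * x * t + t\<^sup>2)"
    proof -
      have "(Re e)\<^sup>2 + (Im e)\<^sup>2 = 1" using e(1) by (simp add: cmod_def)
      then have "(1 - x * t)\<^sup>2 + (Im e * t)\<^sup>2 = 1 - 2 * x * t + t\<^sup>2"
        using e(2) by (simp add: power2_eq_square algebra_simps) (metis distrib_left mult.right_neutral)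
      then show ?thesis by (simp add: cmod_def W_def e(2))
    qed
    ultimately show ?thesis by (simp add: complex_norm_square[symmetric])
  qed
  also have "(\<lambda>n. \<Sum>i\<le>n. (of_real (sqrt_coeff i) * e ^ i * of_real t ^ i) * (of_real (sqrt_coeff (n - i)) * cnj e ^ (n - i) * of_real t ^ (n - i))) =
     (\<lambda>n. complex_of_real (t ^ n * legendre_P n x))"
  proof
    fix n
    have "(\<Sum>i\<le>n. (of_real (sqrt_coeff i) * e ^ i * of_real t ^ i) * (of_real (sqrt_coeff (n - i)) * cnj e ^ (n - i) * of_real t ^ (n - i))) =
      (\<Sum>i\<le>n. of_real t ^ n * (of_real (sqrt_coeff i) * e ^ i * (of_real (sqrt_coeff (n - i)) * cnj e ^ (n - i))))"
    proof (intro sum.cong refl)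
      fix i assume "i \<in> {..n}"
      then have "complex_of_real t ^ n = of_real t ^ i * of_real t ^ (n - i)" by (simp flip: power_add)
      then show "(of_real (sqrt_coeff i) * e ^ i * of_real t ^ i) * (of_real (sqrt_coeff (n - i)) * cnj e ^ (n - i) * of_real t ^ (n - i)) = of_real t ^ n * (of_real (sqrt_coeff i) * e ^ i * (of_real (sqrt_coeff (n - i)) * cnj e ^ (n - i)))"
        by simp
    qed
    also have "\<dots> = of_real t ^ n * of_real (legendre_P n x)"
      using legendre_fourier[OF e(1), of n] e(2) by (simp flip: sum_distrib_left)
    finally show "(\<Sum>i\<le>n. (of_real (sqrt_coeff i) * e ^ i * of_real t ^ i) * (of_real (sqrt_coeff (n - i)) * cnj e ^ (n - i) * of_real t ^ (n - i))) = complex_of_real (t ^ n * legendre_P n x)"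
      by simp
  qed
  finally show ?thesis by (simp only: sums_of_real_iff)
qed

section \<open>Continuation of the Legendre expansion to the cut plane\<close>

text \<open>The generating function of the Legendre polynomials at \<open>z\<close> is \<open>1/csqrt\<close> of this, so its
  zeros and negative values are the obstructions to continuation in \<open>z\<close>.\<close>

definition radicand :: "complex \<Rightarrow> real \<Rightarrow> complex" where
  "radicand z t = 1 - 2 * z * of_real t + (of_real t)\<^sup>2"

lemma open_cut_plane: "open cut_plane"
proof -
  have c: "closed ({z. Im z = 0} \<inter> {z. Re z \<ge> 1})"
    by (intro closed_Int closed_Collect_eq closed_Collect_le continuous_intros)
  have e: "cut_plane = - ({z. Im z = 0} \<inter> {z. Re z \<ge> 1})" by (auto simp: cut_plane_def)
  show ?thesis unfolding e by (rule open_Compl[OF c])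
qed

lemma connected_cut_plane: "connected cut_plane"
proof -
  have "starlike cut_plane"
    unfolding starlike_def
  proof (intro bexI[of _ 0] ballI subsetI)
    fix z y :: complex assume z: "z \<in> cut_plane" and "y \<in> closed_segment 0 z"
    then obtain u where u: "0 \<le> u" "u \<le> 1" "y = of_real u * z"
      by (auto simp: in_segment scaleR_conv_of_real)
    show "y \<in> cut_plane"
    proof (rule ccontr)
      assume "y \<notin> cut_plane"
      then have y: "Im y = 0" "Re y \<ge> 1" by (auto simp: cut_plane_def)
      then have u0: "u > 0" using u by (cases "u = 0") auto
      have "Im z = 0" using y u u0 by simp
      moreover have "1 \<le> Re z"
      proof -
        have uz: "u * Re z \<ge> 1" using y u by simp
        have "Re z > 0"
        proof (rule ccontr)
          assume "\<not> Re z > 0"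
          then have "u * Re z \<le> 0" using u0 by (intro mult_nonneg_nonpos) auto
          then show False using uz by simp
        qed
        then have "u * Re z \<le> 1 * Re z" using u by (intro mult_right_mono) auto
        then show ?thesis using uz by simp
      qed
      ultimately show False using z by (auto simp: cut_plane_def)
    qed
  qed (auto simp: cut_plane_def)
  then show ?thesis by (rule starlike_imp_connected)
qed

text \<open>Hence the principal square root is holomorphic in \<open>z\<close> on the cut plane, for every \<open>t\<close> in
  \<open>[0,1]\<close>.\<close>

lemma radicand_not_nonpos:
  assumes z: "z \<in> cut_plane" and t: "0 \<le> t" "t \<le> 1"
  shows "radicand z t \<notin> \<real>\<^sub>\<le>\<^sub>0"
proof
  assume "radicand z t \<in> \<real>\<^sub>\<le>\<^sub>0"
  then have im: "Im (radicand z t) = 0" and re: "Re (radicand z t) \<le> 0" by (auto simp: complex_nonpos_Reals_iff)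
  have re': "1 - 2 * Re z * t + t\<^sup>2 \<le> 0" using re by (simp add: radicand_def power2_eq_square)
  have im': "Im z * t = 0" using im by (simp add: radicand_def power2_eq_square)
  show False
  proof (cases "t = 0")
    case False
    then have "Im z = 0" using im' by simp
    then have "Re z < 1" using z by (auto simp: cut_plane_def)
    then have "Re z * t < 1 * t" using False t by (intro mult_strict_right_mono) auto
    then have "1 - 2 * Re z * t + t\<^sup>2 > (1 - t)\<^sup>2" by (simp add: power2_eq_square algebra_simps)
    then show False using re' zero_le_power2[of "1 - t"] by linarith
  qed (use re' in simp)
qed

text \<open>From \<open>1 - r\<^sup>2 = (1 - r)(1 + r)\<close> and \<open>Re r \<ge> 0\<close> for the principal root \<open>r\<close>. The factor \<open>t\<close>
  is the decay in \<open>w\<close> gained by subtracting 1, and only the square root of the modulus stays in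
  the denominator.\<close>

lemma inverse_csqrt_radicand_bound:
  assumes R: "radicand z t \<noteq> 0" and t: "0 \<le> t" "t \<le> 1"
  shows "norm (1 / csqrt (radicand z t) - 1) \<le> (2 * norm z + 1) * t / sqrt (norm (radicand z t))"
proof -
  define r where "r = csqrt (radicand z t)"
  have r0: "r \<noteq> 0" using R by (simp add: r_def)
  have r2: "r\<^sup>2 = radicand z t" by (simp add: r_def)
  have nr: "norm r = sqrt (norm (radicand z t))"
    by (metis r2 norm_power norm_ge_zero real_sqrt_unique)
  have "Re r \<ge> 0" unfolding r_def using csqrt_principal[of "radicand z t"] by auto
  then have "1 \<le> Re (1 + r)" by simp
  also have "\<dots> \<le> norm (1 + r)" by (rule complex_Re_le_cmod)
  finally have n1: "norm (1 + r) \<ge> 1" .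
  have "norm (1 - r) * 1 \<le> norm (1 - r) * norm (1 + r)" by (intro mult_left_mono n1) auto
  also have "\<dots> = norm (1 - r\<^sup>2)" by (simp add: power2_eq_square algebra_simps flip: norm_mult)
  also have "1 - r\<^sup>2 = of_real t * (2 * z - of_real t)" unfolding r2 by (simp add: radicand_def power2_eq_square algebra_simps)
  also have "norm \<dots> \<le> t * (2 * norm z + 1)"
  proof -
    have "norm (2 * z - of_real t) \<le> norm (2 * z) + norm (complex_of_real t)" by (rule norm_triangle_ineq4)
    also have "\<dots> \<le> 2 * norm z + 1" using t by (simp add: norm_mult)
    finally show ?thesis using t by (simp add: norm_mult mult_left_mono)
  qed
  finally have "norm (1 - r) \<le> (2 * norm z + 1) * t" by (simp add: mult.commute)
  moreover have "1 / r - 1 = (1 - r) / r" using r0 by (simp add: field_simps)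
  ultimately show ?thesis
    unfolding r_def[symmetric] nr[symmetric] by (simp add: norm_divide divide_right_mono)
qed

lemma radicand_lower_bound:
  assumes z0: "z0 \<in> cut_plane"
  obtains d c where "d > 0" "c > 0" "\<And>z. dist z z0 < d \<Longrightarrow> z \<in> cut_plane"
    "\<And>z t. dist z z0 < d \<Longrightarrow> 0 \<le> t \<Longrightarrow> t \<le> 1 \<Longrightarrow> c \<le> norm (radicand z t)"
proof -
  obtain d where d: "d > 0" "cball z0 d \<subseteq> cut_plane"
    using open_cut_plane z0 open_contains_cball by blast
  have 1: "compact (cball z0 d \<times> {0..1::real})" by (intro compact_Times) auto
  have 2: "continuous_on (cball z0 d \<times> {0..1::real}) (\<lambda>p. norm (radicand (fst p) (snd p)))"
    unfolding radicand_def by (intro continuous_intros)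
  have 3: "cball z0 d \<times> {0..1::real} \<noteq> {}" using d by auto
  obtain p where p1: "p \<in> cball z0 d \<times> {0..1}"
    and p2: "\<forall>q\<in>cball z0 d \<times> {0..1}. norm (radicand (fst p) (snd p)) \<le> norm (radicand (fst q) (snd q))"
    using continuous_attains_inf[OF 1 3 2] by (rule bexE)
  note p = p1 p2[rule_format]
  have "radicand (fst p) (snd p) \<notin> \<real>\<^sub>\<le>\<^sub>0" by (rule radicand_not_nonpos) (use p(1) d in auto)
  then have "norm (radicand (fst p) (snd p)) > 0" by auto
  then show ?thesis
  proof (rule that[OF d(1)])
    show "z \<in> cut_plane" if "dist z z0 < d" for z using that d(2) by (auto simp: dist_commute subset_iff)
    show "norm (radicand (fst p) (snd p)) \<le> norm (radicand z t)" if "dist z z0 < d" "0 \<le> t" "t \<le> 1" for z t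
      using p(2)[of "(z, t)"] that by (auto simp: dist_commute)
  qed
qed

text \<open>The subtraction of 1 in the kernel below and the separate treatment of \<open>a 0\<close> are forced by
  the representation, which says nothing about the coefficient with index 0.\<close>

locale legendre_data =
  fixes D :: "real \<Rightarrow> real" and C :: real and a :: "nat \<Rightarrow> real"
  assumes Dc: "continuous_on UNIV D" and C: "C \<ge> 0"
    and Db: "\<And>w. w > 0 \<Longrightarrow> \<bar>D w\<bar> \<le> C * (sqrt w * exp (w / 16))"
    and Da: "\<And>n. (2 * real (Suc n) + 1) * a (Suc n) = (LBINT w:{0<..}. exp (- real (Suc n) * w) * D w)"
begin

lemma D_exp_integrable: "set_integrable lborel {0<..} (\<lambda>w. exp (- w) * \<bar>D w\<bar>)"
proof (rule set_integrable_sqrt_bound[where C = C and c = "15/16"])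
  show "set_borel_measurable lborel {0<..} (\<lambda>w. exp (- w) * \<bar>D w\<bar>)"
    by (intro set_borel_measurable_continuous_on continuous_intros continuous_on_subset[OF Dc]) auto
  fix w :: real assume w: "w > 0"
  have "exp (- w) * \<bar>D w\<bar> \<le> exp (- w) * (C * (sqrt w * exp (w / 16)))"
    by (intro mult_left_mono Db w) auto
  also have "\<dots> = C * (sqrt w * (exp (w / 16) * exp (- w)))" by simp
  also have "exp (w / 16) * exp (- w) = exp (- (15 / 16) * w)" by (simp add: mult_exp_exp)
  finally show "\<bar>exp (- w) * \<bar>D w\<bar>\<bar> \<le> C * (sqrt w * exp (- (15 / 16) * w))" by simp
qed simp

definition legendre_kernel :: "complex \<Rightarrow> real \<Rightarrow> complex" where
  "legendre_kernel z w = of_real (D w) * (1 / csqrt (radicand z (exp (- w))) - 1)"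

definition legendre_continuation :: "complex \<Rightarrow> complex" where
  "legendre_continuation z = of_real (a 0 / (4 * pi)) + of_real (1 / (4 * pi)) * (LBINT w:{0<..}. legendre_kernel z w)"

lemma legendre_kernel_measurable:
  assumes "z \<in> cut_plane"
  shows "set_borel_measurable lborel {0<..} (legendre_kernel z)"
proof -
  have "continuous_on {0<..} (legendre_kernel z)"
    unfolding legendre_kernel_def
  proof (intro continuous_intros continuous_on_subset[OF Dc])
    show "continuous_on {0<..} (\<lambda>w. csqrt (radicand z (exp (- w))))"
    proof (rule continuous_on_compose2[OF continuous_on_csqrt])
      show "continuous_on {0<..} (\<lambda>w. radicand z (exp (- w)))" unfolding radicand_def by (intro continuous_intros)
      show "(\<lambda>w. radicand z (exp (- w))) ` {0<..} \<subseteq> - \<real>\<^sub>\<le>\<^sub>0"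
        using radicand_not_nonpos[OF assms] by auto
    qed
    show "\<forall>w\<in>{0<..}. csqrt (radicand z (exp (- w))) \<noteq> 0"
    proof
      fix w :: real assume "w \<in> {0<..}"
      then have "radicand z (exp (- w)) \<notin> \<real>\<^sub>\<le>\<^sub>0" by (intro radicand_not_nonpos[OF assms]) auto
      then show "csqrt (radicand z (exp (- w))) \<noteq> 0" by (auto simp: csqrt_eq_0)
    qed
  qed auto
  then show ?thesis unfolding set_borel_measurable_def
    using borel_measurable_continuous_on_indicator[of "{0<..}" "legendre_kernel z"] by simp
qed

lemma legendre_kernel_integrable:
  assumes z: "z \<in> cut_plane" and c: "c > 0" "\<And>t. 0 \<le> t \<Longrightarrow> t \<le> 1 \<Longrightarrow> c \<le> norm (radicand z t)"
  shows "set_integrable lborel {0<..} (legendre_kernel z)"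
proof (rule set_integrable_bound[OF set_integrable_mult_right[OF D_exp_integrable, of "(2 * norm z + 1) / sqrt c"] legendre_kernel_measurable[OF z]], intro AE_I2 impI)
  fix w :: real assume "w \<in> {0<..}"
  then have t: "0 \<le> exp (- w)" "exp (- w) \<le> 1" by auto
  have cR: "c \<le> norm (radicand z (exp (- w)))" by (rule c(2)[OF t])
  then have "radicand z (exp (- w)) \<noteq> 0" using c(1) by auto
  then have "norm (1 / csqrt (radicand z (exp (- w))) - 1) \<le> (2 * norm z + 1) * exp (- w) / sqrt (norm (radicand z (exp (- w))))"
    using t by (rule inverse_csqrt_radicand_bound)
  also have "\<dots> \<le> (2 * norm z + 1) * exp (- w) / sqrt c"
    using cR c(1) by (intro divide_left_mono mult_nonneg_nonneg mult_pos_pos) auto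
  finally have "\<bar>D w\<bar> * norm (1 / csqrt (radicand z (exp (- w))) - 1) \<le> \<bar>D w\<bar> * ((2 * norm z + 1) * exp (- w) / sqrt c)"
    by (intro mult_left_mono) auto
  also have "\<dots> \<le> norm ((2 * norm z + 1) / sqrt c * (exp (- w) * \<bar>D w\<bar>))"
    using c(1) by (simp add: abs_mult mult_ac)
  finally show "norm (legendre_kernel z w) \<le> norm ((2 * norm z + 1) / sqrt c * (exp (- w) * \<bar>D w\<bar>))"
    by (simp add: legendre_kernel_def norm_mult)
qed

lemma legendre_continuation_holomorphic: "legendre_continuation holomorphic_on cut_plane"
proof -
  have "(\<lambda>z. LBINT w:{0<..}. legendre_kernel z w) field_differentiable (at z0)" if z0: "z0 \<in> cut_plane" for z0
  proof -
    obtain d c where d: "d > 0" and c: "c > 0" and cut: "\<And>z. dist z z0 < d \<Longrightarrow> z \<in> cut_plane"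
      and low: "\<And>z t. dist z z0 < d \<Longrightarrow> 0 \<le> t \<Longrightarrow> t \<le> 1 \<Longrightarrow> c \<le> norm (radicand z t)"
      using radicand_lower_bound[OF z0] by metis
    define f' where "f' = (\<lambda>z w. of_real (D w) * (of_real (exp (- w)) / (csqrt (radicand z (exp (- w))) * radicand z (exp (- w)))))"
    have "((\<lambda>z. LBINT w:{0<..}. legendre_kernel z w) has_field_derivative (LBINT w:{0<..}. f' z0 w)) (at z0)"
    proof (rule has_field_derivative_set_integral[OF d])
      show "set_integrable lborel {0<..} (legendre_kernel z)" if "dist z z0 < d" for z
        by (rule legendre_kernel_integrable[OF cut[OF that] c low[OF that]])
      show "set_integrable lborel {0<..} (\<lambda>w. 1 / (sqrt c * c) * (exp (- w) * \<bar>D w\<bar>))"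
        by (rule set_integrable_mult_right[OF D_exp_integrable])
      fix z :: complex and w :: real assume z: "dist z z0 < d" and w: "w \<in> {0<..}"
      have t: "0 \<le> exp (- w)" "exp (- w) \<le> 1" using w by auto
      define R where "R = radicand z (exp (- w))"
      have R: "R \<notin> \<real>\<^sub>\<le>\<^sub>0" unfolding R_def by (rule radicand_not_nonpos[OF cut[OF z] t])
      then have R0: "R \<noteq> 0" by auto
      have cR: "c \<le> norm R" unfolding R_def by (rule low[OF z t])
      have dR: "((\<lambda>z. radicand z (exp (- w))) has_field_derivative (- 2 * of_real (exp (- w)))) (at z)"
        unfolding radicand_def by (auto intro!: derivative_eq_intros)
      have "((\<lambda>z. csqrt (radicand z (exp (- w)))) has_field_derivative (1 / (2 * csqrt R) * (- 2 * of_real (exp (- w))))) (at z)"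
        using R unfolding R_def
        by (intro DERIV_cong[OF DERIV_chain2[OF has_field_derivative_csqrt dR]]) (auto simp: inverse_eq_divide)
      then have "((\<lambda>z. 1 / csqrt (radicand z (exp (- w)))) has_field_derivative (- (1 / (2 * csqrt R) * (- 2 * of_real (exp (- w)))) / (csqrt R * csqrt R))) (at z)"
        using R0 unfolding R_def by (intro DERIV_cong[OF DERIV_divide[OF DERIV_const]]) auto
      moreover have "csqrt R * csqrt R = R" using power2_csqrt[of R] by (simp add: power2_eq_square)
      ultimately have "((\<lambda>z. 1 / csqrt (radicand z (exp (- w)))) has_field_derivative (of_real (exp (- w)) / (csqrt R * R))) (at z)"
        by simp
      then show "((\<lambda>z. legendre_kernel z w) has_field_derivative f' z w) (at z)"
        unfolding legendre_kernel_def f'_def R_def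
        by (intro DERIV_cmult DERIV_cong[OF DERIV_diff[OF _ DERIV_const]]) auto
      have "norm (csqrt R) = sqrt (norm R)"
        by (metis power2_csqrt norm_power norm_ge_zero real_sqrt_unique)
      then have "norm (f' z w) = \<bar>D w\<bar> * (exp (- w) / (sqrt (norm R) * norm R))"
        by (simp add: f'_def R_def norm_mult norm_divide)
      also have "\<dots> \<le> \<bar>D w\<bar> * (exp (- w) / (sqrt c * c))"
        using cR c by (intro mult_left_mono divide_left_mono mult_mono mult_pos_pos) auto
      finally show "norm (f' z w) \<le> 1 / (sqrt c * c) * (exp (- w) * \<bar>D w\<bar>)" by (simp add: mult_ac)
    next
      have "continuous_on {0<..} (f' z0)"
        unfolding f'_def
      proof (intro continuous_intros continuous_on_subset[OF Dc])
        show "continuous_on {0<..} (\<lambda>w. csqrt (radicand z0 (exp (- w))))"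
        proof (rule continuous_on_compose2[OF continuous_on_csqrt])
          show "continuous_on {0<..} (\<lambda>w. radicand z0 (exp (- w)))" unfolding radicand_def by (intro continuous_intros)
          show "(\<lambda>w. radicand z0 (exp (- w))) ` {0<..} \<subseteq> - \<real>\<^sub>\<le>\<^sub>0"
            using radicand_not_nonpos[OF z0] by auto
        qed
        show "continuous_on {0<..} (\<lambda>w. radicand z0 (exp (- w)))" unfolding radicand_def by (intro continuous_intros)
        show "\<forall>w\<in>{0<..}. csqrt (radicand z0 (exp (- w))) * radicand z0 (exp (- w)) \<noteq> 0"
        proof
          fix w :: real assume "w \<in> {0<..}"
          then have "radicand z0 (exp (- w)) \<notin> \<real>\<^sub>\<le>\<^sub>0" by (intro radicand_not_nonpos[OF z0]) auto
          then show "csqrt (radicand z0 (exp (- w))) * radicand z0 (exp (- w)) \<noteq> 0" by (auto simp: csqrt_eq_0)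
        qed
      qed auto
      then show "set_borel_measurable lborel {0<..} (f' z0)" unfolding set_borel_measurable_def
        using borel_measurable_continuous_on_indicator[of "{0<..}" "f' z0"] by simp
    qed
    then show ?thesis by (auto simp: field_differentiable_def)
  qed
  then have "(\<lambda>z. LBINT w:{0<..}. legendre_kernel z w) holomorphic_on cut_plane"
    by (auto simp: holomorphic_on_def intro: field_differentiable_at_within)
  then show ?thesis unfolding legendre_continuation_def[abs_def] by (intro holomorphic_intros)
qed

text \<open>The generating function is summed under the integral. The bound \<open>\<bar>P\<^sub>n\<bar> \<le> 1\<close> and the
  behaviour \<open>sqrt w\<close> of \<open>D\<close> at 0 make the terms \<open>O(n^(-3/2))\<close>.\<close>

lemma legendre_continuation_sums:
  fixes x :: real
  assumes x: "\<bar>x\<bar> < 1"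
  shows "(\<lambda>n. complex_of_real (1 / (4 * pi) * ((2 * real n + 1) * a n * legendre_P n x))) sums legendre_continuation (of_real x)"
proof -
  define g where "g = (\<lambda>n w. exp (- real (Suc n) * w) * D w * legendre_P (Suc n) x)"
  have Pb: "\<bar>legendre_P n x\<bar> \<le> 1" for n using x by (intro legendre_P_bound) simp
  have gb: "\<bar>g n w\<bar> \<le> C * (w powr (3 / 2 - 1) * exp (- (real (Suc n) - 1 / 16) * w))" if "w > 0" for n w
  proof -
    have "exp (- real (Suc n) * w) * \<bar>D w\<bar> * \<bar>legendre_P (Suc n) x\<bar> \<le> exp (- real (Suc n) * w) * (C * (sqrt w * exp (w / 16))) * 1"
      using Db[OF that] that C by (intro mult_mono Pb) auto
    also have "\<dots> = C * (sqrt w * (exp (- real (Suc n) * w) * exp (w / 16)))" by simp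
    also have "exp (- real (Suc n) * w) * exp (w / 16) = exp (- (real (Suc n) - 1 / 16) * w)"
      unfolding mult_exp_exp by (simp add: algebra_simps)
    also have "sqrt w = w powr (3 / 2 - 1)" using that by (simp add: powr_half_sqrt)
    finally show ?thesis by (simp add: g_def abs_mult)
  qed
  have k: "real (Suc n) - 1 / 16 > 0" for n by simp
  note G = Gamma_integral_scaled[of "3/2", OF _ k]
  have Gi: "set_integrable lborel {0<..} (\<lambda>w. C * (w powr (3 / 2 - 1) * exp (- (real (Suc n) - 1 / 16) * w)))" for n
    by (intro set_integrable_mult_right G(1)) simp
  have gi: "set_integrable lborel {0<..} (g n)" for n
  proof (rule set_integrable_bound[OF Gi])
    show "set_borel_measurable lborel {0<..} (g n)"
      unfolding g_def by (intro set_borel_measurable_continuous_on continuous_intros continuous_on_subset[OF Dc]) auto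
    show "AE w in lborel. w \<in> {0<..} \<longrightarrow> norm (g n w) \<le> norm (C * (w powr (3 / 2 - 1) * exp (- (real (Suc n) - 1 / 16) * w)))"
    proof (intro AE_I2 impI)
      fix w :: real assume "w \<in> {0<..}"
      then show "norm (g n w) \<le> norm (C * (w powr (3 / 2 - 1) * exp (- (real (Suc n) - 1 / 16) * w)))"
        using order_trans[OF gb abs_ge_self, of w n] by simp
    qed
  qed
  have gen: "(\<lambda>n. g n w) sums (D w * (1 / sqrt (1 - 2 * x * exp (- w) + (exp (- w))\<^sup>2) - 1))" if w: "w > 0" for w
  proof -
    have "(\<lambda>n. exp (- w) ^ n * legendre_P n x) sums (1 / sqrt (1 - 2 * x * exp (- w) + (exp (- w))\<^sup>2))"
      by (rule legendre_genfun) (use x w in auto)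
    then have "(\<lambda>n. exp (- w) ^ Suc n * legendre_P (Suc n) x) sums (1 / sqrt (1 - 2 * x * exp (- w) + (exp (- w))\<^sup>2) - 1)"
      by (subst sums_Suc_iff) simp
    then have "(\<lambda>n. D w * (exp (- w) ^ Suc n * legendre_P (Suc n) x)) sums (D w * (1 / sqrt (1 - 2 * x * exp (- w) + (exp (- w))\<^sup>2) - 1))"
      by (rule sums_mult)
    moreover have e: "exp (- w) ^ Suc n = exp (- real (Suc n) * w)" for n
      by (simp only: exp_of_nat_mult[symmetric]) (simp add: algebra_simps)
    ultimately show ?thesis by (simp only: e g_def mult_ac)
  qed
  have gs: "summable (\<lambda>n. \<bar>g n w\<bar>)" if "w \<in> {0<..}" for w
  proof -
    have w: "exp (- w) < 1" using that by simp
    have "summable (\<lambda>n. exp (- w) ^ Suc n * \<bar>D w\<bar>)"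
      using w by (intro summable_mult2) (simp add: summable_Suc_iff summable_geometric)
    then show ?thesis
    proof (rule summable_comparison_test')
      fix n
      have "exp (- w) ^ Suc n = exp (- real (Suc n) * w)"
        by (simp only: exp_of_nat_mult[symmetric]) (simp add: algebra_simps)
      moreover have "exp (- real (Suc n) * w) * \<bar>D w\<bar> * \<bar>legendre_P (Suc n) x\<bar> \<le> exp (- real (Suc n) * w) * \<bar>D w\<bar> * 1"
        by (intro mult_left_mono Pb) auto
      ultimately show "norm \<bar>g n w\<bar> \<le> exp (- w) ^ Suc n * \<bar>D w\<bar>"
        by (simp only: g_def abs_mult real_norm_def abs_abs abs_exp_cancel)
    qed
  qed
  have gn: "summable (\<lambda>n. LBINT w:{0<..}. \<bar>g n w\<bar>)"
  proof (rule summable_comparison_test')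
    have "summable (\<lambda>n. real (Suc n) powr (- (3 / 2)))"
      by (subst summable_Suc_iff) (simp add: summable_real_powr_iff)
    then show "summable (\<lambda>n. C * Gamma (3 / 2) * 2 powr (3 / 2) * real (Suc n) powr (- (3 / 2)))"
      by (rule summable_mult)
    fix n
    have "(LBINT w:{0<..}. \<bar>g n w\<bar>) \<le> (LBINT w:{0<..}. C * (w powr (3 / 2 - 1) * exp (- (real (Suc n) - 1 / 16) * w)))"
      by (intro set_integral_mono set_integrable_abs gi Gi gb) auto
    also have "\<dots> = C * (Gamma (3 / 2) / (real (Suc n) - 1 / 16) powr (3 / 2))"
      using G(2)[of n] by (simp only: set_integral_mult_right)
    also have "\<dots> \<le> C * (Gamma (3 / 2) / (real (Suc n) / 2) powr (3 / 2))"
      using C by (intro mult_left_mono divide_left_mono powr_mono2 mult_pos_pos) (auto simp: Gamma_real_pos less_imp_le)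
    also have "\<dots> = C * Gamma (3 / 2) * 2 powr (3 / 2) * real (Suc n) powr (- (3 / 2))"
    proof -
      have "(real (Suc n) / 2) powr (3 / 2) = real (Suc n) powr (3 / 2) / 2 powr (3 / 2)"
        by (rule powr_divide)
      moreover have "real (Suc n) powr (- (3 / 2)) = 1 / real (Suc n) powr (3 / 2)"
        by (simp only: powr_minus_divide)
      ultimately show ?thesis by (simp only: divide_divide_eq_right times_divide_eq_left times_divide_eq_right mult_1_right mult.assoc)
    qed
    finally show "norm (LBINT w:{0<..}. \<bar>g n w\<bar>) \<le> C * Gamma (3 / 2) * 2 powr (3 / 2) * real (Suc n) powr (- (3 / 2))"
      using set_lebesgue_integral_nonneg[of "{0<..}" "\<lambda>w. \<bar>g n w\<bar>" lborel] by simp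
  qed
  have "(\<lambda>n. LBINT w:{0<..}. g n w) sums (LBINT w:{0<..}. (\<Sum>n. g n w))"
    by (rule set_integral_suminf(2)[OF gi gs gn])
  moreover have "(LBINT w:{0<..}. g n w) = (2 * real (Suc n) + 1) * a (Suc n) * legendre_P (Suc n) x" for n
    unfolding g_def Da by (rule set_integral_mult_left)
  ultimately have s1: "(\<lambda>n. (2 * real (Suc n) + 1) * a (Suc n) * legendre_P (Suc n) x) sums (LBINT w:{0<..}. (\<Sum>n. g n w))"
    by simp
  have "(\<lambda>n. (2 * real n + 1) * a n * legendre_P n x) sums ((LBINT w:{0<..}. (\<Sum>n. g n w)) + a 0)"
    using sums_Suc[OF s1] by simp
  then have "(\<lambda>n. complex_of_real (1 / (4 * pi) * ((2 * real n + 1) * a n * legendre_P n x))) sums of_real (1 / (4 * pi) * ((LBINT w:{0<..}. (\<Sum>n. g n w)) + a 0))"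
    by (intro sums_of_real sums_mult)
  also have "of_real (1 / (4 * pi) * ((LBINT w:{0<..}. (\<Sum>n. g n w)) + a 0)) = legendre_continuation (of_real x)"
  proof -
    have "(LBINT w:{0<..}. legendre_kernel (of_real x) w) = (LBINT w:{0<..}. complex_of_real (\<Sum>n. g n w))"
    proof (intro set_lebesgue_integral_cong allI impI)
      fix w :: real assume w: "w \<in> {0<..}"
      define \<rho> where "\<rho> = 1 - 2 * x * exp (- w) + (exp (- w))\<^sup>2"
      have "radicand (of_real x) (exp (- w)) = of_real \<rho>"
        by (simp add: radicand_def \<rho>_def)
      moreover have "\<rho> \<ge> 0"
      proof -
        have "x * exp (- w) \<le> 1 * exp (- w)" using x by (intro mult_right_mono) auto
        then have "\<rho> \<ge> (1 - exp (- w))\<^sup>2" by (simp add: \<rho>_def power2_eq_square algebra_simps)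
        then show ?thesis using zero_le_power2[of "1 - exp (- w)"] by linarith
      qed
      ultimately have "csqrt (radicand (of_real x) (exp (- w))) = of_real (sqrt \<rho>)"
        by (simp add: csqrt_of_real_nonneg)
      then have "legendre_kernel (of_real x) w = of_real (D w * (1 / sqrt \<rho> - 1))"
        by (simp add: legendre_kernel_def)
      then show "legendre_kernel (of_real x) w = of_real (\<Sum>n. g n w)"
        using gen[of w] w by (simp add: sums_iff \<rho>_def)
    qed simp
    also have "\<dots> = of_real (LBINT w:{0<..}. (\<Sum>n. g n w))" by (rule set_integral_complex_of_real)
    finally show ?thesis by (simp add: legendre_continuation_def algebra_simps)
  qed
  finally show ?thesis .
qed

text \<open>The explicit integral is a witness for the choice in the definition of the Legendre sum,
  and by the identity theorem on the connected cut plane every other witness agrees with it.\<close>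

lemma legendre_sum_eq:
  assumes z: "z \<in> cut_plane"
  shows "legendre_sum a z = legendre_continuation z"
proof -
  define Q where "Q = (\<lambda>g. g holomorphic_on cut_plane \<and>
     (\<forall>x::real. \<bar>x\<bar> < 1 \<longrightarrow>
        (\<lambda>n. complex_of_real (1 / (4 * pi) * ((2 * real n + 1) * a n * legendre_P n x))) sums g (of_real x)))"
  have "Q legendre_continuation" unfolding Q_def by (intro conjI allI impI legendre_continuation_holomorphic legendre_continuation_sums)
  then have QS: "Q (legendre_sum a)" unfolding legendre_sum_def Q_def[symmetric] by (rule someI[of Q legendre_continuation])
  have eq: "legendre_sum a (of_real x) = legendre_continuation (of_real x)" if "\<bar>x\<bar> < 1" for x :: real
  proof (rule sums_unique2[OF _ legendre_continuation_sums[OF that]])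
    show "(\<lambda>n. complex_of_real (1 / (4 * pi) * ((2 * real n + 1) * a n * legendre_P n x))) sums legendre_sum a (of_real x)"
      using QS that unfolding Q_def by blast
  qed
  have "legendre_sum a z - legendre_continuation z = 0"
  proof (rule analytic_continuation[of "\<lambda>z. legendre_sum a z - legendre_continuation z" cut_plane "complex_of_real ` {-1<..<1}" 0])
    show "(\<lambda>z. legendre_sum a z - legendre_continuation z) holomorphic_on cut_plane"
      using QS legendre_continuation_holomorphic unfolding Q_def by (intro holomorphic_intros) auto
    show "(0::complex) islimpt complex_of_real ` {- 1<..<1}"
      unfolding islimpt_approachable
    proof (intro allI impI)
      fix e :: real assume e: "e > 0"
      then show "\<exists>x'\<in>complex_of_real ` {- 1<..<1}. x' \<noteq> 0 \<and> dist x' 0 < e"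
        by (intro bexI[OF _ imageI[of "min e 1 / 2"]]) (auto simp: min_def)
    qed
    show "legendre_sum a z - legendre_continuation z = 0" if "z \<in> complex_of_real ` {- 1<..<1}" for z
      using that eq by (auto simp: abs_less_iff)
  qed (use z open_cut_plane connected_cut_plane in \<open>auto simp: cut_plane_def\<close>)
  then show ?thesis by simp
qed

end

section \<open>The jump across the cut\<close>

text \<open>The continuous extension of the principal square root from the upper half-plane to its
  closure. On the negative axis it is the limit from above, and its conjugate the limit from
  below.\<close>

definition sqrt_above :: "complex \<Rightarrow> complex" where
  "sqrt_above R = Complex (sqrt ((norm R + Re R) / 2)) (sqrt ((norm R - Re R) / 2))"

lemma csqrt_sqrt_above:
  "Im R > 0 \<Longrightarrow> csqrt R = sqrt_above R" "Im R < 0 \<Longrightarrow> csqrt R = cnj (sqrt_above R)"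
  by (simp_all add: sqrt_above_def complex_eq_iff)

lemma tendsto_sqrt_above [tendsto_intros]:
  "(f \<longlongrightarrow> l) F \<Longrightarrow> ((\<lambda>x. sqrt_above (f x)) \<longlongrightarrow> sqrt_above l) F"
  unfolding sqrt_above_def by (intro tendsto_intros) auto

lemma sqrt_above_of_real:
  "\<rho> \<ge> 0 \<Longrightarrow> sqrt_above (of_real \<rho>) = of_real (sqrt \<rho>)"
  "\<rho> \<le> 0 \<Longrightarrow> sqrt_above (of_real \<rho>) = \<i> * of_real (sqrt (- \<rho>))"
  by (auto simp: sqrt_above_def complex_eq_iff)

lemma cos_Complex: "cos (Complex u v) = Complex (cos u * cosh v) (- (sin u * sinh v))"
  by (simp add: complex_eq_iff Re_cos Im_cos cosh_def sinh_def field_simps)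

text \<open>This factorisation shows where the radicand is real and negative: at \<open>z = cosh v\<close>, exactly
  for \<open>\<bar>w\<bar> < v\<close>.\<close>

lemma radicand_exp: "radicand z (exp (- w)) = 2 * of_real (exp (- w)) * (of_real (cosh w) - z)"
proof -
  have "2 * exp (- w) * cosh w = 1 + (exp (- w))\<^sup>2"
    by (simp add: cosh_def power2_eq_square algebra_simps mult_exp_exp)
  then have "2 * complex_of_real (exp (- w)) * of_real (cosh w) = 1 + (of_real (exp (- w)))\<^sup>2"
    by (metis of_real_1 of_real_add of_real_mult of_real_numeral of_real_power)
  then show ?thesis by (simp add: radicand_def right_diff_distrib)
qed

text \<open>The point of the confocal ellipse through \<open>cosh v\<close> that is nearest to \<open>cosh w\<close> is its
  vertex. This makes the majorant of the kernel independent of \<open>u\<close>.\<close>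

lemma norm_cosh_minus_cos:
  "\<bar>cosh w - cosh v\<bar> \<le> norm (of_real (cosh w) - cos (Complex u v))"
proof -
  define X Y where "X = cosh w" and "Y = cosh v"
  have XY: "X \<ge> 1" "Y \<ge> 1" by (auto simp: X_def Y_def cosh_real_ge_1)
  have S: "(sinh v)\<^sup>2 = Y\<^sup>2 - 1" using cosh_square_eq[of v] by (simp add: Y_def)
  have s: "(sin u)\<^sup>2 = 1 - (cos u)\<^sup>2" by (simp add: sin_squared_eq)
  have "1 * 1 \<le> X * Y" using XY by (intro mult_mono) auto
  then have "(1 - cos u) * (2 * X * Y - 1 - cos u) \<ge> 0"
    using cos_le_one[of u] by (intro mult_nonneg_nonneg) linarith+
  moreover have "(X - cos u * Y)\<^sup>2 + (sin u * sinh v)\<^sup>2 = (X - Y)\<^sup>2 + (1 - cos u) * (2 * X * Y - 1 - cos u)"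
    unfolding power_mult_distrib[of "sin u"] S s by (simp add: power2_eq_square algebra_simps)
  ultimately have "(X - Y)\<^sup>2 \<le> (X - cos u * Y)\<^sup>2 + (sin u * sinh v)\<^sup>2" by simp
  then have "\<bar>X - Y\<bar> \<le> sqrt ((X - cos u * Y)\<^sup>2 + (sin u * sinh v)\<^sup>2)"
    by (intro real_le_rsqrt) simp
  then show ?thesis by (simp add: cos_Complex cmod_def X_def Y_def)
qed

lemma norm_cos_Complex_le: "v \<ge> 0 \<Longrightarrow> norm (cos (Complex u v)) \<le> 2 * cosh v"
proof -
  assume v: "v \<ge> 0"
  have "norm (cos (Complex u v)) \<le> \<bar>cos u * cosh v\<bar> + \<bar>sin u * sinh v\<bar>"
    using cmod_le[of "cos (Complex u v)"] by (simp add: cos_Complex)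
  also have "\<dots> \<le> 1 * cosh v + 1 * cosh v"
    unfolding abs_mult using v sinh_le_cosh_real[of v] by (intro add_mono mult_mono) auto
  finally show ?thesis by simp
qed

lemma cosh_diff_lower:
  fixes v w :: real
  shows "v \<ge> 0 \<Longrightarrow> w \<ge> 0 \<Longrightarrow> v * \<bar>w - v\<bar> / 2 \<le> \<bar>cosh w - cosh v\<bar>"
proof -
  have *: "v * (y - x) / 2 \<le> cosh y - cosh x" if "0 \<le> x" "x \<le> y" "v \<le> y" "0 \<le> v" for x y v :: real
  proof -
    have sx: "sinh t \<ge> t" if "t \<ge> 0" for t :: real
    proof -
      have "sinh 0 - 0 \<le> sinh t - t"
      proof (rule DERIV_nonneg_imp_nondecreasing[OF that])
        fix x :: real
        show "\<exists>y. ((\<lambda>t. sinh t - t) has_real_derivative y) (at x) \<and> 0 \<le> y"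
          by (rule exI[of _ "cosh x - 1"]) (auto intro!: derivative_eq_intros cosh_real_ge_1)
      qed
      then show ?thesis by simp
    qed
    have "cosh y - cosh x = 2 * sinh ((y + x) / 2) * sinh ((y - x) / 2)"
      by (simp add: cosh_def sinh_def algebra_simps mult_exp_exp add_divide_distrib diff_divide_distrib)
    moreover have "((y + x) / 2) * ((y - x) / 2) \<le> sinh ((y + x) / 2) * sinh ((y - x) / 2)"
      using that by (intro mult_mono sx) auto
    moreover have "v * ((y - x) / 2) \<le> (y + x) * ((y - x) / 2)"
      using that by (intro mult_right_mono) auto
    ultimately show ?thesis by simp
  qed
  assume "v \<ge> 0" "w \<ge> 0"
  then show ?thesis using *[of v w v] *[of w v v] by (cases "v \<le> w") (auto simp: abs_if)
qed

context legendre_data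
begin

text \<open>Both boundary values come from dominated convergence in the integral formula, with kernel
  involving the square root from above or from below. The two kernels agree where the radicand
  is positive and are opposite, up to the common term, where it is negative; this leaves the
  integral over \<open>w < arcosh y\<close>.\<close>

lemma jump_fun_eq:
  assumes y: "y > 1"
  shows "jump_fun a y = of_real (1 / (pi * sqrt 2) * (LBINT w:{0<..<arcosh y}. (D w * exp (w / 2) / 2) / sqrt (y - cosh w)))"
proof -
  define v where "v = arcosh y"
  have v: "v > 0" "cosh v = y" using y by (auto simp: v_def)
  have sv: "sinh v > 0" using v by simp
  define \<rho> where "\<rho> = (\<lambda>w. 2 * exp (- w) * (cosh w - y))"
  \<comment> \<open>Here \<open>\<rho>\<close> is the radicand at the boundary point \<open>z = cosh v\<close>.\<close>
  define Q where "Q = (\<lambda>w. sqrt_above (of_real (\<rho> w)))"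
  define M where "M = (4 * y + 1) * C * 17 / sqrt v"
  have domint: "set_integrable lborel {0<..} (\<lambda>w. M * (exp (- (3 / 8) * w) / sqrt \<bar>w - v\<bar>))"
    using v by (intro set_integrable_mult_right set_integrable_exp_inverse_sqrt) auto
  have dom: "norm (legendre_kernel (cos (Complex u v)) w) \<le> M * (exp (- (3 / 8) * w) / sqrt \<bar>w - v\<bar>)" if w: "w > 0" "w \<noteq> v" for u w
  proof -
    define z where "z = cos (Complex u v)"
    define t where "t = exp (- w)"
    have t: "0 < t" "t \<le> 1" using w by (auto simp: t_def)
    have "v * \<bar>w - v\<bar> / 2 \<le> norm (of_real (cosh w) - z)"
      unfolding z_def using cosh_diff_lower[of v w] norm_cosh_minus_cos[of w v u] v w by linarith
    then have "2 * t * (v * \<bar>w - v\<bar> / 2) \<le> 2 * t * norm (of_real (cosh w) - z)"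
      using t by (intro mult_left_mono) auto
    also have "\<dots> = norm (radicand z t)"
      using t unfolding radicand_exp t_def by (simp add: norm_mult)
    finally have low: "t * v * \<bar>w - v\<bar> \<le> norm (radicand z t)" by simp
    have pos: "0 < t * v * \<bar>w - v\<bar>" using t v w by simp
    have "norm (1 / csqrt (radicand z t) - 1) \<le> (2 * norm z + 1) * t / sqrt (norm (radicand z t))"
      by (rule inverse_csqrt_radicand_bound) (use t low pos in auto)
    also have "\<dots> \<le> (4 * y + 1) * t / sqrt (t * v * \<bar>w - v\<bar>)"
      using norm_cos_Complex_le[of v u] v t low pos unfolding z_def[symmetric]
      by (intro frac_le mult_mono real_sqrt_le_mono real_sqrt_gt_zero) auto
    also have "\<dots> = (4 * y + 1) * sqrt t / (sqrt v * sqrt \<bar>w - v\<bar>)"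
    proof -
      have A: "sqrt (t * v * \<bar>w - v\<bar>) = sqrt t * sqrt v * sqrt \<bar>w - v\<bar>" by (simp only: real_sqrt_mult)
      have "(4 * y + 1) * t / sqrt (t * v * \<bar>w - v\<bar>) = (4 * y + 1) * (sqrt t * sqrt t) / (sqrt t * sqrt v * sqrt \<bar>w - v\<bar>)"
        unfolding A using t by simp
      also have "\<dots> = (4 * y + 1) * sqrt t / (sqrt v * sqrt \<bar>w - v\<bar>)" using t by (simp del: real_sqrt_mult_self)
      finally show ?thesis .
    qed
    finally have k: "norm (1 / csqrt (radicand z t) - 1) \<le> (4 * y + 1) * sqrt t / (sqrt v * sqrt \<bar>w - v\<bar>)" .
    have st: "sqrt t = exp (- w / 2)"
      by (rule real_sqrt_unique) (auto simp: t_def power2_eq_square mult_exp_exp)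
    have "\<bar>D w\<bar> \<le> C * (sqrt w * exp (w / 16))" by (rule Db[OF w(1)])
    also have "\<dots> \<le> C * (((1 + 1 / (1 / 16)) * exp (1 / 16 * w)) * exp (w / 16))"
      using w C by (intro mult_left_mono mult_right_mono sqrt_le_exp) auto
    also have "\<dots> = C * 17 * exp (w / 8)" by (simp add: mult_exp_exp)
    finally have d: "\<bar>D w\<bar> \<le> C * 17 * exp (w / 8)" .
    have "norm (legendre_kernel z w) = \<bar>D w\<bar> * norm (1 / csqrt (radicand z t) - 1)"
      by (simp add: legendre_kernel_def norm_mult t_def)
    also have "\<dots> \<le> (C * 17 * exp (w / 8)) * ((4 * y + 1) * sqrt t / (sqrt v * sqrt \<bar>w - v\<bar>))"
      using d k C by (intro mult_mono) auto
    also have "\<dots> = (4 * y + 1) * C * 17 / sqrt v * ((exp (w / 8) * exp (- w / 2)) / sqrt \<bar>w - v\<bar>)"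
      unfolding st by simp
    also have "exp (w / 8) * exp (- w / 2) = exp (- (3 / 8) * w)" by (simp add: mult_exp_exp)
    finally show ?thesis by (simp only: M_def z_def)
  qed
  have Qcont: "continuous_on S Q" for S
    unfolding Q_def sqrt_above_def \<rho>_def Complex_eq by (intro continuous_intros) auto
  \<comment> \<open>The boundary kernels: \<open>q\<close> is the identity for the approach \<open>u > 0\<close>, where the radicand
    tends to the real axis from above, and conjugation for \<open>u < 0\<close>.\<close>
  define K :: "(complex \<Rightarrow> complex) \<Rightarrow> real \<Rightarrow> complex" where "K = (\<lambda>q w. of_real (D w) * (1 / q (Q w) - 1))"
  have \<rho>0: "\<rho> w \<noteq> 0" if "w > 0" "w \<noteq> v" for w
  proof -
    have "cosh w \<noteq> cosh v"
      using that v arcosh_cosh_real[of w] arcosh_cosh_real[of v] by (metis less_imp_le)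
    then show ?thesis using v by (simp add: \<rho>_def)
  qed
  have Q0: "Q w \<noteq> 0" if "w > 0" "w \<noteq> v" for w
  proof (cases "\<rho> w \<ge> 0")
    case True
    then show ?thesis using \<rho>0[OF that] by (simp add: Q_def sqrt_above_of_real)
  next
    case False
    then show ?thesis by (simp add: Q_def sqrt_above_of_real)
  qed
  have lim: "((\<lambda>u. legendre_sum a (cos (Complex (sg * u) v))) \<longlongrightarrow> of_real (a 0 / (4 * pi)) + of_real (1 / (4 * pi)) * (LBINT w:{0<..}. K q w)) (at_right 0)"
    and int: "set_integrable lborel {0<..} (K q)"
    if sg: "(sg = 1 \<and> q = (\<lambda>x. x)) \<or> (sg = -1 \<and> q = cnj)" for sg :: real and q :: "complex \<Rightarrow> complex"
  proof -
    have Kmeas: "set_borel_measurable lborel {0<..} (K q)"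
    proof -
      have [measurable]: "Q \<in> borel_measurable borel" by (rule borel_measurable_continuous_onI[OF Qcont])
      have [measurable]: "D \<in> borel_measurable borel" by (rule borel_measurable_continuous_onI[OF Dc])
      have [measurable]: "q \<in> borel_measurable borel"
        using sg by (auto intro!: borel_measurable_continuous_onI continuous_intros)
      show ?thesis unfolding set_borel_measurable_def K_def by measurable
    qed
    have cz: "cos (Complex (sg * u) v) \<in> cut_plane" if "0 < u" "u < 1" for u
    proof -
      have "sin u > 0" by (rule sin_gt_zero) (use that pi_gt3 in auto)
      then have "Im (cos (Complex (sg * u) v)) \<noteq> 0" using sv sg by (auto simp: cos_Complex)
      then show ?thesis by (auto simp: cut_plane_def)
    qed
    have pw: "(\<lambda>n. legendre_kernel (cos (Complex (sg * S n) v)) w) \<longlonglongrightarrow> K q w"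
      if S: "\<And>n. 0 < S n" "\<And>n. S n < 1" "S \<longlonglongrightarrow> 0" and w: "w > 0" "w \<noteq> v" for S w
    proof -
      define R where "R = (\<lambda>n. radicand (cos (Complex (sg * S n) v)) (exp (- w)))"
      have "(\<lambda>n. 2 * of_real (exp (- w)) * (of_real (cosh w) - Complex (cos (sg * S n) * cosh v) (- (sin (sg * S n) * sinh v)))) \<longlonglongrightarrow> 2 * of_real (exp (- w)) * (of_real (cosh w) - Complex (cos (sg * 0) * cosh v) (- (sin (sg * 0) * sinh v)))"
        by (intro tendsto_intros S)
      moreover have "2 * of_real (exp (- w)) * (of_real (cosh w) - Complex (cos (sg * 0) * cosh v) (- (sin (sg * 0) * sinh v))) = of_real (\<rho> w)"
        by (simp add: \<rho>_def v complex_eq_iff)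
      ultimately have R: "R \<longlonglongrightarrow> of_real (\<rho> w)"
        unfolding R_def radicand_exp cos_Complex by (simp only:)
      have "csqrt (R n) = q (sqrt_above (R n))" for n
      proof -
        have "sin (S n) > 0" by (rule sin_gt_zero) (use S(1,2)[of n] pi_gt3 in auto)
        then have p: "2 * exp (- w) * (sin (S n) * sinh v) > 0" using sv by simp
        have "Im (R n) = sg * (2 * exp (- w) * (sin (S n) * sinh v))"
          using sg unfolding R_def radicand_exp cos_Complex by auto
        then show ?thesis using sg p csqrt_sqrt_above[of "R n"] by auto
      qed
      moreover have "(\<lambda>n. of_real (D w) * (1 / q (sqrt_above (R n)) - 1)) \<longlonglongrightarrow> of_real (D w) * (1 / q (Q w) - 1)"
        unfolding Q_def using sg Q0[OF w] by (auto intro!: tendsto_intros R simp: Q_def)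
      ultimately show ?thesis by (simp add: legendre_kernel_def K_def R_def)
    qed
    have Kdom: "norm (K q w) \<le> M * (exp (- (3 / 8) * w) / sqrt \<bar>w - v\<bar>)" if w: "w > 0" "w \<noteq> v" for w
    proof -
      have "(\<lambda>n. legendre_kernel (cos (Complex (sg * (1 / real (n + 2))) v)) w) \<longlonglongrightarrow> K q w"
      proof (rule pw[OF _ _ _ w])
        show "(\<lambda>n. 1 / real (n + 2)) \<longlonglongrightarrow> 0" by real_asymp
      qed auto
      then have "(\<lambda>n. norm (legendre_kernel (cos (Complex (sg * (1 / real (n + 2))) v)) w)) \<longlonglongrightarrow> norm (K q w)"
        by (rule tendsto_norm)
      then show ?thesis by (rule LIMSEQ_le_const2) (use dom[OF w] in auto)
    qed
    have ne: "AE w in lborel. w \<noteq> v" by (rule AE_lborel_singleton)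
    show Kint: "set_integrable lborel {0<..} (K q)"
    proof (rule set_integrable_bound[OF domint Kmeas])
      show "AE w in lborel. w \<in> {0<..} \<longrightarrow> norm (K q w) \<le> norm (M * (exp (- (3 / 8) * w) / sqrt \<bar>w - v\<bar>))"
        using ne
      proof eventually_elim
        case (elim w)
        show ?case
        proof
          assume "w \<in> {0<..}"
          then have "norm (K q w) \<le> M * (exp (- (3 / 8) * w) / sqrt \<bar>w - v\<bar>)" by (intro Kdom) (use elim in auto)
          also have "\<dots> \<le> norm (M * (exp (- (3 / 8) * w) / sqrt \<bar>w - v\<bar>))" by (simp only: real_norm_def abs_ge_self)
          finally show "norm (K q w) \<le> norm (M * (exp (- (3 / 8) * w) / sqrt \<bar>w - v\<bar>))" .
        qed
      qed
    qed
    show "((\<lambda>u. legendre_sum a (cos (Complex (sg * u) v))) \<longlongrightarrow> of_real (a 0 / (4 * pi)) + of_real (1 / (4 * pi)) * (LBINT w:{0<..}. K q w)) (at_right 0)"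
    proof (rule tendsto_at_right_sequentially[of 0 1])
      fix S :: "nat \<Rightarrow> real"
      assume S: "\<And>n. 0 < S n" "\<And>n. S n < 1" "decseq S" "S \<longlonglongrightarrow> 0"
      have "(\<lambda>n. LBINT w:{0<..}. legendre_kernel (cos (Complex (sg * S n) v)) w) \<longlonglongrightarrow> (LBINT w:{0<..}. K q w)"
        unfolding set_lebesgue_integral_def
      proof (rule integral_dominated_convergence[where w = "\<lambda>w. indicator {0<..} w *\<^sub>R (M * (exp (- (3 / 8) * w) / sqrt \<bar>w - v\<bar>))"])
        show "(\<lambda>x. indicator {0<..} x *\<^sub>R K q x) \<in> borel_measurable lborel"
          using Kmeas by (simp add: set_borel_measurable_def)
        show "(\<lambda>x. indicator {0<..} x *\<^sub>R legendre_kernel (cos (Complex (sg * S n) v)) x) \<in> borel_measurable lborel" for n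
          using legendre_kernel_measurable[OF cz[OF S(1) S(2)], of n] by (simp add: set_borel_measurable_def)
        show "integrable lborel (\<lambda>w. indicator {0<..} w *\<^sub>R (M * (exp (- (3 / 8) * w) / sqrt \<bar>w - v\<bar>)))"
          using domint by (simp add: set_integrable_def)
        show "AE x in lborel. (\<lambda>n. indicator {0<..} x *\<^sub>R legendre_kernel (cos (Complex (sg * S n) v)) x) \<longlonglongrightarrow> indicator {0<..} x *\<^sub>R K q x"
          using ne
        proof eventually_elim
          case (elim x)
          then show ?case using pw[OF S(1) S(2) S(4), of x] by (cases "x > 0") auto
        qed
        show "AE x in lborel. norm (indicator {0<..} x *\<^sub>R legendre_kernel (cos (Complex (sg * S n) v)) x) \<le> indicator {0<..} x *\<^sub>R (M * (exp (- (3 / 8) * x) / sqrt \<bar>x - v\<bar>))" for n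
          using ne
        proof eventually_elim
          case (elim x)
          then show ?case using dom[of x "sg * S n"] by (cases "x > 0") auto
        qed
      qed
      then have "(\<lambda>n. legendre_continuation (cos (Complex (sg * S n) v))) \<longlonglongrightarrow> of_real (a 0 / (4 * pi)) + of_real (1 / (4 * pi)) * (LBINT w:{0<..}. K q w)"
        unfolding legendre_continuation_def by (intro tendsto_intros)
      then show "(\<lambda>n. legendre_sum a (cos (Complex (sg * S n) v))) \<longlonglongrightarrow> of_real (a 0 / (4 * pi)) + of_real (1 / (4 * pi)) * (LBINT w:{0<..}. K q w)"
        using legendre_sum_eq[OF cz[OF S(1) S(2)]] by simp
    qed simp
  qed
  have fp: "f_plus a v = of_real (a 0 / (4 * pi)) + of_real (1 / (4 * pi)) * (LBINT w:{0<..}. K (\<lambda>x. x) w)"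
    unfolding f_plus_def using lim(1)[of 1 "\<lambda>x. x"] by (intro tendsto_Lim) auto
  have fm: "f_minus a v = of_real (a 0 / (4 * pi)) + of_real (1 / (4 * pi)) * (LBINT w:{0<..}. K cnj w)"
    unfolding f_minus_def using lim(1)[of "-1" cnj] by (intro tendsto_Lim) auto
  have "(LBINT w:{0<..}. K (\<lambda>x. x) w) - (LBINT w:{0<..}. K cnj w) = (LBINT w:{0<..}. K (\<lambda>x. x) w - K cnj w)"
    by (rule set_integral_diff(2)[symmetric]) (use int[of 1 "\<lambda>x. x"] int[of "-1" cnj] in auto)
  also have "\<dots> = (LBINT w:{0<..<v}. - \<i> * of_real (2 * sqrt 2 * ((D w * exp (w / 2) / 2) / sqrt (y - cosh w))))"
    unfolding set_lebesgue_integral_def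
  proof (rule integral_cong_AE)
    have [measurable]: "Q \<in> borel_measurable borel" by (rule borel_measurable_continuous_onI[OF Qcont])
    have [measurable]: "D \<in> borel_measurable borel" by (rule borel_measurable_continuous_onI[OF Dc])
    have [measurable]: "cnj \<in> borel_measurable borel" by (intro borel_measurable_continuous_onI continuous_intros)
    have [measurable]: "(cosh :: real \<Rightarrow> real) \<in> borel_measurable borel" by (intro borel_measurable_continuous_onI continuous_intros)
    show "(\<lambda>w. indicator {0<..} w *\<^sub>R (K (\<lambda>x. x) w - K cnj w)) \<in> borel_measurable lborel"
      unfolding K_def by measurable
    show "(\<lambda>w. indicator {0<..<v} w *\<^sub>R (- \<i> * of_real (2 * sqrt 2 * ((D w * exp (w / 2) / 2) / sqrt (y - cosh w))))) \<in> borel_measurable lborel"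
      by measurable
    have "AE w in lborel. w \<noteq> v" by (rule AE_lborel_singleton)
    then show "AE w in lborel. indicator {0<..} w *\<^sub>R (K (\<lambda>x. x) w - K cnj w) = indicator {0<..<v} w *\<^sub>R (- \<i> * of_real (2 * sqrt 2 * ((D w * exp (w / 2) / 2) / sqrt (y - cosh w))))"
    proof eventually_elim
      case (elim w)
      show ?case
      proof (cases "w > 0")
        case w: True
        show ?thesis
        proof (cases "w < v")
          case True
          have "cosh w < y" using cosh_real_strict_mono[of w v] w True v by simp
          then have "exp (- w) * (cosh w - y) < 0" by (intro mult_pos_neg) auto
          then have neg: "\<rho> w \<le> 0" "- \<rho> w > 0" by (auto simp: \<rho>_def)
          define r where "r = sqrt (- \<rho> w)"
          have r: "r > 0" using neg by (simp add: r_def)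
          have Q: "Q w = \<i> * of_real r" unfolding Q_def r_def by (rule sqrt_above_of_real(2)[OF neg(1)])
          have "1 / (\<i> * complex_of_real r) - 1 / cnj (\<i> * complex_of_real r) = - \<i> * of_real (2 / r)"
            using r by (simp add: field_simps)
          then have "of_real (D w) * (1 / (\<i> * complex_of_real r) - 1 / cnj (\<i> * complex_of_real r)) = of_real (D w) * (- \<i> * of_real (2 / r))"
            by (rule arg_cong)
          moreover have "K (\<lambda>x. x) w - K cnj w = of_real (D w) * (1 / (\<i> * complex_of_real r) - 1 / cnj (\<i> * complex_of_real r))"
            unfolding K_def Q by (simp add: divide_inverse algebra_simps)
          ultimately have 1: "K (\<lambda>x. x) w - K cnj w = - \<i> * of_real (2 / r * D w)"
            by (simp only: of_real_mult mult_ac)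
          have "r = sqrt 2 * exp (- w / 2) * sqrt (y - cosh w)"
          proof -
            have "- \<rho> w = 2 * (exp (- w / 2))\<^sup>2 * (y - cosh w)"
              by (simp add: \<rho>_def power2_eq_square mult_exp_exp algebra_simps)
            then show ?thesis unfolding r_def by (simp add: real_sqrt_mult)
          qed
          then have "2 / r * D w = (sqrt 2 * sqrt 2) / (sqrt 2 * (exp (- w / 2) * sqrt (y - cosh w))) * D w"
            by (simp add: mult_ac)
          also have "(sqrt 2 * sqrt 2) / (sqrt 2 * (exp (- w / 2) * sqrt (y - cosh w))) = sqrt 2 / (exp (- w / 2) * sqrt (y - cosh w))"
            by (rule nonzero_mult_divide_mult_cancel_left) simp
          also have "\<dots> * D w = 2 * sqrt 2 * ((D w * exp (w / 2) / 2) / sqrt (y - cosh w))"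
          proof -
            have "exp (- w / 2) = inverse (exp (w / 2))" by (simp add: exp_minus[symmetric])
            then show ?thesis by (simp only:) (simp add: field_simps)
          qed
          finally have 2: "2 / r * D w = 2 * sqrt 2 * ((D w * exp (w / 2) / 2) / sqrt (y - cosh w))" .
          show ?thesis unfolding 1 2 using w True by simp
        next
          case False
          then have "v < w" using elim by simp
          then have "y < cosh w" using cosh_real_strict_mono[of v w] v by simp
          then have "\<rho> w \<ge> 0" by (simp add: \<rho>_def)
          then have "Q w = of_real (sqrt (\<rho> w))" unfolding Q_def by (rule sqrt_above_of_real(1))
          then have "K (\<lambda>x. x) w = K cnj w" by (simp add: K_def)
          then show ?thesis using False by simp
        qed
      qed auto
    qed
  qed
  also have "\<dots> = - \<i> * of_real (2 * sqrt 2 * (LBINT w:{0<..<v}. (D w * exp (w / 2) / 2) / sqrt (y - cosh w)))"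
    by (simp only: set_integral_mult_right set_integral_complex_of_real)
  finally have diff: "(LBINT w:{0<..}. K (\<lambda>x. x) w) - (LBINT w:{0<..}. K cnj w) = - \<i> * of_real (2 * sqrt 2 * (LBINT w:{0<..<v}. (D w * exp (w / 2) / 2) / sqrt (y - cosh w)))" .
  define I where "I = (LBINT w:{0<..<v}. (D w * exp (w / 2) / 2) / sqrt (y - cosh w))"
  have "jump_fun a y = \<i> * (f_plus a v - f_minus a v)" using y by (simp add: jump_fun_def v_def)
  also have "f_plus a v - f_minus a v = of_real (1 / (4 * pi)) * ((LBINT w:{0<..}. K (\<lambda>x. x) w) - (LBINT w:{0<..}. K cnj w))"
    unfolding fp fm by (simp only: right_diff_distrib add_diff_cancel_left)
  also have "\<dots> = of_real (1 / (4 * pi)) * (- \<i> * of_real (2 * sqrt 2 * I))" unfolding diff I_def ..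
  also have "\<i> * (of_real (1 / (4 * pi)) * (- \<i> * of_real (2 * sqrt 2 * I))) = of_real (1 / (4 * pi) * (2 * sqrt 2 * I))"
    by simp
  also have "1 / (4 * pi) * (2 * sqrt 2 * I) = 1 / (pi * sqrt 2) * I"
  proof -
    have "(2 * sqrt 2) * (pi * sqrt 2) = 2 * pi * (sqrt 2 * sqrt 2)" by (simp only: mult_ac)
    then have "4 * pi = (2 * sqrt 2) * (pi * sqrt 2)" by simp
    then have "(2 * sqrt 2) / (4 * pi) = (2 * sqrt 2) / ((2 * sqrt 2) * (pi * sqrt 2))" by (rule arg_cong)
    also have "\<dots> = 1 / (pi * sqrt 2)" by (subst nonzero_divide_mult_cancel_left) auto
    finally have "(2 * sqrt 2) / (4 * pi) * I = 1 / (pi * sqrt 2) * I" by (rule arg_cong)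
    then show ?thesis by (simp only: times_divide_eq_left mult_1_left times_divide_eq_right mult_ac)
  qed
  finally show ?thesis by (simp only: I_def v_def)
qed

end

section \<open>The Abel transform and its derivative\<close>

lemma exp_arcosh_le: "x \<ge> 1 \<Longrightarrow> exp (arcosh x) \<le> 2 * x" for x :: real
proof -
  assume x: "x \<ge> 1"
  have "sqrt (x\<^sup>2 - 1) \<le> sqrt (x\<^sup>2)" by (intro real_sqrt_le_mono) simp
  moreover have "exp (arcosh x) = x + sqrt (x\<^sup>2 - 1)"
  proof -
    have "x + sqrt (x\<^sup>2 - 1) > 0" using x by (intro add_pos_nonneg) auto
    then show ?thesis using x by (simp add: arcosh_real_def)
  qed
  ultimately show ?thesis using x by simp
qed

lemma DERIV_arcosh_chain:
  fixes g :: "real \<Rightarrow> real"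
  assumes "(g has_real_derivative D) (at z)" "g z > 1"
  shows "((\<lambda>y. arcosh (g y)) has_real_derivative D / sqrt ((g z)\<^sup>2 - 1)) (at z)"
  by (rule DERIV_cong[OF DERIV_chain2[OF arcosh_real_has_field_derivative[OF assms(2)] assms(1)]]) simp

lemma cosh_real_gt_1: "w > 0 \<Longrightarrow> cosh w > (1::real)"
  using cosh_real_strict_mono[of 0 w] by simp

text \<open>The substitution \<open>x = y - (y - 1) \<eta>\<^sup>2\<close> maps \<open>[0,1]\<close> to \<open>[1,y]\<close>, absorbs the square root
  singularity at \<open>x = y\<close> and makes the domain independent of \<open>y\<close>, so that one can differentiate
  in \<open>y\<close>.\<close>

definition abel_node :: "real \<Rightarrow> real \<Rightarrow> real" where "abel_node y \<eta> = y - (y - 1) * \<eta>\<^sup>2"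

lemma abel_node_ge_1: "y \<ge> 1 \<Longrightarrow> 0 \<le> \<eta> \<Longrightarrow> \<eta> \<le> 1 \<Longrightarrow> abel_node y \<eta> \<ge> 1"
  and abel_node_gt_1: "y > 1 \<Longrightarrow> 0 \<le> \<eta> \<Longrightarrow> \<eta> < 1 \<Longrightarrow> abel_node y \<eta> > 1"
  and abel_node_le: "y \<ge> 1 \<Longrightarrow> abel_node y \<eta> \<le> y"
proof -
  have e: "abel_node y \<eta> - 1 = (y - 1) * (1 - \<eta>\<^sup>2)" by (simp add: abel_node_def algebra_simps)
  show "abel_node y \<eta> \<ge> 1" if "y \<ge> 1" "0 \<le> \<eta>" "\<eta> \<le> 1"
  proof -
    have "(y - 1) * (1 - \<eta>\<^sup>2) \<ge> 0" using that by (intro mult_nonneg_nonneg) (auto simp: power_le_one)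
    then show ?thesis using e by simp
  qed
  show "abel_node y \<eta> > 1" if "y > 1" "0 \<le> \<eta>" "\<eta> < 1"
  proof -
    have "(y - 1) * (1 - \<eta>\<^sup>2) > 0" using that by (intro mult_pos_pos) (auto simp: power2_eq_square mult_less_cancel_left intro: le_less_trans[OF mult_left_le])
    then show ?thesis using e by simp
  qed
qed (simp add: abel_node_def)

lemma abel_node_cont [continuous_intros]:
  "continuous_on S f \<Longrightarrow> continuous_on S g \<Longrightarrow> continuous_on S (\<lambda>x. abel_node (f x) (g x))"
  unfolding abel_node_def by (intro continuous_intros)

lemma abel_node_square: "(abel_node y \<eta>)\<^sup>2 - 1 = (y - 1) * (1 - \<eta>\<^sup>2) * (abel_node y \<eta> + 1)"
  by (simp add: abel_node_def power2_eq_square algebra_simps)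

context
  fixes h h' :: "real \<Rightarrow> real"
  assumes hd: "\<And>w. (h has_real_derivative h' w) (at w)"
    and hc: "continuous_on UNIV h'"
begin

lemma h_cont: "continuous_on UNIV h"
  by (auto intro!: continuous_at_imp_continuous_on DERIV_isCont[OF hd])

definition abel_int :: "real \<Rightarrow> real" where
  "abel_int y = integral {0..1} (\<lambda>\<eta>. h (arcosh (abel_node y \<eta>)))"

lemma cont_abel: "y \<ge> 1 \<Longrightarrow> continuous_on {0..1} (\<lambda>\<eta>. h (arcosh (abel_node y \<eta>)))"
  by (intro continuous_on_compose2[OF h_cont] continuous_intros) (auto simp: abel_node_ge_1)

lemma abel_substitution:
  assumes y: "y > 1"
  shows "(LBINT x:{1..<y}. h (arcosh x) / sqrt (y - x)) = 2 * sqrt (y - 1) * abel_int y"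
proof -
  have img: "abel_node y ` {0<..1} = {1..<y}"
  proof (intro equalityI subsetI)
    fix x assume "x \<in> {1..<y}"
    then have "x = abel_node y (sqrt ((y - x) / (y - 1)))" "sqrt ((y - x) / (y - 1)) \<in> {0<..1}"
      using y by (auto simp: abel_node_def)
    then show "x \<in> abel_node y ` {0<..1}" by (rule image_eqI)
  qed (use y in \<open>auto simp: abel_node_ge_1\<close>, simp add: abel_node_def)
  have c: "continuous_on {1..<y} (\<lambda>x. h (arcosh x) / sqrt (y - x))"
    by (intro continuous_intros continuous_on_compose2[OF h_cont]) auto
  have ev: "\<bar>- (2 * (y - 1) * \<eta>)\<bar> * (h (arcosh (abel_node y \<eta>)) / sqrt (y - abel_node y \<eta>)) = 2 * sqrt (y - 1) * h (arcosh (abel_node y \<eta>))"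
    if "\<eta> \<in> {0<..1}" for \<eta>
  proof -
    have 1: "sqrt (y - abel_node y \<eta>) = sqrt (y - 1) * \<eta>" using that by (simp add: abel_node_def real_sqrt_mult)
    have 2: "\<bar>- (2 * (y - 1) * \<eta>)\<bar> = 2 * sqrt (y - 1) * (sqrt (y - 1) * \<eta>)"
      using that y by (simp add: abs_mult)
    show ?thesis unfolding 1 2 using that y by simp
  qed
  have c2: "continuous_on {0<..1} (\<lambda>\<eta>. 2 * sqrt (y - 1) * h (arcosh (abel_node y \<eta>)))"
    by (intro continuous_intros continuous_on_subset[OF cont_abel]) (use y in auto)
  have "(LBINT x:{1..<y}. h (arcosh x) / sqrt (y - x)) = (LBINT \<eta>:{0<..1}. \<bar>- (2 * (y - 1) * \<eta>)\<bar> * (h (arcosh (abel_node y \<eta>)) / sqrt (y - abel_node y \<eta>)))"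
  proof (rule lborel_change_of_variables(2)[symmetric, OF _ img])
    show "(abel_node y has_real_derivative - (2 * (y - 1) * \<eta>)) (at \<eta> within {0<..1})" for \<eta>
      unfolding abel_node_def[abs_def] by (auto intro!: derivative_eq_intros)
    show "inj_on (abel_node y) {0<..1}"
      using y by (auto simp: inj_on_def abel_node_def)
    show "set_borel_measurable lborel {1..<y} (\<lambda>x. h (arcosh x) / sqrt (y - x))"
      by (rule set_borel_measurable_continuous_on[OF c]) auto
    show "set_borel_measurable lborel {0<..1} (\<lambda>\<eta>. \<bar>- (2 * (y - 1) * \<eta>)\<bar> * (h (arcosh (abel_node y \<eta>)) / sqrt (y - abel_node y \<eta>)))"
      by (rule set_borel_measurable_continuous_on[OF continuous_on_eq[OF c2]]) (use ev in auto)
  qed auto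
  also have "\<dots> = (LBINT \<eta>:{0<..1}. 2 * sqrt (y - 1) * h (arcosh (abel_node y \<eta>)))"
    by (intro set_lebesgue_integral_cong) (use ev in auto)
  also have "\<dots> = 2 * sqrt (y - 1) * (LBINT \<eta>:{0<..1}. h (arcosh (abel_node y \<eta>)))" by simp
  also have "(LBINT \<eta>:{0<..1}. h (arcosh (abel_node y \<eta>))) = (LBINT \<eta>:{0..1}. h (arcosh (abel_node y \<eta>)))"
    by (rule set_integral_discrete_difference[of "{0}"]) auto
  also have "\<dots> = abel_int y" unfolding abel_int_def
    by (rule set_borel_integral_eq_integral(2)[OF borel_integrable_atLeastAtMost'[OF cont_abel]]) (use y in auto)
  finally show ?thesis .
qed

lemma conv_chi_eq:
  assumes y: "y > 1"
  shows "conv_chi (\<lambda>x. complex_of_real (h (arcosh x))) y = of_real (2 * sqrt (y - 1) * abel_int y)"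
proof -
  have "conv_chi (\<lambda>x. complex_of_real (h (arcosh x))) y = (LBINT x:{1..y}. complex_of_real (h (arcosh x) / sqrt (y - x)))"
    by (simp add: conv_chi_def)
  also have "\<dots> = of_real (LBINT x:{1..y}. h (arcosh x) / sqrt (y - x))"
    by (rule set_integral_complex_of_real)
  also have "(LBINT x:{1..y}. h (arcosh x) / sqrt (y - x)) = (LBINT x:{1..<y}. h (arcosh x) / sqrt (y - x))"
    by (rule set_integral_discrete_difference[of "{y}"]) auto
  finally show ?thesis using abel_substitution[OF y] by simp
qed

text \<open>The integrand of \<open>\<integral> h'(w) / sqrt (y - cosh w) dw\<close> after the substitution; it differs from
  the one in the derivative of the Abel integral by the factor \<open>1 - \<eta>\<^sup>2\<close>.\<close>

definition abel_kernel :: "real \<Rightarrow> real \<Rightarrow> real" where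
  "abel_kernel y \<eta> = h' (arcosh (abel_node y \<eta>)) / (sqrt (y - 1) * sqrt (1 - \<eta>\<^sup>2) * sqrt (abel_node y \<eta> + 1))"

definition abel_int' :: "real \<Rightarrow> real" where
  "abel_int' y = integral {0..1} (\<lambda>\<eta>. h' (arcosh (abel_node y \<eta>)) * sqrt (1 - \<eta>\<^sup>2) / (sqrt (y - 1) * sqrt (abel_node y \<eta> + 1)))"

lemma cont_abel': "continuous_on ({1<..} \<times> {0..1}) (\<lambda>(y, \<eta>). h' (arcosh (abel_node y \<eta>)) * sqrt (1 - \<eta>\<^sup>2) / (sqrt (y - 1) * sqrt (abel_node y \<eta> + 1)))"
proof -
  have "abel_node (fst p) (snd p) \<ge> 1" if "p \<in> {1<..} \<times> {0..1}" for p
    using that by (intro abel_node_ge_1) auto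
  note g = this
  have "continuous_on ({1<..} \<times> {0..1}) (\<lambda>p. arcosh (abel_node (fst p) (snd p)))"
    by (rule continuous_on_compose2[OF continuous_on_arcosh[OF order_refl]]) (auto intro!: continuous_intros abel_node_ge_1)
  then have "continuous_on ({1<..} \<times> {0..1}) (\<lambda>p. h' (arcosh (abel_node (fst p) (snd p))))"
    by (rule continuous_on_compose2[OF hc]) auto
  then show ?thesis
    unfolding case_prod_unfold
  proof (intro continuous_intros ballI)
    fix p :: "real \<times> real" assume "p \<in> {1<..} \<times> {0..1}"
    with g[of p] show "sqrt (fst p - 1) * sqrt (abel_node (fst p) (snd p) + 1) \<noteq> 0" by auto
  qed
qed

lemma abel_int_deriv:
  assumes y: "y > 1"
  shows "(abel_int has_real_derivative abel_int' y) (at y)"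
proof -
  have "((\<lambda>y. integral (cbox 0 1) (\<lambda>\<eta>. h (arcosh (abel_node y \<eta>)))) has_field_derivative
      integral (cbox 0 1) (\<lambda>\<eta>. h' (arcosh (abel_node y \<eta>)) * sqrt (1 - \<eta>\<^sup>2) / (sqrt (y - 1) * sqrt (abel_node y \<eta> + 1)))) (at y within {1<..})"
  proof (rule leibniz_rule_field_derivative)
    fix z \<eta> :: real assume z: "z \<in> {1<..}" and \<eta>: "\<eta> \<in> cbox 0 1"
    show "((\<lambda>y. h (arcosh (abel_node y \<eta>))) has_real_derivative
            h' (arcosh (abel_node z \<eta>)) * sqrt (1 - \<eta>\<^sup>2) / (sqrt (z - 1) * sqrt (abel_node z \<eta> + 1))) (at z within {1<..})"
    proof (cases "\<eta> = 1")
      case True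
      then show ?thesis by (simp add: abel_node_def)
    next
      case False
      then have \<eta>: "0 \<le> \<eta>" "\<eta> < 1" using \<eta> by auto
      have gt: "abel_node z \<eta> > 1" using abel_node_gt_1[of z \<eta>] z \<eta> by auto
      have p: "1 - \<eta>\<^sup>2 > 0" using \<eta> by (simp add: abs_square_less_1)
      have "((\<lambda>y. abel_node y \<eta>) has_real_derivative 1 - \<eta>\<^sup>2) (at z)"
        unfolding abel_node_def by (auto intro!: derivative_eq_intros)
      then have "((\<lambda>y. arcosh (abel_node y \<eta>)) has_real_derivative (1 - \<eta>\<^sup>2) / sqrt ((abel_node z \<eta>)\<^sup>2 - 1)) (at z)"
        using gt by (rule DERIV_arcosh_chain)
      then have "((\<lambda>y. h (arcosh (abel_node y \<eta>))) has_real_derivative h' (arcosh (abel_node z \<eta>)) * ((1 - \<eta>\<^sup>2) / sqrt ((abel_node z \<eta>)\<^sup>2 - 1))) (at z)"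
        by (rule DERIV_chain2[OF hd])
      also have "(1 - \<eta>\<^sup>2) / sqrt ((abel_node z \<eta>)\<^sup>2 - 1) = sqrt (1 - \<eta>\<^sup>2) / (sqrt (z - 1) * sqrt (abel_node z \<eta> + 1))"
      proof -
        have r: "1 - \<eta>\<^sup>2 = sqrt (1 - \<eta>\<^sup>2) * sqrt (1 - \<eta>\<^sup>2)" using p by simp
        have "(r * r) / (a * r * b) = r / (a * b)" if "r \<noteq> 0" for r a b :: real
          using that by simp
        then show ?thesis unfolding abel_node_square real_sqrt_mult using p r by (metis real_sqrt_eq_zero_cancel_iff less_irrefl)
      qed
      finally show ?thesis by (simp add: has_field_derivative_at_within)
    qed
  next
    fix z :: real assume "z \<in> {1<..}"
    then show "(\<lambda>\<eta>. h (arcosh (abel_node z \<eta>))) integrable_on cbox 0 1"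
      using integrable_continuous_real[OF cont_abel[of z]] by simp
  next
    show "continuous_on ({1<..} \<times> cbox 0 1) (\<lambda>(y, \<eta>). h' (arcosh (abel_node y \<eta>)) * sqrt (1 - \<eta>\<^sup>2) / (sqrt (y - 1) * sqrt (abel_node y \<eta> + 1)))"
      using cont_abel' by simp
  qed (use y in auto)
  then show ?thesis
    using at_within_open[of y "{1<..}"] y by (simp add: abel_int_def[abs_def] abel_int'_def)
qed

lemma cont_abel_int': "continuous_on {1<..} abel_int'"
proof -
  have "continuous_on {1<..} (\<lambda>y. integral (cbox 0 1) (\<lambda>\<eta>. h' (arcosh (abel_node y \<eta>)) * sqrt (1 - \<eta>\<^sup>2) / (sqrt (y - 1) * sqrt (abel_node y \<eta> + 1))))"
    by (rule integral_continuous_on_param) (use cont_abel' in simp)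
  then show ?thesis by (simp add: abel_int'_def[abs_def])
qed

lemma abel_kernel_integrable:
  assumes y: "y > 1"
  shows "set_integrable lborel {0<..<1} (abel_kernel y)"
proof -
  have "compact ((\<lambda>\<eta>. h' (arcosh (abel_node y \<eta>))) ` {0..1})"
    by (intro compact_continuous_image continuous_on_compose2[OF hc] continuous_intros) (use y in \<open>auto simp: abel_node_ge_1\<close>)
  then obtain B where B: "\<And>\<eta>. \<eta> \<in> {0..1} \<Longrightarrow> \<bar>h' (arcosh (abel_node y \<eta>))\<bar> \<le> B"
    using compact_imp_bounded[THEN bounded_iff[THEN iffD1]] by (metis imageI real_norm_def)
  have B0: "B \<ge> 0" using B[of 0] by simp
  have i: "set_integrable lborel {0<..<1} (\<lambda>\<eta>. B / sqrt (y - 1) * (1 / sqrt \<bar>\<eta> - 1\<bar>))"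
    by (intro set_integrable_mult_right set_integrable_subset[OF set_integrable_inverse_sqrt_dist[of 1]]) auto
  have p: "1 - \<eta>\<^sup>2 > 0" "abel_node y \<eta> > 1" if "\<eta> \<in> {0<..<1}" for \<eta>
    using that y by (auto simp: abel_node_gt_1 abs_square_less_1)
  show ?thesis
  proof (rule set_integrable_bound[OF i])
    show "set_borel_measurable lborel {0<..<1} (abel_kernel y)"
      unfolding abel_kernel_def
      by (intro set_borel_measurable_continuous_on continuous_intros continuous_on_compose2[OF hc])
         (use p y in \<open>auto simp: less_imp_le\<close>, (use p in fastforce)+)
    show "AE \<eta> in lborel. \<eta> \<in> {0<..<1} \<longrightarrow> norm (abel_kernel y \<eta>) \<le> norm (B / sqrt (y - 1) * (1 / sqrt \<bar>\<eta> - 1\<bar>))"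
    proof (intro AE_I2 impI)
      fix \<eta> :: real assume \<eta>: "\<eta> \<in> {0<..<1}"
      have "1 - \<eta> \<le> 1 - \<eta>\<^sup>2" using \<eta> by (simp add: power2_eq_square mult_left_le)
      then have s: "sqrt (1 - \<eta>) * 1 \<le> sqrt (1 - \<eta>\<^sup>2) * sqrt (abel_node y \<eta> + 1)"
        using p[OF \<eta>] by (intro mult_mono) auto
      have "norm (abel_kernel y \<eta>) = \<bar>h' (arcosh (abel_node y \<eta>))\<bar> / (sqrt (y - 1) * (sqrt (1 - \<eta>\<^sup>2) * sqrt (abel_node y \<eta> + 1)))"
        using p[OF \<eta>] y by (simp add: abel_kernel_def abs_mult mult_ac)
      also have "\<dots> \<le> B / (sqrt (y - 1) * (sqrt (1 - \<eta>) * 1))"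
        using B[of \<eta>] \<eta> y s B0 by (intro frac_le mult_left_mono) auto
      also have "\<dots> = norm (B / sqrt (y - 1) * (1 / sqrt \<bar>\<eta> - 1\<bar>))"
        using B0 y \<eta> by (simp add: abs_mult)
      finally show "norm (abel_kernel y \<eta>) \<le> norm (B / sqrt (y - 1) * (1 / sqrt \<bar>\<eta> - 1\<bar>))" .
    qed
  qed
qed

lemma abel_kernel_substitution:
  assumes y: "y > 1"
  shows "(LBINT w:{0<..<arcosh y}. h' w / sqrt (y - cosh w)) = 2 * sqrt (y - 1) * (LBINT \<eta>:{0<..<1}. abel_kernel y \<eta>)"
proof -
  have gt: "abel_node y \<eta> > 1" "abel_node y \<eta> < y" if "\<eta> \<in> {0<..<1}" for \<eta>
    using that y abel_node_gt_1[of y \<eta>] by (auto simp: abel_node_def)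
  have img: "(\<lambda>\<eta>. arcosh (abel_node y \<eta>)) ` {0<..<1} = {0<..<arcosh y}"
  proof (intro equalityI subsetI)
    fix w assume "w \<in> {0<..<arcosh y}"
    then have w: "w > 0" "cosh w < y"
      using y cosh_real_strict_mono[of w "arcosh y"] by auto
    have w1: "cosh w > 1" using w cosh_real_gt_1[of w] by simp
    have "sqrt ((y - cosh w) / (y - 1)) \<in> {0<..<1}" using w w1 by simp
    moreover have "abel_node y (sqrt ((y - cosh w) / (y - 1))) = cosh w" using w w1 by (simp add: abel_node_def)
    ultimately show "w \<in> (\<lambda>\<eta>. arcosh (abel_node y \<eta>)) ` {0<..<1}"
      using w by (intro image_eqI[of _ _ "sqrt ((y - cosh w) / (y - 1))"]) (auto simp: arcosh_cosh_real)
  qed (use gt y in \<open>force+\<close>)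
  have ev: "\<bar>- (2 * (y - 1) * \<eta>) / sqrt ((abel_node y \<eta>)\<^sup>2 - 1)\<bar> * (h' (arcosh (abel_node y \<eta>)) / sqrt (y - cosh (arcosh (abel_node y \<eta>)))) = 2 * sqrt (y - 1) * abel_kernel y \<eta>"
    if \<eta>: "\<eta> \<in> {0<..<1}" for \<eta>
  proof -
    have p: "1 - \<eta>\<^sup>2 > 0" using \<eta> by (simp add: abs_square_less_1)
    have 1: "sqrt (y - cosh (arcosh (abel_node y \<eta>))) = sqrt (y - 1) * \<eta>"
      using gt[OF \<eta>] \<eta> by (simp add: abel_node_def real_sqrt_mult)
    have 2: "\<bar>- (2 * (y - 1) * \<eta>) / sqrt ((abel_node y \<eta>)\<^sup>2 - 1)\<bar> = 2 * (sqrt (y - 1) * sqrt (y - 1)) * \<eta> / (sqrt (y - 1) * sqrt (1 - \<eta>\<^sup>2) * sqrt (abel_node y \<eta> + 1))"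
      unfolding abel_node_square real_sqrt_mult using \<eta> y p gt[OF \<eta>] by (simp add: abs_mult)
    have "2 * (a * a) * \<eta> / (a * b * c) * (k / (a * \<eta>)) = 2 * a * (k / (a * b * c))" if "a \<noteq> 0" for a b c k
      using that \<eta> by (simp add: field_simps)
    from this[of "sqrt (y - 1)"] show ?thesis unfolding 1 2 abel_kernel_def using y by auto
  qed
  have "(LBINT w:{0<..<arcosh y}. h' w / sqrt (y - cosh w)) =
    (LBINT \<eta>:{0<..<1}. \<bar>- (2 * (y - 1) * \<eta>) / sqrt ((abel_node y \<eta>)\<^sup>2 - 1)\<bar> * (h' (arcosh (abel_node y \<eta>)) / sqrt (y - cosh (arcosh (abel_node y \<eta>)))))"
  proof (rule lborel_change_of_variables(2)[symmetric, OF _ img])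
    show "((\<lambda>\<eta>. arcosh (abel_node y \<eta>)) has_real_derivative - (2 * (y - 1) * \<eta>) / sqrt ((abel_node y \<eta>)\<^sup>2 - 1)) (at \<eta> within {0<..<1})"
      if "\<eta> \<in> {0<..<1}" for \<eta>
    proof -
      have "(abel_node y has_real_derivative - (2 * (y - 1) * \<eta>)) (at \<eta>)"
        unfolding abel_node_def[abs_def] by (auto intro!: derivative_eq_intros)
      then have "((\<lambda>\<eta>. arcosh (abel_node y \<eta>)) has_real_derivative - (2 * (y - 1) * \<eta>) / sqrt ((abel_node y \<eta>)\<^sup>2 - 1)) (at \<eta>)"
        using gt(1)[OF that] by (rule DERIV_arcosh_chain)
      then show ?thesis by (rule has_field_derivative_at_within)
    qed
    show "inj_on (\<lambda>\<eta>. arcosh (abel_node y \<eta>)) {0<..<1}"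
    proof (rule inj_onI)
      fix a b assume ab: "a \<in> {0<..<1}" "b \<in> {0<..<1}" "arcosh (abel_node y a) = arcosh (abel_node y b)"
      then have "cosh (arcosh (abel_node y a)) = cosh (arcosh (abel_node y b))" by simp
      then have "abel_node y a = abel_node y b" using gt(1)[OF ab(1)] gt(1)[OF ab(2)] by simp
      then show "a = b" using ab y by (auto simp: abel_node_def)
    qed
    show "set_borel_measurable lborel {0<..<arcosh y} (\<lambda>w. h' w / sqrt (y - cosh w))"
    proof (intro set_borel_measurable_continuous_on continuous_intros continuous_on_subset[OF hc])
      show "\<forall>w\<in>{0<..<arcosh y}. sqrt (y - cosh w) \<noteq> 0"
      proof
        fix w assume "w \<in> {0<..<arcosh y}"
        then have "cosh w < cosh (arcosh y)" by (intro cosh_real_strict_mono) auto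
        then show "sqrt (y - cosh w) \<noteq> 0" using y by simp
      qed
    qed auto
    show "set_borel_measurable lborel {0<..<1} (\<lambda>\<eta>. \<bar>- (2 * (y - 1) * \<eta>) / sqrt ((abel_node y \<eta>)\<^sup>2 - 1)\<bar> * (h' (arcosh (abel_node y \<eta>)) / sqrt (y - cosh (arcosh (abel_node y \<eta>)))))"
    proof -
      have "set_integrable lborel {0<..<1} (\<lambda>\<eta>. 2 * sqrt (y - 1) * abel_kernel y \<eta>)"
        using abel_kernel_integrable[OF y] by simp
      then have "set_integrable lborel {0<..<1} (\<lambda>\<eta>. \<bar>- (2 * (y - 1) * \<eta>) / sqrt ((abel_node y \<eta>)\<^sup>2 - 1)\<bar> * (h' (arcosh (abel_node y \<eta>)) / sqrt (y - cosh (arcosh (abel_node y \<eta>)))))"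
        by (rule set_integrable_cong[THEN iffD1, rotated -1]) (use ev in auto)
      then show ?thesis by (auto simp: set_integrable_def set_borel_measurable_def)
    qed
  qed auto
  also have "\<dots> = (LBINT \<eta>:{0<..<1}. 2 * sqrt (y - 1) * abel_kernel y \<eta>)"
    by (intro set_lebesgue_integral_cong) (use ev in auto)
  finally show ?thesis by simp
qed

definition abel_deriv :: "real \<Rightarrow> real" where
  "abel_deriv y = h 0 / sqrt (y - 1) + (LBINT w:{0<..<arcosh y}. h' w / sqrt (y - cosh w))"

text \<open>Differentiating \<open>2 sqrt (y - 1)\<close> times the Abel integral does not give the kernel integral
  directly. The two are reconciled by integrating the \<open>\<eta>\<close>-derivative of \<open>\<eta> h(arcosh (abel_node y
  \<eta>))\<close> over \<open>[0,1]\<close>, whose boundary value is \<open>h 0\<close>.\<close>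

lemma abel_deriv_eq:
  assumes y: "y > 1"
  shows "abel_deriv y = abel_int y / sqrt (y - 1) + 2 * sqrt (y - 1) * abel_int' y"
proof -
  have p: "1 - \<eta>\<^sup>2 > 0" "abel_node y \<eta> > 1" if "0 < \<eta>" "\<eta> < 1" for \<eta>
    using that y by (auto simp: abel_node_gt_1 abs_square_less_1)
  have K: "set_integrable lborel {0<..<1} (abel_kernel y)" by (rule abel_kernel_integrable[OF y])
  have K2: "set_integrable lborel {0<..<1} (\<lambda>\<eta>. \<eta>\<^sup>2 * abel_kernel y \<eta>)"
  proof (rule set_integrable_bound[OF K])
    have "set_borel_measurable lborel {0<..<1} (abel_kernel y)"
      using K by (auto simp: set_integrable_def set_borel_measurable_def)
    then have "(\<lambda>\<eta>. \<eta>\<^sup>2 * (indicator {0<..<1} \<eta> *\<^sub>R abel_kernel y \<eta>)) \<in> borel_measurable lborel"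
      unfolding set_borel_measurable_def by (intro borel_measurable_times) auto
    then show "set_borel_measurable lborel {0<..<1} (\<lambda>\<eta>. \<eta>\<^sup>2 * abel_kernel y \<eta>)"
      by (simp add: set_borel_measurable_def mult.left_commute)
    show "AE \<eta> in lborel. \<eta> \<in> {0<..<1} \<longrightarrow> norm (\<eta>\<^sup>2 * abel_kernel y \<eta>) \<le> norm (abel_kernel y \<eta>)"
      by (intro AE_I2 impI) (auto simp: abs_mult power_le_one intro!: mult_left_le_one_le)
  qed
  have hI: "set_integrable lborel {0<..<1} (\<lambda>\<eta>. h (arcosh (abel_node y \<eta>)))"
    by (rule set_integrable_subset[OF borel_integrable_atLeastAtMost'[OF cont_abel]]) (use y in auto)
  have hI2: "(LBINT \<eta>:{0<..<1}. h (arcosh (abel_node y \<eta>))) = abel_int y"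
  proof -
    have "(LBINT \<eta>:{0<..<1}. h (arcosh (abel_node y \<eta>))) = (LBINT \<eta>:{0..1}. h (arcosh (abel_node y \<eta>)))"
      by (rule set_integral_discrete_difference[of "{0,1}"]) auto
    also have "\<dots> = abel_int y" unfolding abel_int_def
      by (rule set_borel_integral_eq_integral(2)[OF borel_integrable_atLeastAtMost'[OF cont_abel]]) (use y in auto)
    finally show ?thesis .
  qed
  have kI: "(LBINT \<eta>:{0<..<1}. abel_kernel y \<eta> - \<eta>\<^sup>2 * abel_kernel y \<eta>) = abel_int' y"
  proof -
    have c: "continuous_on {0..1} (\<lambda>\<eta>. h' (arcosh (abel_node y \<eta>)) * sqrt (1 - \<eta>\<^sup>2) / (sqrt (y - 1) * sqrt (abel_node y \<eta> + 1)))"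
    proof -
      have "continuous_on {0..1} (\<lambda>\<eta>. (\<lambda>(y, \<eta>). h' (arcosh (abel_node y \<eta>)) * sqrt (1 - \<eta>\<^sup>2) / (sqrt (y - 1) * sqrt (abel_node y \<eta> + 1))) (y, \<eta>))"
        by (rule continuous_on_compose2[OF cont_abel']) (use y in \<open>auto intro!: continuous_intros\<close>)
      then show ?thesis by simp
    qed
    have "(LBINT \<eta>:{0<..<1}. abel_kernel y \<eta> - \<eta>\<^sup>2 * abel_kernel y \<eta>) = (LBINT \<eta>:{0<..<1}. h' (arcosh (abel_node y \<eta>)) * sqrt (1 - \<eta>\<^sup>2) / (sqrt (y - 1) * sqrt (abel_node y \<eta> + 1)))"
    proof (intro set_lebesgue_integral_cong allI impI)
      fix \<eta> :: real assume "\<eta> \<in> {0<..<1}"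
      then have p: "1 - \<eta>\<^sup>2 > 0" using p by auto
      define r where "r = sqrt (1 - \<eta>\<^sup>2)"
      have r: "r > 0" "r * r = 1 - \<eta>\<^sup>2" using p by (auto simp: r_def)
      have "abel_kernel y \<eta> - \<eta>\<^sup>2 * abel_kernel y \<eta> = (r * r) * abel_kernel y \<eta>"
        unfolding r by (simp add: algebra_simps)
      then show "abel_kernel y \<eta> - \<eta>\<^sup>2 * abel_kernel y \<eta> = h' (arcosh (abel_node y \<eta>)) * sqrt (1 - \<eta>\<^sup>2) / (sqrt (y - 1) * sqrt (abel_node y \<eta> + 1))"
        using r(1) by (simp add: abel_kernel_def mult_ac flip: r_def)
    qed auto
    also have "\<dots> = (LBINT \<eta>:{0..1}. h' (arcosh (abel_node y \<eta>)) * sqrt (1 - \<eta>\<^sup>2) / (sqrt (y - 1) * sqrt (abel_node y \<eta> + 1)))"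
      by (rule set_integral_discrete_difference[of "{0,1}"]) auto
    also have "\<dots> = abel_int' y" unfolding abel_int'_def
      by (rule set_borel_integral_eq_integral(2)[OF borel_integrable_atLeastAtMost'[OF c]])
    finally show ?thesis .
  qed
  have "(LBINT \<eta>=0..1. h (arcosh (abel_node y \<eta>)) - 2 * (y - 1) * (\<eta>\<^sup>2 * abel_kernel y \<eta>)) = h 0 - 0"
  proof (rule interval_integral_FTC_integrable[where F = "\<lambda>\<eta>. \<eta> * h (arcosh (abel_node y \<eta>))"])
    fix \<eta> :: real assume "0 < ereal \<eta>" "ereal \<eta> < 1"
    then have \<eta>: "0 < \<eta>" "\<eta> < 1" by (auto simp: zero_ereal_def one_ereal_def)
    have "(abel_node y has_real_derivative - (2 * (y - 1) * \<eta>)) (at \<eta>)"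
      unfolding abel_node_def[abs_def] by (auto intro!: derivative_eq_intros)
    then have "((\<lambda>\<eta>. arcosh (abel_node y \<eta>)) has_real_derivative - (2 * (y - 1) * \<eta>) / sqrt ((abel_node y \<eta>)\<^sup>2 - 1)) (at \<eta>)"
      using p(2)[OF \<eta>] by (rule DERIV_arcosh_chain)
    then have D: "((\<lambda>\<eta>. h (arcosh (abel_node y \<eta>))) has_real_derivative h' (arcosh (abel_node y \<eta>)) * (- (2 * (y - 1) * \<eta>) / sqrt ((abel_node y \<eta>)\<^sup>2 - 1))) (at \<eta>)"
      by (rule DERIV_chain2[OF hd])
    have "((\<lambda>\<eta>. \<eta> * h (arcosh (abel_node y \<eta>))) has_real_derivative h (arcosh (abel_node y \<eta>)) - 2 * (y - 1) * (\<eta>\<^sup>2 * abel_kernel y \<eta>)) (at \<eta>)"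
      by (rule DERIV_cong[OF DERIV_mult[OF DERIV_ident D]])
         (simp only: abel_kernel_def abel_node_square real_sqrt_mult, simp add: power2_eq_square)
    then show "((\<lambda>\<eta>. \<eta> * h (arcosh (abel_node y \<eta>))) has_vector_derivative h (arcosh (abel_node y \<eta>)) - 2 * (y - 1) * (\<eta>\<^sup>2 * abel_kernel y \<eta>)) (at \<eta>)"
      by (simp add: has_real_derivative_iff_has_vector_derivative)
    have "continuous_on {0<..<1} (\<lambda>\<eta>. h (arcosh (abel_node y \<eta>)) - 2 * (y - 1) * (\<eta>\<^sup>2 * abel_kernel y \<eta>))"
      unfolding abel_kernel_def
      by (intro continuous_intros continuous_on_compose2[OF hc] continuous_on_compose2[OF h_cont])
         (use p y in \<open>auto simp: less_imp_le\<close>, (use p in fastforce)+)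
    then show "isCont (\<lambda>\<eta>. h (arcosh (abel_node y \<eta>)) - 2 * (y - 1) * (\<eta>\<^sup>2 * abel_kernel y \<eta>)) \<eta>"
      using \<eta> by (simp add: continuous_on_eq_continuous_at)
  next
    have e: "einterval 0 1 = {0<..<1::real}" by (auto simp: einterval_def zero_ereal_def one_ereal_def)
    show "set_integrable lborel (einterval 0 1) (\<lambda>\<eta>. h (arcosh (abel_node y \<eta>)) - 2 * (y - 1) * (\<eta>\<^sup>2 * abel_kernel y \<eta>))"
      unfolding e by (intro set_integral_diff(1) hI set_integrable_mult_right K2)
    have c: "continuous_on {0..1} (\<lambda>\<eta>. \<eta> * h (arcosh (abel_node y \<eta>)))"
      by (intro continuous_intros cont_abel) (use y in auto)
    have "((\<lambda>\<eta>. \<eta> * h (arcosh (abel_node y \<eta>))) \<longlongrightarrow> 0 * h (arcosh (abel_node y 0))) (at_right 0)"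
      using continuous_on_Icc_at_rightD[OF c] by simp
    then show "(((\<lambda>\<eta>. \<eta> * h (arcosh (abel_node y \<eta>))) \<circ> real_of_ereal) \<longlongrightarrow> 0) (at_right 0)"
      unfolding zero_ereal_def ereal_tendsto_simps by simp
    have "((\<lambda>\<eta>. \<eta> * h (arcosh (abel_node y \<eta>))) \<longlongrightarrow> 1 * h (arcosh (abel_node y 1))) (at_left 1)"
      using continuous_on_Icc_at_leftD[OF c] by simp
    then show "(((\<lambda>\<eta>. \<eta> * h (arcosh (abel_node y \<eta>))) \<circ> real_of_ereal) \<longlongrightarrow> h 0) (at_left 1)"
      unfolding one_ereal_def ereal_tendsto_simps by (simp add: abel_node_def)
  qed auto
  also have "(LBINT \<eta>=0..1. h (arcosh (abel_node y \<eta>)) - 2 * (y - 1) * (\<eta>\<^sup>2 * abel_kernel y \<eta>)) = (LBINT \<eta>:{0<..<1}. h (arcosh (abel_node y \<eta>)) - 2 * (y - 1) * (\<eta>\<^sup>2 * abel_kernel y \<eta>))"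
    by (simp add: interval_lebesgue_integral_le_eq einterval_def zero_ereal_def one_ereal_def greaterThanLessThan_def greaterThan_def lessThan_def Collect_conj_eq)
  also have "\<dots> = abel_int y - 2 * (y - 1) * (LBINT \<eta>:{0<..<1}. \<eta>\<^sup>2 * abel_kernel y \<eta>)"
    using hI K2 hI2 by (subst set_integral_diff(2)) auto
  finally have h0: "h 0 = abel_int y - 2 * (y - 1) * (LBINT \<eta>:{0<..<1}. \<eta>\<^sup>2 * abel_kernel y \<eta>)" by simp
  have k: "(LBINT \<eta>:{0<..<1}. abel_kernel y \<eta>) = abel_int' y + (LBINT \<eta>:{0<..<1}. \<eta>\<^sup>2 * abel_kernel y \<eta>)"
    using kI set_integral_diff(2)[OF K K2] by simp
  have "(I - 2 * d * J) / r + 2 * r * (I' + J) = I / r + 2 * r * I'" if "r \<noteq> 0" "d = r * r" for I I' J r d :: real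
    using that by (simp add: field_simps)
  note alg = this
  show ?thesis
    unfolding abel_deriv_def abel_kernel_substitution[OF y] k h0 by (rule alg) (use y in auto)
qed

lemma abel_has_deriv:
  assumes y: "y > 1"
  shows "((\<lambda>y. 2 * sqrt (y - 1) * abel_int y) has_real_derivative abel_deriv y) (at y)"
  unfolding abel_deriv_eq[OF y]
  using y by (auto intro!: derivative_eq_intros abel_int_deriv simp: field_simps)

lemma vector_derivative_conv_chi:
  assumes y: "y > 1"
  shows "vector_derivative (conv_chi (\<lambda>x. complex_of_real (h (arcosh x)))) (at y) = of_real (abel_deriv y)"
proof -
  have "((\<lambda>y. complex_of_real (2 * sqrt (y - 1) * abel_int y)) has_vector_derivative of_real (abel_deriv y)) (at y)"
    by (intro has_vector_derivative_of_real) (use abel_has_deriv[OF y] in \<open>simp add: has_real_derivative_iff_has_vector_derivative\<close>)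
  then have "(conv_chi (\<lambda>x. complex_of_real (h (arcosh x))) has_vector_derivative of_real (abel_deriv y)) (at y)"
    by (rule has_vector_derivative_transform_within_open[of _ _ _ "{1<..}"])
       (use y conv_chi_eq in auto)
  then show ?thesis by (rule vector_derivative_at)
qed

end

section \<open>The dual Abel transform of a test function\<close>

text \<open>A real function with all its derivatives, smooth on the line and rapidly decreasing on the
  positive half-line. The whole sequence of derivatives is the primitive object, which keeps
  iterated derivatives out of the proofs.\<close>

definition schwartz_tower :: "(nat \<Rightarrow> real \<Rightarrow> real) \<Rightarrow> bool" where
  "schwartz_tower \<psi> \<longleftrightarrow> (\<forall>k x. (\<psi> k has_real_derivative \<psi> (Suc k) x) (at x)) \<and>
     (\<forall>k j. \<exists>B. \<forall>x\<ge>0. \<bar>\<psi> k x\<bar> * (1 + x) ^ j \<le> B)"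

lemma schwartz_tower_deriv: "schwartz_tower \<psi> \<Longrightarrow> (\<psi> k has_real_derivative \<psi> (Suc k) x) (at x)"
  by (simp add: schwartz_tower_def)

lemma schwartz_tower_cont: "schwartz_tower \<psi> \<Longrightarrow> continuous_on UNIV (\<psi> k)"
  by (auto intro!: continuous_at_imp_continuous_on DERIV_isCont[OF schwartz_tower_deriv])

lemma schwartz_tower_bound:
  assumes "schwartz_tower \<psi>"
  obtains B where "B \<ge> 0" "\<And>x. x \<ge> 0 \<Longrightarrow> \<bar>\<psi> k x\<bar> \<le> B / (1 + x) ^ j"
proof -
  obtain B where B: "\<And>x. x \<ge> 0 \<Longrightarrow> \<bar>\<psi> k x\<bar> * (1 + x) ^ j \<le> B"
    using assms unfolding schwartz_tower_def by blast
  have "\<bar>\<psi> k x\<bar> \<le> B / (1 + x) ^ j" if "x \<ge> 0" for x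
    using B[OF that] that by (simp add: pos_le_divide_eq)
  moreover have "B \<ge> 0" using B[of 0] by simp
  ultimately show ?thesis using that by blast
qed

lemma set_integrable_cauchy:
  "set_integrable lborel {0<..} (\<lambda>t::real. 1 / (1 + t\<^sup>2))"
  "(LBINT t:{0<..}. 1 / (1 + t\<^sup>2)) = pi / 2"
proof -
  have D: "(arctan has_real_derivative 1 / (1 + t\<^sup>2)) (at t)" for t
    using DERIV_arctan[of t] by (simp add: inverse_eq_divide)
  have A: "(arctan \<longlongrightarrow> 0) (at_right 0)"
    using isCont_arctan[of 0] by (simp add: isCont_def filterlim_at_split)
  have c: "isCont (\<lambda>t::real. 1 / (1 + t\<^sup>2)) x" for x
    by (intro continuous_intros) (simp add: add_nonneg_eq_0_iff)
  show "set_integrable lborel {0<..} (\<lambda>t::real. 1 / (1 + t\<^sup>2))"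
    by (rule improper_FTC_nonneg[OF D c _ A tendsto_arctan_at_top]) auto
  show "(LBINT t:{0<..}. 1 / (1 + t\<^sup>2)) = pi / 2"
    by (subst improper_FTC_nonneg(2)[OF D c _ A tendsto_arctan_at_top]) auto
qed

lemma square_shift_image: "(\<lambda>t::real. x + t\<^sup>2) ` {0<..} = {x<..}"
proof (intro equalityI subsetI)
  fix y assume "y \<in> {x<..}"
  then show "y \<in> (\<lambda>t. x + t\<^sup>2) ` {0<..}" by (intro image_eqI[of _ _ "sqrt (y - x)"]) auto
qed auto

lemma square_shift_substitution:
  fixes f :: "real \<Rightarrow> real"
  assumes "continuous_on {x<..} f"
  shows "set_integrable lborel {0<..} (\<lambda>t. 2 * t * f (x + t\<^sup>2)) \<longleftrightarrow> set_integrable lborel {x<..} f"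
    and "(LBINT t:{0<..}. 2 * t * f (x + t\<^sup>2)) = (LBINT y:{x<..}. f y)"
proof -
  have e: "\<bar>2 * t\<bar> * f (x + t\<^sup>2) = 2 * t * f (x + t\<^sup>2)" if "t \<in> {0<..}" for t
    using that by simp
  have m1: "set_borel_measurable lborel {x<..} f"
    by (rule set_borel_measurable_continuous_on[OF assms]) auto
  have m2: "set_borel_measurable lborel {0<..} (\<lambda>t. \<bar>2 * t\<bar> * f (x + t\<^sup>2))"
    by (intro set_borel_measurable_continuous_on continuous_intros continuous_on_compose2[OF assms]) auto
  have d: "((\<lambda>t. x + t\<^sup>2) has_real_derivative 2 * t) (at t within {0<..})" for t :: real
    by (auto intro!: derivative_eq_intros)
  have i: "inj_on (\<lambda>t::real. x + t\<^sup>2) {0<..}" by (auto simp: inj_on_def)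
  note cov = lborel_change_of_variables[OF _ square_shift_image _ d i m1 m2]
  have "set_integrable lborel {0<..} (\<lambda>t. \<bar>2 * t\<bar> * f (x + t\<^sup>2)) = set_integrable lborel {0<..} (\<lambda>t. 2 * t * f (x + t\<^sup>2))"
    by (rule set_integrable_cong) (use e in auto)
  then show "set_integrable lborel {0<..} (\<lambda>t. 2 * t * f (x + t\<^sup>2)) \<longleftrightarrow> set_integrable lborel {x<..} f"
    using cov(1) by simp
  have "(LBINT t:{0<..}. \<bar>2 * t\<bar> * f (x + t\<^sup>2)) = (LBINT t:{0<..}. 2 * t * f (x + t\<^sup>2))"
    by (intro set_lebesgue_integral_cong) (use e in auto)
  then show "(LBINT t:{0<..}. 2 * t * f (x + t\<^sup>2)) = (LBINT y:{x<..}. f y)"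
    using cov(2) by simp
qed

lemma set_integrable_inverse_square_bound:
  fixes f :: "real \<Rightarrow> real"
  assumes c: "continuous_on {1<..} f"
    and b: "\<And>y. y > 1 \<Longrightarrow> \<bar>f y\<bar> \<le> M * (1 + 1 / sqrt (y - 1)) / y\<^sup>2"
  shows "set_integrable lborel {1<..} f"
proof -
  have M: "M \<ge> 0"
  proof -
    have "0 \<le> M * (1 + 1 / sqrt (2 - 1)) / 2\<^sup>2" using b[of 2] by linarith
    then show ?thesis by simp
  qed
  have "set_integrable lborel {0<..} (\<lambda>t. 4 * M * (1 / (1 + t\<^sup>2)))"
    using set_integrable_cauchy(1) by (rule set_integrable_mult_right)
  then have "set_integrable lborel {0<..} (\<lambda>t. 2 * t * f (1 + t\<^sup>2))"
  proof (rule set_integrable_bound)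
    show "set_borel_measurable lborel {0<..} (\<lambda>t. 2 * t * f (1 + t\<^sup>2))"
      by (intro set_borel_measurable_continuous_on continuous_intros continuous_on_compose2[OF c]) auto
    show "AE t in lborel. t \<in> {0<..} \<longrightarrow> norm (2 * t * f (1 + t\<^sup>2)) \<le> norm (4 * M * (1 / (1 + t\<^sup>2)))"
    proof (intro AE_I2 impI)
      fix t :: real assume "t \<in> {0<..}"
      then have t: "t > 0" by simp
      have "2 * t * \<bar>f (1 + t\<^sup>2)\<bar> \<le> 2 * t * (M * (1 + 1 / t) / (1 + t\<^sup>2)\<^sup>2)"
        using b[of "1 + t\<^sup>2"] t by (intro mult_left_mono) auto
      also have "\<dots> = 2 * M * ((t * (1 + 1 / t)) / (1 + t\<^sup>2)\<^sup>2)" by simp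
      also have "t * (1 + 1 / t) = t + 1" using t by (simp add: field_simps)
      also have "2 * M * ((t + 1) / (1 + t\<^sup>2)\<^sup>2) \<le> 2 * M * (2 / (1 + t\<^sup>2))"
      proof (rule mult_left_mono)
        have "0 \<le> 2 * (t - 1 / 4)\<^sup>2" by simp
        then have "t + 1 \<le> 2 * (1 + t\<^sup>2)" by (simp add: power2_eq_square algebra_simps)
        then have "(t + 1) / (1 + t\<^sup>2)\<^sup>2 \<le> (2 * (1 + t\<^sup>2)) / (1 + t\<^sup>2)\<^sup>2"
          by (rule divide_right_mono) simp
        also have "(2 * u) / u\<^sup>2 = 2 / u" for u :: real by (simp add: power2_eq_square)
        finally show "(t + 1) / (1 + t\<^sup>2)\<^sup>2 \<le> 2 / (1 + t\<^sup>2)" .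
      qed (use M in simp)
      finally show "norm (2 * t * f (1 + t\<^sup>2)) \<le> norm (4 * M * (1 / (1 + t\<^sup>2)))"
        using t M by (simp add: abs_mult)
    qed
  qed
  then show ?thesis using square_shift_substitution(1)[OF c] by simp
qed

text \<open>This is \<open>\<integral> \<psi>\<^sub>k(y) / sqrt (y - x) dy\<close> over \<open>y > x\<close>, the adjoint of the Abel transform,
  after the substitution \<open>y = x + t\<^sup>2\<close>. In this form smoothness in \<open>x\<close> is evident: \<open>x\<close> occurs
  only as a shift.\<close>

definition abel_test :: "(nat \<Rightarrow> real \<Rightarrow> real) \<Rightarrow> nat \<Rightarrow> real \<Rightarrow> real" where
  "abel_test \<psi> k x = 2 * (LBINT t:{0<..}. \<psi> k (x + t\<^sup>2))"

lemma schwartz_tower_shift_bound: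
  fixes \<psi> :: "nat \<Rightarrow> real \<Rightarrow> real" and B x t :: real
  assumes B: "\<And>x. x \<ge> 0 \<Longrightarrow> \<bar>\<psi> k x\<bar> \<le> B / (1 + x) ^ Suc j" "B \<ge> 0" and x: "x \<ge> 0"
  shows "\<bar>\<psi> k (x + t\<^sup>2)\<bar> \<le> B / (1 + x) ^ j * (1 / (1 + t\<^sup>2))"
proof -
  have "\<bar>\<psi> k (x + t\<^sup>2)\<bar> \<le> B / (1 + (x + t\<^sup>2)) ^ Suc j" by (rule B(1)) (use x in \<open>auto intro: add_nonneg_nonneg\<close>)
  also have "\<dots> \<le> B / ((1 + t\<^sup>2) * (1 + x) ^ j)"
    unfolding power_Suc using B(2) x by (intro divide_left_mono mult_mono power_mono mult_pos_pos zero_less_power) (auto intro: add_pos_nonneg)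
  finally show ?thesis by (simp add: mult.commute)
qed

lemma abel_test_integrable:
  assumes \<psi>: "schwartz_tower \<psi>" and x: "x \<ge> 0"
  shows "set_integrable lborel {0<..} (\<lambda>t. \<psi> k (x + t\<^sup>2))"
proof -
  obtain B where B: "B \<ge> 0" "\<And>x. x \<ge> 0 \<Longrightarrow> \<bar>\<psi> k x\<bar> \<le> B / (1 + x) ^ Suc 0"
    using schwartz_tower_bound[OF \<psi>, of k "Suc 0"] by blast
  have "set_integrable lborel {0<..} (\<lambda>t. B / (1 + x) ^ 0 * (1 / (1 + t\<^sup>2)))"
    using set_integrable_cauchy(1) by (rule set_integrable_mult_right)
  then show ?thesis
  proof (rule set_integrable_bound)
    show "set_borel_measurable lborel {0<..} (\<lambda>t. \<psi> k (x + t\<^sup>2))"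
      by (intro set_borel_measurable_continuous_on continuous_on_compose2[OF schwartz_tower_cont[OF \<psi>]] continuous_intros) auto
    show "AE t in lborel. t \<in> {0<..} \<longrightarrow> norm (\<psi> k (x + t\<^sup>2)) \<le> norm (B / (1 + x) ^ 0 * (1 / (1 + t\<^sup>2)))"
    proof (intro AE_I2 impI)
      fix t :: real
      have "\<bar>\<psi> k (x + t\<^sup>2)\<bar> \<le> B / (1 + x) ^ 0 * (1 / (1 + t\<^sup>2))"
        by (rule schwartz_tower_shift_bound[OF _ B(1) x]) (rule B(2))
      then show "norm (\<psi> k (x + t\<^sup>2)) \<le> norm (B / (1 + x) ^ 0 * (1 / (1 + t\<^sup>2)))" by (simp add: B(1))
    qed
  qed
qed

lemma abel_test_abs_bound:
  assumes \<psi>: "schwartz_tower \<psi>"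
  obtains B where "B \<ge> 0" "\<And>x. x \<ge> 0 \<Longrightarrow> 2 * (LBINT t:{0<..}. \<bar>\<psi> k (x + t\<^sup>2)\<bar>) \<le> B / (1 + x) ^ j"
proof -
  obtain B where B: "B \<ge> 0" "\<And>x. x \<ge> 0 \<Longrightarrow> \<bar>\<psi> k x\<bar> \<le> B / (1 + x) ^ Suc j"
    using schwartz_tower_bound[OF \<psi>, of k "Suc j"] by blast
  have "2 * (LBINT t:{0<..}. \<bar>\<psi> k (x + t\<^sup>2)\<bar>) \<le> (pi * B) / (1 + x) ^ j" if x: "x \<ge> 0" for x
  proof -
    have i: "set_integrable lborel {0<..} (\<lambda>t. B / (1 + x) ^ j * (1 / (1 + t\<^sup>2)))"
      using set_integrable_cauchy(1) by (rule set_integrable_mult_right)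
    have "(LBINT t:{0<..}. \<bar>\<psi> k (x + t\<^sup>2)\<bar>) \<le> (LBINT t:{0<..}. B / (1 + x) ^ j * (1 / (1 + t\<^sup>2)))"
      by (intro set_integral_mono set_integrable_abs abel_test_integrable[OF \<psi> x] i schwartz_tower_shift_bound B x)
    also have "\<dots> = B / (1 + x) ^ j * (LBINT t:{0<..}. 1 / (1 + t\<^sup>2))"
      by (rule set_integral_mult_right)
    finally show ?thesis unfolding set_integrable_cauchy(2) by (simp add: field_simps)
  qed
  then show ?thesis using that[of "pi * B"] B(1) by simp
qed

lemma abel_test_bound:
  assumes \<psi>: "schwartz_tower \<psi>"
  obtains B where "B \<ge> 0" "\<And>x. x \<ge> 0 \<Longrightarrow> \<bar>abel_test \<psi> k x\<bar> \<le> B / (1 + x) ^ j"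
proof -
  obtain B where B: "B \<ge> 0" "\<And>x. x \<ge> 0 \<Longrightarrow> 2 * (LBINT t:{0<..}. \<bar>\<psi> k (x + t\<^sup>2)\<bar>) \<le> B / (1 + x) ^ j"
    using abel_test_abs_bound[OF \<psi>, of k j] by blast
  have "\<bar>abel_test \<psi> k x\<bar> \<le> B / (1 + x) ^ j" if "x \<ge> 0" for x
  proof -
    have "\<bar>LBINT t:{0<..}. \<psi> k (x + t\<^sup>2)\<bar> \<le> (LBINT t:{0<..}. \<bar>\<psi> k (x + t\<^sup>2)\<bar>)"
      unfolding set_lebesgue_integral_def
      by (rule order_trans[OF integral_abs_bound]) (simp add: abs_mult)
    then show ?thesis using B(2)[OF that] by (simp add: abel_test_def abs_mult)
  qed
  then show ?thesis using that B(1) by blast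
qed

lemma abel_test_deriv:
  assumes \<psi>: "schwartz_tower \<psi>" and x: "x > 0"
  shows "(abel_test \<psi> k has_real_derivative abel_test \<psi> (Suc k) x) (at x)"
proof -
  obtain B where B: "B \<ge> 0" "\<And>x. x \<ge> 0 \<Longrightarrow> \<bar>\<psi> (Suc k) x\<bar> \<le> B / (1 + x) ^ Suc 0"
    using schwartz_tower_bound[OF \<psi>, of "Suc k" "Suc 0"] by blast
  have pos: "y > 0" if "dist y x < x" for y using that by (auto simp: dist_real_def)
  have "((\<lambda>x. LBINT t:{0<..}. \<psi> k (x + t\<^sup>2)) has_real_derivative (LBINT t:{0<..}. \<psi> (Suc k) (x + t\<^sup>2))) (at x)"
  proof (rule has_field_derivative_set_integral[OF x])
    show "set_integrable lborel {0<..} (\<lambda>t. \<psi> k (y + t\<^sup>2))" if "dist y x < x" for y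
      by (rule abel_test_integrable[OF \<psi>]) (use pos[OF that] in simp)
    show "((\<lambda>y. \<psi> k (y + t\<^sup>2)) has_real_derivative \<psi> (Suc k) (y + t\<^sup>2)) (at y)" for y t
      by (rule DERIV_cong[OF DERIV_chain2[OF schwartz_tower_deriv[OF \<psi>]]]) (auto intro!: derivative_eq_intros)
    show "set_integrable lborel {0<..} (\<lambda>t. B * (1 / (1 + t\<^sup>2)))"
      using set_integrable_cauchy(1) by (rule set_integrable_mult_right)
    show "norm (\<psi> (Suc k) (y + t\<^sup>2)) \<le> B * (1 / (1 + t\<^sup>2))" if "dist y x < x" for y t
    proof -
      have "\<bar>\<psi> (Suc k) (y + t\<^sup>2)\<bar> \<le> B / (1 + y) ^ 0 * (1 / (1 + t\<^sup>2))"
        by (rule schwartz_tower_shift_bound[OF _ B(1)]) (use B(2) pos[OF that] in auto)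
      then show ?thesis by simp
    qed
    show "set_borel_measurable lborel {0<..} (\<lambda>t. \<psi> (Suc k) (x + t\<^sup>2))"
      by (intro set_borel_measurable_continuous_on continuous_on_compose2[OF schwartz_tower_cont[OF \<psi>]] continuous_intros) auto
  qed
  then show ?thesis unfolding abel_test_def[abs_def] by (rule DERIV_cmult)
qed

lemma abel_test_substitution:
  assumes \<psi>: "schwartz_tower \<psi>" and x: "x \<ge> 0"
  shows "set_integrable lborel {x<..} (\<lambda>y. \<psi> k y / sqrt (y - x))"
    and "(LBINT y:{x<..}. \<psi> k y / sqrt (y - x)) = abel_test \<psi> k x"
    and "(LBINT y:{x<..}. \<bar>\<psi> k y\<bar> / sqrt (y - x)) = 2 * (LBINT t:{0<..}. \<bar>\<psi> k (x + t\<^sup>2)\<bar>)"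
proof -
  have c: "continuous_on {x<..} (\<lambda>y. \<psi> k y / sqrt (y - x))" "continuous_on {x<..} (\<lambda>y. \<bar>\<psi> k y\<bar> / sqrt (y - x))"
    by (intro continuous_intros continuous_on_subset[OF schwartz_tower_cont[OF \<psi>]]; simp)+
  have e: "2 * t * (\<psi> k (x + t\<^sup>2) / sqrt (x + t\<^sup>2 - x)) = 2 * \<psi> k (x + t\<^sup>2)"
     "2 * t * (\<bar>\<psi> k (x + t\<^sup>2)\<bar> / sqrt (x + t\<^sup>2 - x)) = 2 * \<bar>\<psi> k (x + t\<^sup>2)\<bar>" if "t \<in> {0<..}" for t
    using that by simp_all
  have "set_integrable lborel {0<..} (\<lambda>t. 2 * \<psi> k (x + t\<^sup>2))"
    using abel_test_integrable[OF \<psi> x] by (rule set_integrable_mult_right)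
  then have "set_integrable lborel {0<..} (\<lambda>t. 2 * t * (\<psi> k (x + t\<^sup>2) / sqrt (x + t\<^sup>2 - x)))"
    by (rule set_integrable_cong[THEN iffD1, rotated -1]) (use e in auto)
  then show "set_integrable lborel {x<..} (\<lambda>y. \<psi> k y / sqrt (y - x))"
    using square_shift_substitution(1)[OF c(1)] by simp
  have "(LBINT y:{x<..}. \<psi> k y / sqrt (y - x)) = (LBINT t:{0<..}. 2 * t * (\<psi> k (x + t\<^sup>2) / sqrt (x + t\<^sup>2 - x)))"
    by (rule square_shift_substitution(2)[OF c(1), symmetric])
  also have "\<dots> = (LBINT t:{0<..}. 2 * \<psi> k (x + t\<^sup>2))"
    by (intro set_lebesgue_integral_cong) (use e in auto)
  finally show "(LBINT y:{x<..}. \<psi> k y / sqrt (y - x)) = abel_test \<psi> k x" by (simp add: abel_test_def)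
  have "(LBINT y:{x<..}. \<bar>\<psi> k y\<bar> / sqrt (y - x)) = (LBINT t:{0<..}. 2 * t * (\<bar>\<psi> k (x + t\<^sup>2)\<bar> / sqrt (x + t\<^sup>2 - x)))"
    by (rule square_shift_substitution(2)[OF c(2), symmetric])
  also have "\<dots> = (LBINT t:{0<..}. 2 * \<bar>\<psi> k (x + t\<^sup>2)\<bar>)"
    by (intro set_lebesgue_integral_cong) (use e in auto)
  finally show "(LBINT y:{x<..}. \<bar>\<psi> k y\<bar> / sqrt (y - x)) = 2 * (LBINT t:{0<..}. \<bar>\<psi> k (x + t\<^sup>2)\<bar>)" by simp
qed

section \<open>Pairing the derivative of an Abel transform with a test function\<close>

locale abel_data =
  fixes h h' :: "real \<Rightarrow> real" and C :: real and \<psi> :: "nat \<Rightarrow> real \<Rightarrow> real"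
  assumes hd: "\<And>w. (h has_real_derivative h' w) (at w)"
    and hc: "continuous_on UNIV h'"
    and hb: "\<And>w. w \<ge> 0 \<Longrightarrow> \<bar>h w\<bar> \<le> C * exp w"
    and h'b: "\<And>w. w \<ge> 0 \<Longrightarrow> \<bar>h' w\<bar> \<le> C * exp w"
    and \<psi>: "schwartz_tower \<psi>"
begin

lemma C_nonneg: "C \<ge> 0" using hb[of 0] by simp

lemma arcosh_bound: "x \<ge> 1 \<Longrightarrow> \<bar>h (arcosh x)\<bar> \<le> 2 * C * x" "x \<ge> 1 \<Longrightarrow> \<bar>h' (arcosh x)\<bar> \<le> 2 * C * x"
proof -
  assume x: "x \<ge> 1"
  then have "C * exp (arcosh x) \<le> C * (2 * x)" using C_nonneg by (intro mult_left_mono exp_arcosh_le)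
  then show "\<bar>h (arcosh x)\<bar> \<le> 2 * C * x" "\<bar>h' (arcosh x)\<bar> \<le> 2 * C * x"
    using hb[of "arcosh x"] h'b[of "arcosh x"] x by auto
qed

lemma abel_int_bound: "y > 1 \<Longrightarrow> \<bar>abel_int h y\<bar> \<le> 2 * C * y"
proof -
  assume y: "y > 1"
  have "norm (integral {0..1} (\<lambda>\<eta>. h (arcosh (abel_node y \<eta>)))) \<le> (2 * C * y) * (1 - 0)"
  proof (rule integral_bound)
    show "continuous_on {0..1} (\<lambda>\<eta>. h (arcosh (abel_node y \<eta>)))" by (rule cont_abel[OF hd hc]) (use y in simp)
    fix \<eta> :: real assume "\<eta> \<in> {0..1}"
    then have a: "abel_node y \<eta> \<ge> 1" "abel_node y \<eta> \<le> y" using y by (auto intro: abel_node_ge_1 abel_node_le)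
    have "\<bar>h (arcosh (abel_node y \<eta>))\<bar> \<le> 2 * C * abel_node y \<eta>" by (rule arcosh_bound) (rule a)
    also have "\<dots> \<le> 2 * C * y" using a C_nonneg by (intro mult_left_mono) auto
    finally show "norm (h (arcosh (abel_node y \<eta>))) \<le> 2 * C * y" by simp
  qed simp
  then show ?thesis by (simp add: abel_int_def[OF hd hc])
qed

lemma abel_int'_bound: "y > 1 \<Longrightarrow> \<bar>abel_int' h' y\<bar> \<le> 2 * C * y / sqrt (y - 1)"
proof -
  assume y: "y > 1"
  have "norm (integral {0..1} (\<lambda>\<eta>. h' (arcosh (abel_node y \<eta>)) * sqrt (1 - \<eta>\<^sup>2) / (sqrt (y - 1) * sqrt (abel_node y \<eta> + 1)))) \<le> (2 * C * y / sqrt (y - 1)) * (1 - 0)"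
  proof (rule integral_bound)
    have "continuous_on {0..1} (\<lambda>\<eta>. (\<lambda>(y, \<eta>). h' (arcosh (abel_node y \<eta>)) * sqrt (1 - \<eta>\<^sup>2) / (sqrt (y - 1) * sqrt (abel_node y \<eta> + 1))) (y, \<eta>))"
      by (rule continuous_on_compose2[OF cont_abel'[OF hd hc]]) (use y in \<open>auto intro!: continuous_intros\<close>)
    then show "continuous_on {0..1} (\<lambda>\<eta>. h' (arcosh (abel_node y \<eta>)) * sqrt (1 - \<eta>\<^sup>2) / (sqrt (y - 1) * sqrt (abel_node y \<eta> + 1)))" by simp
    fix \<eta> :: real assume \<eta>: "\<eta> \<in> {0..1}"
    then have a: "abel_node y \<eta> \<ge> 1" "abel_node y \<eta> \<le> y" using y by (auto intro: abel_node_ge_1 abel_node_le)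
    have "\<bar>h' (arcosh (abel_node y \<eta>))\<bar> \<le> 2 * C * abel_node y \<eta>" by (rule arcosh_bound) (rule a)
    also have "\<dots> \<le> 2 * C * y" using a C_nonneg by (intro mult_left_mono) auto
    finally have 1: "\<bar>h' (arcosh (abel_node y \<eta>))\<bar> \<le> 2 * C * y" .
    have 2: "\<bar>sqrt (1 - \<eta>\<^sup>2)\<bar> \<le> 1" using \<eta> by (simp add: power_le_one)
    have "\<bar>h' (arcosh (abel_node y \<eta>))\<bar> * \<bar>sqrt (1 - \<eta>\<^sup>2)\<bar> \<le> (2 * C * y) * 1"
      using 1 2 C_nonneg y by (intro mult_mono) auto
    moreover have "sqrt (y - 1) * 1 \<le> sqrt (y - 1) * sqrt (abel_node y \<eta> + 1)"
      using a y by (intro mult_left_mono) auto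
    ultimately have "(\<bar>h' (arcosh (abel_node y \<eta>))\<bar> * \<bar>sqrt (1 - \<eta>\<^sup>2)\<bar>) / (sqrt (y - 1) * sqrt (abel_node y \<eta> + 1)) \<le> ((2 * C * y) * 1) / (sqrt (y - 1) * 1)"
      using y C_nonneg by (intro frac_le) auto
    then show "norm (h' (arcosh (abel_node y \<eta>)) * sqrt (1 - \<eta>\<^sup>2) / (sqrt (y - 1) * sqrt (abel_node y \<eta> + 1))) \<le> 2 * C * y / sqrt (y - 1)"
      using y a by (simp add: abs_mult)
  qed simp
  then show ?thesis by (simp add: abel_int'_def[OF hd hc])
qed

abbreviation K where "K \<equiv> abel_deriv h h'"
abbreviation c where "c \<equiv> (\<lambda>y. 2 * sqrt (y - 1) * abel_int h y)"

lemma c_deriv: "y > 1 \<Longrightarrow> (c has_real_derivative K y) (at y)"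
  by (rule abel_has_deriv[OF hd hc])

lemma c_cont: "continuous_on {1<..} c"
  by (auto intro!: continuous_at_imp_continuous_on DERIV_isCont[OF c_deriv])

lemma K_cont: "continuous_on {1<..} K"
proof -
  have "continuous_on {1<..} (\<lambda>y. abel_int h y / sqrt (y - 1) + 2 * sqrt (y - 1) * abel_int' h' y)"
    by (intro continuous_intros cont_abel_int'[OF hd hc] continuous_at_imp_continuous_on ballI DERIV_isCont[OF abel_int_deriv[OF hd hc]]) auto
  then show ?thesis
    by (rule continuous_on_eq) (use abel_deriv_eq[OF hd hc] in auto)
qed

lemma c_bound: "y > 1 \<Longrightarrow> \<bar>c y\<bar> \<le> 4 * C * y * sqrt (y - 1)"
  using mult_left_mono[OF abel_int_bound[of y], of "2 * sqrt (y - 1)"] by (simp add: abs_mult mult_ac)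

text \<open>The bound may be as singular as \<open>1 / sqrt (y - 1)\<close> at 1, which happens when \<open>h 0 \<noteq> 0\<close>, as
  may be the case for the partial sums.\<close>

lemma K_bound: "y > 1 \<Longrightarrow> \<bar>K y\<bar> \<le> 4 * C * y * (1 + 1 / sqrt (y - 1))"
proof -
  assume y: "y > 1"
  have "\<bar>abel_int h y / sqrt (y - 1)\<bar> \<le> 2 * C * y / sqrt (y - 1)"
    using abel_int_bound[OF y] y by (simp add: divide_right_mono)
  moreover have "\<bar>2 * sqrt (y - 1) * abel_int' h' y\<bar> \<le> 2 * sqrt (y - 1) * (2 * C * y / sqrt (y - 1))"
    unfolding abs_mult using abel_int'_bound[OF y] y by (intro mult_mono) auto
  ultimately have "\<bar>K y\<bar> \<le> 2 * C * y / sqrt (y - 1) + 2 * sqrt (y - 1) * (2 * C * y / sqrt (y - 1))"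
    unfolding abel_deriv_eq[OF hd hc y] by linarith
  also have "2 * sqrt (y - 1) * (2 * C * y / sqrt (y - 1)) = 4 * C * y" using y by simp
  also have "2 * C * y / sqrt (y - 1) + 4 * C * y \<le> 4 * C * y / sqrt (y - 1) + 4 * C * y"
    using C_nonneg y by (intro add_right_mono divide_right_mono) auto
  also have "\<dots> = 4 * C * y * (1 + 1 / sqrt (y - 1))" by (simp add: algebra_simps)
  finally show ?thesis .
qed

lemma K_integrable: "set_integrable lborel {1<..} (\<lambda>y. K y * \<psi> 0 y)"
proof -
  obtain B where B: "B \<ge> 0" "\<And>x. x \<ge> 0 \<Longrightarrow> \<bar>\<psi> 0 x\<bar> \<le> B / (1 + x) ^ 3"
    using schwartz_tower_bound[OF \<psi>, of 0 3] by blast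
  show ?thesis
  proof (rule set_integrable_inverse_square_bound[where M = "4 * C * B"])
    show "continuous_on {1<..} (\<lambda>y. K y * \<psi> 0 y)"
      by (intro continuous_intros K_cont continuous_on_subset[OF schwartz_tower_cont[OF \<psi>]]) auto
    fix y :: real assume y: "y > 1"
    have "B / (1 + y) ^ 3 \<le> B / y ^ 3" using B(1) y by (intro divide_left_mono power_mono mult_pos_pos) auto
    then have "\<bar>\<psi> 0 y\<bar> \<le> B / y ^ 3" using B(2)[of y] y by auto
    then have "\<bar>K y\<bar> * \<bar>\<psi> 0 y\<bar> \<le> (4 * C * y * (1 + 1 / sqrt (y - 1))) * (B / y ^ 3)"
      using K_bound[OF y] C_nonneg y by (intro mult_mono) auto
    also have "\<dots> = 4 * C * B * (1 + 1 / sqrt (y - 1)) / y\<^sup>2"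
      using y by (simp add: power2_eq_square power3_eq_cube)
    finally show "\<bar>K y * \<psi> 0 y\<bar> \<le> 4 * C * B * (1 + 1 / sqrt (y - 1)) / y\<^sup>2" by (simp add: abs_mult)
  qed
qed

lemma c_integrable: "set_integrable lborel {1<..} (\<lambda>y. c y * \<psi> 1 y)"
proof -
  obtain B where B: "B \<ge> 0" "\<And>x. x \<ge> 0 \<Longrightarrow> \<bar>\<psi> 1 x\<bar> \<le> B / (1 + x) ^ 4"
    using schwartz_tower_bound[OF \<psi>, of 1 4] by blast
  show ?thesis
  proof (rule set_integrable_inverse_square_bound[where M = "4 * C * B"])
    show "continuous_on {1<..} (\<lambda>y. c y * \<psi> 1 y)"
      by (intro continuous_on_mult c_cont continuous_on_subset[OF schwartz_tower_cont[OF \<psi>]]) auto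
    fix y :: real assume y: "y > 1"
    have "B / (1 + y) ^ 4 \<le> B / y ^ 4" using B(1) y by (intro divide_left_mono power_mono mult_pos_pos) auto
    then have "\<bar>\<psi> 1 y\<bar> \<le> B / y ^ 4" using B(2)[of y] y by auto
    moreover have "sqrt (y - 1) \<le> y"
      by (rule real_le_lsqrt) (use y in \<open>auto simp: power2_eq_square intro: order_trans[of _ "1 * y"]\<close>)
    ultimately have "\<bar>c y\<bar> * \<bar>\<psi> 1 y\<bar> \<le> (4 * C * y * y) * (B / y ^ 4)"
      using C_nonneg y by (intro mult_mono order_trans[OF c_bound] mult_left_mono) auto
    also have "\<dots> = 4 * C * B * (1 + 0) / y\<^sup>2"
      using y by (simp add: power2_eq_square power4_eq_xxxx)
    also have "\<dots> \<le> 4 * C * B * (1 + 1 / sqrt (y - 1)) / y\<^sup>2"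
      using y C_nonneg B(1) by (intro divide_right_mono mult_left_mono) auto
    finally show "\<bar>c y * \<psi> 1 y\<bar> \<le> 4 * C * B * (1 + 1 / sqrt (y - 1)) / y\<^sup>2" by (simp only: abs_mult)
  qed
qed

lemma abel_parts: "(LBINT y:{1<..}. K y * \<psi> 0 y) = - (LBINT y:{1<..}. c y * \<psi> 1 y)"
proof -
  obtain B where B: "B \<ge> 0" "\<And>x. x \<ge> 0 \<Longrightarrow> \<bar>\<psi> 0 x\<bar> \<le> B / (1 + x) ^ 3"
    using schwartz_tower_bound[OF \<psi>, of 0 3] by blast
  have "(LBINT y:{1<..}. K y * \<psi> 0 y + c y * \<psi> 1 y) = 0 - 0"
  proof (rule improper_FTC[where F = "\<lambda>y. c y * \<psi> 0 y"])
    fix y :: real assume y: "y > 1"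
    show "((\<lambda>y. c y * \<psi> 0 y) has_real_derivative K y * \<psi> 0 y + c y * \<psi> 1 y) (at y)"
      by (rule DERIV_cong[OF DERIV_mult[OF c_deriv[OF y] schwartz_tower_deriv[OF \<psi>]]]) simp
    have "continuous_on {1<..} (\<lambda>y. K y * \<psi> 0 y + c y * \<psi> 1 y)"
      by (intro continuous_on_add continuous_on_mult[OF c_cont] continuous_on_mult[OF K_cont] continuous_on_subset[OF schwartz_tower_cont[OF \<psi>]]) auto
    then show "isCont (\<lambda>y. K y * \<psi> 0 y + c y * \<psi> 1 y) y"
      using y by (simp add: continuous_on_eq_continuous_at)
  next
    show "set_integrable lborel {1<..} (\<lambda>y. K y * \<psi> 0 y + c y * \<psi> 1 y)"
      by (intro set_integral_add K_integrable c_integrable)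
    have b: "norm (c y * \<psi> 0 y) \<le> 4 * C * y * sqrt (y - 1) * (B / y ^ 3)" if y: "y > 1" for y
    proof -
      have "B / (1 + y) ^ 3 \<le> B / y ^ 3" using B(1) y by (intro divide_left_mono power_mono mult_pos_pos) auto
      then have "\<bar>\<psi> 0 y\<bar> \<le> B / y ^ 3" using B(2)[of y] y by auto
      then have "\<bar>c y\<bar> * \<bar>\<psi> 0 y\<bar> \<le> 4 * C * y * sqrt (y - 1) * (B / y ^ 3)"
        using c_bound[OF y] y C_nonneg by (intro mult_mono) auto
      then show ?thesis by (simp only: real_norm_def abs_mult)
    qed
    have "((\<lambda>y. 4 * C * y * sqrt (y - 1) * (B / y ^ 3)) \<longlongrightarrow> 4 * C * 1 * sqrt (1 - 1) * (B / 1 ^ 3)) (at_right 1)"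
      by (intro tendsto_intros) auto
    then have "((\<lambda>y. 4 * C * y * sqrt (y - 1) * (B / y ^ 3)) \<longlongrightarrow> 0) (at_right 1)" by simp
    then show "((\<lambda>y. c y * \<psi> 0 y) \<longlongrightarrow> 0) (at_right 1)"
      by (rule Lim_null_comparison[rotated]) (use b in \<open>auto simp: eventually_at_filter simp del: real_norm_def\<close>)
    have "((\<lambda>y. 4 * C * y * sqrt (y - 1) * (B / y ^ 3)) \<longlongrightarrow> 0) at_top"
      by real_asymp
    then show "((\<lambda>y. c y * \<psi> 0 y) \<longlongrightarrow> 0) at_top"
      by (rule Lim_null_comparison[rotated]) (use b in \<open>auto intro!: eventually_mono[OF eventually_gt_at_top[of 1]] simp del: real_norm_def\<close>)
  qed
  moreover have "(LBINT y:{1<..}. K y * \<psi> 0 y + c y * \<psi> 1 y) = (LBINT y:{1<..}. K y * \<psi> 0 y) + (LBINT y:{1<..}. c y * \<psi> 1 y)"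
    by (intro set_integral_add K_integrable c_integrable)
  ultimately show ?thesis by simp
qed

lemma c_eq: "y > 1 \<Longrightarrow> c y = (LBINT x:{1<..<y}. h (arcosh x) / sqrt (y - x))"
proof -
  assume y: "y > 1"
  have "(LBINT x:{1..<y}. h (arcosh x) / sqrt (y - x)) = (LBINT x:{1<..<y}. h (arcosh x) / sqrt (y - x))"
    by (rule set_integral_discrete_difference[of "{1}"]) auto
  then show ?thesis using abel_substitution[OF hd hc y] by simp
qed

lemma h_arcosh_cont: "continuous_on {1<..} (\<lambda>x. h (arcosh x))"
  by (intro continuous_on_compose2[OF h_cont[OF hd hc]] continuous_intros) auto

lemma abel_fubini:
  "(LBINT y:{1<..}. c y * \<psi> 1 y) = (LBINT x:{1<..}. h (arcosh x) * abel_test \<psi> 1 x)"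
proof -
  \<comment> \<open>Since \<open>arcosh\<close> is well-behaved only on \<open>[1,\<infinity>)\<close>, the argument is clamped to keep the
    integrand measurable on the plane.\<close>
  define f where "f = (\<lambda>x y. indicator {1<..} x * (indicator {0<..} (y - x) * (h (arcosh (max 1 x)) * (\<psi> 1 y / sqrt (y - x)))))"
  have [measurable]: "\<psi> 1 \<in> borel_measurable borel"
    by (intro borel_measurable_continuous_onI schwartz_tower_cont[OF \<psi>])
  have [measurable]: "(\<lambda>x. h (arcosh (max 1 x))) \<in> borel_measurable borel"
    by (intro borel_measurable_continuous_onI continuous_on_compose2[OF h_cont[OF hd hc]] continuous_intros) auto
  have m: "(\<lambda>(x, y). f x y) \<in> borel_measurable (lborel \<Otimes>\<^sub>M lborel)"
    unfolding f_def by measurable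
  have fx: "f x y = indicator {1<..} x * (h (arcosh x) * (indicator {x<..} y *\<^sub>R (\<psi> 1 y / sqrt (y - x))))" for x y
    by (auto simp: f_def indicator_def max_def)
  have fy: "f x y = indicator {1<..} y * (\<psi> 1 y * (indicator {1<..<y} x *\<^sub>R (h (arcosh x) / sqrt (y - x))))" for x y
    by (auto simp: f_def indicator_def max_def)
  obtain B where B: "B \<ge> 0" "\<And>x. x \<ge> 0 \<Longrightarrow> 2 * (LBINT t:{0<..}. \<bar>\<psi> 1 (x + t\<^sup>2)\<bar>) \<le> B / (1 + x) ^ 3"
    using abel_test_abs_bound[OF \<psi>, of 1 3] by blast
  have nf: "(LBINT y. norm (f x y)) = indicator {1<..} x * (\<bar>h (arcosh x)\<bar> * (2 * (LBINT t:{0<..}. \<bar>\<psi> 1 (x + t\<^sup>2)\<bar>)))" for x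
  proof (cases "x > 1")
    case True
    have "(LBINT y. norm (f x y)) = (LBINT y. \<bar>h (arcosh x)\<bar> * (indicator {x<..} y *\<^sub>R (\<bar>\<psi> 1 y\<bar> / sqrt (y - x))))"
      using True by (intro Bochner_Integration.integral_cong) (auto simp: fx abs_mult indicator_def)
    also have "\<dots> = \<bar>h (arcosh x)\<bar> * (LBINT y:{x<..}. \<bar>\<psi> 1 y\<bar> / sqrt (y - x))"
      by (simp only: set_lebesgue_integral_def integral_mult_right_zero)
    finally show ?thesis using True abel_test_substitution(3)[OF \<psi>, of x 1] by simp
  qed (simp add: fx)
  have "integrable lborel (\<lambda>x. LBINT y. norm (f x y))"
  proof -
    have i: "set_integrable lborel {1<..} (\<lambda>x. 2 * C * B * (1 + 1 / sqrt (x - 1)) / x\<^sup>2)"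
    proof (rule set_integrable_inverse_square_bound)
      show "continuous_on {1<..} (\<lambda>x. 2 * C * B * (1 + 1 / sqrt (x - 1)) / x\<^sup>2)"
        by (intro continuous_intros) auto
      fix y :: real assume "1 < y"
      then show "\<bar>2 * C * B * (1 + 1 / sqrt (y - 1)) / y\<^sup>2\<bar> \<le> 2 * C * B * (1 + 1 / sqrt (y - 1)) / y\<^sup>2"
        using C_nonneg B(1) by simp
    qed
    have i: "integrable lborel (\<lambda>x. indicator {1<..} x *\<^sub>R (2 * C * B * (1 + 1 / sqrt (x - 1)) / x\<^sup>2))"
      using i by (simp add: set_integrable_def)
    show ?thesis
    proof (rule Bochner_Integration.integrable_bound[OF i])
      show "(\<lambda>x. LBINT y. norm (f x y)) \<in> borel_measurable lborel"
        using m by measurable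
      show "AE x in lborel. norm (LBINT y. norm (f x y)) \<le> norm (indicator {1<..} x *\<^sub>R (2 * C * B * (1 + 1 / sqrt (x - 1)) / x\<^sup>2))"
      proof (intro AE_I2)
        fix x :: real
        show "norm (LBINT y. norm (f x y)) \<le> norm (indicator {1<..} x *\<^sub>R (2 * C * B * (1 + 1 / sqrt (x - 1)) / x\<^sup>2))"
        proof (cases "x > 1")
          case True
          define I where "I = 2 * (LBINT t:{0<..}. \<bar>\<psi> 1 (x + t\<^sup>2)\<bar>)"
          have I0: "I \<ge> 0" unfolding I_def by (intro mult_nonneg_nonneg set_lebesgue_integral_nonneg) auto
          have "B / (1 + x) ^ 3 \<le> B / x ^ 3" using B(1) True by (intro divide_left_mono power_mono mult_pos_pos) auto
          then have "I \<le> B / x ^ 3" using B(2)[of x] True unfolding I_def by linarith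
          then have "\<bar>h (arcosh x)\<bar> * I \<le> (2 * C * x) * (B / x ^ 3)"
            using arcosh_bound(1)[of x] True C_nonneg I0 by (intro mult_mono) auto
          also have "\<dots> = 2 * C * B * (1 + 0) / x\<^sup>2" using True by (simp add: power2_eq_square power3_eq_cube)
          also have "\<dots> \<le> 2 * C * B * (1 + 1 / sqrt (x - 1)) / x\<^sup>2"
            using True C_nonneg B(1) by (intro divide_right_mono mult_left_mono) auto
          finally show ?thesis
            unfolding nf I_def[symmetric] using True I0 C_nonneg B(1) by (simp add: abs_mult)
        qed (simp only: nf, simp)
      qed
    qed
  qed
  moreover have "AE x in lborel. integrable lborel (\<lambda>y. f x y)"
  proof (intro AE_I2)
    fix x :: real
    show "integrable lborel (\<lambda>y. f x y)"
    proof (cases "x > 1")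
      case True
      have "integrable lborel (\<lambda>y. indicator {x<..} y *\<^sub>R (\<psi> 1 y / sqrt (y - x)))"
        using abel_test_substitution(1)[OF \<psi>, of x 1] True by (simp add: set_integrable_def)
      then show ?thesis unfolding fx by (intro integrable_mult_right)
    qed (simp add: fx)
  qed
  ultimately have int: "integrable (lborel \<Otimes>\<^sub>M lborel) (\<lambda>(x, y). f x y)"
    using m by (intro lborel_pair.Fubini_integrable) auto
  have "(LBINT y:{1<..}. c y * \<psi> 1 y) = (LBINT y. (LBINT x. f x y))"
    unfolding set_lebesgue_integral_def[of _ "{1<..}"]
  proof (intro Bochner_Integration.integral_cong refl)
    fix y :: real
    show "indicator {1<..} y *\<^sub>R (c y * \<psi> 1 y) = (LBINT x. f x y)"
    proof -
      have "(LBINT x. f x y) = indicator {1<..} y * (\<psi> 1 y * (LBINT x:{1<..<y}. h (arcosh x) / sqrt (y - x)))"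
        by (simp only: fy integral_mult_right_zero set_lebesgue_integral_def)
      then show ?thesis using c_eq[of y] by (cases "y > 1") simp_all
    qed
  qed
  also have "\<dots> = (LBINT x. (LBINT y. f x y))"
    by (rule lborel_pair.Fubini_integral[OF int])
  also have "\<dots> = (LBINT x:{1<..}. h (arcosh x) * abel_test \<psi> 1 x)"
    unfolding set_lebesgue_integral_def[of _ "{1<..}"]
  proof (intro Bochner_Integration.integral_cong refl)
    fix x :: real
    show "(LBINT y. f x y) = indicator {1<..} x *\<^sub>R (h (arcosh x) * abel_test \<psi> 1 x)"
    proof -
      have "(LBINT y. f x y) = indicator {1<..} x * (h (arcosh x) * (LBINT y:{x<..}. \<psi> 1 y / sqrt (y - x)))"
        by (simp only: fx integral_mult_right_zero set_lebesgue_integral_def)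
      then show ?thesis using abel_test_substitution(2)[OF \<psi>, of x 1] by (cases "x > 1") simp_all
    qed
  qed
  finally show ?thesis .
qed

lemma cosh_substitution:
  "(LBINT x:{1<..}. h (arcosh x) * abel_test \<psi> 1 x) = (LBINT w:{0<..}. h w * (sinh w * abel_test \<psi> 1 (cosh w)))"
proof -
  have img: "cosh ` {0<..} = {1::real<..}"
  proof (intro equalityI subsetI)
    fix x :: real assume "x \<in> {1<..}"
    then show "x \<in> cosh ` {0<..}" by (intro image_eqI[of _ _ "arcosh x"]) auto
  qed (auto intro: cosh_real_gt_1)
  have tc: "continuous_on {1<..} (abel_test \<psi> 1)"
    by (intro continuous_at_imp_continuous_on ballI DERIV_isCont[OF abel_test_deriv[OF \<psi>]]) auto
  have "(LBINT w:{0<..}. \<bar>sinh w\<bar> * (h (arcosh (cosh w)) * abel_test \<psi> 1 (cosh w))) = (LBINT x:{1<..}. h (arcosh x) * abel_test \<psi> 1 x)"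
  proof (rule lborel_change_of_variables(2)[OF _ img])
    show "inj_on cosh {0::real<..}"
    proof (rule inj_onI)
      fix x y :: real assume xy: "x \<in> {0<..}" "y \<in> {0<..}" "cosh x = cosh y"
      then have "arcosh (cosh x) = arcosh (cosh y)" by simp
      then show "x = y" using xy by (simp add: arcosh_cosh_real)
    qed
    show "set_borel_measurable lborel {1<..} (\<lambda>x. h (arcosh x) * abel_test \<psi> 1 x)"
      by (intro set_borel_measurable_continuous_on continuous_intros h_arcosh_cont tc) auto
    show "set_borel_measurable lborel {0<..} (\<lambda>w. \<bar>sinh w\<bar> * (h (arcosh (cosh w)) * abel_test \<psi> 1 (cosh w)))"
      by (intro set_borel_measurable_continuous_on continuous_intros continuous_on_compose2[OF h_arcosh_cont] continuous_on_compose2[OF tc])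
         (auto intro: cosh_real_gt_1)
  qed (auto intro!: derivative_eq_intros)
  moreover have "(LBINT w:{0<..}. \<bar>sinh w\<bar> * (h (arcosh (cosh w)) * abel_test \<psi> 1 (cosh w))) = (LBINT w:{0<..}. h w * (sinh w * abel_test \<psi> 1 (cosh w)))"
    by (intro set_lebesgue_integral_cong) (auto simp: arcosh_cosh_real)
  ultimately show ?thesis by simp
qed

text \<open>The derivative is moved to the test function by parts, the Abel transform to the
  derivative of the test function by Fubini, and \<open>x = cosh w\<close> is substituted. Only \<open>h\<close> itself
  remains, so that weak convergence of the series to \<open>h\<close> is all that is needed.\<close>

theorem abel_pairing:
  "(LBINT y:{1<..}. K y * \<psi> 0 y) = - (LBINT w:{0<..}. h w * (sinh w * abel_test \<psi> 1 (cosh w)))"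
  using abel_parts abel_fubini cosh_substitution by simp

end

text \<open>Applied with real and imaginary part, this reduces complex test functions to real ones.
  The bounds concern \<open>x \<ge> 0\<close> since the jump function and the approximants live on \<open>y \<ge> 1\<close>.\<close>

lemma schwartz_space_tower:
  assumes \<phi>: "\<phi> \<in> schwartz_space" and L: "bounded_linear L" "\<And>z. \<bar>L z\<bar> \<le> norm z"
  shows "schwartz_tower (\<lambda>k x. L ((vderiv ^^ k) \<phi> x))"
  unfolding schwartz_tower_def
proof (intro conjI allI)
  have diff: "(vderiv ^^ k) \<phi> differentiable (at x)" for k x
    using \<phi> by (simp add: schwartz_space_def)
  have D: "((vderiv ^^ k) \<phi> has_vector_derivative (vderiv ^^ Suc k) \<phi> x) (at x)" for k x
    using diff[of k x] by (simp add: vderiv_def vector_derivative_works)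
  show "((\<lambda>x. L ((vderiv ^^ k) \<phi> x)) has_real_derivative L ((vderiv ^^ Suc k) \<phi> x)) (at x)" for k x
    unfolding has_real_derivative_iff_has_vector_derivative
    by (rule bounded_linear.has_vector_derivative[OF L(1) D])
  fix k j :: nat
  have "((\<lambda>x. of_real (x ^ j) * (vderiv ^^ k) \<phi> x) \<longlongrightarrow> 0) at_infinity"
    using \<phi> by (simp add: schwartz_space_def)
  then have "eventually (\<lambda>x. norm (of_real (x ^ j) * (vderiv ^^ k) \<phi> x) < 1) at_infinity"
    by (auto simp: tendsto_iff dist_norm)
  then obtain R where R: "\<And>x. norm x \<ge> R \<Longrightarrow> norm (of_real (x ^ j) * (vderiv ^^ k) \<phi> x) < 1"
    by (auto simp: eventually_at_infinity)
  define R' where "R' = max 1 R"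
  have "continuous_on {0..R'} (\<lambda>x. norm ((vderiv ^^ k) \<phi> x) * (1 + x) ^ j)"
    by (intro continuous_intros continuous_at_imp_continuous_on ballI differentiable_imp_continuous_within diff)
  then have "bounded ((\<lambda>x. norm ((vderiv ^^ k) \<phi> x) * (1 + x) ^ j) ` {0..R'})"
    by (intro compact_imp_bounded compact_continuous_image) auto
  then obtain B where "\<forall>b\<in>(\<lambda>x. norm ((vderiv ^^ k) \<phi> x) * (1 + x) ^ j) ` {0..R'}. norm b \<le> B"
    unfolding bounded_iff by blast
  then have B: "\<bar>norm ((vderiv ^^ k) \<phi> x) * (1 + x) ^ j\<bar> \<le> B" if "x \<in> {0..R'}" for x
    using that by auto
  have "\<bar>L ((vderiv ^^ k) \<phi> x)\<bar> * (1 + x) ^ j \<le> max B (2 ^ j)" if x: "x \<ge> 0" for x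
  proof -
    have 1: "\<bar>L ((vderiv ^^ k) \<phi> x)\<bar> * (1 + x) ^ j \<le> norm ((vderiv ^^ k) \<phi> x) * (1 + x) ^ j"
      using x by (intro mult_right_mono L(2)) auto
    also have "\<dots> \<le> max B (2 ^ j)"
    proof (cases "x \<le> R'")
      case True
      then show ?thesis using B[of x] x by auto
    next
      case False
      then have xR: "x \<ge> 1" "norm x \<ge> R" by (auto simp: R'_def)
      have "norm ((vderiv ^^ k) \<phi> x) * (1 + x) ^ j \<le> norm ((vderiv ^^ k) \<phi> x) * (2 * x) ^ j"
        using xR by (intro mult_left_mono power_mono) auto
      also have "\<dots> = 2 ^ j * norm (of_real (x ^ j) * (vderiv ^^ k) \<phi> x)"
        using xR by (simp add: norm_mult norm_power power_mult_distrib)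
      also have "\<dots> \<le> 2 ^ j * 1" using R[OF xR(2)] by (intro mult_left_mono) auto
      finally show ?thesis by simp
    qed
    finally show ?thesis .
  qed
  then show "\<exists>B. \<forall>x\<ge>0. \<bar>L ((vderiv ^^ k) \<phi> x)\<bar> * (1 + x) ^ j \<le> B" by blast
qed

text \<open>The function \<open>P\<close> against which \<open>\<tau>\<close> and the Laguerre series are tested: the factor \<open>exp
  (w/2)\<close> comes from \<open>h(w) = exp (w/2) \<tau>(w)\<close>, the rest from the Abel pairing. It vanishes at 0
  thanks to the factor \<open>sinh w\<close>.\<close>

definition abel_weight :: "(nat \<Rightarrow> real \<Rightarrow> real) \<Rightarrow> real \<Rightarrow> real" where
  "abel_weight \<psi> w = exp (w / 2) * (sinh w * abel_test \<psi> 1 (cosh w))"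

definition abel_weight' :: "(nat \<Rightarrow> real \<Rightarrow> real) \<Rightarrow> real \<Rightarrow> real" where
  "abel_weight' \<psi> w = exp (w / 2) * ((1 / 2 * sinh w + cosh w) * abel_test \<psi> 1 (cosh w) + (sinh w)\<^sup>2 * abel_test \<psi> 2 (cosh w))"

definition abel_weight'' :: "(nat \<Rightarrow> real \<Rightarrow> real) \<Rightarrow> real \<Rightarrow> real" where
  "abel_weight'' \<psi> w = exp (w / 2) * ((5 / 4 * sinh w + cosh w) * abel_test \<psi> 1 (cosh w)
      + ((sinh w)\<^sup>2 + 3 * sinh w * cosh w) * abel_test \<psi> 2 (cosh w) + (sinh w) ^ 3 * abel_test \<psi> 3 (cosh w))"

context
  fixes \<psi> :: "nat \<Rightarrow> real \<Rightarrow> real"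
  assumes \<psi>: "schwartz_tower \<psi>"
begin

lemma abel_test_cosh_deriv:
  "((\<lambda>w. abel_test \<psi> k (cosh w)) has_real_derivative abel_test \<psi> (Suc k) (cosh w) * sinh w) (at w)"
  by (rule DERIV_chain2[OF abel_test_deriv[OF \<psi>]]) (auto intro!: derivative_eq_intros cosh_real_pos)

lemma abel_weight_deriv: "(abel_weight \<psi> has_real_derivative abel_weight' \<psi> w) (at w)"
proof -
  note A = abel_test_cosh_deriv[of 1 w, simplified, folded numeral_2_eq_2]
  show ?thesis
    unfolding abel_weight_def[abs_def] abel_weight'_def One_nat_def
    by (auto intro!: derivative_eq_intros A) (simp add: algebra_simps power2_eq_square)
qed

lemma abel_weight'_deriv: "(abel_weight' \<psi> has_real_derivative abel_weight'' \<psi> w) (at w)"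
proof -
  note A = abel_test_cosh_deriv[of 1 w, simplified, folded numeral_2_eq_2]
  have B: "((\<lambda>w. abel_test \<psi> 2 (cosh w)) has_real_derivative abel_test \<psi> 3 (cosh w) * sinh w) (at w)"
    using abel_test_cosh_deriv[of 2 w] by (simp add: numeral_3_eq_3 numeral_2_eq_2)
  show ?thesis
    unfolding abel_weight'_def[abs_def] abel_weight''_def One_nat_def
    by (auto intro!: derivative_eq_intros A B) (simp add: field_simps power2_eq_square power3_eq_cube)
qed

lemma abel_weight''_cont: "continuous_on UNIV (abel_weight'' \<psi>)"
proof -
  have "continuous_on UNIV (\<lambda>w. abel_test \<psi> k (cosh w))" for k
    by (auto intro!: continuous_at_imp_continuous_on DERIV_isCont[OF abel_test_cosh_deriv])
  then show ?thesis unfolding abel_weight''_def by (intro continuous_intros) auto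
qed

lemma abel_weight_0: "abel_weight \<psi> 0 = 0" by (simp add: abel_weight_def)

lemma abel_weight_bounds:
  obtains C where "\<And>w. w \<ge> 0 \<Longrightarrow> \<bar>abel_weight \<psi> w\<bar> \<le> C * exp (- w)"
    "\<And>w. w \<ge> 0 \<Longrightarrow> \<bar>abel_weight' \<psi> w\<bar> \<le> C * exp (- w)"
    "\<And>w. w \<ge> 0 \<Longrightarrow> \<bar>abel_weight'' \<psi> w\<bar> \<le> C * exp (- w)"
proof -
  obtain B1 where B1: "B1 \<ge> 0" "\<And>x. x \<ge> 0 \<Longrightarrow> \<bar>abel_test \<psi> 1 x\<bar> \<le> B1 / (1 + x) ^ 5" using abel_test_bound[OF \<psi>, of 1 5] by blast
  obtain B2 where B2: "B2 \<ge> 0" "\<And>x. x \<ge> 0 \<Longrightarrow> \<bar>abel_test \<psi> 2 x\<bar> \<le> B2 / (1 + x) ^ 5" using abel_test_bound[OF \<psi>, of 2 5] by blast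
  obtain B3 where B3: "B3 \<ge> 0" "\<And>x. x \<ge> 0 \<Longrightarrow> \<bar>abel_test \<psi> 3 x\<bar> \<le> B3 / (1 + x) ^ 5" using abel_test_bound[OF \<psi>, of 3 5] by blast
  define B where "B = 32 * (B1 + B2 + B3)"
  have main: "\<bar>exp (w / 2) * (p * abel_test \<psi> 1 (cosh w) + q * abel_test \<psi> 2 (cosh w) + r * abel_test \<psi> 3 (cosh w))\<bar> \<le> (12 * B) * exp (- w)"
    if w: "w \<ge> 0" and p: "\<bar>p\<bar> \<le> 4 * exp w ^ 3" and q: "\<bar>q\<bar> \<le> 4 * exp w ^ 3" and r: "\<bar>r\<bar> \<le> 4 * exp w ^ 3" for w p q r
  proof -
    define u where "u = exp w"
    have u: "u \<ge> 1" using w by (simp add: u_def)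
    have cu: "cosh w \<ge> u / 2" by (simp add: cosh_def u_def)
    have J: "\<bar>abel_test \<psi> k (cosh w)\<bar> \<le> B / u ^ 5"
      if "\<And>x. x \<ge> 0 \<Longrightarrow> \<bar>abel_test \<psi> k x\<bar> \<le> B' / (1 + x) ^ 5" "0 \<le> B'" "32 * B' \<le> B" for k B'
    proof -
      have "\<bar>abel_test \<psi> k (cosh w)\<bar> \<le> B' / (1 + cosh w) ^ 5" by (rule that(1)) (simp add: less_imp_le)
      also have "\<dots> \<le> B' / (u / 2) ^ 5" using that(2) u cu by (intro divide_left_mono power_mono mult_pos_pos zero_less_power) auto
      also have "\<dots> = 32 * B' / u ^ 5" by (simp add: power_divide)
      also have "\<dots> \<le> B / u ^ 5" using that(3) u by (intro divide_right_mono) auto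
      finally show ?thesis .
    qed
    have J1: "\<bar>abel_test \<psi> 1 (cosh w)\<bar> \<le> B / u ^ 5" by (rule J[OF B1(2) B1(1)]) (use B1 B2 B3 in \<open>auto simp: B_def\<close>)
    have J2: "\<bar>abel_test \<psi> 2 (cosh w)\<bar> \<le> B / u ^ 5" by (rule J[OF B2(2) B2(1)]) (use B1 B2 B3 in \<open>auto simp: B_def\<close>)
    have J3: "\<bar>abel_test \<psi> 3 (cosh w)\<bar> \<le> B / u ^ 5" by (rule J[OF B3(2) B3(1)]) (use B1 B2 B3 in \<open>auto simp: B_def\<close>)
    have BB: "B \<ge> 0" using B1 B2 B3 by (simp add: B_def)
    have t: "\<bar>x * y\<bar> \<le> 4 * u ^ 3 * (B / u ^ 5)" if "\<bar>x\<bar> \<le> 4 * exp w ^ 3" "\<bar>y\<bar> \<le> B / u ^ 5" for x y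
      unfolding abs_mult using that u by (intro mult_mono) (auto simp: u_def)
    have "\<bar>p * abel_test \<psi> 1 (cosh w) + q * abel_test \<psi> 2 (cosh w) + r * abel_test \<psi> 3 (cosh w)\<bar> \<le> 3 * (4 * u ^ 3 * (B / u ^ 5))"
      using t[OF p J1] t[OF q J2] t[OF r J3] by linarith
    moreover have "exp (w / 2) \<le> u" using w by (simp add: u_def)
    ultimately have "exp (w / 2) * \<bar>p * abel_test \<psi> 1 (cosh w) + q * abel_test \<psi> 2 (cosh w) + r * abel_test \<psi> 3 (cosh w)\<bar> \<le> u * (3 * (4 * u ^ 3 * (B / u ^ 5)))"
      using u by (intro mult_mono) auto
    also have "\<dots> = 12 * B * (1 / u)" using u by (simp add: eval_nat_numeral field_simps)
    also have "1 / u = exp (- w)" by (simp add: u_def exp_minus inverse_eq_divide)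
    finally show ?thesis by (simp add: abs_mult)
  qed
  have e: "\<bar>sinh w\<bar> \<le> exp w" "\<bar>cosh w\<bar> \<le> exp w" "1 \<le> exp w" if "w \<ge> 0" for w :: real
  proof -
    have "\<bar>(p - q) / 2\<bar> \<le> p \<and> \<bar>(p + q) / 2\<bar> \<le> p" if "q \<le> p" "q > 0" for p q :: real
      using that by (auto simp: abs_le_iff)
    from this[of "exp (- w)" "exp w"] that
    show "\<bar>sinh w\<bar> \<le> exp w" "\<bar>cosh w\<bar> \<le> exp w"
      by (simp_all add: sinh_field_def cosh_field_def)
    show "1 \<le> exp w" using that by simp
  qed
  have e1: "\<bar>sinh w\<bar> \<le> exp w ^ 3" "\<bar>cosh w\<bar> \<le> exp w ^ 3" "(sinh w)\<^sup>2 \<le> exp w ^ 3" "\<bar>sinh w * cosh w\<bar> \<le> exp w ^ 3" "\<bar>(sinh w) ^ 3\<bar> \<le> exp w ^ 3"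
    if w: "w \<ge> 0" for w :: real
  proof -
    note ee = e[OF w]
    have p2: "exp w ^ 2 \<le> exp w ^ 3" using ee(3) by (intro power_increasing) auto
    have "exp w ^ 1 \<le> exp w ^ 3" using ee(3) by (intro power_increasing) auto
    then have p1: "exp w \<le> exp w ^ 3" by (simp only: power_one_right)
    show "\<bar>sinh w\<bar> \<le> exp w ^ 3" "\<bar>cosh w\<bar> \<le> exp w ^ 3" using ee p1 by auto
    have "\<bar>sinh w\<bar> ^ 2 \<le> exp w ^ 2" using ee by (intro power_mono) auto
    then show "(sinh w)\<^sup>2 \<le> exp w ^ 3" using p2 by simp
    have "\<bar>sinh w\<bar> * \<bar>cosh w\<bar> \<le> exp w * exp w" using ee by (intro mult_mono) auto
    then show "\<bar>sinh w * cosh w\<bar> \<le> exp w ^ 3" using p2 by (simp add: abs_mult power2_eq_square)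
    show "\<bar>(sinh w) ^ 3\<bar> \<le> exp w ^ 3" unfolding power_abs using ee by (intro power_mono) auto
  qed
  show ?thesis
  proof (rule that[of "12 * B"])
    fix w :: real assume w: "w \<ge> 0"
    note E = e1[OF w]
    show "\<bar>abel_weight \<psi> w\<bar> \<le> 12 * B * exp (- w)"
      using main[OF w, of "sinh w" 0 0] E by (simp add: abel_weight_def)
    have "\<bar>1 / 2 * sinh w + cosh w\<bar> \<le> 4 * exp w ^ 3" "\<bar>(sinh w)\<^sup>2\<bar> \<le> 4 * exp w ^ 3"
      using E zero_le_power2[of "sinh w"] by linarith+
    then show "\<bar>abel_weight' \<psi> w\<bar> \<le> 12 * B * exp (- w)"
      using main[OF w, of "1 / 2 * sinh w + cosh w" "(sinh w)\<^sup>2" 0] by (simp add: abel_weight'_def)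
    have "\<bar>5 / 4 * sinh w + cosh w\<bar> \<le> 4 * exp w ^ 3" "\<bar>(sinh w)\<^sup>2 + 3 * sinh w * cosh w\<bar> \<le> 4 * exp w ^ 3" "\<bar>sinh w ^ 3\<bar> \<le> 4 * exp w ^ 3"
      using E zero_le_power2[of "sinh w"] unfolding mult.assoc by linarith+
    then show "\<bar>abel_weight'' \<psi> w\<bar> \<le> 12 * B * exp (- w)"
      unfolding abel_weight''_def by (intro main w)
  qed
qed

end

section \<open>Convergence of the approximants\<close>

text \<open>The real form of \<open>\<Phi>\<^sub>l\<close>; the phases \<open>i^l\<close> and \<open>(-i)^l\<close> of \<open>\<Phi>\<^sub>l\<close> and \<open>c\<^sub>l\<close> cancel.\<close>

definition laguerre_wave :: "nat \<Rightarrow> real \<Rightarrow> real" where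
  "laguerre_wave l w = 2 * exp (- w / 2) * laguerre_fun l (exp (- w))"

definition laguerre_wave' :: "nat \<Rightarrow> real \<Rightarrow> real" where
  "laguerre_wave' l w = - (exp (- w / 2) * (laguerre_fun l (exp (- w)) + 2 * (exp (- w) * laguerre_fun' l (exp (- w)))))"

lemma laguerre_wave_deriv: "(laguerre_wave l has_real_derivative laguerre_wave' l w) (at w)"
proof -
  have "((\<lambda>w. laguerre_fun l (exp (- w))) has_real_derivative laguerre_fun' l (exp (- w)) * (exp (- w) * (-1))) (at w)"
    by (rule DERIV_chain2[OF laguerre_fun_deriv]) (auto intro!: derivative_eq_intros)
  note d = this
  show ?thesis
    unfolding laguerre_wave_def laguerre_wave'_def by (auto intro!: derivative_eq_intros d simp: algebra_simps)
qed

lemma laguerre_wave'_cont: "continuous_on UNIV (laguerre_wave' l)"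
proof -
  have "isCont (\<lambda>s. s * laguerre_fun' l s) s" for s by (rule DERIV_isCont[OF laguerre_fun'_deriv])
  then have 1: "continuous_on UNIV (\<lambda>s. s * laguerre_fun' l s)" by (simp add: continuous_on_eq_continuous_at)
  have "isCont (laguerre_fun l) s" for s by (rule DERIV_isCont[OF laguerre_fun_deriv])
  then have 2: "continuous_on UNIV (laguerre_fun l)" by (simp add: continuous_on_eq_continuous_at)
  show ?thesis
    unfolding laguerre_wave'_def
    by (intro continuous_intros continuous_on_compose2[OF 1] continuous_on_compose2[OF 2]) auto
qed

lemma laguerre_wave_bounds:
  assumes w: "w \<ge> 0"
  shows "\<bar>laguerre_wave l w\<bar> \<le> (3 + 4 * real l) * exp w" "\<bar>laguerre_wave' l w\<bar> \<le> (3 + 4 * real l) * exp w"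
proof -
  define s where "s = exp (- w)"
  have s: "s > 0" "s \<le> 1" using w by (auto simp: s_def)
  have E: "\<bar>laguerre_fun l s\<bar> \<le> 1" "s * (laguerre_fun' l s)\<^sup>2 \<le> 2 * real l + 1"
    using laguerre_fun_energy_bound[of s l] s by auto
  have "(s * laguerre_fun' l s)\<^sup>2 = s * (s * (laguerre_fun' l s)\<^sup>2)" by (simp add: power2_eq_square)
  also have "\<dots> \<le> 1 * (s * (laguerre_fun' l s)\<^sup>2)" using s by (intro mult_right_mono) auto
  also have "\<dots> \<le> (2 * real l + 1) * (2 * real l + 1)"
  proof -
    have "(2 * real l + 1) * 1 \<le> (2 * real l + 1) * (2 * real l + 1)" by (intro mult_left_mono) auto
    then show ?thesis unfolding mult_1_left mult_1_right using E(2) by (rule order_trans[rotated])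
  qed
  finally have "(s * laguerre_fun' l s)\<^sup>2 \<le> (2 * real l + 1)\<^sup>2" by (simp add: power2_eq_square)
  then have d: "\<bar>s * laguerre_fun' l s\<bar> \<le> 2 * real l + 1" using abs_le_square_iff[of "s * laguerre_fun' l s" "2 * real l + 1"] by simp
  have x: "0 < exp (- w / 2)" "exp (- w / 2) \<le> 1" using w by auto
  have e: "1 \<le> exp w" using w by simp
  have mono: "\<bar>exp (- w / 2) * z\<bar> \<le> (3 + 4 * real l) * exp w" if "\<bar>z\<bar> \<le> 3 + 4 * real l" for z
  proof -
    have "exp (- w / 2) * \<bar>z\<bar> \<le> 1 * (3 + 4 * real l)" using x that by (intro mult_mono) auto
    also have "\<dots> \<le> (3 + 4 * real l) * exp w" using e mult_left_mono[OF e, of "3 + 4 * real l"] by simp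
    finally show ?thesis by (simp add: abs_mult)
  qed
  have "\<bar>2 * laguerre_fun l s\<bar> \<le> 3 + 4 * real l" using E(1) by simp
  from mono[OF this] show "\<bar>laguerre_wave l w\<bar> \<le> (3 + 4 * real l) * exp w"
    by (simp add: laguerre_wave_def s_def mult_ac)
  have "\<bar>laguerre_fun l s + 2 * (s * laguerre_fun' l s)\<bar> \<le> 3 + 4 * real l" using E(1) d by linarith
  from mono[OF this] show "\<bar>laguerre_wave' l w\<bar> \<le> (3 + 4 * real l) * exp w"
    by (simp only: laguerre_wave'_def s_def abs_minus_cancel)
qed

definition laguerre_partial :: "(nat \<Rightarrow> real) \<Rightarrow> nat \<Rightarrow> real \<Rightarrow> real" where
  "laguerre_partial a m w = (\<Sum>l\<le>m. laguerre_coeff a l * laguerre_wave l w)"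

definition laguerre_partial' :: "(nat \<Rightarrow> real) \<Rightarrow> nat \<Rightarrow> real \<Rightarrow> real" where
  "laguerre_partial' a m w = (\<Sum>l\<le>m. laguerre_coeff a l * laguerre_wave' l w)"

lemma laguerre_partial_deriv: "(laguerre_partial a m has_real_derivative laguerre_partial' a m w) (at w)"
  unfolding laguerre_partial_def laguerre_partial'_def
  by (intro DERIV_sum DERIV_cmult laguerre_wave_deriv)

lemma laguerre_partial'_cont: "continuous_on UNIV (laguerre_partial' a m)"
  unfolding laguerre_partial'_def by (intro continuous_intros laguerre_wave'_cont)

lemma abel_data_laguerre_partial:
  assumes "schwartz_tower \<psi>"
  shows "abel_data (laguerre_partial a m) (laguerre_partial' a m) (\<Sum>l\<le>m. \<bar>laguerre_coeff a l\<bar> * (3 + 4 * real l)) \<psi>"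
proof
  fix w :: real assume w: "w \<ge> 0"
  have *: "\<bar>\<Sum>l\<le>m. laguerre_coeff a l * g l\<bar> \<le> (\<Sum>l\<le>m. \<bar>laguerre_coeff a l\<bar> * (3 + 4 * real l)) * exp w"
    if g: "\<And>l. \<bar>g l\<bar> \<le> (3 + 4 * real l) * exp w" for g
  proof -
    have "\<bar>\<Sum>l\<le>m. laguerre_coeff a l * g l\<bar> \<le> (\<Sum>l\<le>m. \<bar>laguerre_coeff a l * g l\<bar>)" by (rule sum_abs)
    also have "\<dots> \<le> (\<Sum>l\<le>m. \<bar>laguerre_coeff a l\<bar> * ((3 + 4 * real l) * exp w))"
      unfolding abs_mult by (intro sum_mono mult_left_mono g) auto
    finally show ?thesis by (simp add: sum_distrib_right mult.assoc)
  qed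
  show "\<bar>laguerre_partial a m w\<bar> \<le> (\<Sum>l\<le>m. \<bar>laguerre_coeff a l\<bar> * (3 + 4 * real l)) * exp w"
    unfolding laguerre_partial_def by (intro * laguerre_wave_bounds w)
  show "\<bar>laguerre_partial' a m w\<bar> \<le> (\<Sum>l\<le>m. \<bar>laguerre_coeff a l\<bar> * (3 + 4 * real l)) * exp w"
    unfolding laguerre_partial'_def by (intro * laguerre_wave_bounds w)
qed (use assms laguerre_partial_deriv laguerre_partial'_cont in auto)

lemma psi_eq_abel_deriv:
  fixes m :: nat
  assumes A: "\<And>N. \<bar>a N\<bar> \<le> A" and y: "y > 1"
  shows "psi a m y = of_real (1 / (pi * sqrt 2) * abel_deriv (laguerre_partial a m) (laguerre_partial' a m) y)"
proof -
  have "(\<lambda>x. \<Sum>l\<le>m. coeff_c a l * Phi l (arcosh x)) = (\<lambda>x. complex_of_real (laguerre_partial a m (arcosh x)))"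
    unfolding coeff_c_Phi[OF A] laguerre_partial_def laguerre_wave_def by simp
  moreover have "vector_derivative (conv_chi (\<lambda>x. complex_of_real (laguerre_partial a m (arcosh x)))) (at y) = of_real (abel_deriv (laguerre_partial a m) (laguerre_partial' a m) y)"
    by (rule vector_derivative_conv_chi[OF laguerre_partial_deriv laguerre_partial'_cont y])
  ultimately show ?thesis using y by (simp add: psi_def)
qed

text \<open>The exponents 1/16 and 1/2 leave 7/16 below 1 for absorbing \<open>sqrt w\<close>.\<close>

lemma exp_half_bound:
  fixes w x C :: real
  assumes x: "\<bar>x\<bar> \<le> C * (sqrt w * exp (w / 16))" and w: "w \<ge> 0" and C: "C \<ge> 0"
  shows "\<bar>x * exp (w / 2)\<bar> \<le> 4 * C * exp w"
proof -
  have "sqrt w \<le> (1 + 1 / (7/16)) * exp ((7/16) * w)" by (rule sqrt_le_exp) (use w in auto)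
  also have "\<dots> \<le> 4 * exp ((7/16) * w)" by (intro mult_right_mono) auto
  finally have s: "sqrt w \<le> 4 * exp ((7/16) * w)" .
  have "\<bar>x * exp (w / 2)\<bar> = \<bar>x\<bar> * exp (w / 2)" by (simp add: abs_mult)
  also have "\<dots> \<le> (C * ((4 * exp ((7/16) * w)) * exp (w / 16))) * exp (w / 2)"
    using x mult_left_mono[OF mult_right_mono[OF s, of "exp (w / 16)"] C]
    by (intro mult_right_mono) auto
  also have "\<dots> = 4 * C * exp w" by (simp add: mult_exp_exp)
  finally show ?thesis .
qed

locale spectral_data =
  fixes \<tau> T :: "real \<Rightarrow> real" and C A :: real and a :: "nat \<Rightarrow> real"
  assumes \<tau>: "\<And>w. (\<tau> has_real_derivative T w) (at w)" and Tc: "continuous_on UNIV T"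
    and C: "C \<ge> 0"
    and Tb: "\<And>w. w \<ge> 0 \<Longrightarrow> \<bar>T w\<bar> \<le> C * (sqrt w * exp (w / 16))"
    and \<tau>b: "\<And>w. w \<ge> 0 \<Longrightarrow> \<bar>\<tau> w\<bar> \<le> C * (sqrt w * exp (w / 16))"
    and a: "\<And>k. a (Suc k) = (LBINT w:{0<..}. exp (- real (Suc k) * w) * \<tau> w)"
    and A: "\<And>n. \<bar>a n\<bar> \<le> A"
begin

definition h where "h w = \<tau> w * exp (w / 2)"
definition h' where "h' w = (2 * T w + \<tau> w) * exp (w / 2) / 2"

lemma h_deriv: "(h has_real_derivative h' w) (at w)"
  unfolding h_def h'_def by (auto intro!: derivative_eq_intros \<tau> simp: algebra_simps)

lemma \<tau>_cont: "continuous_on UNIV \<tau>"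
  using DERIV_isCont[OF \<tau>] by (simp add: continuous_on_eq_continuous_at)

lemma h'_cont: "continuous_on UNIV h'"
  unfolding h'_def by (intro continuous_intros Tc \<tau>_cont) auto

lemma abel_data_h:
  assumes "schwartz_tower \<psi>"
  shows "abel_data h h' (12 * C) \<psi>"
proof
  fix w :: real assume w: "w \<ge> 0"
  have "\<bar>h w\<bar> \<le> 4 * C * exp w" unfolding h_def by (rule exp_half_bound[OF \<tau>b[OF w] w C])
  also have "\<dots> \<le> 12 * C * exp w" using C by (intro mult_right_mono) auto
  finally show "\<bar>h w\<bar> \<le> 12 * C * exp w" .
  have "\<bar>2 * T w + \<tau> w\<bar> \<le> (3 * C) * (sqrt w * exp (w / 16))" using Tb[OF w] \<tau>b[OF w] by linarith
  from exp_half_bound[OF this w] C have "\<bar>(2 * T w + \<tau> w) * exp (w / 2)\<bar> \<le> 12 * C * exp w" by simp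
  then show "\<bar>h' w\<bar> \<le> 12 * C * exp w" by (simp add: h'_def abs_divide)
qed (use assms h_deriv h'_cont in auto)

abbreviation defect where
  "defect m y \<equiv> abel_deriv h h' y - abel_deriv (laguerre_partial a m) (laguerre_partial' a m) y"

lemma defect_pairing:
  assumes \<psi>: "schwartz_tower \<psi>"
  shows "set_integrable lborel {1<..} (\<lambda>y. defect m y * \<psi> 0 y)"
    and "(\<lambda>m. LBINT y:{1<..}. defect m y * \<psi> 0 y) \<longlonglongrightarrow> 0"
proof -
  interpret h: abel_data h h' "12 * C" \<psi> by (rule abel_data_h[OF \<psi>])
  have S: "abel_data (laguerre_partial a m) (laguerre_partial' a m) (\<Sum>l\<le>m. \<bar>laguerre_coeff a l\<bar> * (3 + 4 * real l)) \<psi>" for m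
    by (rule abel_data_laguerre_partial[OF \<psi>])
  note SI = abel_data.K_integrable[OF S] and SP = abel_data.abel_pairing[OF S]
  show "set_integrable lborel {1<..} (\<lambda>y. defect m y * \<psi> 0 y)" for m
    unfolding left_diff_distrib by (intro set_integral_diff h.K_integrable SI)
  obtain B where B: "\<And>w. w \<ge> 0 \<Longrightarrow> \<bar>abel_weight \<psi> w\<bar> \<le> B * exp (- w)"
    "\<And>w. w \<ge> 0 \<Longrightarrow> \<bar>abel_weight' \<psi> w\<bar> \<le> B * exp (- w)"
    "\<And>w. w \<ge> 0 \<Longrightarrow> \<bar>abel_weight'' \<psi> w\<bar> \<le> B * exp (- w)"
    using abel_weight_bounds[OF \<psi>] by blast
  have sums: "(\<lambda>l. laguerre_coeff a l * (2 * (LBINT w:{0<..}. exp (- w) * laguerre_fun l (exp (- w)) * abel_weight \<psi> w))) sums (LBINT w:{0<..}. \<tau> w * abel_weight \<psi> w)"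
    by (rule laguerre_series_pairing[OF \<tau>_cont \<tau>b a A abel_weight_deriv[OF \<psi>] abel_weight'_deriv[OF \<psi>] abel_weight''_cont[OF \<psi>] B abel_weight_0[OF \<psi>]]) auto
  have wc: "continuous_on UNIV (abel_weight \<psi>)"
    using DERIV_isCont[OF abel_weight_deriv[OF \<psi>]] by (simp add: continuous_on_eq_continuous_at)
  have lc: "continuous_on UNIV (\<lambda>w. laguerre_fun l (exp (- w)))" for l
    by (rule continuous_on_compose2[of UNIV "laguerre_fun l"])
       (auto intro!: continuous_intros continuous_at_imp_continuous_on DERIV_isCont[OF laguerre_fun_deriv])
  have int: "set_integrable lborel {0<..} (\<lambda>w. exp (- w) * laguerre_fun l (exp (- w)) * abel_weight \<psi> w)" for l
  proof (rule set_integrable_bound)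
    show "set_integrable lborel {0<..} (\<lambda>w. B * exp (- 1 * w))"
      by (intro set_integrable_mult_right set_integrable_exp_decay) auto
    show "set_borel_measurable lborel {0<..} (\<lambda>w. exp (- w) * laguerre_fun l (exp (- w)) * abel_weight \<psi> w)"
      by (intro set_borel_measurable_continuous_on continuous_on_mult
          continuous_on_subset[OF wc] continuous_on_subset[OF lc] continuous_intros) auto
    show "AE w in lborel. w \<in> {0<..} \<longrightarrow> norm (exp (- w) * laguerre_fun l (exp (- w)) * abel_weight \<psi> w) \<le> norm (B * exp (- 1 * w))"
    proof (intro AE_I2 impI)
      fix w :: real assume "w \<in> {0<..}"
      then have w: "w > 0" by simp
      have "exp (- w) * \<bar>laguerre_fun l (exp (- w))\<bar> * \<bar>abel_weight \<psi> w\<bar> \<le> 1 * 1 * (B * exp (- w))"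
        using w by (intro mult_mono B laguerre_fun_le_one) auto
      also have "\<dots> \<le> \<bar>B * exp (- w)\<bar>" by simp
      finally show "norm (exp (- w) * laguerre_fun l (exp (- w)) * abel_weight \<psi> w) \<le> norm (B * exp (- 1 * w))"
        by (simp add: abs_mult)
    qed
  qed
  have ph: "(LBINT y:{1<..}. abel_deriv h h' y * \<psi> 0 y) = - (LBINT w:{0<..}. \<tau> w * abel_weight \<psi> w)"
    unfolding h.abel_pairing by (simp add: h_def abel_weight_def mult_ac)
  have pS: "(LBINT y:{1<..}. abel_deriv (laguerre_partial a m) (laguerre_partial' a m) y * \<psi> 0 y)
     = - (\<Sum>l\<le>m. laguerre_coeff a l * (2 * (LBINT w:{0<..}. exp (- w) * laguerre_fun l (exp (- w)) * abel_weight \<psi> w)))" for m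
  proof -
    have pw: "laguerre_partial a m w * (sinh w * abel_test \<psi> 1 (cosh w)) = (\<Sum>l\<le>m. laguerre_coeff a l * (2 * (exp (- w) * laguerre_fun l (exp (- w)) * abel_weight \<psi> w)))" for w
    proof -
      have "laguerre_wave l w * (sinh w * abel_test \<psi> 1 (cosh w)) = 2 * (exp (- w) * laguerre_fun l (exp (- w)) * abel_weight \<psi> w)" for l
      proof -
        have "exp (- w / 2) = exp (- w) * exp (w / 2)" by (simp add: mult_exp_exp)
        then show ?thesis by (simp only: laguerre_wave_def abel_weight_def mult_ac)
      qed
      then show ?thesis by (simp only: laguerre_partial_def sum_distrib_right mult.assoc)
    qed
    have "(LBINT w:{0<..}. \<Sum>l\<le>m. laguerre_coeff a l * (2 * (exp (- w) * laguerre_fun l (exp (- w)) * abel_weight \<psi> w)))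
       = (\<Sum>l\<le>m. LBINT w:{0<..}. laguerre_coeff a l * (2 * (exp (- w) * laguerre_fun l (exp (- w)) * abel_weight \<psi> w)))"
      unfolding set_lebesgue_integral_def scaleR_sum_right
      by (rule Bochner_Integration.integral_sum) (fold set_integrable_def, intro set_integrable_mult_right int)
    then show ?thesis unfolding SP pw by (simp only: set_integral_mult_right)
  qed
  have "(LBINT y:{1<..}. defect m y * \<psi> 0 y) = (LBINT y:{1<..}. abel_deriv h h' y * \<psi> 0 y) - (LBINT y:{1<..}. abel_deriv (laguerre_partial a m) (laguerre_partial' a m) y * \<psi> 0 y)" for m
    unfolding left_diff_distrib by (intro set_integral_diff(2) h.K_integrable SI)
  then have "(LBINT y:{1<..}. defect m y * \<psi> 0 y) = (\<Sum>l\<le>m. laguerre_coeff a l * (2 * (LBINT w:{0<..}. exp (- w) * laguerre_fun l (exp (- w)) * abel_weight \<psi> w))) - (LBINT w:{0<..}. \<tau> w * abel_weight \<psi> w)" for m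
    unfolding ph pS by simp
  moreover have "(\<lambda>m. (\<Sum>l\<le>m. laguerre_coeff a l * (2 * (LBINT w:{0<..}. exp (- w) * laguerre_fun l (exp (- w)) * abel_weight \<psi> w)))) \<longlonglongrightarrow> (LBINT w:{0<..}. \<tau> w * abel_weight \<psi> w)"
    using sums by (simp add: sums_def_le)
  ultimately show "(\<lambda>m. LBINT y:{1<..}. defect m y * \<psi> 0 y) \<longlonglongrightarrow> 0"
    by (simp add: LIM_zero)
qed

end

context spectral_data
begin

text \<open>The term \<open>h 0 / sqrt (y - 1)\<close> of the derivative of an Abel transform vanishes for \<open>h\<close>, so
  that the jump function is exactly such a derivative.\<close>

lemma jump_minus_psi:
  assumes \<tau>0: "\<tau> 0 = 0"
    and aD: "\<And>k. (2 * real (Suc k) + 1) * a (Suc k) = (LBINT w:{0<..}. exp (- real (Suc k) * w) * (2 * T w + \<tau> w))"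
    and y: "y > 1"
  shows "jump_fun a y - psi a m y = of_real (1 / (pi * sqrt 2) * defect m y)"
proof -
  interpret L: legendre_data "\<lambda>w. 2 * T w + \<tau> w" "3 * C" a
  proof
    show "continuous_on UNIV (\<lambda>w. 2 * T w + \<tau> w)" by (intro continuous_intros Tc \<tau>_cont)
    show "\<bar>2 * T w + \<tau> w\<bar> \<le> 3 * C * (sqrt w * exp (w / 16))" if "w > 0" for w
      using Tb[of w] \<tau>b[of w] that by (simp add: algebra_simps)
  qed (use C aD in auto)
  have "abel_deriv h h' y = (LBINT w:{0<..<arcosh y}. ((2 * T w + \<tau> w) * exp (w / 2) / 2) / sqrt (y - cosh w))"
    unfolding abel_deriv_def[OF h_deriv h'_cont] by (simp add: h_def \<tau>0 h'_def)
  then have "jump_fun a y = of_real (1 / (pi * sqrt 2) * abel_deriv h h' y)"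
    using L.jump_fun_eq[OF y] by simp
  then show ?thesis
    unfolding psi_eq_abel_deriv[OF A y] right_diff_distrib of_real_diff by (rule arg_cong)
qed

end

lemma integrable_indicator_singleton:
  "integrable lborel (\<lambda>y::real. indicator {x} y *\<^sub>R (c::complex))" "(LBINT y. indicator {x} y *\<^sub>R (c::complex)) = 0"
  by auto

theorem proposition10:
  fixes a f :: "nat \<Rightarrow> real" and p M \<epsilon> :: real and \<phi> :: "real \<Rightarrow> complex"
  assumes p: "p \<ge> 2"
    and f: "\<And>n. f n = real n powr p * a n"
    and "M > 0" and "\<epsilon> > 0"
    and hausdorff: "\<And>n. real (n + 1) powr (1 + \<epsilon>) *
           (\<Sum>i\<le>n. real (n choose i) powr (2 + \<epsilon>) * \<bar>(fdiff ^^ i) f (n - i)\<bar> powr (2 + \<epsilon>)) < M"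
    and schwartz: "\<phi> \<in> schwartz_space"
  shows "(\<forall>m. integrable lborel (\<lambda>y. cnj (jump_fun a y - psi a m y) * \<phi> y)) \<and>
         (\<lambda>m. pairing (\<lambda>y. jump_fun a y - psi a m y) \<phi>) \<longlonglongrightarrow> 0"
proof -
  obtain \<tau> T C A where rep: "\<And>w. (\<tau> has_real_derivative T w) (at w)" "continuous_on UNIV T" "\<tau> 0 = 0" "C \<ge> 0"
    "\<And>w. w \<ge> 0 \<Longrightarrow> \<bar>T w\<bar> \<le> C * (sqrt w * exp (w / 16))"
    "\<And>w. w \<ge> 0 \<Longrightarrow> \<bar>\<tau> w\<bar> \<le> C * (sqrt w * exp (w / 16))"
    "\<And>k. a (Suc k) = (LBINT w:{0<..}. exp (- real (Suc k) * w) * \<tau> w)"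
    "\<And>k. (2 * real (Suc k) + 1) * a (Suc k) = (LBINT w:{0<..}. exp (- real (Suc k) * w) * (2 * T w + \<tau> w))"
    "\<And>n. \<bar>a n\<bar> \<le> A"
    using hausdorff_laplace_representation[OF p f \<open>\<epsilon> > 0\<close> hausdorff] by blast
  interpret spectral_data \<tau> T C A a by standard (use rep in auto)
  define \<kappa> where "\<kappa> = 1 / (pi * sqrt 2)"
  have diff: "jump_fun a y - psi a m y = of_real (\<kappa> * defect m y)" if "y > 1" for m y
    unfolding \<kappa>_def by (rule jump_minus_psi[OF rep(3,8) that])
  define \<psi>R where "\<psi>R = (\<lambda>k x. Re ((vderiv ^^ k) \<phi> x))"
  define \<psi>I where "\<psi>I = (\<lambda>k x. Im ((vderiv ^^ k) \<phi> x))"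
  have R: "schwartz_tower \<psi>R" unfolding \<psi>R_def
    by (rule schwartz_space_tower[OF schwartz bounded_linear_Re abs_Re_le_cmod])
  have I: "schwartz_tower \<psi>I" unfolding \<psi>I_def
    by (rule schwartz_space_tower[OF schwartz bounded_linear_Im abs_Im_le_cmod])
  \<comment> \<open>Splitting \<open>\<phi>\<close> into real and imaginary part leaves real pairings over \<open>y > 1\<close>. The point \<open>y
    = 1\<close>, where the derivative defining \<open>\<psi>\<^sub>m\<close> need not exist, contributes a null set.\<close>
  define G where "G = (\<lambda>(\<psi> :: nat \<Rightarrow> real \<Rightarrow> real) m y. indicator {1<..} y *\<^sub>R (defect m y * \<psi> 0 y))"
  have GI: "integrable lborel (G \<psi>R m)" "integrable lborel (G \<psi>I m)" for m
    using defect_pairing(1)[OF R, of m] defect_pairing(1)[OF I, of m] by (simp_all add: set_integrable_def G_def)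
  have G0: "(\<lambda>m. LBINT y. G \<psi>R m y) \<longlonglongrightarrow> 0" "(\<lambda>m. LBINT y. G \<psi>I m y) \<longlonglongrightarrow> 0"
    using defect_pairing(2)[OF R] defect_pairing(2)[OF I] by (simp_all add: set_lebesgue_integral_def G_def)
  define c where "c m = cnj (jump_fun a 1 - psi a m 1) * \<phi> 1" for m
  define H where "H = (\<lambda>m y. of_real \<kappa> * (complex_of_real (G \<psi>R m y) + \<i> * of_real (G \<psi>I m y)))"
  have pw: "cnj (jump_fun a y - psi a m y) * \<phi> y = H m y + indicator {1} y *\<^sub>R c m" for m y
  proof (cases y "1 :: real" rule: linorder_cases)
    case less
    then show ?thesis by (simp add: jump_fun_def psi_def H_def G_def)
  next
    case equal
    then show ?thesis by (simp add: c_def H_def G_def)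
  next
    case greater
    have "\<phi> y = of_real (\<psi>R 0 y) + \<i> * of_real (\<psi>I 0 y)"
      by (simp add: \<psi>R_def \<psi>I_def complex_eq_iff)
    then show ?thesis using greater unfolding diff[OF greater] by (simp add: H_def G_def algebra_simps)
  qed
  have HI: "integrable lborel (H m)" for m
    unfolding H_def by (intro integrable_mult_right Bochner_Integration.integrable_add integrable_of_real GI)
  have "integrable lborel (\<lambda>y. complex_of_real (G \<psi>R m y))" "integrable lborel (\<lambda>y. \<i> * complex_of_real (G \<psi>I m y))" for m
    by (intro integrable_mult_right integrable_of_real GI)+
  then have Hint: "(LBINT y. H m y) = of_real \<kappa> * (of_real (LBINT y. G \<psi>R m y) + \<i> * of_real (LBINT y. G \<psi>I m y))" for m
    unfolding H_def by (simp del: of_real_mult)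
  have "integrable lborel (\<lambda>y. cnj (jump_fun a y - psi a m y) * \<phi> y)" for m
    unfolding pw by (intro Bochner_Integration.integrable_add HI integrable_indicator_singleton)
  moreover have "pairing (\<lambda>y. jump_fun a y - psi a m y) \<phi> = of_real \<kappa> * (of_real (LBINT y. G \<psi>R m y) + \<i> * of_real (LBINT y. G \<psi>I m y))" for m
    unfolding pairing_def pw
    using Bochner_Integration.integral_add[OF HI[of m] integrable_indicator_singleton(1)[of 1 "c m"]]
      integrable_indicator_singleton(2)[of 1 "c m"] by (simp add: Hint)
  moreover have "(\<lambda>m. of_real \<kappa> * (of_real (LBINT y. G \<psi>R m y) + \<i> * of_real (LBINT y. G \<psi>I m y))) \<longlonglongrightarrow> of_real \<kappa> * (of_real 0 + \<i> * of_real 0)"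
    by (intro tendsto_intros G0)
  ultimately show ?thesis by simp
qed

end
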